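(* Let $(R,\mathfrak m)$ be a complete Noetherian local reduced $F$-finite ring of prime characteristic $p>0$. Let $M$ be an Artinian $R$-module. Then for any prime ideal $\mathfrak p$ of $R$, $${}^{\mathfrak p}(0^*_M)=0^*_{{}^{\mathfrak p}M}$$ as submodules of ${}^{\mathfrak p}M$, where the tight closure on the left is taken over $R$ and that on the right over $\widehat{R_{\mathfrak p}}$.
   Context: For an $R$-module $M$ and $\mathfrak p\in\operatorname{Spec}R$, the (Richardson) colocalization of $M$ at $\mathfrak p$ is the $\widehat{R_{\mathfrak p}}$-module ${}^{\mathfrak p}M:=\operatorname{Hom}_R(\operatorname{Hom}_R(M,E_R(R/\mathfrak m)),E_R(R/\mathfrak p))$, where $E_R(-)$ denotes injective hull and $\widehat{R_{\mathfrak p}}$ is the $\mathfrak pR_{\mathfrak p}$-adic completion of $R_{\mathfrak p}$. It is an exact covariant functor, so for a submodule $L\subseteq M$, ${}^{\mathfrak p}L$ is regarded as a submodule of ${}^{\mathfrak p}M$. For a Noetherian ring $A$ of prime characteristic $p$ and an $A$-module $M$, let $A^\circ$ be the set of elements of $A$ not in any minimal prime, let $F^e(M)$ be the base change of $M$ along the $e$-th iterate of the Frobenius endomorphism of $A$, and for $u\in M$ and $q=p^e$ let $u^q:=1\otimes u\in F^e(M)$. The tight closure of zero in $M$ is $0^*_M=\{u\in M\mid\text{there is }c\in A^\circ\text{ with }cu^q=0\text{ in }F^e(M)\text{ for all }q=p^e\gg0\}$. $R$ is $F$-finite if the Frobenius endomorphism of $R$ is module-finite. *)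

theory Defs
  imports "HOL-Algebra.Algebra"
begin

section \<open>Rings\<close>

definition local_ring :: "('a, 'r) ring_scheme \<Rightarrow> 'a set \<Rightarrow> bool" where
  "local_ring R \<mm> \<longleftrightarrow> cring R \<and> maximalideal \<mm> R \<and> (\<forall>I. maximalideal I R \<longrightarrow> I = \<mm>)"

definition reduced_ring :: "('a, 'r) ring_scheme \<Rightarrow> bool" where
  "reduced_ring R \<longleftrightarrow>
     cring R \<and> (\<forall>x\<in>carrier R. \<forall>n::nat. x [^]\<^bsub>R\<^esub> n = \<zero>\<^bsub>R\<^esub> \<longrightarrow> x = \<zero>\<^bsub>R\<^esub>)"

definition ring_characteristic :: "('a, 'r) ring_scheme \<Rightarrow> nat \<Rightarrow> bool" where
  "ring_characteristic R p \<longleftrightarrow> (\<forall>n::nat. [n] \<cdot>\<^bsub>R\<^esub> \<one>\<^bsub>R\<^esub> = \<zero>\<^bsub>R\<^esub> \<longleftrightarrow> p dvd n)"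

definition frobenius :: "('a, 'r) ring_scheme \<Rightarrow> nat \<Rightarrow> nat \<Rightarrow> 'a \<Rightarrow> 'a" where
  "frobenius R p e x = x [^]\<^bsub>R\<^esub> (p ^ e)"

definition module_finite_map ::
  "('a, 'r) ring_scheme \<Rightarrow> ('b, 's) ring_scheme \<Rightarrow> ('a \<Rightarrow> 'b) \<Rightarrow> bool" where
  "module_finite_map A B \<phi> \<longleftrightarrow>
     (\<exists>T\<subseteq>carrier B. finite T \<and>
        (\<forall>b\<in>carrier B. \<exists>a\<in>T \<rightarrow> carrier A. b = (\<Oplus>\<^bsub>B\<^esub>t\<in>T. \<phi> (a t) \<otimes>\<^bsub>B\<^esub> t)))"

definition F_finite :: "('a, 'r) ring_scheme \<Rightarrow> nat \<Rightarrow> bool" where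
  "F_finite R p \<longleftrightarrow> module_finite_map R R (frobenius R p 1)"

definition minimal_prime :: "('a, 'r) ring_scheme \<Rightarrow> 'a set \<Rightarrow> bool" where
  "minimal_prime R Q \<longleftrightarrow>
     primeideal Q R \<and> (\<forall>Q'. primeideal Q' R \<and> Q' \<subseteq> Q \<longrightarrow> Q' = Q)"

definition avoiding_minimal_primes :: "('a, 'r) ring_scheme \<Rightarrow> 'a set" where
  "avoiding_minimal_primes R = {c \<in> carrier R. \<forall>Q. minimal_prime R Q \<longrightarrow> c \<notin> Q}"

subsection \<open>Completion\<close>

abbreviation ideal_power :: "('a, 'r) ring_scheme \<Rightarrow> 'a set \<Rightarrow> nat \<Rightarrow> 'a set" where
  "ideal_power R I n \<equiv> I [^]\<^bsub>ideals_set R\<^esub> n"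

text \<open>
  The inverse limit of the rings \<open>R / I\<^sup>n\<close>.  Since \<open>I\<^sup>n\<^sup>+\<^sup>1 \<subseteq> I\<^sup>n\<close>, a coset of \<open>I\<^sup>n\<^sup>+\<^sup>1\<close> is sent to a
  coset of \<open>I\<^sup>n\<close> by the transition map exactly when it is contained in it.
\<close>

definition adic_completion :: "('a, 'r) ring_scheme \<Rightarrow> 'a set \<Rightarrow> (nat \<Rightarrow> 'a set) ring" where
  "adic_completion R I =
     \<lparr>carrier = {a. \<forall>n. a n \<in> carrier (R Quot ideal_power R I n) \<and> a (Suc n) \<subseteq> a n},
      monoid.mult = (\<lambda>a b n. a n \<otimes>\<^bsub>R Quot ideal_power R I n\<^esub> b n),
      one = (\<lambda>n. \<one>\<^bsub>R Quot ideal_power R I n\<^esub>),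
      ring.zero = (\<lambda>n. \<zero>\<^bsub>R Quot ideal_power R I n\<^esub>),
      add = (\<lambda>a b n. a n \<oplus>\<^bsub>R Quot ideal_power R I n\<^esub> b n)\<rparr>"

definition adically_complete :: "('a, 'r) ring_scheme \<Rightarrow> 'a set \<Rightarrow> bool" where
  "adically_complete R I \<longleftrightarrow>
     bij_betw (\<lambda>x n. ideal_power R I n +>\<^bsub>R\<^esub> x) (carrier R) (carrier (adic_completion R I))"

subsection \<open>Localization at a prime\<close>

text \<open>The fraction \<open>r / s\<close>, as an equivalence class of pairs.\<close>

definition fraction :: "('a, 'r) ring_scheme \<Rightarrow> 'a set \<Rightarrow> 'a \<Rightarrow> 'a \<Rightarrow> ('a \<times> 'a) set" where
  "fraction R P r s =
     {(r', s'). r' \<in> carrier R \<and> s' \<in> carrier R - P \<and>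
        (\<exists>t\<in>carrier R - P. t \<otimes>\<^bsub>R\<^esub> (s' \<otimes>\<^bsub>R\<^esub> r \<ominus>\<^bsub>R\<^esub> s \<otimes>\<^bsub>R\<^esub> r') = \<zero>\<^bsub>R\<^esub>)}"

definition localization :: "('a, 'r) ring_scheme \<Rightarrow> 'a set \<Rightarrow> ('a \<times> 'a) set ring" where
  "localization R P =
     \<lparr>carrier = {fraction R P r s |r s. r \<in> carrier R \<and> s \<in> carrier R - P},
      monoid.mult = (\<lambda>U V. \<Union>(r, s)\<in>U. \<Union>(r', s')\<in>V. fraction R P (r \<otimes>\<^bsub>R\<^esub> r') (s \<otimes>\<^bsub>R\<^esub> s')),
      one = fraction R P \<one>\<^bsub>R\<^esub> \<one>\<^bsub>R\<^esub>,
      ring.zero = fraction R P \<zero>\<^bsub>R\<^esub> \<one>\<^bsub>R\<^esub>,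
      add = (\<lambda>U V. \<Union>(r, s)\<in>U. \<Union>(r', s')\<in>V.
               fraction R P (s' \<otimes>\<^bsub>R\<^esub> r \<oplus>\<^bsub>R\<^esub> s \<otimes>\<^bsub>R\<^esub> r') (s \<otimes>\<^bsub>R\<^esub> s'))\<rparr>"

definition localization_ideal :: "('a, 'r) ring_scheme \<Rightarrow> 'a set \<Rightarrow> ('a \<times> 'a) set set" where
  "localization_ideal R P = {fraction R P r s |r s. r \<in> P \<and> s \<in> carrier R - P}"

definition completed_localization ::
  "('a, 'r) ring_scheme \<Rightarrow> 'a set \<Rightarrow> (nat \<Rightarrow> ('a \<times> 'a) set set) ring" where
  "completed_localization R P = adic_completion (localization R P) (localization_ideal R P)"

section \<open>Modules\<close>

text \<open>
  Records of type \<^typ>\<open>('a, 'b) module\<close> contain a multiplication and a unit, about which the locale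
  \<^locale>\<open>module\<close> says nothing; they are left unspecified here.
\<close>

definition make_module ::
  "'b set \<Rightarrow> ('b \<Rightarrow> 'b \<Rightarrow> 'b) \<Rightarrow> 'b \<Rightarrow> ('a \<Rightarrow> 'b \<Rightarrow> 'b) \<Rightarrow> ('a, 'b) module" where
  "make_module C pl z sm =
     \<lparr>carrier = C, monoid.mult = undefined, one = undefined, ring.zero = z, add = pl, smult = sm\<rparr>"

definition with_scalars ::
  "('a, 'b, 'm) module_scheme \<Rightarrow> ('s \<Rightarrow> 'b \<Rightarrow> 'b) \<Rightarrow> ('s, 'b) module" where
  "with_scalars M sm = make_module (carrier M) (add M) (ring.zero M) sm"

definition artinian_module :: "('a, 'r) ring_scheme \<Rightarrow> ('a, 'b, 'm) module_scheme \<Rightarrow> bool" where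
  "artinian_module R M \<longleftrightarrow>
     module R M \<and>
     (\<forall>N::nat \<Rightarrow> 'b set. (\<forall>n. submodule (N n) R M \<and> N (Suc n) \<subseteq> N n)
        \<longrightarrow> (\<exists>k. \<forall>n\<ge>k. N n = N k))"

definition submodule_span ::
  "('a, 'r) ring_scheme \<Rightarrow> ('a, 'b, 'm) module_scheme \<Rightarrow> 'b set \<Rightarrow> 'b set" where
  "submodule_span R M S = \<Inter>{N. submodule N R M \<and> S \<subseteq> N}"

definition quotient_module ::
  "('a, 'b, 'm) module_scheme \<Rightarrow> 'b set \<Rightarrow> ('a, 'b set) module" where
  "quotient_module M N =
     make_module (a_rcosets\<^bsub>M\<^esub> N) (set_add M) N (\<lambda>a U. \<Union>x\<in>U. N +>\<^bsub>M\<^esub> (a \<odot>\<^bsub>M\<^esub> x))"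

definition self_module :: "('a, 'r) ring_scheme \<Rightarrow> ('a, 'a) module" where
  "self_module R = make_module (carrier R) (add R) (ring.zero R) (monoid.mult R)"

definition cyclic_module :: "('a, 'r) ring_scheme \<Rightarrow> 'a set \<Rightarrow> ('a, 'a set) module" where
  "cyclic_module R I = quotient_module (self_module R) I"

subsection \<open>Homomorphisms\<close>

definition linear_maps ::
  "('a, 'r) ring_scheme \<Rightarrow> ('a, 'b, 'm) module_scheme \<Rightarrow> ('a, 'c, 'n) module_scheme
     \<Rightarrow> ('b \<Rightarrow> 'c) set" where
  "linear_maps R M N =
     {f \<in> carrier M \<rightarrow>\<^sub>E carrier N.
        (\<forall>x\<in>carrier M. \<forall>y\<in>carrier M. f (x \<oplus>\<^bsub>M\<^esub> y) = f x \<oplus>\<^bsub>N\<^esub> f y) \<and>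
        (\<forall>a\<in>carrier R. \<forall>x\<in>carrier M. f (a \<odot>\<^bsub>M\<^esub> x) = a \<odot>\<^bsub>N\<^esub> f x)}"

text \<open>
  The set of \<open>R\<close>-linear maps from \<open>M\<close> to \<open>N\<close>, with scalars from a possibly different ring which
  acts on the values of the maps through \<open>sm\<close>.
\<close>

definition hom_module ::
  "('a, 'r) ring_scheme \<Rightarrow> ('a, 'b, 'm) module_scheme \<Rightarrow> ('a, 'c, 'n) module_scheme
     \<Rightarrow> ('s \<Rightarrow> 'c \<Rightarrow> 'c) \<Rightarrow> ('s, 'b \<Rightarrow> 'c) module" where
  "hom_module R M N sm =
     make_module (linear_maps R M N)
       (\<lambda>f g. \<lambda>x\<in>carrier M. f x \<oplus>\<^bsub>N\<^esub> g x)
       (\<lambda>x\<in>carrier M. \<zero>\<^bsub>N\<^esub>)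
       (\<lambda>a f. \<lambda>x\<in>carrier M. sm a (f x))"

subsection \<open>Injective hulls\<close>

text \<open>
  A definition cannot quantify over the modules on all types.  Modules whose elements have the type
  of the ring elements suffice: they include copies of \<open>R\<close> itself, so by Baer's criterion
  \<open>injective_module R E\<close> implies the extension property for modules on every type.
\<close>

definition injective_module :: "('a, 'r) ring_scheme \<Rightarrow> ('a, 'b, 'm) module_scheme \<Rightarrow> bool" where
  "injective_module R E \<longleftrightarrow>
     module R E \<and>
     (\<forall>(N :: ('a, 'a) module) L. module R N \<and> submodule L R N
        \<longrightarrow> (\<forall>f\<in>linear_maps R (N\<lparr>carrier := L\<rparr>) E.
               \<exists>g\<in>linear_maps R N E. \<forall>x\<in>L. g x = f x))"

definition injective_hull ::
  "('a, 'r) ring_scheme \<Rightarrow> ('a, 'b, 'm) module_scheme \<Rightarrow> ('a, 'c, 'n) module_scheme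
     \<Rightarrow> ('b \<Rightarrow> 'c) \<Rightarrow> bool" where
  "injective_hull R N E \<iota> \<longleftrightarrow>
     module R N \<and> injective_module R E \<and>
     \<iota> \<in> linear_maps R N E \<and> inj_on \<iota> (carrier N) \<and>
     (\<forall>K. submodule K R E \<and> K \<noteq> {\<zero>\<^bsub>E\<^esub>} \<longrightarrow> K \<inter> \<iota> ` carrier N \<noteq> {\<zero>\<^bsub>E\<^esub>})"

subsection \<open>Base change\<close>

definition free_module :: "('a, 'r) ring_scheme \<Rightarrow> 'b set \<Rightarrow> ('a, 'b \<Rightarrow> 'a) module" where
  "free_module B S =
     make_module {f \<in> S \<rightarrow>\<^sub>E carrier B. finite {x \<in> S. f x \<noteq> \<zero>\<^bsub>B\<^esub>}}
       (\<lambda>f g. \<lambda>x\<in>S. f x \<oplus>\<^bsub>B\<^esub> g x)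
       (\<lambda>x\<in>S. \<zero>\<^bsub>B\<^esub>)
       (\<lambda>b f. \<lambda>x\<in>S. b \<otimes>\<^bsub>B\<^esub> f x)"

definition free_generator :: "('a, 'r) ring_scheme \<Rightarrow> 'b set \<Rightarrow> 'b \<Rightarrow> 'b \<Rightarrow> 'a" where
  "free_generator B S x = (\<lambda>y\<in>S. if y = x then \<one>\<^bsub>B\<^esub> else \<zero>\<^bsub>B\<^esub>)"

text \<open>
  The base change \<open>B \<otimes>\<^sub>A M\<close> of an \<open>A\<close>-module \<open>M\<close> along \<open>\<phi> : A \<rightarrow> B\<close>: the \<open>B\<close>-module on generators
  \<open>1 \<otimes> x\<close> with relations \<open>1 \<otimes> (x + y) = 1 \<otimes> x + 1 \<otimes> y\<close> and \<open>1 \<otimes> a x = \<phi>(a) (1 \<otimes> x)\<close>.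
\<close>

definition base_change_relations ::
  "('a, 'r) ring_scheme \<Rightarrow> ('b, 's) ring_scheme \<Rightarrow> ('a \<Rightarrow> 'b) \<Rightarrow> ('a, 'c, 'm) module_scheme
     \<Rightarrow> ('c \<Rightarrow> 'b) set" where
  "base_change_relations A B \<phi> M =
     (let F = free_module B (carrier M); \<delta> = free_generator B (carrier M)
      in submodule_span B F
           ({\<delta> (x \<oplus>\<^bsub>M\<^esub> y) \<ominus>\<^bsub>F\<^esub> (\<delta> x \<oplus>\<^bsub>F\<^esub> \<delta> y) |x y. x \<in> carrier M \<and> y \<in> carrier M} \<union>
            {\<delta> (a \<odot>\<^bsub>M\<^esub> x) \<ominus>\<^bsub>F\<^esub> (\<phi> a \<odot>\<^bsub>F\<^esub> \<delta> x) |a x. a \<in> carrier A \<and> x \<in> carrier M}))"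

definition base_change ::
  "('a, 'r) ring_scheme \<Rightarrow> ('b, 's) ring_scheme \<Rightarrow> ('a \<Rightarrow> 'b) \<Rightarrow> ('a, 'c, 'm) module_scheme
     \<Rightarrow> ('b, ('c \<Rightarrow> 'b) set) module" where
  "base_change A B \<phi> M =
     quotient_module (free_module B (carrier M)) (base_change_relations A B \<phi> M)"

text \<open>The element \<open>1 \<otimes> u\<close>.\<close>

definition base_change_elem ::
  "('a, 'r) ring_scheme \<Rightarrow> ('b, 's) ring_scheme \<Rightarrow> ('a \<Rightarrow> 'b) \<Rightarrow> ('a, 'c, 'm) module_scheme
     \<Rightarrow> 'c \<Rightarrow> ('c \<Rightarrow> 'b) set" where
  "base_change_elem A B \<phi> M u =
     base_change_relations A B \<phi> M +>\<^bsub>free_module B (carrier M)\<^esub> free_generator B (carrier M) u"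

section \<open>Tight closure of zero\<close>

definition tight_closure_zero ::
  "('a, 'r) ring_scheme \<Rightarrow> nat \<Rightarrow> ('a, 'b, 'm) module_scheme \<Rightarrow> 'b set" where
  "tight_closure_zero A p M =
     {u \<in> carrier M. \<exists>c\<in>avoiding_minimal_primes A. \<exists>e\<^sub>0. \<forall>e\<ge>e\<^sub>0.
        c \<odot>\<^bsub>base_change A A (frobenius A p e) M\<^esub> base_change_elem A A (frobenius A p e) M u
          = \<zero>\<^bsub>base_change A A (frobenius A p e) M\<^esub>}"

section \<open>Colocalization\<close>

text \<open>
  On an \<open>R\<close>-module \<open>E\<close> on which every element outside \<open>P\<close> acts bijectively, such as an injective
  hull of \<open>R/P\<close>, the fraction \<open>r / s\<close> sends \<open>e\<close> to the unique \<open>e'\<close> with \<open>s e' = r e\<close>.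
\<close>

definition localized_smult ::
  "('a, 'r) ring_scheme \<Rightarrow> 'a set \<Rightarrow> ('a, 'b, 'm) module_scheme \<Rightarrow> ('a \<times> 'a) set \<Rightarrow> 'b \<Rightarrow> 'b" where
  "localized_smult R P E U e =
     (THE e'. e' \<in> carrier E \<and> (\<exists>(r, s)\<in>U. s \<odot>\<^bsub>E\<^esub> e' = r \<odot>\<^bsub>E\<^esub> e))"

text \<open>
  On an \<open>A\<close>-module \<open>E\<close> each of whose elements is killed by some power of \<open>I\<close>, an element
  \<open>(a\<^sub>n)\<^sub>n\<close> of the completion acts on \<open>e\<close> as any representative of \<open>a\<^sub>n\<close>, where \<open>I\<^sup>n e = 0\<close>.
\<close>

definition completed_smult ::
  "('a, 'r) ring_scheme \<Rightarrow> 'a set \<Rightarrow> ('a, 'b, 'm) module_scheme \<Rightarrow> (nat \<Rightarrow> 'a set) \<Rightarrow> 'b \<Rightarrow> 'b" where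
  "completed_smult A I E a e =
     (THE e'. \<exists>n. (\<forall>y\<in>ideal_power A I n. y \<odot>\<^bsub>E\<^esub> e = \<zero>\<^bsub>E\<^esub>) \<and> (\<exists>x\<in>a n. e' = x \<odot>\<^bsub>E\<^esub> e))"

text \<open>
  For \<open>E\<close> an injective hull of \<open>R/P\<close>, the action of the completion of \<open>R\<^sub>P\<close> on \<open>E\<close>.
\<close>

definition completed_localization_smult ::
  "('a, 'r) ring_scheme \<Rightarrow> 'a set \<Rightarrow> ('a, 'b, 'm) module_scheme
     \<Rightarrow> (nat \<Rightarrow> ('a \<times> 'a) set set) \<Rightarrow> 'b \<Rightarrow> 'b" where
  "completed_localization_smult R P E =
     completed_smult (localization R P) (localization_ideal R P)
       (with_scalars E (localized_smult R P E))"

definition matlis_dual ::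
  "('a, 'r) ring_scheme \<Rightarrow> ('a, 'c, 'n) module_scheme \<Rightarrow> ('a, 'b, 'm) module_scheme
     \<Rightarrow> ('a, 'b \<Rightarrow> 'c) module" where
  "matlis_dual R E M = hom_module R M E (smult E)"

text \<open>
  The colocalization of \<open>M\<close> at \<open>P\<close>, where \<open>E\<close> and \<open>E'\<close> are injective hulls of the residue field of
  \<open>R\<close> and of \<open>R/P\<close>, respectively.
\<close>

definition colocalization ::
  "('a, 'r) ring_scheme \<Rightarrow> 'a set \<Rightarrow> ('a, 'c, 'n) module_scheme \<Rightarrow> ('a, 'd, 'k) module_scheme
     \<Rightarrow> ('a, 'b, 'm) module_scheme
     \<Rightarrow> (nat \<Rightarrow> ('a \<times> 'a) set set, ('b \<Rightarrow> 'c) \<Rightarrow> 'd) module" where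
  "colocalization R P E E' M =
     hom_module R (matlis_dual R E M) E' (completed_localization_smult R P E')"

text \<open>The map of colocalizations induced by a linear map \<open>h : L \<rightarrow> M\<close>.\<close>

definition colocalization_map ::
  "('a, 'r) ring_scheme \<Rightarrow> ('a, 'c, 'n) module_scheme
     \<Rightarrow> ('a, 'l, 'i) module_scheme \<Rightarrow> ('a, 'b, 'm) module_scheme \<Rightarrow> ('l \<Rightarrow> 'b)
     \<Rightarrow> (('l \<Rightarrow> 'c) \<Rightarrow> 'd) \<Rightarrow> (('b \<Rightarrow> 'c) \<Rightarrow> 'd)" where
  "colocalization_map R E L M h \<psi> =
     (\<lambda>f\<in>carrier (matlis_dual R E M). \<psi> (\<lambda>x\<in>carrier L. f (h x)))"

text \<open>\<open>\<^sup>PL\<close> as a submodule of \<open>\<^sup>PM\<close>, for a submodule \<open>L\<close> of \<open>M\<close>.\<close>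

definition colocalization_submodule ::
  "('a, 'r) ring_scheme \<Rightarrow> 'a set \<Rightarrow> ('a, 'c, 'n) module_scheme \<Rightarrow> ('a, 'd, 'k) module_scheme
     \<Rightarrow> ('a, 'b, 'm) module_scheme \<Rightarrow> 'b set \<Rightarrow> (('b \<Rightarrow> 'c) \<Rightarrow> 'd) set" where
  "colocalization_submodule R P E E' M L =
     colocalization_map R E (M\<lparr>carrier := L\<rparr>) M (\<lambda>x. x)
       ` carrier (colocalization R P E E' (M\<lparr>carrier := L\<rparr>))"

end

theory Submission
  imports Defs
begin

text \<open>
  Let \<open>N\<close> be the Matlis dual of \<open>M\<close>, let \<open>W\<close> be the colocalization of \<open>M\<close> at \<open>P\<close>, which consists of the linear maps
  from \<open>N\<close> to the injective hull of \<open>R/P\<close>, let \<open>S\<close> be the completion of \<open>R\<^sub>P\<close>, and let \<open>q\<close> range over the powers of \<open>p\<close>.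

  Since \<open>R\<close> is reduced and \<open>F\<close>-finite, for some nonzerodivisor \<open>c\<close> the pushforward \<open>F\<^sub>*R\<close> has a dual basis up to the
  factor \<open>c\<close>, and it extends to \<open>S\<close>. Over a noetherian ring this makes \<open>c\<^sup>3\<close> a test element: \<open>u\<close> is in the tight closure
  of zero iff \<open>c\<^sup>3u\<^sup>q = 0\<close> for all \<open>q\<close>. Now \<open>c\<^sup>3u\<^sup>q = 0\<close> for \<open>u \<in> M\<close> iff \<open>\<phi>(c\<^sup>3)(u) = 0\<close> for all additive \<open>\<phi> : R \<rightarrow> N\<close>
  with \<open>\<phi>(a\<^sup>qr) = a\<phi>(r)\<close>, because the injective hull of the residue field is a cogenerator. Likewise \<open>c\<^sup>3w\<^sup>q = 0\<close> for \<open>w \<in> W\<close>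
  iff \<open>w(\<phi>(c\<^sup>3)) = 0\<close> for all such \<open>\<phi>\<close>: for one direction \<open>w \<circ> \<phi>\<close> is extended continuously to \<open>S\<close>, for the other one
  uses that the pushforward of \<open>R\<close> is finitely presented and the hull of \<open>R/P\<close> injective.

  Hence both tight closures are annihilators of the same set \<open>\<tau>\<close> of elements \<open>\<phi>(c\<^sup>3)\<close> of \<open>N\<close>. This set is stable under
  composition with endomorphisms of the hull of the residue field; as \<open>M\<close> is Artinian, it therefore spans the elements of \<open>N\<close>
  which vanish on its annihilator in \<open>M\<close>, and the colocalization of that annihilator is the annihilator of \<open>\<tau>\<close> in \<open>W\<close>.
\<close>

section \<open>Ideals of noetherian rings\<close>

text \<open>Membership in a tight closure is witnessed by a multiplier and a bound on
  \<open>q\<close> that may depend on the element, the module and the ring, so the two sides cannot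
  be compared directly. One multiplier taken from \<open>R\<close>, valid for every module over
  \<open>R\<close> and over \<open>S\<close> and for every \<open>q\<close>, reduces the theorem to
  comparing, for each single \<open>q\<close>, when \<open>c^3\<close> kills a Frobenius power. A
  dual basis is a convenient certificate for such a multiplier: it is a finite amount of data with
  continuous maps, so it passes to \<open>S\<close> by density, and neither reducedness nor
  finiteness of Frobenius has to be proved for \<open>S\<close>. What does have to be proved is that
  \<open>S\<close> is noetherian and that \<open>c\<close> stays a nonzerodivisor; the latter holds
  because \<open>S\<close> acts faithfully on the hull of \<open>R/P\<close>, on which
  \<open>c\<close> acts surjectively. The exponent 3 arises because one descent step turns
  \<open>N\<close> into \<open>N/2 + 1\<close>, rounded up, which decreases as long as
  \<open>N\<close> exceeds 3. Base change enters through one half of its universal property: a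
  balanced biadditive map respects the vanishing of \<open>c (1 \<otimes> u)\<close>.\<close>

lemma (in ideal) minus_in:
  "x \<in> I \<Longrightarrow> y \<in> I \<Longrightarrow> x \<ominus> y \<in> I"
  by (simp add: minus_eq)

lemma (in cring) Idl_insert:
  assumes "x \<in> carrier R" "Z \<subseteq> carrier R"
  shows "Idl (insert x Z) = {a \<otimes> x \<oplus> y |a y. a \<in> carrier R \<and> y \<in> Idl Z}" (is "_ = ?D")
proof
  have IX: "ideal (Idl Z) R" by (simp add: assms genideal_ideal)
  interpret IX: ideal "Idl Z" R by fact
  have e: "?D = PIdl x <+>\<^bsub>R\<^esub> Idl Z"
    using assms by (auto simp: set_add_def' cgenideal_def)
  have iD: "ideal ?D R" unfolding e
    by (intro add_ideals IX cgenideal_ideal assms)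
  have "x = \<one> \<otimes> x \<oplus> \<zero>" using assms by simp
  then have "x \<in> ?D" by force
  moreover have "y \<in> ?D" if "y \<in> Z" for y
  proof -
    have "y = \<zero> \<otimes> x \<oplus> y" using assms that by auto
    then show ?thesis using genideal_self[OF assms(2)] that by blast
  qed
  ultimately show "Idl (insert x Z) \<subseteq> ?D"
    by (intro genideal_minimal[OF iD]) auto
  have iI: "ideal (Idl (insert x Z)) R" by (simp add: assms genideal_ideal)
  then interpret I: ideal "Idl (insert x Z)" R .
  have "insert x Z \<subseteq> Idl (insert x Z)" using assms genideal_self[of "insert x Z"] by blast
  then have "Idl Z \<subseteq> Idl (insert x Z)" "x \<in> Idl (insert x Z)"
    using genideal_minimal[OF iI, of Z] by blast+
  then show "?D \<subseteq> Idl (insert x Z)"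
    using I.I_l_closed by auto
qed

lemma (in cring) ideal_sum_principal:
  assumes "ideal I R" "y \<in> carrier R"
  shows "ideal (I <+>\<^bsub>R\<^esub> PIdl y) R" "I \<subseteq> I <+>\<^bsub>R\<^esub> PIdl y" "y \<in> I <+>\<^bsub>R\<^esub> PIdl y"
    "z \<in> I <+>\<^bsub>R\<^esub> PIdl y \<longleftrightarrow> (\<exists>i\<in>I. \<exists>a\<in>carrier R. z = i \<oplus> a \<otimes> y)"
proof -
  interpret I: ideal I R by fact
  show "ideal (I <+>\<^bsub>R\<^esub> PIdl y) R"
    by (intro add_ideals assms cgenideal_ideal)
  show iff: "z \<in> I <+>\<^bsub>R\<^esub> PIdl y \<longleftrightarrow> (\<exists>i\<in>I. \<exists>a\<in>carrier R. z = i \<oplus> a \<otimes> y)" for z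
    using assms by (auto simp: set_add_def' cgenideal_def)
  show "I \<subseteq> I <+>\<^bsub>R\<^esub> PIdl y"
  proof
    fix i assume "i \<in> I"
    then have "i = i \<oplus> \<zero> \<otimes> y" using assms by simp
    then show "i \<in> I <+>\<^bsub>R\<^esub> PIdl y" using iff \<open>i \<in> I\<close> by blast
  qed
  have "y = \<zero> \<oplus> \<one> \<otimes> y" using assms by simp
  then show "y \<in> I <+>\<^bsub>R\<^esub> PIdl y" using iff I.zero_closed one_closed by blast
qed

text \<open>The ideal quotient \<open>(I : y)\<close>. That it is an ideal lets a claim about
  multiples of \<open>y\<close> be checked on generators.\<close>

lemma (in cring) colon_ideal:
  assumes "ideal I R" "y \<in> carrier R"
  shows "ideal {x \<in> carrier R. x \<otimes> y \<in> I} R"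
proof -
  interpret I: ideal I R by fact
  show ?thesis
  proof (rule idealI[OF ring_axioms])
    show "subgroup {x \<in> carrier R. x \<otimes> y \<in> I} (add_monoid R)"
      using assms by (intro add.subgroupI) (auto simp: l_distr l_minus simp flip: a_inv_def)
  next
    fix a x assume "a \<in> {x \<in> carrier R. x \<otimes> y \<in> I}" "x \<in> carrier R"
    then show "x \<otimes> a \<in> {x \<in> carrier R. x \<otimes> y \<in> I}" "a \<otimes> x \<in> {x \<in> carrier R. x \<otimes> y \<in> I}"
      using assms I.I_l_closed by (auto simp: m_assoc m_comm[of a x])
  qed
qed

text \<open>Zorn's lemma yields a maximal counterexample: a nonempty chain of ideals contains its
  own union, so chains of counterexamples are bounded within the family.\<close>

lemma (in noetherian_ring) noetherian_induct [consumes 1, case_names ideal]: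
  assumes "ideal I R"
    and step: "\<And>I. ideal I R \<Longrightarrow> (\<And>J. ideal J R \<Longrightarrow> I \<subset> J \<Longrightarrow> Q J) \<Longrightarrow> Q I"
  shows "Q I"
proof (rule ccontr)
  assume "\<not> Q I"
  define A where "A = {J. ideal J R \<and> \<not> Q J}"
  have "\<exists>M\<in>A. \<forall>Z\<in>A. M \<subseteq> Z \<longrightarrow> Z = M"
  proof (rule subset_Zorn)
    fix C assume C: "subset.chain A C"
    show "\<exists>U\<in>A. \<forall>Z\<in>C. Z \<subseteq> U"
    proof (cases "C = {}")
      case True
      then show ?thesis using \<open>\<not> Q I\<close> assms(1) by (auto simp: A_def)
    next
      case False
      have "subset.chain {I. ideal I R} C"
        using C by (auto simp: pred_on.chain_def A_def)
      then have "\<Union>C \<in> C" by (rule ideal_chain_is_trivial[OF False])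
      then show ?thesis using C by (auto simp: pred_on.chain_def)
    qed
  qed
  then obtain M where M: "M \<in> A" "\<And>Z. Z \<in> A \<Longrightarrow> M \<subseteq> Z \<Longrightarrow> Z = M" by blast
  have "Q M"
  proof (rule step)
    show "ideal M R" using M by (auto simp: A_def)
    fix J assume "ideal J R" "M \<subset> J"
    then show "Q J" using M(2)[of J] by (auto simp: A_def)
  qed
  then show False using M by (auto simp: A_def)
qed

lemma (in cring) ideal_power_ideal: "ideal I R \<Longrightarrow> ideal (ideal_power R I n) R"
proof -
  assume I: "ideal I R"
  interpret M: comm_monoid "ideals_set R" by (rule ideals_set_is_comm_monoid)
  have "I \<in> carrier (ideals_set R)" using I by (simp add: ideals_set_def)
  then have "I [^]\<^bsub>ideals_set R\<^esub> n \<in> carrier (ideals_set R)" by (rule M.nat_pow_closed)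
  then show ?thesis by (simp add: ideals_set_def)
qed

lemma ideal_power_0 [simp]: "ideal_power R I 0 = carrier R"
  by (simp add: ideals_set_def nat_pow_def)

lemma ideal_power_Suc: "ideal_power R I (Suc n) = ideal_prod R (ideal_power R I n) I"
  by (simp add: ideals_set_def nat_pow_def)

lemma (in cring) ideal_power_add:
  assumes "ideal I R"
  shows "ideal_power R I (m + n) = ideal_prod R (ideal_power R I m) (ideal_power R I n)"
proof -
  interpret M: comm_monoid "ideals_set R" by (rule ideals_set_is_comm_monoid)
  have "I \<in> carrier (ideals_set R)" using assms by (simp add: ideals_set_def)
  then show ?thesis using M.nat_pow_mult[of I m n] by (simp add: ideals_set_def)
qed

lemma (in cring) ideal_power_1:
  assumes "ideal I R"
  shows "ideal_power R I 1 = I"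
proof -
  interpret M: comm_monoid "ideals_set R" by (rule ideals_set_is_comm_monoid)
  have "I \<in> carrier (ideals_set R)" using assms by (simp add: ideals_set_def)
  then show ?thesis using M.nat_pow_eone[of I] by simp
qed

lemma (in cring) ideal_prod_least:
  assumes "ideal K R" "\<And>i j. i \<in> I \<Longrightarrow> j \<in> J \<Longrightarrow> i \<otimes> j \<in> K"
  shows "I \<cdot> J \<subseteq> K"
proof
  interpret ideal K R by fact
  fix x assume "x \<in> I \<cdot> J"
  then show "x \<in> K" by induct (auto simp: assms)
qed

lemma (in cring) ideal_power_mult_closed:
  assumes "ideal I R" "x \<in> ideal_power R I m" "y \<in> ideal_power R I n"
  shows "x \<otimes> y \<in> ideal_power R I (m + n)"
  unfolding ideal_power_add[OF assms(1)] by (intro ideal_prod.prod assms)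

lemma (in cring) ideal_power_antimono:
  assumes "ideal I R" "m \<le> n"
  shows "ideal_power R I n \<subseteq> ideal_power R I m"
proof -
  obtain k where k: "n = m + k" using assms(2) le_Suc_ex by blast
  have "ideal_power R I n \<subseteq> ideal_power R I m \<inter> ideal_power R I k"
    unfolding k ideal_power_add[OF assms(1)]
    by (intro ideal_prod_inter ideal_power_ideal assms)
  then show ?thesis by blast
qed

text \<open>Noetherian induction on \<^term>\<open>J\<close>: with \<open>x \<in> I\<close>, \<open>y = x\<^sup>n \<notin> J\<close> and \<open>x y \<in> J\<close>, a power of \<^term>\<open>I\<close> is
  contained in \<open>J + (y)\<close> and a power in \<open>(J : y)\<close>.\<close>

lemma ideal_power_subset_of_radical:
  fixes R (structure)
  assumes "noetherian_ring R" "cring R" "ideal I R" "ideal J R"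
    and "\<And>x. x \<in> I \<Longrightarrow> \<exists>n::nat. x [^]\<^bsub>R\<^esub> n \<in> J"
  shows "\<exists>n::nat. ideal_power R I n \<subseteq> J"
proof -
  interpret noetherian_ring R by fact
  interpret cring R by fact
  interpret I: ideal I R by fact
  show ?thesis using assms(4,5)
  proof (induct J rule: noetherian_induct)
    case (ideal J)
    interpret J: ideal J R by fact
    show ?case
    proof (cases "I \<subseteq> J")
      case True
      then show ?thesis using ideal_power_1[OF assms(3)] by blast
    next
      case False
      then obtain x where x: "x \<in> I" "x \<notin> J" by blast
      have xc: "x \<in> carrier R" using x by (rule_tac I.Icarr)
      define n where "n = (LEAST n::nat. x [^] n \<in> J)"
      have n: "x [^] n \<in> J" unfolding n_def using ideal(3)[OF x(1)] by (rule LeastI_ex)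
      have less: "k < n \<Longrightarrow> x [^] k \<notin> J" for k
        unfolding n_def by (rule not_less_Least)
      show ?thesis
      proof (cases n)
        case 0
        then have "carrier R \<subseteq> J" using n J.one_imp_carrier by simp
        then show ?thesis by (intro exI[of _ 0]) (simp add: ideals_set_def)
      next
        case (Suc k)
        define y where "y = x [^] k"
        have y: "y \<in> carrier R" "y \<notin> J" "x \<otimes> y \<in> J"
          using less[of k] Suc n xc m_comm[of x "x [^] k"] by (auto simp: y_def)
        note S = ideal_sum_principal[OF J.is_ideal y(1)]
        define C where "C = {z \<in> carrier R. z \<otimes> y \<in> J}"
        have C: "ideal C R" unfolding C_def by (rule colon_ideal[OF J.is_ideal y(1)])
        have JC: "J \<subseteq> C" using J.I_r_closed y(1) J.Icarr by (auto simp: C_def)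
        have "\<exists>n::nat. ideal_power R I n \<subseteq> J <+>\<^bsub>R\<^esub> PIdl y"
        proof (rule ideal(2)[OF S(1)])
          show "J \<subset> J <+>\<^bsub>R\<^esub> PIdl y" using S(2,3) y(2) by blast
          show "\<exists>n::nat. z [^] n \<in> J <+>\<^bsub>R\<^esub> PIdl y" if "z \<in> I" for z
            using ideal(3)[OF that] S(2) by (meson subsetD)
        qed
        then obtain n1 where n1: "ideal_power R I n1 \<subseteq> J <+>\<^bsub>R\<^esub> PIdl y" ..
        have "\<exists>n::nat. ideal_power R I n \<subseteq> C"
        proof (rule ideal(2)[OF C])
          have "x \<in> C" using y xc by (simp add: C_def)
          then show "J \<subset> C" using JC x by blast
          show "\<exists>n::nat. z [^] n \<in> C" if "z \<in> I" for z
            using ideal(3)[OF that] JC by (meson subsetD)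
        qed
        then obtain n2 where n2: "ideal_power R I n2 \<subseteq> C" ..
        \<comment> \<open>The product of \<open>J + (y)\<close> and \<open>(J : y)\<close> lies in
          \<open>J\<close>.\<close>
        have "ideal_power R I (n1 + n2) \<subseteq> J"
          unfolding ideal_power_add[OF assms(3)]
        proof (rule ideal_prod_least[OF J.is_ideal])
          fix i j assume "i \<in> ideal_power R I n1" "j \<in> ideal_power R I n2"
          then have "i \<in> J <+>\<^bsub>R\<^esub> PIdl y" and j: "j \<in> carrier R" "j \<otimes> y \<in> J"
            using n1 n2 by (auto simp: C_def)
          then obtain i' a where i: "i' \<in> J" "a \<in> carrier R" "i = i' \<oplus> a \<otimes> y"
            using S(4) by blast
          have "i \<otimes> j = i' \<otimes> j \<oplus> a \<otimes> (j \<otimes> y)"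
            using i j y J.Icarr[OF i(1)] by (simp add: l_distr m_assoc m_comm[of y j])
          then show "i \<otimes> j \<in> J" using i j J.I_r_closed J.I_l_closed by simp
        qed
        then show ?thesis ..
      qed
    qed
  qed
qed

text \<open>If a proper \<open>I\<close> is not prime, choose \<open>a b\<close> in \<open>I\<close>
  with \<open>a\<close> and \<open>b\<close> outside. As the product of \<open>I + (a)\<close> and
  \<open>I + (b)\<close> lies in \<open>I\<close>, the primes found for these two larger ideals
  together serve \<open>I\<close>.\<close>

lemma finite_primes_radical:
  fixes R (structure)
  assumes "noetherian_ring R" "cring R" "ideal I R"
  shows "\<exists>F. finite F \<and> (\<forall>Q\<in>F. primeideal Q R) \<and>
     (\<forall>x\<in>carrier R. (\<forall>Q\<in>F. x \<in> Q) \<longrightarrow> (\<exists>n::nat. x [^]\<^bsub>R\<^esub> n \<in> I))"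
proof -
  interpret noetherian_ring R by fact
  interpret cring R by fact
  show ?thesis using assms(3)
  proof (induct I rule: noetherian_induct)
    case (ideal I)
    interpret I: ideal I R by fact
    show ?case
    proof (cases "I = carrier R")
      case True
      then show ?thesis by (intro exI[of _ "{}"]) auto
    next
      case False
      show ?thesis
      proof (cases "primeideal I R")
        case True
        then show ?thesis
          by (intro exI[of _ "{I}"]) (auto intro: exI[of _ 1])
      next
        case False
        then obtain a b where ab: "a \<in> carrier R" "b \<in> carrier R" "a \<otimes> b \<in> I" "a \<notin> I" "b \<notin> I"
          using I.primeidealCD[OF is_cring] \<open>I \<noteq> carrier R\<close> by blast
        note A = ideal_sum_principal[OF I.is_ideal ab(1)]
        note B = ideal_sum_principal[OF I.is_ideal ab(2)]
        obtain F where F: "finite F" "\<forall>Q\<in>F. primeideal Q R"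
           "\<And>x. x \<in> carrier R \<Longrightarrow> (\<forall>Q\<in>F. x \<in> Q) \<Longrightarrow> (\<exists>n::nat. x [^] n \<in> I <+>\<^bsub>R\<^esub> PIdl a)"
        proof -
          have "I \<subset> I <+>\<^bsub>R\<^esub> PIdl a" using A(2,3) ab(4) by blast
          from ideal(2)[OF A(1) this] show ?thesis using that by blast
        qed
        obtain G where G: "finite G" "\<forall>Q\<in>G. primeideal Q R"
           "\<And>x. x \<in> carrier R \<Longrightarrow> (\<forall>Q\<in>G. x \<in> Q) \<Longrightarrow> (\<exists>n::nat. x [^] n \<in> I <+>\<^bsub>R\<^esub> PIdl b)"
        proof -
          have "I \<subset> I <+>\<^bsub>R\<^esub> PIdl b" using B(2,3) ab(5) by blast
          from ideal(2)[OF B(1) this] show ?thesis using that by blast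
        qed
        show ?thesis
        proof (intro exI[of _ "F \<union> G"] conjI ballI impI)
          show "finite (F \<union> G)" using F G by simp
          show "primeideal Q R" if "Q \<in> F \<union> G" for Q using that F G by blast
          fix x assume x: "x \<in> carrier R" "\<forall>Q\<in>F \<union> G. x \<in> Q"
          obtain n m where nm: "x [^] (n::nat) \<in> I <+>\<^bsub>R\<^esub> PIdl a" "x [^] (m::nat) \<in> I <+>\<^bsub>R\<^esub> PIdl b"
            using F(3)[of x] G(3)[of x] x by blast
          obtain i r where i: "i \<in> I" "r \<in> carrier R" "x [^] n = i \<oplus> r \<otimes> a"
            using A(4) nm by blast
          obtain j s where j: "j \<in> I" "s \<in> carrier R" "x [^] m = j \<oplus> s \<otimes> b"
            using B(4) nm by blast
          have ij: "i \<in> carrier R" "j \<in> carrier R" using i j by auto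
          have "x [^] (n + m) = (i \<oplus> r \<otimes> a) \<otimes> (j \<oplus> s \<otimes> b)"
            using i j x by (simp flip: nat_pow_mult)
          also have "\<dots> = (j \<oplus> s \<otimes> b) \<otimes> i \<oplus> (r \<otimes> a) \<otimes> j \<oplus> (r \<otimes> s) \<otimes> (a \<otimes> b)"
            using i(2) j(2) ij ab(1,2) by algebra
          also have "\<dots> \<in> I"
            using i j ij ab I.I_l_closed by simp
          finally show "\<exists>n::nat. x [^] n \<in> I" ..
        qed
      qed
    qed
  qed
qed

section \<open>Minimal primes and nonzerodivisors\<close>

definition nonzerodivisor :: "('a, 'r) ring_scheme \<Rightarrow> 'a \<Rightarrow> bool" where
  "nonzerodivisor R c \<longleftrightarrow> c \<in> carrier R \<and> (\<forall>x\<in>carrier R. c \<otimes>\<^bsub>R\<^esub> x = \<zero>\<^bsub>R\<^esub> \<longrightarrow> x = \<zero>\<^bsub>R\<^esub>)"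

text \<open>Multiply one element from each \<open>Q\<close> outside \<open>I\<close>; primality
  keeps the product outside.\<close>

lemma (in primeideal) finite_Inter_not_subset:
  assumes "finite T" "\<And>Q. Q \<in> T \<Longrightarrow> ideal Q R" "\<And>Q. Q \<in> T \<Longrightarrow> \<not> Q \<subseteq> I"
  shows "\<exists>t\<in>carrier R. t \<notin> I \<and> (\<forall>Q\<in>T. t \<in> Q)"
  using assms
proof (induct T rule: finite_induct)
  case empty
  then show ?case using I_notcarr a_subset by blast
next
  case (insert Q T)
  then obtain t where t: "t \<in> carrier R" "t \<notin> I" "\<forall>Q\<in>T. t \<in> Q" by blast
  interpret Q: ideal Q R using insert by blast
  obtain q where q: "q \<in> Q" "q \<notin> I" using insert by blast
  have "q \<otimes> t \<in> Q'" if "Q' \<in> insert Q T" for Q'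
  proof -
    interpret Q': ideal Q' R using insert that by blast
    show ?thesis using that q t by (auto intro: Q.I_r_closed Q'.I_l_closed)
  qed
  moreover have "q \<otimes> t \<notin> I" using I_prime[of q t] q t by auto
  ultimately show ?case using q t by (intro bexI[of _ "q \<otimes> t"]) auto
qed

lemma (in primeideal) pow_memD:
  "x \<in> carrier R \<Longrightarrow> x [^] (n::nat) \<in> I \<Longrightarrow> x \<in> I"
proof (induct n)
  case 0
  then show ?case using one_imp_carrier I_notcarr by simp
next
  case (Suc n)
  then show ?case using I_prime[of "x [^] n" x] by auto
qed

text \<open>Suppose \<open>c\<close> lies in a minimal prime \<open>Q\<close>. Finitely many primes
  have only nilpotent common elements, and some \<open>t\<close> outside \<open>Q\<close> lies in
  all of them except possibly \<open>Q\<close>. Then \<open>c t\<close> is nilpotent, cancelling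
  \<open>c\<close> makes \<open>t\<close> nilpotent, and \<open>t\<close> would lie in
  \<open>Q\<close>.\<close>

lemma nonzerodivisor_avoids:
  fixes R (structure)
  assumes "noetherian_ring R" "cring R" "nonzerodivisor R c"
  shows "c \<in> avoiding_minimal_primes R"
proof -
  interpret noetherian_ring R by fact
  interpret cring R by fact
  have c: "c \<in> carrier R" and nz: "\<And>x. x \<in> carrier R \<Longrightarrow> c \<otimes> x = \<zero> \<Longrightarrow> x = \<zero>"
    using assms(3) by (auto simp: nonzerodivisor_def)
  obtain F where F: "finite F" "\<And>Q. Q \<in> F \<Longrightarrow> primeideal Q R"
    "\<And>x. x \<in> carrier R \<Longrightarrow> (\<forall>Q\<in>F. x \<in> Q) \<Longrightarrow> (\<exists>n::nat. x [^] n \<in> {\<zero>})"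
    using finite_primes_radical[OF assms(1,2) zeroideal] by metis
  have "c \<notin> Q" if Q: "minimal_prime R Q" for Q
  proof
    assume cQ: "c \<in> Q"
    interpret Q: primeideal Q R using Q by (simp add: minimal_prime_def)
    have "\<exists>t\<in>carrier R. t \<notin> Q \<and> (\<forall>Q'\<in>F - {Q}. t \<in> Q')"
    proof (rule Q.finite_Inter_not_subset)
      show "ideal Q' R" if "Q' \<in> F - {Q}" for Q'
        using F(2)[of Q'] that by (auto dest: primeideal.axioms(1))
      show "\<not> Q' \<subseteq> Q" if "Q' \<in> F - {Q}" for Q'
        using F(2)[of Q'] that Q by (auto simp: minimal_prime_def)
    qed (use F in auto)
    then obtain t where t: "t \<in> carrier R" "t \<notin> Q" "\<forall>Q'\<in>F - {Q}. t \<in> Q'" by blast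
    have "\<forall>Q'\<in>F. c \<otimes> t \<in> Q'"
    proof
      fix Q' assume "Q' \<in> F"
      then interpret Q': primeideal Q' R using F by blast
      show "c \<otimes> t \<in> Q'"
        using Q'.I_l_closed[of t c] Q'.I_r_closed[of c t] cQ t c \<open>Q' \<in> F\<close> by blast
    qed
    then obtain n :: nat where n: "(c \<otimes> t) [^] n = \<zero>" using F(3)[of "c \<otimes> t"] c t by auto
    have "t [^] n = \<zero>"
    proof -
      have "c [^] k \<otimes> x = \<zero> \<Longrightarrow> x = \<zero>" if "x \<in> carrier R" for k :: nat and x
        using that
      proof (induct k arbitrary: x)
        case (Suc k)
        then show ?case using nz[of x] c by (auto simp: m_assoc)
      qed auto
      moreover have "c [^] n \<otimes> t [^] n = \<zero>" using n c t by (simp add: nat_pow_distrib)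
      ultimately show ?thesis using t by blast
    qed
    then show False using Q.pow_memD[of t n] t by auto
  qed
  then show ?thesis using c by (auto simp: avoiding_minimal_primes_def)
qed

text \<open>Each member of the finite family \<open>F\<close> contains an inclusion-minimal member
  \<open>N\<close>, and \<open>N\<close> is a minimal prime of the ring. From \<open>x d = 0\<close>
  and \<open>d\<close> outside \<open>N\<close> follows \<open>x\<close> in \<open>N\<close>, so
  \<open>x\<close> lies in every member of \<open>F\<close> and is nilpotent.\<close>

lemma avoiding_minimal_primes_annihilator:
  fixes R (structure)
  assumes "noetherian_ring R" "cring R" "d \<in> avoiding_minimal_primes R"
    and "x \<in> carrier R" "x \<otimes>\<^bsub>R\<^esub> d = \<zero>\<^bsub>R\<^esub>"
  shows "\<exists>n::nat. x [^]\<^bsub>R\<^esub> n = \<zero>\<^bsub>R\<^esub>"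
proof -
  interpret noetherian_ring R by fact
  interpret cring R by fact
  have d: "d \<in> carrier R" "\<And>Q. minimal_prime R Q \<Longrightarrow> d \<notin> Q"
    using assms(3) by (auto simp: avoiding_minimal_primes_def)
  obtain F where F: "finite F" "\<And>Q. Q \<in> F \<Longrightarrow> primeideal Q R"
    "\<And>x. x \<in> carrier R \<Longrightarrow> (\<forall>Q\<in>F. x \<in> Q) \<Longrightarrow> (\<exists>n::nat. x [^] n \<in> {\<zero>})"
    using finite_primes_radical[OF assms(1,2) zeroideal] by metis
  have "\<forall>Q\<in>F. x \<in> Q"
  proof
    fix Q assume Q: "Q \<in> F"
    obtain N where N: "N \<in> F" "N \<subseteq> Q" "\<And>Q'. Q' \<in> F \<Longrightarrow> Q' \<subseteq> N \<Longrightarrow> Q' = N"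
      using finite_has_minimal2[OF F(1) Q] by (metis order.refl)
    interpret N: primeideal N R using N F by blast
    have "minimal_prime R N"
      unfolding minimal_prime_def
    proof (intro conjI allI impI)
      show "primeideal N R" using N F by blast
      fix P assume P: "primeideal P R \<and> P \<subseteq> N"
      then interpret P: primeideal P R by blast
      \<comment> \<open>Otherwise an element outside \<open>P\<close> would lie in all members of
        \<open>F\<close>, hence be nilpotent and lie in \<open>P\<close>.\<close>
      have "\<exists>Q'\<in>F. Q' \<subseteq> P"
      proof (rule ccontr)
        assume "\<not> (\<exists>Q'\<in>F. Q' \<subseteq> P)"
        then have "\<exists>t\<in>carrier R. t \<notin> P \<and> (\<forall>Q\<in>F. t \<in> Q)"
          by (intro P.finite_Inter_not_subset F(1)) (auto dest: primeideal.axioms(1) F(2))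
        then obtain t where "t \<in> carrier R" "t \<notin> P" "\<forall>Q\<in>F. t \<in> Q" by blast
        moreover obtain n :: nat where "t [^] n \<in> {\<zero>}" using F(3) calculation by blast
        ultimately show False using P.pow_memD[of t n] by auto
      qed
      then show "P = N" using N P by blast
    qed
    then have "d \<notin> N" by (rule d)
    then show "x \<in> Q" using N.I_prime[of x d] assms(4,5) d(1) N by auto
  qed
  then show ?thesis using F(3)[OF assms(4)] by auto
qed

section \<open>Complete filtered rings\<close>

text \<open>For an ideal \<open>I\<close> this is the product of \<open>I\<close> with the ideal
  generated by \<open>Z\<close>. The form with explicit coefficients in \<open>I\<close> is what the
  elimination of a single generator requires.\<close>

inductive_set combinations :: "('a, 'r) ring_scheme \<Rightarrow> 'a set \<Rightarrow> 'a set \<Rightarrow> 'a set"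
  for R (structure) and I and Z where
  zero: "\<zero> \<in> combinations R I Z"
| step: "m \<in> I \<Longrightarrow> x \<in> Z \<Longrightarrow> w \<in> combinations R I Z \<Longrightarrow> m \<otimes> x \<oplus> w \<in> combinations R I Z"

lemma (in cring) idealI':
  assumes "I \<subseteq> carrier R" "\<zero> \<in> I" "\<And>x y. x \<in> I \<Longrightarrow> y \<in> I \<Longrightarrow> x \<oplus> y \<in> I"
    and "\<And>a x. a \<in> carrier R \<Longrightarrow> x \<in> I \<Longrightarrow> a \<otimes> x \<in> I"
  shows "ideal I R"
proof (rule idealI[OF ring_axioms])
  have "\<ominus> x \<in> I" if "x \<in> I" for x
    using assms(4)[of "\<ominus> \<one>" x] assms(1) that by (auto simp: l_minus subset_eq)
  then show "subgroup I (add_monoid R)"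
    using assms by (intro add.subgroupI) (auto simp flip: a_inv_def)
  fix a x assume "a \<in> I" "x \<in> carrier R"
  then show "x \<otimes> a \<in> I" "a \<otimes> x \<in> I"
    using assms(1,4) m_comm[of a x] by auto
qed

context cring
begin

context
  fixes I Z
  assumes I: "ideal I R" and Z: "Z \<subseteq> carrier R"
begin

interpretation I: ideal I R by (rule I)

lemma combinations_carrier: "w \<in> combinations R I Z \<Longrightarrow> w \<in> carrier R"
  by (induct rule: combinations.induct) (use Z in auto)

lemma combinations_add:
  "w \<in> combinations R I Z \<Longrightarrow> v \<in> combinations R I Z \<Longrightarrow> w \<oplus> v \<in> combinations R I Z"
proof (induct rule: combinations.induct)
  case zero
  then show ?case using combinations_carrier by simp
next
  case (step m x w)
  have "m \<otimes> x \<oplus> w \<oplus> v = m \<otimes> x \<oplus> (w \<oplus> v)"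
    using step combinations_carrier Z by (intro a_assoc) auto
  then show ?case using step combinations.step by metis
qed

lemma combinations_mult:
  "w \<in> combinations R I Z \<Longrightarrow> a \<in> carrier R \<Longrightarrow> a \<otimes> w \<in> combinations R I Z"
proof (induct rule: combinations.induct)
  case zero
  then show ?case using combinations.zero by simp
next
  case (step m x w)
  have "a \<otimes> (m \<otimes> x \<oplus> w) = (a \<otimes> m) \<otimes> x \<oplus> a \<otimes> w"
    using step combinations_carrier Z by (simp add: r_distr m_assoc subset_eq)
  moreover have "a \<otimes> m \<in> I" using step I.I_l_closed by simp
  ultimately show ?case using step combinations.step by metis
qed

lemma combinations_ideal: "ideal (combinations R I Z) R"
  by (rule idealI') (use combinations_carrier combinations_add combinations_mult combinations.zero in auto)

text \<open>For fixed \<open>i\<close>, the \<open>j\<close> with \<open>j i\<close> among the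
  combinations form an ideal quotient that contains \<open>Z\<close>.\<close>

lemma mult_genideal_combinations:
  assumes "i \<in> I" "j \<in> Idl Z"
  shows "i \<otimes> j \<in> combinations R I Z"
proof -
  define D where "D = {j \<in> carrier R. j \<otimes> i \<in> combinations R I Z}"
  have D: "ideal D R"
    unfolding D_def using assms by (intro colon_ideal combinations_ideal) auto
  have "Z \<subseteq> D"
  proof
    fix x assume "x \<in> Z"
    then have "i \<otimes> x \<oplus> \<zero> \<in> combinations R I Z" using assms by (intro combinations.intros)
    then show "x \<in> D" using Z \<open>x \<in> Z\<close> assms m_comm[of i x] by (auto simp: D_def)
  qed
  then have "Idl Z \<subseteq> D" by (rule genideal_minimal[OF D])
  then show ?thesis using assms m_comm[of i j] by (auto simp: D_def)
qed

lemma combinations_annihilator: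
  assumes "z \<in> carrier R" "\<And>x. x \<in> Z \<Longrightarrow> z \<otimes> x = \<zero>" "w \<in> combinations R I Z"
  shows "z \<otimes> w = \<zero>"
  using assms(3)
proof induct
  case (step m x w)
  have "z \<otimes> (m \<otimes> x \<oplus> w) = m \<otimes> (z \<otimes> x) \<oplus> z \<otimes> w"
    using step assms(1) combinations_carrier Z by (simp add: r_distr m_lcomm subset_eq)
  then show ?case using step assms by simp
qed (use assms in auto)

end

lemma combinations_insert:
  assumes "ideal I R" "x \<in> carrier R" "Z \<subseteq> carrier R" "w \<in> combinations R I (insert x Z)"
  shows "\<exists>m\<in>I. \<exists>v\<in>combinations R I Z. w = m \<otimes> x \<oplus> v"
  using assms(4)
proof induct
  interpret I: ideal I R by fact
  case zero
  have "\<zero> = \<zero> \<otimes> x \<oplus> \<zero>" using assms by simp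
  then show ?case using I.zero_closed combinations.zero by blast
next
  interpret I: ideal I R by fact
  case (step m y w)
  then obtain m' v where v: "m' \<in> I" "v \<in> combinations R I Z" "w = m' \<otimes> x \<oplus> v" by blast
  have vc: "v \<in> carrier R" using combinations_carrier[OF assms(1,3) v(2)] .
  have c: "m \<in> carrier R" "m' \<in> carrier R" using step v by auto
  show ?case
  proof (cases "y = x")
    case True
    have "m \<otimes> y \<oplus> w = (m \<oplus> m') \<otimes> x \<oplus> v"
      using c vc assms(2) unfolding True v by algebra
    then show ?thesis using step v I.a_closed by blast
  next
    case False
    then have y: "y \<in> Z" "y \<in> carrier R" using step assms(3) by auto
    have "m \<otimes> y \<oplus> w = m' \<otimes> x \<oplus> (m \<otimes> y \<oplus> v)"
      using c vc y assms(2) unfolding v by algebra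
    then show ?thesis using step v y combinations.step by metis
  qed
qed

text \<open>The determinant trick, by eliminating one generator at a time.\<close>

lemma combinations_elimination:
  assumes "ideal I R" "finite Z" "Z \<subseteq> carrier R" "c \<in> carrier R"
    and "\<And>x. x \<in> Z \<Longrightarrow> c \<otimes> x \<in> combinations R I Z"
  shows "\<exists>(n::nat). \<exists>j\<in>I. \<forall>x\<in>Z. (c [^] n \<oplus> j) \<otimes> x = \<zero>"
  using assms(2-5)
proof (induct Z arbitrary: c rule: finite_induct)
  case empty
  interpret I: ideal I R by fact
  show ?case using I.zero_closed by blast
next
  case (insert x Z)
  interpret I: ideal I R by fact
  have x: "x \<in> carrier R" and Z: "Z \<subseteq> carrier R" using insert by auto
  note c = \<open>c \<in> carrier R\<close>
  obtain m v where m: "m \<in> I" and v: "v \<in> combinations R I Z" "c \<otimes> x = m \<otimes> x \<oplus> v"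
    using combinations_insert[OF assms(1) x Z insert(6)] by blast
  have mc: "m \<in> carrier R" using m by auto
  interpret D: ideal "combinations R I Z" R by (rule combinations_ideal[OF assms(1) Z])
  \<comment> \<open>\<open>z x\<close> involves only the other generators. Multiplying the relation
    for another \<open>y\<close> by \<open>z\<close> therefore removes \<open>x\<close> from it, and
    the induction applies to \<open>Z\<close> with \<open>z c\<close> in place of
    \<open>c\<close>.\<close>
  define z where "z = c \<ominus> m"
  have z: "z \<in> carrier R" using c mc by (simp add: z_def)
  have vc: "v \<in> carrier R" using v by auto
  have zx: "z \<otimes> x = v"
  proof -
    have "z \<otimes> x = c \<otimes> x \<ominus> m \<otimes> x" using c mc x unfolding z_def by algebra
    also have "\<dots> = v" unfolding v(2) using mc x vc by algebra
    finally show ?thesis .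
  qed
  have step: "z \<otimes> c \<otimes> y \<in> combinations R I Z" if y: "y \<in> Z" for y
  proof -
    have yc: "y \<in> carrier R" using y Z by auto
    obtain m' v' where m': "m' \<in> I" and v': "v' \<in> combinations R I Z" "c \<otimes> y = m' \<otimes> x \<oplus> v'"
      using combinations_insert[OF assms(1) x Z, of "c \<otimes> y"] insert(6)[of y] y by blast
    have cc: "m' \<in> carrier R" "v' \<in> carrier R" using m' v' by auto
    have "z \<otimes> c \<otimes> y = z \<otimes> (c \<otimes> y)" using z c yc by (simp add: m_assoc)
    also have "\<dots> = m' \<otimes> v \<oplus> z \<otimes> v'"
      unfolding v' zx[symmetric] using cc x z by algebra
    finally show ?thesis using v v' cc z D.I_l_closed by simp
  qed
  obtain n :: nat and j where j: "j \<in> I" "\<And>y. y \<in> Z \<Longrightarrow> ((z \<otimes> c) [^] n \<oplus> j) \<otimes> y = \<zero>"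
    using insert(3)[OF Z _ step] z c by auto
  define t where "t = (z \<otimes> c) [^] n \<oplus> j"
  have jc: "j \<in> carrier R" using j by auto
  have t: "t \<in> carrier R" using z c jc by (simp add: t_def)
  have tv: "t \<otimes> v = \<zero>"
    by (rule combinations_annihilator[OF assms(1) Z t _ v(1)]) (use j t_def in auto)
  \<comment> \<open>\<open>z\<close> and \<open>c\<close> agree modulo \<open>I\<close>, hence so do
    \<open>(z c)^k\<close> and \<open>c^(2 k)\<close>.\<close>
  have pow: "\<exists>j\<in>I. (z \<otimes> c) [^] k = c [^] (2 * k) \<oplus> j" for k :: nat
  proof (induct k)
    case 0
    then show ?case using I.zero_closed by (intro bexI[of _ \<zero>]) auto
  next
    case (Suc k)
    then obtain j where j: "j \<in> I" "(z \<otimes> c) [^] k = c [^] (2 * k) \<oplus> j" by blast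
    have jc: "j \<in> carrier R" "c [^] (2 * k) \<in> carrier R" using j c by auto
    have "(z \<otimes> c) [^] Suc k = (c [^] (2 * k) \<oplus> j) \<otimes> (z \<otimes> c)" using j by simp
    also have "\<dots> = c [^] (2 * k) \<otimes> c \<otimes> c \<oplus> ((z \<otimes> c) \<otimes> j \<oplus> \<ominus> (c [^] (2 * k) \<otimes> c) \<otimes> m)"
      unfolding z_def using c mc jc by algebra
    also have "c [^] (2 * k) \<otimes> c \<otimes> c = c [^] (2 * Suc k)" using c by simp
    finally have "(z \<otimes> c) [^] Suc k = c [^] (2 * Suc k) \<oplus> ((z \<otimes> c) \<otimes> j \<oplus> \<ominus> (c [^] (2 * k) \<otimes> c) \<otimes> m)" .
    moreover have "(z \<otimes> c) \<otimes> j \<oplus> \<ominus> (c [^] (2 * k) \<otimes> c) \<otimes> m \<in> I"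
      using j m z c by (intro I.a_closed I.I_l_closed) auto
    ultimately show ?case by blast
  qed
  obtain j' where j': "j' \<in> I" "(z \<otimes> c) [^] n = c [^] (2 * n) \<oplus> j'" using pow by blast
  have j'c: "j' \<in> carrier R" "c [^] (2 * n) \<in> carrier R" using j' c by auto
  \<comment> \<open>The factor \<open>z\<close> makes \<open>t z\<close> kill \<open>x\<close> as
    well, since \<open>t\<close> kills \<open>z x = v\<close>. Modulo \<open>I\<close> it is an odd
    power of \<open>c\<close>.\<close>
  have "t \<otimes> z = c [^] (2 * n) \<otimes> c \<oplus> (\<ominus> (c [^] (2 * n)) \<otimes> m \<oplus> z \<otimes> (j' \<oplus> j))"
  proof -
    have te: "t = c [^] (2 * n) \<oplus> j' \<oplus> j" unfolding t_def j'(2) ..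
    show ?thesis unfolding te z_def using c mc jc j'c by algebra
  qed
  also have "c [^] (2 * n) \<otimes> c = c [^] (2 * n + 1)" using c by simp
  finally have e: "t \<otimes> z = c [^] (2 * n + 1) \<oplus> (\<ominus> (c [^] (2 * n)) \<otimes> m \<oplus> z \<otimes> (j' \<oplus> j))" .
  show ?case
  proof (intro exI bexI ballI)
    show "\<ominus> (c [^] (2 * n)) \<otimes> m \<oplus> z \<otimes> (j' \<oplus> j) \<in> I"
      using j j' m z c by (intro I.a_closed I.I_l_closed) auto
    fix y assume y: "y \<in> insert x Z"
    then have yc: "y \<in> carrier R" using x Z by auto
    have "t \<otimes> z \<otimes> y = \<zero>"
    proof (cases "y = x")
      case True
      have "t \<otimes> z \<otimes> x = t \<otimes> (z \<otimes> x)" using t z x by (simp add: m_assoc)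
      then show ?thesis using True tv zx by simp
    next
      case False
      then have "t \<otimes> y = \<zero>" using y j t_def by auto
      moreover have "t \<otimes> z \<otimes> y = z \<otimes> (t \<otimes> y)" using t z yc by algebra
      ultimately show ?thesis using z by simp
    qed
    then show "(c [^] (2 * n + 1) \<oplus> (\<ominus> (c [^] (2 * n)) \<otimes> m \<oplus> z \<otimes> (j' \<oplus> j))) \<otimes> y = \<zero>"
      using e by simp
  qed
qed

lemma pow_add_cong:
  assumes "ideal I R" "a \<in> carrier R" "j \<in> I"
  shows "\<exists>j'\<in>I. (a \<oplus> j) [^] (k::nat) = a [^] k \<oplus> j'"
proof (induct k)
  case 0
  interpret I: ideal I R by fact
  show ?case using I.zero_closed by (intro bexI[of _ \<zero>]) auto
next
  case (Suc k)
  interpret I: ideal I R by fact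
  obtain j' where j': "j' \<in> I" "(a \<oplus> j) [^] k = a [^] k \<oplus> j'" using Suc by blast
  have c: "j \<in> carrier R" "j' \<in> carrier R" "a [^] k \<in> carrier R" using j' assms by auto
  have "(a \<oplus> j) [^] Suc k = a [^] k \<otimes> a \<oplus> (a [^] k \<otimes> j \<oplus> (a \<oplus> j) \<otimes> j')"
    using j' c assms(2) unfolding nat_pow_Suc j'(2) by algebra
  moreover have "a [^] k \<otimes> j \<oplus> (a \<oplus> j) \<otimes> j' \<in> I"
    using j' c assms by (intro I.a_closed I.I_l_closed) auto
  ultimately show ?case by auto
qed

end

text \<open>By the determinant trick some \<open>z = c^n + j\<close> with \<open>j\<close> in
  \<open>I\<close> kills \<open>I\<close>, in particular \<open>d\<close>. As \<open>d\<close>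
  avoids the minimal primes, \<open>z\<close> is nilpotent, and expanding \<open>z^k = 0\<close>
  modulo \<open>I\<close> puts a power of \<open>c\<close> into \<open>I\<close>.\<close>

lemma power_in_ideal_of_square_absorbing:
  fixes R (structure)
  assumes "noetherian_ring R" "cring R" "ideal I R" "c \<in> carrier R"
    and "\<And>x. x \<in> I \<Longrightarrow> c \<otimes> x \<in> ideal_prod R I I"
    and "d \<in> I" "d \<in> avoiding_minimal_primes R"
  shows "\<exists>N::nat. c [^] N \<in> I"
proof -
  interpret noetherian_ring R by fact
  interpret cring R by fact
  interpret I: ideal I R by fact
  obtain Z where Z: "Z \<subseteq> carrier R" "finite Z" "I = Idl Z"
    using finetely_gen[OF assms(3)] by blast
  have ZI: "Z \<subseteq> I" using genideal_self Z by blast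
  have "c \<otimes> x \<in> combinations R I Z" if "x \<in> Z" for x
  proof -
    have "ideal_prod R I I \<subseteq> combinations R I Z"
      using mult_genideal_combinations[OF assms(3) Z(1)] Z(3)
      by (intro ideal_prod_least combinations_ideal assms Z) auto
    then show ?thesis using assms(5) that ZI by blast
  qed
  then obtain n :: nat and j where j: "j \<in> I" "\<And>x. x \<in> Z \<Longrightarrow> (c [^] n \<oplus> j) \<otimes> x = \<zero>"
    using combinations_elimination[OF assms(3) Z(2,1) assms(4)] by blast
  define z where "z = c [^] n \<oplus> j"
  have z: "z \<in> carrier R" using j assms by (auto simp: z_def)
  define D where "D = {x \<in> carrier R. x \<otimes> z \<in> {\<zero>}}"
  have D: "ideal D R" unfolding D_def by (rule colon_ideal[OF zeroideal z])
  have "Z \<subseteq> D" using Z j m_comm[OF z] by (auto simp: D_def z_def subset_eq)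
  then have "I \<subseteq> D" unfolding Z(3) by (rule genideal_minimal[OF D])
  then have "z \<otimes> d = \<zero>" using assms(6) z m_comm[of z d] by (auto simp: D_def)
  then obtain k :: nat where "z [^] k = \<zero>"
    using avoiding_minimal_primes_annihilator[OF assms(1,2,7) z] by blast
  moreover obtain j' where j': "j' \<in> I" "z [^] k = (c [^] n) [^] k \<oplus> j'"
    using pow_add_cong[OF assms(3) _ j(1)] assms(4) unfolding z_def by blast
  ultimately have "(c [^] n) [^] k = \<ominus> j'"
    using assms(4) j' I.Icarr by (metis minus_equality minus_minus nat_pow_closed I.a_inv_closed add.inv_closed)
  then have "(c [^] n) [^] k \<in> I" using j' by simp
  then show ?thesis using assms(4) by (auto simp: nat_pow_pow)
qed

section \<open>Complete separated filtrations and Cohen's theorem\<close>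

lemma (in cring) genideal_finsum:
  assumes "finite Z" "Z \<subseteq> carrier R" "w \<in> Idl Z"
  shows "\<exists>a\<in>Z \<rightarrow> carrier R. w = (\<Oplus>x\<in>Z. a x \<otimes> x)"
  using assms
proof (induct Z arbitrary: w rule: finite_induct)
  case empty
  have "Idl {} \<subseteq> {\<zero>}" by (rule genideal_minimal[OF zeroideal]) simp
  then show ?case using empty by auto
next
  case (insert x Z)
  then obtain b y where b: "b \<in> carrier R" "y \<in> Idl Z" "w = b \<otimes> x \<oplus> y"
    using Idl_insert[of x Z] by auto
  then obtain a where a: "a \<in> Z \<rightarrow> carrier R" "y = (\<Oplus>x\<in>Z. a x \<otimes> x)"
    using insert by blast
  have "(\<Oplus>z\<in>insert x Z. (a(x := b)) z \<otimes> z) = b \<otimes> x \<oplus> (\<Oplus>z\<in>Z. (a(x := b)) z \<otimes> z)"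
    using insert a b by (subst finsum_insert) (auto intro!: m_closed)
  also have "(\<Oplus>z\<in>Z. (a(x := b)) z \<otimes> z) = (\<Oplus>z\<in>Z. a z \<otimes> z)"
    using insert a b by (intro finsum_cong') (auto intro!: m_closed)
  finally show ?case
    using insert a b by (intro bexI[of _ "a(x := b)"]) auto
qed

lemma (in cring) finsum_ideal:
  assumes "ideal I R" "\<And>x. x \<in> A \<Longrightarrow> f x \<in> I"
  shows "(\<Oplus>x\<in>A. f x) \<in> I"
  using assms(2)
proof (induct A rule: infinite_finite_induct)
  interpret I: ideal I R by fact
  case (insert x A)
  then have "f x \<oplus> (\<Oplus>x\<in>A. f x) \<in> I" by simp
  then show ?case using insert I.Icarr by (subst finsum_insert) auto
qed (use additive_subgroup.zero_closed[OF ideal.axioms(1)[OF assms(1)]] in auto)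

text \<open>The abstract shape of an adic completion. \<open>K n\<close> stands for the kernel of
  the \<open>n\<close>-th projection and need not be the \<open>n\<close>-th power of
  \<open>K 1\<close>. Completeness is asked for sequences whose \<open>n\<close>-th increment
  already lies in \<open>K n\<close>, as is the case for coherent sequences.\<close>

locale complete_filtration = S?: cring S for S (structure) +
  fixes K :: "nat \<Rightarrow> 'a set"
  assumes K_ideal: "\<And>n. ideal (K n) S"
    and K_Suc: "\<And>n. K (Suc n) \<subseteq> K n"
    and K_0: "K 0 = carrier S"
    and K_mult: "\<And>x y m n. x \<in> K m \<Longrightarrow> y \<in> K n \<Longrightarrow> x \<otimes> y \<in> K (m + n)"
    and K_Inter: "\<And>x. x \<in> carrier S \<Longrightarrow> (\<And>n. x \<in> K n) \<Longrightarrow> x = \<zero>"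
    and K_complete: "\<And>y. (\<And>n. y n \<in> carrier S) \<Longrightarrow> (\<And>n. y (Suc n) \<ominus> y n \<in> K n) \<Longrightarrow>
       \<exists>l\<in>carrier S. \<forall>n. l \<ominus> y n \<in> K n"
begin

lemma K_carrier: "x \<in> K n \<Longrightarrow> x \<in> carrier S"
  using ideal.Icarr[OF K_ideal] .

lemma K_antimono: "m \<le> n \<Longrightarrow> K n \<subseteq> K m"
  by (rule lift_Suc_antimono_le[of K]) (use K_Suc in auto)

lemma K_pow: "x \<in> K 1 \<Longrightarrow> x [^] (n::nat) \<in> K n"
proof (induct n)
  case (Suc n)
  then show ?case using K_mult[of "x [^] n" n x 1] by simp
qed (simp add: K_0)

lemma diff_add:
  "x \<in> carrier S \<Longrightarrow> y \<in> carrier S \<Longrightarrow> z \<in> carrier S \<Longrightarrow> x \<ominus> (y \<oplus> z) = x \<ominus> y \<ominus> z"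
  by algebra

text \<open>Successive approximation: the coefficients converge because those added in step \<open>n\<close> lie in \<open>K n\<close>.\<close>

lemma successive_approximation:
  assumes "finite Y" "Y \<subseteq> carrier S"
    and QK: "\<And>n. Q n \<subseteq> K n"
    and step: "\<And>n z. z \<in> Q n \<Longrightarrow> \<exists>a\<in>Y \<rightarrow> K n. z \<ominus> (\<Oplus>y\<in>Y. a y \<otimes> y) \<in> Q (Suc n)"
    and z: "z \<in> Q 0"
  shows "\<exists>b\<in>Y \<rightarrow> carrier S. z = (\<Oplus>y\<in>Y. b y \<otimes> y)"
proof -
  have zc: "z \<in> carrier S" using z QK K_carrier by blast
  have Yc: "y \<in> carrier S" if "y \<in> Y" for y using assms that by auto
  \<comment> \<open>\<open>f n\<close> holds the coefficients collected in \<open>n\<close> steps,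
    \<open>Q n\<close> confines the remainder, and the correction made in step \<open>n\<close> has
    coefficients in \<open>K n\<close>.\<close>
  have "\<exists>f. \<forall>n. (f n \<in> Y \<rightarrow> carrier S \<and> z \<ominus> (\<Oplus>y\<in>Y. f n y \<otimes> y) \<in> Q n) \<and>
      (\<forall>y\<in>Y. f (Suc n) y \<ominus> f n y \<in> K n)"
  proof (rule dependent_nat_choice)
    have "(\<Oplus>y\<in>Y. \<zero> \<otimes> y) = (\<Oplus>y\<in>Y. \<zero>)"
      using Yc by (intro finsum_cong') auto
    then show "\<exists>x. x \<in> Y \<rightarrow> carrier S \<and> z \<ominus> (\<Oplus>y\<in>Y. x y \<otimes> y) \<in> Q 0"
      using z zc by (intro exI[of _ "\<lambda>_. \<zero>"]) (auto simp: minus_eq)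
  next
    fix A n assume "A \<in> Y \<rightarrow> carrier S \<and> z \<ominus> (\<Oplus>y\<in>Y. A y \<otimes> y) \<in> Q n"
    then have A: "A \<in> Y \<rightarrow> carrier S" "z \<ominus> (\<Oplus>y\<in>Y. A y \<otimes> y) \<in> Q n" by auto
    obtain a where a: "a \<in> Y \<rightarrow> K n"
      "z \<ominus> (\<Oplus>y\<in>Y. A y \<otimes> y) \<ominus> (\<Oplus>y\<in>Y. a y \<otimes> y) \<in> Q (Suc n)"
      using step[OF A(2)] by blast
    have ac: "a \<in> Y \<rightarrow> carrier S" using a K_carrier by blast
    have "(\<Oplus>y\<in>Y. (A y \<oplus> a y) \<otimes> y) = (\<Oplus>y\<in>Y. A y \<otimes> y \<oplus> a y \<otimes> y)"
      using A ac Yc by (intro finsum_cong') (auto intro!: l_distr m_closed a_closed)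
    also have "\<dots> = (\<Oplus>y\<in>Y. A y \<otimes> y) \<oplus> (\<Oplus>y\<in>Y. a y \<otimes> y)"
      using A ac Yc by (intro finsum_addf) (auto intro!: m_closed)
    finally have e: "(\<Oplus>y\<in>Y. (A y \<oplus> a y) \<otimes> y) = (\<Oplus>y\<in>Y. A y \<otimes> y) \<oplus> (\<Oplus>y\<in>Y. a y \<otimes> y)" .
    have c: "(\<Oplus>y\<in>Y. A y \<otimes> y) \<in> carrier S" "(\<Oplus>y\<in>Y. a y \<otimes> y) \<in> carrier S"
      using A ac Yc by (auto intro!: finsum_closed m_closed)
    have "z \<ominus> (\<Oplus>y\<in>Y. (A y \<oplus> a y) \<otimes> y) = z \<ominus> (\<Oplus>y\<in>Y. A y \<otimes> y) \<ominus> (\<Oplus>y\<in>Y. a y \<otimes> y)"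
      unfolding e using c zc by (simp add: diff_add)
    moreover have "(A y \<oplus> a y) \<ominus> A y \<in> K n" if "y \<in> Y" for y
    proof -
      have "A y \<in> carrier S" "a y \<in> carrier S" using A ac that by auto
      then have "(A y \<oplus> a y) \<ominus> A y = a y" by algebra
      then show ?thesis using a that by auto
    qed
    ultimately show "\<exists>B. (B \<in> Y \<rightarrow> carrier S \<and> z \<ominus> (\<Oplus>y\<in>Y. B y \<otimes> y) \<in> Q (Suc n)) \<and>
        (\<forall>y\<in>Y. B y \<ominus> A y \<in> K n)"
      using a A ac by (intro exI[of _ "\<lambda>y. A y \<oplus> a y"]) auto
  qed
  then obtain f where f: "\<And>n. f n \<in> Y \<rightarrow> carrier S" "\<And>n. z \<ominus> (\<Oplus>y\<in>Y. f n y \<otimes> y) \<in> Q n"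
    "\<And>n y. y \<in> Y \<Longrightarrow> f (Suc n) y \<ominus> f n y \<in> K n" by blast
  have "\<forall>y\<in>Y. \<exists>l\<in>carrier S. \<forall>n. l \<ominus> f n y \<in> K n"
    using f by (intro ballI K_complete) auto
  then obtain l where l: "\<And>y. y \<in> Y \<Longrightarrow> l y \<in> carrier S" "\<And>y n. y \<in> Y \<Longrightarrow> l y \<ominus> f n y \<in> K n"
    by metis
  have lc: "(\<Oplus>y\<in>Y. l y \<otimes> y) \<in> carrier S"
    using l Yc by (intro finsum_closed) auto
  have "z \<ominus> (\<Oplus>y\<in>Y. l y \<otimes> y) \<in> K n" for n
  proof -
    interpret Kn: ideal "K n" S by (rule K_ideal)
    have fy: "f n y \<in> carrier S" if "y \<in> Y" for y using f(1)[of n] that by auto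
    have fc: "(\<Oplus>y\<in>Y. f n y \<otimes> y) \<in> carrier S" "(\<Oplus>y\<in>Y. (l y \<ominus> f n y) \<otimes> y) \<in> carrier S"
      using fy l Yc by (auto intro!: finsum_closed)
    \<comment> \<open>The limit coefficients are split into those of stage \<open>n\<close> and an
      error in \<open>K n\<close>.\<close>
    have "(\<Oplus>y\<in>Y. l y \<otimes> y) = (\<Oplus>y\<in>Y. f n y \<otimes> y \<oplus> (l y \<ominus> f n y) \<otimes> y)"
    proof (rule finsum_cong')
      fix y assume y: "y \<in> Y"
      note c = fy[OF y] l(1)[OF y] Yc[OF y]
      show "l y \<otimes> y = f n y \<otimes> y \<oplus> (l y \<ominus> f n y) \<otimes> y" using c by algebra
    qed (use fy l Yc in auto)
    also have "\<dots> = (\<Oplus>y\<in>Y. f n y \<otimes> y) \<oplus> (\<Oplus>y\<in>Y. (l y \<ominus> f n y) \<otimes> y)"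
      using fy l Yc by (intro finsum_addf) auto
    finally have "z \<ominus> (\<Oplus>y\<in>Y. l y \<otimes> y) = (z \<ominus> (\<Oplus>y\<in>Y. f n y \<otimes> y)) \<ominus> (\<Oplus>y\<in>Y. (l y \<ominus> f n y) \<otimes> y)"
      using fc zc by (simp add: diff_add)
    moreover have "(\<Oplus>y\<in>Y. (l y \<ominus> f n y) \<otimes> y) \<in> K n"
      using l Yc by (intro finsum_ideal K_ideal Kn.I_r_closed) auto
    moreover have "z \<ominus> (\<Oplus>y\<in>Y. f n y \<otimes> y) \<in> K n" using f(2)[of n] QK by blast
    ultimately show ?thesis using Kn.minus_in by simp
  qed
  then have "z \<ominus> (\<Oplus>y\<in>Y. l y \<otimes> y) = \<zero>"
    using zc lc by (intro K_Inter) auto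
  then have "z = (\<Oplus>y\<in>Y. l y \<otimes> y)" using zc lc by simp
  then show ?thesis using l by (intro bexI[of _ l]) auto
qed

text \<open>An ideal \<open>Q\<close> maximal among those which are not finitely generated is prime (Cohen), and every
  larger ideal is finitely generated. For a generator \<open>x \<notin> Q\<close> of \<open>K 1\<close>, generators of \<open>Q + (x)\<close> yield
  finitely many \<open>y \<in> Q\<close> with \<open>Q = (y) + x Q\<close>, hence \<open>Q = (y)\<close> by completeness.\<close>

theorem noetherian:
  assumes G: "finite G" "G \<subseteq> carrier S" "K 1 = Idl G"
    and max: "\<And>I. ideal I S \<Longrightarrow> K 1 \<subseteq> I \<Longrightarrow> I = K 1 \<or> I = carrier S"
  shows "noetherian_ring S"
proof -
  define fg where "fg I \<longleftrightarrow> (\<exists>A\<subseteq>carrier S. finite A \<and> I = Idl A)" for I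
  have "fg I" if I: "ideal I S" for I
  proof (rule ccontr)
    assume nI: "\<not> fg I"
    define N where "N = {J. ideal J S \<and> \<not> fg J}"
    have "\<exists>M\<in>N. \<forall>Y\<in>N. M \<subseteq> Y \<longrightarrow> Y = M"
    proof (rule subset_Zorn)
      fix C assume C: "subset.chain N C"
      show "\<exists>U\<in>N. \<forall>Y\<in>C. Y \<subseteq> U"
      proof (cases "C = {}")
        case True
        then show ?thesis using I nI by (auto simp: N_def)
      next
        case False
        have "subset.chain {I. ideal I S} C"
          using C by (auto simp: pred_on.chain_def N_def)
        from chain_Union_is_ideal[OF this] False have iC: "ideal (\<Union>C) S" by simp
        have "\<not> fg (\<Union>C)"
        proof
          assume "fg (\<Union>C)"
          then obtain A where A: "A \<subseteq> carrier S" "finite A" "\<Union>C = Idl A" by (auto simp: fg_def)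
          have "A \<subseteq> \<Union>C" using A genideal_self by blast
          then obtain J where J: "J \<in> C" "A \<subseteq> J"
            using finite_subset_Union_chain[OF A(2) _ False] C
            by (metis pred_on.chain_def subset_chain_def)
          then have "ideal J S" "\<not> fg J" using C by (auto simp: pred_on.chain_def N_def)
          moreover have "J = Idl A"
            using genideal_minimal[of J A] J A(3) calculation by blast
          ultimately show False using A by (auto simp: fg_def)
        qed
        then show ?thesis using iC by (auto simp: N_def)
      qed
    qed
    then obtain Q where "Q \<in> N" and Qmax: "\<And>Y. Y \<in> N \<Longrightarrow> Q \<subseteq> Y \<Longrightarrow> Y = Q" by blast
    then have Q: "ideal Q S" "\<not> fg Q" by (auto simp: N_def)
    interpret Q: ideal Q S by fact
    have larger: "fg J" if "ideal J S" "Q \<subset> J" for J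
      using Qmax[of J] that by (auto simp: N_def)
    \<comment> \<open>Finitely many generators of \<open>Q + (a)\<close> can be replaced by elements
      of \<open>Q\<close> together with \<open>a\<close> itself.\<close>
    have span: "\<exists>H\<subseteq>Q. finite H \<and> (\<forall>q\<in>Q. \<exists>h\<in>Idl H. \<exists>r\<in>carrier S. q = h \<oplus> r \<otimes> a)"
      if a: "a \<in> carrier S" "a \<notin> Q" for a
    proof -
      note S = ideal_sum_principal[OF Q(1) a(1)]
      have "fg (Q <+>\<^bsub>S\<^esub> PIdl a)" using S a by (intro larger) auto
      then obtain A where A: "A \<subseteq> carrier S" "finite A" "Q <+>\<^bsub>S\<^esub> PIdl a = Idl A"
        by (auto simp: fg_def)
      have "\<forall>x\<in>A. \<exists>q\<in>Q. \<exists>r\<in>carrier S. x = q \<oplus> r \<otimes> a"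
        using S(4) genideal_self[OF A(1)] A(3) by blast
      then obtain q r where q: "\<And>x. x \<in> A \<Longrightarrow> q x \<in> Q \<and> r x \<in> carrier S \<and> x = q x \<oplus> r x \<otimes> a"
        by metis
      have qA: "q ` A \<subseteq> carrier S" using q by auto
      have iq: "ideal (Idl (q ` A)) S" by (rule genideal_ideal[OF qA])
      note T = ideal_sum_principal[OF iq a(1)]
      have "A \<subseteq> Idl (q ` A) <+>\<^bsub>S\<^esub> PIdl a"
      proof
        fix x assume "x \<in> A"
        then show "x \<in> Idl (q ` A) <+>\<^bsub>S\<^esub> PIdl a"
          using T(4)[of x] q[of x] genideal_self[OF qA] by blast
      qed
      then have "Idl A \<subseteq> Idl (q ` A) <+>\<^bsub>S\<^esub> PIdl a" by (rule genideal_minimal[OF T(1)])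
      then have "Q \<subseteq> Idl (q ` A) <+>\<^bsub>S\<^esub> PIdl a" using S(2) A(3) by simp
      then have "\<forall>y\<in>Q. \<exists>h\<in>Idl (q ` A). \<exists>r\<in>carrier S. y = h \<oplus> r \<otimes> a"
        using T(4) by (meson subsetD)
      then show ?thesis using q A(2) by (intro exI[of _ "q ` A"]) auto
    qed
    \<comment> \<open>If \<open>b\<close> were outside \<open>Q\<close>, then \<open>(Q : a)\<close>
      would contain \<open>b\<close>, be strictly larger than \<open>Q\<close> and so be finitely
      generated. Then \<open>Q\<close> would be generated by \<open>H\<close> and the products of
      \<open>a\<close> with generators of \<open>(Q : a)\<close>.\<close>
    have prime: "b \<in> Q" if a: "a \<in> carrier S" "a \<notin> Q" and b: "b \<in> carrier S" "a \<otimes> b \<in> Q" for a b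
    proof (rule ccontr)
      assume nb: "b \<notin> Q"
      obtain H where H: "H \<subseteq> Q" "finite H" "\<And>q. q \<in> Q \<Longrightarrow> \<exists>h\<in>Idl H. \<exists>r\<in>carrier S. q = h \<oplus> r \<otimes> a"
        using span[OF a] by metis
      define C where "C = {z \<in> carrier S. z \<otimes> a \<in> Q}"
      have C: "ideal C S" unfolding C_def by (rule colon_ideal[OF Q(1) a(1)])
      have "Q \<subseteq> C" using Q.I_r_closed a Q.Icarr by (auto simp: C_def)
      moreover have "b \<in> C" using b m_comm[OF a(1) b(1)] by (simp add: C_def)
      ultimately have "fg C" using nb by (intro larger[OF C]) auto
      then obtain D where D: "D \<subseteq> carrier S" "finite D" "C = Idl D" by (auto simp: fg_def)
      define B where "B = H \<union> (\<lambda>d. d \<otimes> a) ` D"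
      have Bc: "B \<subseteq> carrier S" using H D a Q.Icarr by (auto simp: B_def)
      have DC: "D \<subseteq> C" using genideal_self[OF D(1)] D(3) by simp
      have BQ: "B \<subseteq> Q" using H DC by (auto simp: B_def C_def)
      have iB: "ideal (Idl B) S" by (rule genideal_ideal[OF Bc])
      interpret B: ideal "Idl B" S by (rule iB)
      have BB: "B \<subseteq> Idl B" by (rule genideal_self[OF Bc])
      have CB: "r \<otimes> a \<in> Idl B" if "r \<in> C" for r
      proof -
        have i: "ideal {z \<in> carrier S. z \<otimes> a \<in> Idl B} S" by (rule colon_ideal[OF iB a(1)])
        have "D \<subseteq> {z \<in> carrier S. z \<otimes> a \<in> Idl B}" using BB D by (auto simp: B_def)
        from genideal_minimal[OF i this] show ?thesis using that D(3) by auto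
      qed
      have "Q \<subseteq> Idl B"
      proof
        fix q assume q: "q \<in> Q"
        obtain h r where h: "h \<in> Idl H" "r \<in> carrier S" "q = h \<oplus> r \<otimes> a" using H(3)[OF q] by blast
        have hQ: "h \<in> Q" using genideal_minimal[OF Q(1) H(1)] h by blast
        have "r \<otimes> a = q \<ominus> h"
        proof -
          have "h \<in> carrier S" "r \<otimes> a \<in> carrier S" using hQ h a Q.Icarr by auto
          then show ?thesis unfolding h(3) by algebra
        qed
        then have "r \<otimes> a \<in> Q" using Q.minus_in q hQ by simp
        then have "r \<otimes> a \<in> Idl B" using CB h by (simp add: C_def)
        moreover have "Idl H \<subseteq> Idl B"
          using BB by (intro genideal_minimal[OF iB]) (auto simp: B_def)
        ultimately show "q \<in> Idl B" using h by auto
      qed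
      moreover have "Idl B \<subseteq> Q" by (rule genideal_minimal[OF Q(1) BQ])
      ultimately have "Q = Idl B" by blast
      moreover have "finite B" using H D by (simp add: B_def)
      ultimately have "fg Q" using Bc unfolding fg_def by blast
      then show False using Q by simp
    qed
    \<comment> \<open>\<open>K 1\<close> and the unit ideal are finitely generated and nothing lies
      strictly between them, so \<open>Q\<close> cannot contain \<open>K 1\<close> and misses one of
      its generators.\<close>
    have "fg (K 1)" using G by (auto simp: fg_def)
    moreover have "fg (carrier S)"
      unfolding fg_def by (intro exI[of _ "{\<one>}"]) (simp add: genideal_one)
    ultimately have "\<not> K 1 \<subseteq> Q" using max[OF Q(1)] Q(2) by auto
    then have "\<not> G \<subseteq> Q" using genideal_minimal[OF Q(1), of G] G(3) by auto
    then obtain x where x: "x \<in> G" "x \<notin> Q" by blast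
    have x1: "x \<in> K 1" using genideal_self[OF G(2)] G(3) x by auto
    have xc: "x \<in> carrier S" using x G by auto
    obtain H where H: "H \<subseteq> Q" "finite H" "\<And>q. q \<in> Q \<Longrightarrow> \<exists>h\<in>Idl H. \<exists>r\<in>carrier S. q = h \<oplus> r \<otimes> x"
      using span[OF xc x(2)] by metis
    have Hc: "H \<subseteq> carrier S" using H Q.Icarr by auto
    have "Q \<subseteq> Idl H"
    proof
      fix z assume z: "z \<in> Q"
      have "\<exists>b\<in>H \<rightarrow> carrier S. z = (\<Oplus>y\<in>H. b y \<otimes> y)"
      proof (rule successive_approximation[OF H(2) Hc])
        \<comment> \<open>The remainder after \<open>n\<close> steps is kept in
          \<open>x^n Q\<close>. The process continues because \<open>r x\<close> in \<open>Q\<close>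
          forces \<open>r\<close> in \<open>Q\<close>, as \<open>Q\<close> is prime and
          \<open>x\<close> is outside.\<close>
        define R where "R n = {x [^] n \<otimes> q |q. q \<in> Q}" for n :: nat
        have "z = x [^] (0::nat) \<otimes> z" using Q.Icarr[OF z] by simp
        then show "z \<in> R 0" unfolding R_def using z by blast
        fix n :: nat
        interpret Kn: ideal "K n" S by (rule K_ideal)
        have xn: "x [^] n \<in> K n" "x [^] n \<in> carrier S" using K_pow[OF x1] xc by auto
        show "R n \<subseteq> K n" using xn Kn.I_r_closed Q.Icarr by (auto simp: R_def)
        fix w assume "w \<in> R n"
        then obtain q where q: "q \<in> Q" "w = x [^] n \<otimes> q" by (auto simp: R_def)
        obtain h r where h: "h \<in> Idl H" "r \<in> carrier S" "q = h \<oplus> r \<otimes> x" using H(3)[OF q(1)] by blast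
        have hQ: "h \<in> Q" using genideal_minimal[OF Q(1) H(1)] h by blast
        then have hc: "h \<in> carrier S" by (rule Q.Icarr)
        have "r \<otimes> x = q \<ominus> h"
        proof -
          have "r \<otimes> x \<in> carrier S" using h xc by auto
          then show ?thesis unfolding h(3) using hc by algebra
        qed
        then have "x \<otimes> r \<in> Q" using Q.minus_in q hQ m_comm[OF xc h(2)] by simp
        then have rQ: "r \<in> Q" using prime[OF xc x(2) h(2)] by simp
        obtain a where a: "a \<in> H \<rightarrow> carrier S" "h = (\<Oplus>y\<in>H. a y \<otimes> y)"
          using genideal_finsum[OF H(2) Hc h(1)] by blast
        have "(\<Oplus>y\<in>H. (x [^] n \<otimes> a y) \<otimes> y) = (\<Oplus>y\<in>H. x [^] n \<otimes> (a y \<otimes> y))"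
          using a Hc xn by (intro finsum_cong') (auto intro!: m_assoc m_closed)
        also have "\<dots> = x [^] n \<otimes> h"
          unfolding a(2) using a Hc xn H(2) by (intro finsum_rdistr[symmetric]) (auto intro!: m_closed)
        finally have e: "(\<Oplus>y\<in>H. (x [^] n \<otimes> a y) \<otimes> y) = x [^] n \<otimes> h" .
        have "w \<ominus> x [^] n \<otimes> h = x [^] n \<otimes> x \<otimes> r"
          unfolding q h(3) using xn xc hc h(2) by algebra
        then have "w \<ominus> (\<Oplus>y\<in>H. (x [^] n \<otimes> a y) \<otimes> y) \<in> R (Suc n)"
          unfolding e using rQ by (auto simp: R_def)
        moreover have "(\<lambda>y. x [^] n \<otimes> a y) \<in> H \<rightarrow> K n" using a xn Kn.I_r_closed by auto
        ultimately show "\<exists>a\<in>H \<rightarrow> K n. w \<ominus> (\<Oplus>y\<in>H. a y \<otimes> y) \<in> R (Suc n)"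
          by (intro bexI[of _ "\<lambda>y. x [^] n \<otimes> a y"])
      qed
      then obtain b where b: "b \<in> H \<rightarrow> carrier S" "z = (\<Oplus>y\<in>H. b y \<otimes> y)" by blast
      interpret H: ideal "Idl H" S by (rule genideal_ideal[OF Hc])
      show "z \<in> Idl H"
        unfolding b(2) using b genideal_self[OF Hc]
        by (intro finsum_ideal H.is_ideal H.I_l_closed) auto
    qed
    moreover have "Idl H \<subseteq> Q" by (rule genideal_minimal[OF Q(1) H(1)])
    ultimately have "fg Q" using H Hc by (auto simp: fg_def)
    then show False using Q by simp
  qed
  then show ?thesis
    by (intro noetherian_ringI) (auto simp: fg_def)
qed

end

section \<open>Linear maps and injective modules\<close>

lemma (in abelian_group) diff_eq_zero_iff [simp]:
  assumes "x \<in> carrier G" "y \<in> carrier G"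
  shows "x \<ominus> y = \<zero> \<longleftrightarrow> x = y"
  using assms by (metis add.inv_closed minus_eq minus_equality minus_minus r_neg)

lemma (in abelian_group) diff_self [simp]: "x \<in> carrier G \<Longrightarrow> x \<ominus> x = \<zero>"
  by simp

text \<open>Linearity without the extensionality built into \<open>linear_maps\<close>, so that
  compositions and pointwise sums need no restriction to the carrier.\<close>

definition lin :: "('a, 'r) ring_scheme \<Rightarrow> ('a, 'b, 'm) module_scheme \<Rightarrow> ('a, 'c, 'n) module_scheme
    \<Rightarrow> ('b \<Rightarrow> 'c) \<Rightarrow> bool" where
  "lin R M N f \<longleftrightarrow> f \<in> carrier M \<rightarrow> carrier N \<and>
     (\<forall>x\<in>carrier M. \<forall>y\<in>carrier M. f (x \<oplus>\<^bsub>M\<^esub> y) = f x \<oplus>\<^bsub>N\<^esub> f y) \<and>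
     (\<forall>a\<in>carrier R. \<forall>x\<in>carrier M. f (a \<odot>\<^bsub>M\<^esub> x) = a \<odot>\<^bsub>N\<^esub> f x)"

lemma linI:
  assumes "\<And>x. x \<in> carrier M \<Longrightarrow> f x \<in> carrier N"
    and "\<And>x y. x \<in> carrier M \<Longrightarrow> y \<in> carrier M \<Longrightarrow> f (x \<oplus>\<^bsub>M\<^esub> y) = f x \<oplus>\<^bsub>N\<^esub> f y"
    and "\<And>a x. a \<in> carrier R \<Longrightarrow> x \<in> carrier M \<Longrightarrow> f (a \<odot>\<^bsub>M\<^esub> x) = a \<odot>\<^bsub>N\<^esub> f x"
  shows "lin R M N f"
  using assms by (auto simp: lin_def)

lemma
  assumes "lin R M N f"
  shows lin_closed: "x \<in> carrier M \<Longrightarrow> f x \<in> carrier N"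
    and lin_add: "x \<in> carrier M \<Longrightarrow> y \<in> carrier M \<Longrightarrow> f (x \<oplus>\<^bsub>M\<^esub> y) = f x \<oplus>\<^bsub>N\<^esub> f y"
    and lin_smult: "a \<in> carrier R \<Longrightarrow> x \<in> carrier M \<Longrightarrow> f (a \<odot>\<^bsub>M\<^esub> x) = a \<odot>\<^bsub>N\<^esub> f x"
  using assms by (auto simp: lin_def)

lemma linear_maps_iff: "f \<in> linear_maps R M N \<longleftrightarrow> lin R M N f \<and> f \<in> extensional (carrier M)"
  by (auto simp: linear_maps_def lin_def PiE_def)

lemma lin_cong:
  assumes "module R M" "\<And>x. x \<in> carrier M \<Longrightarrow> f x = g x"
  shows "lin R M N f \<longleftrightarrow> lin R M N g"
proof -
  interpret module R M by fact
  show ?thesis using assms(2) by (auto simp: lin_def Pi_iff)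
qed

lemma restrict_linear_maps:
  assumes "module R M" "lin R M N f"
  shows "restrict f (carrier M) \<in> linear_maps R M N"
proof -
  have "lin R M N (restrict f (carrier M)) \<longleftrightarrow> lin R M N f"
    by (rule lin_cong[OF assms(1)]) simp
  then show ?thesis using assms by (simp add: linear_maps_iff)
qed

lemma lin_comp:
  assumes "lin R L M f" "lin R M N g"
  shows "lin R L N (\<lambda>x. g (f x))"
  using assms by (auto simp: lin_def Pi_iff)

lemma lin_submodule:
  "lin R M N f \<Longrightarrow> D \<subseteq> carrier M \<Longrightarrow> lin R (M\<lparr>carrier := D\<rparr>) N f"
  by (auto simp: lin_def subset_eq)

locale two_modules = M: module R M + N: module R N for R (structure) and M and N
begin

lemma lin_zero: "lin R M N f \<Longrightarrow> f \<zero>\<^bsub>M\<^esub> = \<zero>\<^bsub>N\<^esub>"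
  using lin_smult[of R M N f \<zero> "\<zero>\<^bsub>M\<^esub>"] lin_closed[of R M N f "\<zero>\<^bsub>M\<^esub>"] by simp

lemma lin_minus: "lin R M N f \<Longrightarrow> x \<in> carrier M \<Longrightarrow> f (\<ominus>\<^bsub>M\<^esub> x) = \<ominus>\<^bsub>N\<^esub> f x"
  using lin_smult[of R M N f "\<ominus> \<one>" x] lin_closed[of R M N f x]
  by (simp add: M.smult_l_minus N.smult_l_minus)

lemma lin_diff:
  "lin R M N f \<Longrightarrow> x \<in> carrier M \<Longrightarrow> y \<in> carrier M \<Longrightarrow> f (x \<ominus>\<^bsub>M\<^esub> y) = f x \<ominus>\<^bsub>N\<^esub> f y"
  using lin_add[of R M N f x "\<ominus>\<^bsub>M\<^esub> y"] lin_minus[of f y]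
  by (simp add: M.M.minus_eq N.M.minus_eq)

lemma lin_finsum:
  assumes "lin R M N f" "finite A" "h \<in> A \<rightarrow> carrier M"
  shows "f (\<Oplus>\<^bsub>M\<^esub>i\<in>A. h i) = (\<Oplus>\<^bsub>N\<^esub>i\<in>A. f (h i))"
  using assms(2,3)
proof (induct A rule: finite_induct)
  case empty
  then show ?case using lin_zero[OF assms(1)] by simp
next
  case (insert i A)
  then have "f (\<Oplus>\<^bsub>M\<^esub>i\<in>insert i A. h i) = f (h i \<oplus>\<^bsub>M\<^esub> (\<Oplus>\<^bsub>M\<^esub>i\<in>A. h i))"
    by (subst M.M.finsum_insert) auto
  also have "\<dots> = f (h i) \<oplus>\<^bsub>N\<^esub> (\<Oplus>\<^bsub>N\<^esub>i\<in>A. f (h i))"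
    using insert by (subst lin_add[OF assms(1)]) (auto intro!: M.M.finsum_closed)
  also have "\<dots> = (\<Oplus>\<^bsub>N\<^esub>i\<in>insert i A. f (h i))"
    using insert lin_closed[OF assms(1)] by (subst N.M.finsum_insert) auto
  finally show ?case .
qed

lemma lin_zero_map: "lin R M N (\<lambda>_. \<zero>\<^bsub>N\<^esub>)"
  by (auto simp: lin_def)

lemma lin_plus:
  assumes "lin R M N f" "lin R M N g"
  shows "lin R M N (\<lambda>x. f x \<oplus>\<^bsub>N\<^esub> g x)"
proof (rule linI)
  note c = lin_closed[OF assms(1)] lin_closed[OF assms(2)]
  show "f (x \<oplus>\<^bsub>M\<^esub> y) \<oplus>\<^bsub>N\<^esub> g (x \<oplus>\<^bsub>M\<^esub> y) = f x \<oplus>\<^bsub>N\<^esub> g x \<oplus>\<^bsub>N\<^esub> (f y \<oplus>\<^bsub>N\<^esub> g y)"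
    if "x \<in> carrier M" "y \<in> carrier M" for x y
    using that c by (simp add: lin_add[OF assms(1)] lin_add[OF assms(2)] N.M.a_ac)
qed (use lin_closed[OF assms(1)] lin_closed[OF assms(2)]
  in \<open>auto simp: lin_smult[OF assms(1)] lin_smult[OF assms(2)] N.smult_r_distr\<close>)

lemma lin_scale:
  assumes "a \<in> carrier R" "lin R M N f"
  shows "lin R M N (\<lambda>x. a \<odot>\<^bsub>N\<^esub> f x)"
proof (rule linI)
  note c = lin_closed[OF assms(2)]
  show "a \<odot>\<^bsub>N\<^esub> f (b \<odot>\<^bsub>M\<^esub> x) = b \<odot>\<^bsub>N\<^esub> (a \<odot>\<^bsub>N\<^esub> f x)"
    if "b \<in> carrier R" "x \<in> carrier M" for b x
    using that assms(1) c by (simp add: lin_smult[OF assms(2)] M.R.m_comm flip: N.smult_assoc1)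
qed (use assms(1) lin_closed[OF assms(2)] in \<open>auto simp: lin_add[OF assms(2)] N.smult_r_distr\<close>)

lemma lin_minus_maps:
  assumes "lin R M N f" "lin R M N g"
  shows "lin R M N (\<lambda>x. f x \<ominus>\<^bsub>N\<^esub> g x)"
proof -
  have "lin R M N (\<lambda>x. f x \<oplus>\<^bsub>N\<^esub> \<ominus> \<one> \<odot>\<^bsub>N\<^esub> g x)"
    using assms by (intro lin_plus lin_scale) auto
  then show ?thesis
    by (subst lin_cong[of _ _ _ "\<lambda>x. f x \<oplus>\<^bsub>N\<^esub> \<ominus> \<one> \<odot>\<^bsub>N\<^esub> g x"])
      (use M.module_axioms lin_closed[OF assms(2)] in \<open>auto simp: N.smult_l_minus N.M.minus_eq\<close>)
qed

lemma lin_sum_maps: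
  assumes "finite J" "\<And>j. j \<in> J \<Longrightarrow> lin R M N (f j)"
  shows "lin R M N (\<lambda>x. \<Oplus>\<^bsub>N\<^esub>j\<in>J. f j x)"
  using assms
proof (induct J rule: finite_induct)
  case empty
  then show ?case using lin_zero_map by simp
next
  case (insert j J)
  have "lin R M N (\<lambda>x. f j x \<oplus>\<^bsub>N\<^esub> (\<Oplus>\<^bsub>N\<^esub>j\<in>J. f j x))"
    using insert by (intro lin_plus) auto
  moreover have "(\<Oplus>\<^bsub>N\<^esub>j\<in>insert j J. f j x) = f j x \<oplus>\<^bsub>N\<^esub> (\<Oplus>\<^bsub>N\<^esub>j\<in>J. f j x)" if "x \<in> carrier M" for x
    using insert that by (intro N.M.finsum_insert) (auto intro: lin_closed)
  ultimately show ?case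
    by (subst lin_cong[OF M.module_axioms]) auto
qed

text \<open>\<open>k\<close> is defined through arbitrary preimages. \<open>h\<close> is constant on
  the fibres of \<open>f\<close> because differences of preimages lie in the kernel.\<close>

lemma lin_factor:
  assumes V: "module R V" and f: "lin R M N f" and onto: "f ` carrier M = carrier N"
    and h: "lin R M V h" and ker: "\<And>x. x \<in> carrier M \<Longrightarrow> f x = \<zero>\<^bsub>N\<^esub> \<Longrightarrow> h x = \<zero>\<^bsub>V\<^esub>"
  shows "\<exists>k. lin R N V k \<and> (\<forall>x\<in>carrier M. k (f x) = h x)"
proof -
  interpret V: two_modules R M V by (intro two_modules.intro M.module_axioms V)
  define k where "k y = h (SOME x. x \<in> carrier M \<and> f x = y)" for y
  have k: "k (f x) = h x" if x: "x \<in> carrier M" for x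
  proof -
    define z where "z = (SOME z. z \<in> carrier M \<and> f z = f x)"
    have z: "z \<in> carrier M" "f z = f x"
      using someI[of "\<lambda>z. z \<in> carrier M \<and> f z = f x" x] x by (auto simp: z_def)
    have "h (z \<ominus>\<^bsub>M\<^esub> x) = \<zero>\<^bsub>V\<^esub>"
      using lin_diff[OF f z(1) x] z x lin_closed[OF f x] by (intro ker) simp_all
    then have "h z = h x" using V.lin_diff[OF h z(1) x] lin_closed[OF h] z x by simp
    then show ?thesis by (simp add: k_def z_def)
  qed
  have "lin R N V k"
  proof (rule linI)
    fix y assume "y \<in> carrier N"
    then obtain x where x: "x \<in> carrier M" "y = f x" using onto by blast
    show "k y \<in> carrier V" using x k lin_closed[OF h] by simp
    show "k (a \<odot>\<^bsub>N\<^esub> y) = a \<odot>\<^bsub>V\<^esub> k y" if "a \<in> carrier R" for a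
      using k[of "a \<odot>\<^bsub>M\<^esub> x"] k[of x] lin_smult[OF f that x(1)] lin_smult[OF h that x(1)] x that by simp
    fix z assume "z \<in> carrier N"
    then obtain u where u: "u \<in> carrier M" "z = f u" using onto by blast
    show "k (y \<oplus>\<^bsub>N\<^esub> z) = k y \<oplus>\<^bsub>V\<^esub> k z"
      using k[of "x \<oplus>\<^bsub>M\<^esub> u"] k[of x] k[of u] lin_add[OF f x(1) u(1)] lin_add[OF h x(1) u(1)] x u by simp
  qed
  then show ?thesis using k by blast
qed

lemma kernel_submodule:
  assumes "lin R M N f"
  shows "submodule {x \<in> carrier M. f x = \<zero>\<^bsub>N\<^esub>} R M"
  by (rule M.submoduleI)
    (auto simp: lin_zero[OF assms] lin_minus[OF assms] lin_add[OF assms] lin_smult[OF assms])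

lemma image_submodule:
  assumes "lin R M N f" "submodule D R M"
  shows "submodule (f ` D) R N"
proof (rule N.submoduleI)
  note D = M.submoduleE[OF assms(2)]
  have z: "\<zero>\<^bsub>M\<^esub> \<in> D" using subgroup.one_closed[OF submodule.axioms(1)[OF assms(2)]] by simp
  show "f ` D \<subseteq> carrier N" using D lin_closed[OF assms(1)] by auto
  show "\<zero>\<^bsub>N\<^esub> \<in> f ` D" using z lin_zero[OF assms(1)] by force
  fix a assume "a \<in> f ` D"
  then obtain x where x: "x \<in> D" "x \<in> carrier M" "a = f x" using D(1) by blast
  show "\<ominus>\<^bsub>N\<^esub> a \<in> f ` D"
    using D(3)[OF x(1)] lin_minus[OF assms(1) x(2)] x(3) by (metis imageI)
  show "a \<oplus>\<^bsub>N\<^esub> b \<in> f ` D" if b: "b \<in> f ` D" for b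
  proof -
    obtain y where y: "y \<in> D" "y \<in> carrier M" "b = f y" using D(1) b by blast
    show ?thesis using D(5)[OF x(1) y(1)] lin_add[OF assms(1) x(2) y(2)] x(3) y(3) by (metis imageI)
  qed
  show "r \<odot>\<^bsub>N\<^esub> a \<in> f ` D" if "r \<in> carrier R" for r
    using D(4)[OF that x(1)] lin_smult[OF assms(1) that x(2)] x(3) by (metis imageI)
qed

end

section \<open>Baer's criterion and extension of maps into injective modules\<close>

lemma submodule_zero: "submodule D R M \<Longrightarrow> \<zero>\<^bsub>M\<^esub> \<in> D"
  using subgroup.one_closed[OF submodule.axioms(1)] by fastforce

lemma self_module_simps [simp]:
  "carrier (self_module R) = carrier R" "\<zero>\<^bsub>self_module R\<^esub> = \<zero>\<^bsub>R\<^esub>"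
  "x \<oplus>\<^bsub>self_module R\<^esub> y = x \<oplus>\<^bsub>R\<^esub> y" "x \<odot>\<^bsub>self_module R\<^esub> y = x \<otimes>\<^bsub>R\<^esub> y"
  by (auto simp: self_module_def make_module_def)

lemma (in cring) self_module: "module R (self_module R)"
proof (intro moduleI abelian_groupI)
  show "\<exists>y\<in>carrier (self_module R). y \<oplus>\<^bsub>self_module R\<^esub> x = \<zero>\<^bsub>self_module R\<^esub>"
    if "x \<in> carrier (self_module R)" for x
    using that by (intro bexI[of _ "\<ominus> x"]) (auto simp: l_neg)
qed (auto simp: is_cring a_assoc l_distr r_distr m_assoc intro: a_comm)

lemma (in cring) ideal_submodule:
  assumes "ideal I R"
  shows "submodule I R (self_module R)"
proof -
  interpret I: ideal I R by fact
  interpret N: module R "self_module R" by (rule self_module)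
  show ?thesis
  proof (rule N.submoduleI)
    fix a assume "a \<in> I"
    have "\<ominus>\<^bsub>self_module R\<^esub> a = \<ominus> \<one> \<otimes> a"
      using N.smult_l_minus[of \<one> a] \<open>a \<in> I\<close> I.Icarr by auto
    then show "\<ominus>\<^bsub>self_module R\<^esub> a \<in> I" using \<open>a \<in> I\<close> I.I_l_closed by simp
  qed (auto simp: I.I_l_closed)
qed

text \<open>The graph of a linear map from some submodule of \<open>M\<close> to \<open>E\<close>.
  Graphs of partial maps are ordered by inclusion, so that in Zorn's lemma the union of a chain is
  the upper bound.\<close>

definition linear_graph where
  "linear_graph R M E G \<longleftrightarrow> G \<subseteq> carrier M \<times> carrier E \<and> (\<zero>\<^bsub>M\<^esub>, \<zero>\<^bsub>E\<^esub>) \<in> G \<and>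
     (\<forall>x y x' y'. (x, y) \<in> G \<longrightarrow> (x', y') \<in> G \<longrightarrow> (x \<oplus>\<^bsub>M\<^esub> x', y \<oplus>\<^bsub>E\<^esub> y') \<in> G) \<and>
     (\<forall>a\<in>carrier R. \<forall>x y. (x, y) \<in> G \<longrightarrow> (a \<odot>\<^bsub>M\<^esub> x, a \<odot>\<^bsub>E\<^esub> y) \<in> G) \<and>
     (\<forall>y. (\<zero>\<^bsub>M\<^esub>, y) \<in> G \<longrightarrow> y = \<zero>\<^bsub>E\<^esub>)"

context two_modules
begin

lemma linear_graph_minus:
  assumes G: "linear_graph R M N G" and "(x, y) \<in> G"
  shows "(\<ominus>\<^bsub>M\<^esub> x, \<ominus>\<^bsub>N\<^esub> y) \<in> G"
proof -
  have "x \<in> carrier M" "y \<in> carrier N" "(\<ominus> \<one> \<odot>\<^bsub>M\<^esub> x, \<ominus> \<one> \<odot>\<^bsub>N\<^esub> y) \<in> G"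
    using assms by (auto simp: linear_graph_def)
  then show ?thesis by (simp add: M.smult_l_minus N.smult_l_minus)
qed

lemma linear_graph_unique:
  assumes G: "linear_graph R M N G" and xy: "(x, y) \<in> G" "(x, y') \<in> G"
  shows "y = y'"
proof -
  have c: "x \<in> carrier M" "y \<in> carrier N" "y' \<in> carrier N" using assms by (auto simp: linear_graph_def)
  have "(x \<oplus>\<^bsub>M\<^esub> \<ominus>\<^bsub>M\<^esub> x, y \<oplus>\<^bsub>N\<^esub> \<ominus>\<^bsub>N\<^esub> y') \<in> G"
    using linear_graph_minus[OF G xy(2)] G xy(1) unfolding linear_graph_def by blast
  then have "(\<zero>\<^bsub>M\<^esub>, y \<oplus>\<^bsub>N\<^esub> \<ominus>\<^bsub>N\<^esub> y') \<in> G" using c by (simp add: M.M.r_neg)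
  then have "y \<oplus>\<^bsub>N\<^esub> \<ominus>\<^bsub>N\<^esub> y' = \<zero>\<^bsub>N\<^esub>" using G unfolding linear_graph_def by blast
  then show ?thesis using c by (metis N.M.minus_equality N.M.minus_minus N.M.a_inv_closed N.M.add.m_comm)
qed

lemma linear_graph_THE:
  assumes "linear_graph R M N G" "(x, y) \<in> G"
  shows "(THE y. (x, y) \<in> G) = y"
  using assms linear_graph_unique by blast

end

text \<open>Baer's argument: take a maximal graph extending \<open>f\<close> and suppose
  \<open>x\<close> is outside its domain. The scalars \<open>r\<close> with \<open>r x\<close> in
  the domain form an ideal, and the graph defines a map from it to \<open>E\<close>. The definition
  of injectivity, applied to \<open>self_module R\<close>, extends this map to multiplication by
  some \<open>e\<close>, and \<open>x\<close> can be sent to \<open>e\<close>.\<close>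

theorem injective_extension:
  fixes R (structure)
  assumes E: "injective_module R E" and M: "module R M" and D: "submodule D R M"
    and f: "lin R (M\<lparr>carrier := D\<rparr>) E f"
  shows "\<exists>g. lin R M E g \<and> (\<forall>x\<in>D. g x = f x)"
proof -
  have Em: "module R E" using E by (simp add: injective_module_def)
  interpret two_modules R M E by (intro two_modules.intro M Em)
  interpret self: module R "self_module R" by (rule M.R.self_module)
  note DE = M.submoduleE[OF D]
  have f0: "f \<zero>\<^bsub>M\<^esub> = \<zero>\<^bsub>E\<^esub>"
    using lin_smult[OF f, of \<zero> "\<zero>\<^bsub>M\<^esub>"] lin_closed[OF f, of "\<zero>\<^bsub>M\<^esub>"] submodule_zero[OF D] by simp
  define A where "A = {G. linear_graph R M E G \<and> (\<lambda>x. (x, f x)) ` D \<subseteq> G}"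
  have "\<exists>G\<in>A. \<forall>Y\<in>A. G \<subseteq> Y \<longrightarrow> Y = G"
  proof (rule subset_Zorn_nonempty)
    have "(\<lambda>x. (x, f x)) ` D \<in> A"
      using DE submodule_zero[OF D] lin_closed[OF f] lin_add[OF f] lin_smult[OF f] f0
      by (auto simp: A_def linear_graph_def)
    then show "A \<noteq> {}" by blast
    fix C assume C: "C \<noteq> {}" "subset.chain A C"
    then have CA: "G \<in> A" if "G \<in> C" for G using that by (auto simp: pred_on.chain_def)
    have graph: "linear_graph R M E G" if "G \<in> C" for G using CA[OF that] by (simp add: A_def)
    have two: "\<exists>G\<in>C. u \<in> G \<and> v \<in> G" if "u \<in> \<Union>C" "v \<in> \<Union>C" for u v
      using that C(2) unfolding pred_on.chain_def by blast
    have "linear_graph R M E (\<Union>C)"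
      unfolding linear_graph_def
    proof (intro conjI allI ballI impI)
      show "\<Union>C \<subseteq> carrier M \<times> carrier E" using graph unfolding linear_graph_def by blast
      show "(\<zero>\<^bsub>M\<^esub>, \<zero>\<^bsub>E\<^esub>) \<in> \<Union>C" using graph C(1) unfolding linear_graph_def by blast
      show "(x \<oplus>\<^bsub>M\<^esub> x', y \<oplus>\<^bsub>E\<^esub> y') \<in> \<Union>C" if xy: "(x, y) \<in> \<Union>C" "(x', y') \<in> \<Union>C" for x y x' y'
      proof -
        obtain G where "G \<in> C" "(x, y) \<in> G" "(x', y') \<in> G" using two[OF xy] by blast
        then show ?thesis using graph[of G] unfolding linear_graph_def by blast
      qed
      show "(a \<odot>\<^bsub>M\<^esub> x, a \<odot>\<^bsub>E\<^esub> y) \<in> \<Union>C" if "a \<in> carrier R" "(x, y) \<in> \<Union>C" for a x y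
        using that graph unfolding linear_graph_def by blast
      show "y = \<zero>\<^bsub>E\<^esub>" if "(\<zero>\<^bsub>M\<^esub>, y) \<in> \<Union>C" for y
        using that graph unfolding linear_graph_def by blast
    qed
    then show "\<Union>C \<in> A" using CA C(1) by (auto simp: A_def)
  qed
  then obtain G where "G \<in> A" and max: "\<And>Y. Y \<in> A \<Longrightarrow> G \<subseteq> Y \<Longrightarrow> Y = G" by blast
  then have G: "linear_graph R M E G" and fG: "\<And>x. x \<in> D \<Longrightarrow> (x, f x) \<in> G" by (auto simp: A_def)
  have Gc: "x \<in> carrier M" "y \<in> carrier E" if "(x, y) \<in> G" for x y
    using G that by (auto simp: linear_graph_def)
  have Ga: "(x \<oplus>\<^bsub>M\<^esub> x', y \<oplus>\<^bsub>E\<^esub> y') \<in> G" if "(x, y) \<in> G" "(x', y') \<in> G" for x y x' y'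
    using G that by (auto simp: linear_graph_def)
  have Gs: "(a \<odot>\<^bsub>M\<^esub> x, a \<odot>\<^bsub>E\<^esub> y) \<in> G" if "a \<in> carrier R" "(x, y) \<in> G" for a x y
    using G that by (auto simp: linear_graph_def)
  have G0: "(\<zero>\<^bsub>M\<^esub>, \<zero>\<^bsub>E\<^esub>) \<in> G" using G by (auto simp: linear_graph_def)
  have total: "\<exists>y. (x, y) \<in> G" if x: "x \<in> carrier M" for x
  proof (rule ccontr)
    assume nx: "\<nexists>y. (x, y) \<in> G"
    define I where "I = {r \<in> carrier R. \<exists>y. (r \<odot>\<^bsub>M\<^esub> x, y) \<in> G}"
    have I: "ideal I R"
    proof (rule M.R.idealI')
      show "I \<subseteq> carrier R" by (auto simp: I_def)
      show "\<zero> \<in> I" using G0 x by (auto simp: I_def)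
      show "r \<oplus> s \<in> I" if "r \<in> I" "s \<in> I" for r s
        using that Ga x by (fastforce simp: I_def M.smult_l_distr)
      show "a \<otimes> r \<in> I" if "a \<in> carrier R" "r \<in> I" for a r
        using that Gs x by (fastforce simp: I_def M.smult_assoc1)
    qed
    define h where "h = (\<lambda>r\<in>I. THE y. (r \<odot>\<^bsub>M\<^esub> x, y) \<in> G)"
    have h: "h r = y" if "r \<in> carrier R" "(r \<odot>\<^bsub>M\<^esub> x, y) \<in> G" for r y
    proof -
      have "r \<in> I" using that by (auto simp: I_def)
      then show ?thesis using linear_graph_THE[OF G that(2)] by (simp add: h_def)
    qed
    have hG: "(r \<odot>\<^bsub>M\<^esub> x, h r) \<in> G" if "r \<in> I" for r
      using that h by (auto simp: I_def)
    have "lin R (self_module R\<lparr>carrier := I\<rparr>) E h"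
    proof (rule linI)
      fix r s assume rs: "r \<in> carrier (self_module R\<lparr>carrier := I\<rparr>)" "s \<in> carrier (self_module R\<lparr>carrier := I\<rparr>)"
      then have "r \<in> carrier R" "s \<in> carrier R" by (auto simp: I_def)
      then show "h (r \<oplus>\<^bsub>self_module R\<lparr>carrier := I\<rparr>\<^esub> s) = h r \<oplus>\<^bsub>E\<^esub> h s"
        using Ga[OF hG[of r] hG[of s]] rs x by (intro h) (auto simp: M.smult_l_distr)
    next
      fix a r assume r: "a \<in> carrier R" "r \<in> carrier (self_module R\<lparr>carrier := I\<rparr>)"
      then have "r \<in> carrier R" by (auto simp: I_def)
      then show "h (a \<odot>\<^bsub>self_module R\<lparr>carrier := I\<rparr>\<^esub> r) = a \<odot>\<^bsub>E\<^esub> h r"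
        using Gs[OF r(1) hG[of r]] r x by (intro h) (auto simp: M.smult_assoc1)
    qed (use hG Gc in \<open>auto, blast\<close>)
    then have "h \<in> linear_maps R (self_module R\<lparr>carrier := I\<rparr>) E"
      by (simp add: linear_maps_iff h_def)
    then have "\<exists>g\<in>linear_maps R (self_module R) E. \<forall>r\<in>I. g r = h r"
      using E self.module_axioms M.R.ideal_submodule[OF I]
      unfolding injective_module_def by blast
    then obtain g where g': "g \<in> linear_maps R (self_module R) E" "\<And>r. r \<in> I \<Longrightarrow> g r = h r"
      by blast
    then have g: "lin R (self_module R) E g" "\<And>r. r \<in> I \<Longrightarrow> g r = h r"
      by (simp_all add: linear_maps_iff)
    define e where "e = g \<one>"
    have e: "e \<in> carrier E" using lin_closed[OF g(1), of \<one>] by (simp add: e_def)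
    have ge: "g r = r \<odot>\<^bsub>E\<^esub> e" if "r \<in> carrier R" for r
      using lin_smult[OF g(1) that, of \<one>] that by (simp add: e_def)
    define H where "H = {(d \<oplus>\<^bsub>M\<^esub> r \<odot>\<^bsub>M\<^esub> x, y \<oplus>\<^bsub>E\<^esub> r \<odot>\<^bsub>E\<^esub> e) |d y r. (d, y) \<in> G \<and> r \<in> carrier R}"
    have HI: "(d \<oplus>\<^bsub>M\<^esub> r \<odot>\<^bsub>M\<^esub> x, y \<oplus>\<^bsub>E\<^esub> r \<odot>\<^bsub>E\<^esub> e) \<in> H" if "(d, y) \<in> G" "r \<in> carrier R" for d y r
      using that by (auto simp: H_def)
    have GH: "G \<subseteq> H"
    proof
      fix z assume z: "z \<in> G"
      obtain d y where dy: "z = (d, y)" by (cases z)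
      show "z \<in> H" using HI[of d y \<zero>] Gc[of d y] z x e dy by simp
    qed
    have "linear_graph R M E H"
      unfolding linear_graph_def
    proof (intro conjI allI ballI impI)
      show "H \<subseteq> carrier M \<times> carrier E" using Gc x e by (auto simp: H_def)
      show "(\<zero>\<^bsub>M\<^esub>, \<zero>\<^bsub>E\<^esub>) \<in> H" using GH G0 by blast
      show "(u \<oplus>\<^bsub>M\<^esub> u', v \<oplus>\<^bsub>E\<^esub> v') \<in> H" if uv: "(u, v) \<in> H" "(u', v') \<in> H" for u v u' v'
      proof -
        obtain d y r where 1: "(d, y) \<in> G" "r \<in> carrier R" "u = d \<oplus>\<^bsub>M\<^esub> r \<odot>\<^bsub>M\<^esub> x" "v = y \<oplus>\<^bsub>E\<^esub> r \<odot>\<^bsub>E\<^esub> e"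
          using uv by (auto simp: H_def)
        obtain d' y' r' where 2: "(d', y') \<in> G" "r' \<in> carrier R" "u' = d' \<oplus>\<^bsub>M\<^esub> r' \<odot>\<^bsub>M\<^esub> x" "v' = y' \<oplus>\<^bsub>E\<^esub> r' \<odot>\<^bsub>E\<^esub> e"
          using uv by (auto simp: H_def)
        have "u \<oplus>\<^bsub>M\<^esub> u' = (d \<oplus>\<^bsub>M\<^esub> d') \<oplus>\<^bsub>M\<^esub> (r \<oplus> r') \<odot>\<^bsub>M\<^esub> x"
          using 1 2 Gc x by (simp add: M.smult_l_distr M.M.a_ac)
        moreover have "v \<oplus>\<^bsub>E\<^esub> v' = (y \<oplus>\<^bsub>E\<^esub> y') \<oplus>\<^bsub>E\<^esub> (r \<oplus> r') \<odot>\<^bsub>E\<^esub> e"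
          using 1 2 Gc e by (simp add: N.smult_l_distr N.M.a_ac)
        ultimately show ?thesis using HI[OF Ga[OF 1(1) 2(1)], of "r \<oplus> r'"] 1 2 by simp
      qed
      show "(a \<odot>\<^bsub>M\<^esub> u, a \<odot>\<^bsub>E\<^esub> v) \<in> H" if uv: "a \<in> carrier R" "(u, v) \<in> H" for a u v
      proof -
        obtain d y r where 1: "(d, y) \<in> G" "r \<in> carrier R" "u = d \<oplus>\<^bsub>M\<^esub> r \<odot>\<^bsub>M\<^esub> x" "v = y \<oplus>\<^bsub>E\<^esub> r \<odot>\<^bsub>E\<^esub> e"
          using uv by (auto simp: H_def)
        have "a \<odot>\<^bsub>M\<^esub> u = a \<odot>\<^bsub>M\<^esub> d \<oplus>\<^bsub>M\<^esub> (a \<otimes> r) \<odot>\<^bsub>M\<^esub> x"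
          using 1 Gc x uv by (simp add: M.smult_r_distr M.smult_assoc1)
        moreover have "a \<odot>\<^bsub>E\<^esub> v = a \<odot>\<^bsub>E\<^esub> y \<oplus>\<^bsub>E\<^esub> (a \<otimes> r) \<odot>\<^bsub>E\<^esub> e"
          using 1 Gc e uv by (simp add: N.smult_r_distr N.smult_assoc1)
        ultimately show ?thesis using HI[OF Gs[OF uv(1) 1(1)], of "a \<otimes> r"] 1 uv by simp
      qed
      \<comment> \<open>Single-valuedness: if \<open>d + r x = 0\<close>, then \<open>r\<close> lies
        in \<open>I\<close>, and \<open>r e\<close> equals the value of the old graph at
        \<open>r x\<close>, which is \<open>- y\<close>.\<close>
      show "v = \<zero>\<^bsub>E\<^esub>" if v: "(\<zero>\<^bsub>M\<^esub>, v) \<in> H" for v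
      proof -
        obtain d y r where 1: "(d, y) \<in> G" "r \<in> carrier R" "\<zero>\<^bsub>M\<^esub> = d \<oplus>\<^bsub>M\<^esub> r \<odot>\<^bsub>M\<^esub> x" "v = y \<oplus>\<^bsub>E\<^esub> r \<odot>\<^bsub>E\<^esub> e"
          using v by (auto simp: H_def)
        have c: "d \<in> carrier M" "y \<in> carrier E" using Gc 1 by auto
        have "r \<odot>\<^bsub>M\<^esub> x = \<ominus>\<^bsub>M\<^esub> d"
          using 1 c x by (metis M.M.minus_equality M.M.add.m_comm M.smult_closed)
        then have "(r \<odot>\<^bsub>M\<^esub> x, \<ominus>\<^bsub>E\<^esub> y) \<in> G" using linear_graph_minus[OF G 1(1)] by simp
        then have "g r = \<ominus>\<^bsub>E\<^esub> y" "r \<in> I" using h[of r] g(2)[of r] 1 by (auto simp: I_def)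
        then show ?thesis using ge[of r] 1 c by (simp add: N.M.r_neg)
      qed
    qed
    then have "H \<in> A" using GH fG by (auto simp: A_def)
    then have "H = G" using max GH by blast
    then have "(x, e) \<in> G" using HI[OF G0, of \<one>] x e by simp
    then show False using nx by blast
  qed
  define g where "g x = (THE y. (x, y) \<in> G)" for x
  have gy: "g x = y" if "(x, y) \<in> G" for x y
    unfolding g_def by (rule linear_graph_THE[OF G that])
  have gG: "(x, g x) \<in> G" if "x \<in> carrier M" for x
    using total[OF that] gy by auto
  have "lin R M E g"
  proof (rule linI)
    show "g x \<in> carrier E" if "x \<in> carrier M" for x using gG[OF that] Gc by blast
    show "g (x \<oplus>\<^bsub>M\<^esub> y) = g x \<oplus>\<^bsub>E\<^esub> g y" if "x \<in> carrier M" "y \<in> carrier M" for x y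
      by (intro gy Ga gG that)
    show "g (a \<odot>\<^bsub>M\<^esub> x) = a \<odot>\<^bsub>E\<^esub> g x" if "a \<in> carrier R" "x \<in> carrier M" for a x
      by (intro gy Gs gG that)
  qed
  moreover have "g x = f x" if "x \<in> D" for x by (intro gy fG that)
  ultimately show ?thesis by blast
qed

lemma (in module) lin_orbit: "x \<in> carrier M \<Longrightarrow> lin R (self_module R) M (\<lambda>r. r \<odot>\<^bsub>M\<^esub> x)"
  by (rule linI) (auto simp: smult_l_distr smult_assoc1)

lemma (in module) cyclic_submodule:
  assumes x: "x \<in> carrier M"
  shows "submodule {r \<odot>\<^bsub>M\<^esub> x |r. r \<in> carrier R} R M"
proof -
  interpret RM: two_modules R "self_module R" M by (intro two_modules.intro R.self_module module_axioms)
  have "submodule ((\<lambda>r. r \<odot>\<^bsub>M\<^esub> x) ` carrier (self_module R)) R M"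
    by (rule RM.image_submodule[OF lin_orbit[OF x] RM.M.carrier_is_submodule])
  then show ?thesis by (simp add: Setcompr_eq_image)
qed

text \<open>Sending \<open>x\<close> to \<open>e\<close> is well defined on the cyclic submodule as
  soon as the annihilator of \<open>x\<close> kills \<open>e\<close>; injectivity does the
  rest.\<close>

lemma extension_from_cyclic:
  fixes R (structure)
  assumes E: "injective_module R E" and M: "module R M"
    and x: "x \<in> carrier M" and e: "e \<in> carrier E"
    and ann: "\<And>r. r \<in> carrier R \<Longrightarrow> r \<odot>\<^bsub>M\<^esub> x = \<zero>\<^bsub>M\<^esub> \<Longrightarrow> r \<odot>\<^bsub>E\<^esub> e = \<zero>\<^bsub>E\<^esub>"
  shows "\<exists>g. lin R M E g \<and> g x = e"
proof -
  interpret M: module R M by fact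
  interpret E: module R E using E by (simp add: injective_module_def)
  define D where "D = {r \<odot>\<^bsub>M\<^esub> x |r. r \<in> carrier R}"
  have D: "submodule D R M" unfolding D_def by (rule M.cyclic_submodule[OF x])
  interpret RD: two_modules R "self_module R" "M\<lparr>carrier := D\<rparr>"
    by (intro two_modules.intro M.R.self_module submodule.submodule_is_module[OF D M])
  have "lin R (self_module R) (M\<lparr>carrier := D\<rparr>) (\<lambda>r. r \<odot>\<^bsub>M\<^esub> x)"
    using M.lin_orbit[OF x] by (auto simp: lin_def D_def)
  from RD.lin_factor[OF E.module_axioms this _ E.lin_orbit[OF e]] ann
  have "\<exists>k. lin R (M\<lparr>carrier := D\<rparr>) E k \<and> (\<forall>r\<in>carrier R. k (r \<odot>\<^bsub>M\<^esub> x) = r \<odot>\<^bsub>E\<^esub> e)"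
    by (simp add: D_def Setcompr_eq_image)
  then obtain k where k: "lin R (M\<lparr>carrier := D\<rparr>) E k" "\<forall>r\<in>carrier R. k (r \<odot>\<^bsub>M\<^esub> x) = r \<odot>\<^bsub>E\<^esub> e"
    by blast
  obtain g where g: "lin R M E g" "\<forall>y\<in>D. g y = k y" using injective_extension[OF E M D k(1)] by blast
  have "x \<in> D" using x by (auto simp: D_def intro!: exI[of _ \<one>])
  moreover have "k x = e" using bspec[OF k(2) M.R.one_closed] x e by simp
  ultimately show ?thesis using g by auto
qed

text \<open>Induction on \<^term>\<open>J\<close>: by induction the claim holds on the kernel of the last \<open>g\<^sub>j\<close>, and the error
  then factors through \<open>g\<^sub>j\<close>.\<close>

theorem injective_factorization:
  fixes R (structure)
  assumes E: "injective_module R E" and M: "module R M" and N: "module R N"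
    and J: "finite J" "\<And>j. j \<in> J \<Longrightarrow> lin R M N (g j)"
    and D: "submodule D R M" and f: "lin R (M\<lparr>carrier := D\<rparr>) E f"
    and ker: "\<And>x. x \<in> D \<Longrightarrow> (\<And>j. j \<in> J \<Longrightarrow> g j x = \<zero>\<^bsub>N\<^esub>) \<Longrightarrow> f x = \<zero>\<^bsub>E\<^esub>"
  shows "\<exists>w. (\<forall>j\<in>J. lin R N E (w j)) \<and> (\<forall>x\<in>D. f x = (\<Oplus>\<^bsub>E\<^esub>j\<in>J. w j (g j x)))"
  using J D f ker
proof (induct J arbitrary: D f rule: finite_induct)
  case empty
  interpret E: module R E using E by (simp add: injective_module_def)
  show ?case using empty by simp
next
  case (insert j J)
  have Em: "module R E" using E by (simp add: injective_module_def)
  interpret MN: two_modules R M N by (intro two_modules.intro M N)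
  interpret ME: two_modules R M E by (intro two_modules.intro M Em)
  interpret NE: two_modules R N E by (intro two_modules.intro N Em)
  note D = \<open>submodule D R M\<close> and f = \<open>lin R (M\<lparr>carrier := D\<rparr>) E f\<close>
  note DE = MN.M.submoduleE[OF D]
  have DM: "module R (M\<lparr>carrier := D\<rparr>)" by (rule submodule.submodule_is_module[OF D M])
  interpret DE: two_modules R "M\<lparr>carrier := D\<rparr>" E by (intro two_modules.intro DM Em)
  have gj: "lin R M N (g j)" using insert by simp
  define D' where "D' = {x \<in> D. g j x = \<zero>\<^bsub>N\<^esub>}"
  have D'D: "D' \<subseteq> D" by (auto simp: D'_def)
  have D': "submodule D' R M"
    using DE DE(1)[THEN subsetD] submodule_zero[OF D] MN.lin_zero[OF gj] MN.lin_minus[OF gj]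
      lin_add[OF gj] lin_smult[OF gj]
    by (intro MN.M.submoduleI) (auto simp: D'_def)
  have "lin R (M\<lparr>carrier := D'\<rparr>) E f" using f D'D by (auto simp: lin_def Pi_iff subset_eq)
  moreover have "f x = \<zero>\<^bsub>E\<^esub>" if "x \<in> D'" "\<And>i. i \<in> J \<Longrightarrow> g i x = \<zero>\<^bsub>N\<^esub>" for x
    using insert(7)[of x] that by (auto simp: D'_def)
  ultimately obtain w where w: "\<And>i. i \<in> J \<Longrightarrow> lin R N E (w i)"
    "\<And>x. x \<in> D' \<Longrightarrow> f x = (\<Oplus>\<^bsub>E\<^esub>i\<in>J. w i (g i x))"
    using insert(3)[OF _ D', of f] insert(4) by blast
  define s where "s x = (\<Oplus>\<^bsub>E\<^esub>i\<in>J. w i (g i x))" for x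
  have s: "lin R M E s"
  proof -
    have "lin R M E (\<lambda>x. w i (g i x))" if "i \<in> J" for i
      by (rule lin_comp[of R M N "g i" E "w i"]) (use insert w that in auto)
    then show ?thesis unfolding s_def using insert by (intro ME.lin_sum_maps) auto
  qed
  define h where "h x = f x \<ominus>\<^bsub>E\<^esub> s x" for x
  have h: "lin R (M\<lparr>carrier := D\<rparr>) E h"
    unfolding h_def by (intro DE.lin_minus_maps f lin_submodule s DE(1))
  have h0: "h x = \<zero>\<^bsub>E\<^esub>" if "x \<in> D" "g j x = \<zero>\<^bsub>N\<^esub>" for x
    using w(2)[of x] that lin_closed[OF f, of x] by (auto simp: h_def s_def D'_def)
  \<comment> \<open>The factor of the error is defined only on the image of \<open>D\<close> under
    \<open>g j\<close>; injectivity extends it to all of \<open>N\<close>.\<close>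
  have im: "submodule (g j ` D) R N" by (rule MN.image_submodule[OF gj D])
  let ?D = "M\<lparr>carrier := D\<rparr>" and ?I = "N\<lparr>carrier := g j ` D\<rparr>"
  interpret DI: two_modules R ?D ?I
    by (intro two_modules.intro DM submodule.submodule_is_module[OF im N])
  have "lin R ?D ?I (g j)" using gj DE(1) by (auto simp: lin_def subset_eq)
  from DI.lin_factor[OF Em this _ h] h0
  have "\<exists>k. lin R ?I E k \<and> (\<forall>x\<in>D. k (g j x) = h x)" by simp
  then obtain k where k: "lin R ?I E k" "\<And>x. x \<in> D \<Longrightarrow> k (g j x) = h x" by blast
  from injective_extension[OF E N im k(1)]
  obtain v where v: "lin R N E v" "\<And>y. y \<in> g j ` D \<Longrightarrow> v y = k y" by blast
  have "f x = (\<Oplus>\<^bsub>E\<^esub>i\<in>insert j J. (w(j := v)) i (g i x))" if x: "x \<in> D" for x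
  proof -
    have xM: "x \<in> carrier M" using x DE(1) by blast
    have "(\<Oplus>\<^bsub>E\<^esub>i\<in>insert j J. (w(j := v)) i (g i x)) = v (g j x) \<oplus>\<^bsub>E\<^esub> (\<Oplus>\<^bsub>E\<^esub>i\<in>J. (w(j := v)) i (g i x))"
      using insert w v xM by (subst ME.N.M.finsum_insert) (auto intro!: lin_closed[of R N E] lin_closed[of R M N])
    also have "(\<Oplus>\<^bsub>E\<^esub>i\<in>J. (w(j := v)) i (g i x)) = s x"
      unfolding s_def using insert w xM
      by (intro ME.N.M.finsum_cong') (auto intro!: lin_closed[of R N E] lin_closed[of R M N])
    also have "v (g j x) = h x" using v(2) k(2) x by simp
    also have "h x \<oplus>\<^bsub>E\<^esub> s x = f x"
      using lin_closed[OF f, of x] lin_closed[OF s xM] x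
      by (simp add: h_def ME.N.M.minus_eq ME.N.M.a_assoc ME.N.M.l_neg)
    finally show ?thesis by simp
  qed
  then show ?case using w v by (intro exI[of _ "w(j := v)"]) auto
qed

lemma (in abelian_group) diff_zero [simp]: "x \<in> carrier G \<Longrightarrow> x \<ominus> \<zero> = x"
  using r_neg[of \<zero>] l_zero[of "\<ominus> \<zero>"] by (simp add: minus_eq)

section \<open>Hom modules, quotients and free modules\<close>

lemma make_module_simps [simp]:
  "carrier (make_module C pl z sm) = C" "add (make_module C pl z sm) = pl"
  "ring.zero (make_module C pl z sm) = z" "smult (make_module C pl z sm) = sm"
  by (auto simp: make_module_def)

lemma with_scalars_simps [simp]:
  "carrier (with_scalars M sm) = carrier M" "add (with_scalars M sm) = add M"
  "ring.zero (with_scalars M sm) = ring.zero M" "smult (with_scalars M sm) = sm"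
  by (auto simp: with_scalars_def)

lemma module_with_scalars_smult:
  assumes "module R M"
  shows "module R (with_scalars M (smult M))"
proof -
  interpret module R M by fact
  show ?thesis
  proof (intro moduleI abelian_groupI)
    show "\<exists>y\<in>carrier (with_scalars M (smult M)). y \<oplus>\<^bsub>with_scalars M (smult M)\<^esub> x = \<zero>\<^bsub>with_scalars M (smult M)\<^esub>"
      if "x \<in> carrier (with_scalars M (smult M))" for x
      using that by (intro bexI[of _ "\<ominus>\<^bsub>M\<^esub> x"]) (auto simp: M.l_neg)
  qed (auto simp: R.is_cring M.a_assoc smult_l_distr smult_r_distr smult_assoc1 intro: M.a_comm)
qed

lemma hom_module_simps [simp]:
  "carrier (hom_module R M N sm) = linear_maps R M N"
  "f \<oplus>\<^bsub>hom_module R M N sm\<^esub> g = (\<lambda>x\<in>carrier M. f x \<oplus>\<^bsub>N\<^esub> g x)"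
  "\<zero>\<^bsub>hom_module R M N sm\<^esub> = (\<lambda>x\<in>carrier M. \<zero>\<^bsub>N\<^esub>)"
  "a \<odot>\<^bsub>hom_module R M N sm\<^esub> f = (\<lambda>x\<in>carrier M. sm a (f x))"
  by (auto simp: hom_module_def)

lemma matlis_dual_simps [simp]:
  "carrier (matlis_dual R E M) = linear_maps R M E"
  "f \<oplus>\<^bsub>matlis_dual R E M\<^esub> g = (\<lambda>x\<in>carrier M. f x \<oplus>\<^bsub>E\<^esub> g x)"
  "\<zero>\<^bsub>matlis_dual R E M\<^esub> = (\<lambda>x\<in>carrier M. \<zero>\<^bsub>E\<^esub>)"
  "a \<odot>\<^bsub>matlis_dual R E M\<^esub> f = (\<lambda>x\<in>carrier M. a \<odot>\<^bsub>E\<^esub> f x)"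
  by (auto simp: matlis_dual_def)

lemma linear_maps_eqI:
  assumes "f \<in> linear_maps R M N" "g \<in> linear_maps R M N" "\<And>x. x \<in> carrier M \<Longrightarrow> f x = g x"
  shows "f = g"
  using assms by (auto simp: linear_maps_iff intro: extensionalityI)

text \<open>Scalars of \<open>S\<close> act on the values of a map. They have to commute with those
  of \<open>R\<close> so that a scaled map stays \<open>R\<close>-linear. Matlis duals and
  colocalizations are both instances.\<close>

lemma module_hom_module:
  assumes M: "module R M" and N: "module R N" and SN: "module S (with_scalars N sm)"
    and comm: "\<And>s a x. s \<in> carrier S \<Longrightarrow> a \<in> carrier R \<Longrightarrow> x \<in> carrier N \<Longrightarrow>
      sm s (a \<odot>\<^bsub>N\<^esub> x) = a \<odot>\<^bsub>N\<^esub> sm s x"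
  shows "module S (hom_module R M N sm)"
proof -
  interpret MN: two_modules R M N by (intro two_modules.intro M N)
  interpret SN: module S "with_scalars N sm" by fact
  note sm = SN.smult_closed[simplified] SN.smult_l_distr[simplified] SN.smult_r_distr[simplified]
    SN.smult_assoc1[simplified] SN.smult_one[simplified]
  have L: "lin R M N f" if "f \<in> linear_maps R M N" for f using that by (simp add: linear_maps_iff)
  have c: "f x \<in> carrier N" if "f \<in> linear_maps R M N" "x \<in> carrier M" for f x
    using lin_closed[OF L[OF that(1)] that(2)] .
  have ext: "f x = undefined" if "f \<in> linear_maps R M N" "x \<notin> carrier M" for f x
    using that by (simp add: linear_maps_iff extensional_def)
  have plus: "(\<lambda>x\<in>carrier M. f x \<oplus>\<^bsub>N\<^esub> g x) \<in> linear_maps R M N"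
    if "f \<in> linear_maps R M N" "g \<in> linear_maps R M N" for f g
    by (intro restrict_linear_maps M MN.lin_plus L that)
  have scal: "(\<lambda>x\<in>carrier M. sm s (f x)) \<in> linear_maps R M N"
    if s: "s \<in> carrier S" and f: "f \<in> linear_maps R M N" for s f
  proof (intro restrict_linear_maps M linI)
    fix x assume x: "x \<in> carrier M"
    show "sm s (f x) \<in> carrier N" by (intro sm s c f x)
    show "sm s (f (a \<odot>\<^bsub>M\<^esub> x)) = a \<odot>\<^bsub>N\<^esub> sm s (f x)" if "a \<in> carrier R" for a
      using that x s c[OF f x] by (simp add: lin_smult[OF L[OF f]] comm)
    show "sm s (f (x \<oplus>\<^bsub>M\<^esub> y)) = sm s (f x) \<oplus>\<^bsub>N\<^esub> sm s (f y)" if "y \<in> carrier M" for y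
      using that x s c[OF f] by (simp add: lin_add[OF L[OF f]] sm)
  qed
  have zero: "(\<lambda>x\<in>carrier M. \<zero>\<^bsub>N\<^esub>) \<in> linear_maps R M N"
    by (intro restrict_linear_maps M MN.lin_zero_map)
  have neg: "(\<lambda>x\<in>carrier M. \<ominus>\<^bsub>N\<^esub> f x) \<in> linear_maps R M N" if f: "f \<in> linear_maps R M N" for f
  proof -
    have "(\<lambda>x\<in>carrier M. \<zero>\<^bsub>N\<^esub> \<ominus>\<^bsub>N\<^esub> f x) \<in> linear_maps R M N"
      by (intro restrict_linear_maps M MN.lin_minus_maps MN.lin_zero_map L f)
    moreover have "(\<lambda>x\<in>carrier M. \<zero>\<^bsub>N\<^esub> \<ominus>\<^bsub>N\<^esub> f x) = (\<lambda>x\<in>carrier M. \<ominus>\<^bsub>N\<^esub> f x)"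
      using c[OF f] by (auto simp: restrict_def MN.N.M.minus_eq)
    ultimately show ?thesis by simp
  qed
  show ?thesis
  proof (intro moduleI abelian_groupI, goal_cases)
    case (7 f)
    then show ?case
      using c[of f] neg[of f] by (intro bexI[of _ "\<lambda>x\<in>carrier M. \<ominus>\<^bsub>N\<^esub> f x"])
        (auto simp: restrict_def MN.N.M.l_neg)
  qed (auto simp: SN.R.is_cring plus[unfolded restrict_def] zero[unfolded restrict_def]
      scal[unfolded restrict_def] c sm MN.N.M.a_ac ext restrict_def[abs_def] fun_eq_iff
      simp del: restrict_apply)
qed

lemma module_matlis_dual:
  assumes M: "module R M" and E: "module R E"
  shows "module R (matlis_dual R E M)"
proof -
  interpret E: module R E by fact
  show ?thesis
    unfolding matlis_dual_def
    by (intro module_hom_module M E module_with_scalars_smult)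
      (simp add: E.R.m_comm flip: E.smult_assoc1)
qed

locale module_quotient = module R M for R (structure) and M (structure) +
  fixes N
  assumes N: "submodule N R M"
begin

sublocale Q: abelian_subgroup N M
  by (intro abelian_subgroupI3 additive_subgroup.intro M.abelian_group_axioms submodule.axioms(1)[OF N])

lemma quotient_carrier: "carrier (quotient_module M N) = (\<lambda>x. N +>\<^bsub>M\<^esub> x) ` carrier M"
  by (auto simp: quotient_module_def A_RCOSETS_def')

lemma quotient_closed: "x \<in> carrier M \<Longrightarrow> N +>\<^bsub>M\<^esub> x \<in> carrier (quotient_module M N)"
  by (auto simp: quotient_carrier)

lemma quotient_eq_iff:
  assumes "x \<in> carrier M" "y \<in> carrier M"
  shows "N +>\<^bsub>M\<^esub> x = N +>\<^bsub>M\<^esub> y \<longleftrightarrow> x \<ominus>\<^bsub>M\<^esub> y \<in> N"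
proof
  assume "N +>\<^bsub>M\<^esub> x = N +>\<^bsub>M\<^esub> y"
  then have "x \<in> N +>\<^bsub>M\<^esub> y" using Q.a_rcos_self[OF assms(1)] by simp
  then show "x \<ominus>\<^bsub>M\<^esub> y \<in> N" using Q.a_rcos_module_imp[OF assms(2)] M.minus_eq by simp
next
  assume "x \<ominus>\<^bsub>M\<^esub> y \<in> N"
  then have "x \<in> N +>\<^bsub>M\<^esub> y" using Q.a_rcos_module_rev[OF assms(2,1)] M.minus_eq by simp
  then show "N +>\<^bsub>M\<^esub> x = N +>\<^bsub>M\<^esub> y"
    using M.a_repr_independence[OF _ assms(2) Q.a_subgroup] by simp
qed

lemma quotient_zero: "\<zero>\<^bsub>quotient_module M N\<^esub> = N"
  by (simp add: quotient_module_def)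

lemma quotient_eq_zero_iff:
  assumes "x \<in> carrier M"
  shows "N +>\<^bsub>M\<^esub> x = N \<longleftrightarrow> x \<in> N"
proof -
  have "N = N +>\<^bsub>M\<^esub> \<zero>\<^bsub>M\<^esub>" using submoduleE(1)[OF N] by simp
  then have "N +>\<^bsub>M\<^esub> x = N \<longleftrightarrow> N +>\<^bsub>M\<^esub> x = N +>\<^bsub>M\<^esub> \<zero>\<^bsub>M\<^esub>" by simp
  also have "\<dots> \<longleftrightarrow> x \<in> N" using quotient_eq_iff[OF assms, of "\<zero>\<^bsub>M\<^esub>"] assms by simp
  finally show ?thesis .
qed

lemma quotient_add:
  assumes "x \<in> carrier M" "y \<in> carrier M"
  shows "(N +>\<^bsub>M\<^esub> x) \<oplus>\<^bsub>quotient_module M N\<^esub> (N +>\<^bsub>M\<^esub> y) = N +>\<^bsub>M\<^esub> (x \<oplus>\<^bsub>M\<^esub> y)"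
  using Q.a_rcos_sum[OF assms] by (simp add: quotient_module_def)

lemma quotient_smult:
  assumes "a \<in> carrier R" "x \<in> carrier M"
  shows "a \<odot>\<^bsub>quotient_module M N\<^esub> (N +>\<^bsub>M\<^esub> x) = N +>\<^bsub>M\<^esub> (a \<odot>\<^bsub>M\<^esub> x)"
proof -
  have "N +>\<^bsub>M\<^esub> (a \<odot>\<^bsub>M\<^esub> y) = N +>\<^bsub>M\<^esub> (a \<odot>\<^bsub>M\<^esub> x)" if "y \<in> N +>\<^bsub>M\<^esub> x" for y
  proof -
    have y: "y \<in> carrier M" using Q.a_elemrcos_carrier[OF assms(2) that] .
    have "y \<ominus>\<^bsub>M\<^esub> x \<in> N" using Q.a_rcos_module_imp[OF assms(2) that] M.minus_eq by simp
    then have "a \<odot>\<^bsub>M\<^esub> (y \<ominus>\<^bsub>M\<^esub> x) \<in> N" by (rule submoduleE(4)[OF N assms(1)])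
    moreover have "a \<odot>\<^bsub>M\<^esub> (y \<ominus>\<^bsub>M\<^esub> x) = a \<odot>\<^bsub>M\<^esub> y \<ominus>\<^bsub>M\<^esub> a \<odot>\<^bsub>M\<^esub> x"
      using assms y by (simp add: M.minus_eq smult_r_distr smult_r_minus)
    ultimately show ?thesis using quotient_eq_iff assms y by simp
  qed
  moreover have "x \<in> N +>\<^bsub>M\<^esub> x" using Q.a_rcos_self[OF assms(2)] .
  ultimately have "(\<Union>y\<in>N +>\<^bsub>M\<^esub> x. N +>\<^bsub>M\<^esub> (a \<odot>\<^bsub>M\<^esub> y)) = N +>\<^bsub>M\<^esub> (a \<odot>\<^bsub>M\<^esub> x)"
    by (intro UN_constant_eq) blast+
  then show ?thesis by (simp add: quotient_module_def)
qed

lemma quotient_module: "module R (quotient_module M N)"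
proof -
  have z: "\<zero>\<^bsub>quotient_module M N\<^esub> = N +>\<^bsub>M\<^esub> \<zero>\<^bsub>M\<^esub>"
    using quotient_eq_zero_iff[of "\<zero>\<^bsub>M\<^esub>"] quotient_zero submodule_zero[OF N] by simp
  show ?thesis
  proof (intro moduleI abelian_groupI, goal_cases)
    case (7 U)
    then obtain x where x: "x \<in> carrier M" "U = N +>\<^bsub>M\<^esub> x" by (auto simp: quotient_carrier)
    then show ?case
      by (intro bexI[of _ "N +>\<^bsub>M\<^esub> (\<ominus>\<^bsub>M\<^esub> x)"])
        (auto simp: quotient_carrier quotient_add z M.l_neg)
  qed (auto simp: quotient_carrier quotient_add quotient_smult z R.is_cring M.a_ac
      smult_l_distr smult_r_distr smult_assoc1)
qed

end

lemma free_module_simps [simp]: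
  "carrier (free_module B S) = {f \<in> S \<rightarrow>\<^sub>E carrier B. finite {x \<in> S. f x \<noteq> \<zero>\<^bsub>B\<^esub>}}"
  "f \<oplus>\<^bsub>free_module B S\<^esub> g = (\<lambda>x\<in>S. f x \<oplus>\<^bsub>B\<^esub> g x)"
  "\<zero>\<^bsub>free_module B S\<^esub> = (\<lambda>x\<in>S. \<zero>\<^bsub>B\<^esub>)"
  "b \<odot>\<^bsub>free_module B S\<^esub> f = (\<lambda>x\<in>S. b \<otimes>\<^bsub>B\<^esub> f x)"
  by (auto simp: free_module_def)

lemma (in cring) module_free_module: "module R (free_module R S)"
proof (intro moduleI abelian_groupI, goal_cases)
  case (2 f g)
  then have "{x \<in> S. f x \<oplus> g x \<noteq> \<zero>} \<subseteq> {x \<in> S. f x \<noteq> \<zero>} \<union> {x \<in> S. g x \<noteq> \<zero>}" by auto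
  then have "finite {x \<in> S. f x \<oplus> g x \<noteq> \<zero>}" by (rule finite_subset) (use 2 in auto)
  moreover have "{x \<in> S. (\<lambda>x\<in>S. f x \<oplus> g x) x \<noteq> \<zero>} = {x \<in> S. f x \<oplus> g x \<noteq> \<zero>}" by auto
  ultimately show ?case using 2 by auto
next
  case (7 f)
  then have f: "f x \<in> carrier R" if "x \<in> S" for x using that by auto
  have "{x \<in> S. (\<lambda>x\<in>S. \<ominus> f x) x \<noteq> \<zero>} \<subseteq> {x \<in> S. f x \<noteq> \<zero>}" using f by auto
  then have "finite {x \<in> S. (\<lambda>x\<in>S. \<ominus> f x) x \<noteq> \<zero>}" by (rule finite_subset) (use 7 in auto)
  then show ?case using 7 f by (intro bexI[of _ "\<lambda>x\<in>S. \<ominus> f x"]) (auto simp: l_neg restrict_def fun_eq_iff)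
next
  case (8 a f)
  then have "{x \<in> S. (\<lambda>x\<in>S. a \<otimes> f x) x \<noteq> \<zero>} \<subseteq> {x \<in> S. f x \<noteq> \<zero>}" by auto
  then have "finite {x \<in> S. (\<lambda>x\<in>S. a \<otimes> f x) x \<noteq> \<zero>}" by (rule finite_subset) (use 8 in auto)
  then show ?case using 8 by auto
next
  case (6 f)
  then show ?case by (auto simp: PiE_def Pi_iff fun_eq_iff extensional_def)
next
  case (12 f)
  then show ?case by (auto simp: PiE_def Pi_iff fun_eq_iff extensional_def)
qed (auto simp: is_cring restrict_def fun_eq_iff PiE_def Pi_iff extensional_def a_ac l_distr r_distr m_assoc)

section \<open>Base change\<close>

text \<open>The presentation by generators and relations makes sense for any map \<phi> between the
  carriers, so the locale applies to \<open>frobenius\<close> before its additivity is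
  available.\<close>

locale scalar_extension = A: cring A + B: cring B + M: module A M for A and B and M +
  fixes \<phi>
  assumes \<phi>_closed: "\<And>a. a \<in> carrier A \<Longrightarrow> \<phi> a \<in> carrier B"
begin

abbreviation "F \<equiv> free_module B (carrier M)"
abbreviation "\<delta> \<equiv> free_generator B (carrier M)"
abbreviation "Rel \<equiv> base_change_relations A B \<phi> M"
abbreviation "BM \<equiv> base_change A B \<phi> M"
abbreviation "elt \<equiv> base_change_elem A B \<phi> M"

sublocale F: module B F
  by (rule B.module_free_module)

lemma delta_closed: "u \<in> carrier M \<Longrightarrow> \<delta> u \<in> carrier F"
proof -
  assume u: "u \<in> carrier M"
  have "{x \<in> carrier M. \<delta> u x \<noteq> \<zero>\<^bsub>B\<^esub>} \<subseteq> {u}" by (auto simp: free_generator_def)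
  then have "finite {x \<in> carrier M. \<delta> u x \<noteq> \<zero>\<^bsub>B\<^esub>}" by (rule finite_subset) simp
  then show ?thesis by (auto simp: free_generator_def)
qed

definition "relators =
  {\<delta> (x \<oplus>\<^bsub>M\<^esub> y) \<ominus>\<^bsub>F\<^esub> (\<delta> x \<oplus>\<^bsub>F\<^esub> \<delta> y) |x y. x \<in> carrier M \<and> y \<in> carrier M} \<union>
  {\<delta> (a \<odot>\<^bsub>M\<^esub> x) \<ominus>\<^bsub>F\<^esub> (\<phi> a \<odot>\<^bsub>F\<^esub> \<delta> x) |a x. a \<in> carrier A \<and> x \<in> carrier M}"

lemma Rel_eq: "Rel = \<Inter>{N. submodule N B F \<and> relators \<subseteq> N}"
  by (simp add: base_change_relations_def submodule_span_def relators_def Let_def)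

lemma relators_carrier: "relators \<subseteq> carrier F"
  unfolding relators_def
  by (auto simp del: free_module_simps
      intro!: F.M.minus_closed F.M.a_closed F.smult_closed delta_closed \<phi>_closed)

lemma Rel_submodule: "submodule Rel B F"
proof (rule F.submoduleI)
  show "Rel \<subseteq> carrier F"
    unfolding Rel_eq using F.carrier_is_submodule relators_carrier by blast
  show "\<zero>\<^bsub>F\<^esub> \<in> Rel" unfolding Rel_eq using submodule_zero[of _ B F] by blast
  show "\<ominus>\<^bsub>F\<^esub> a \<in> Rel" if "a \<in> Rel" for a
    using that F.submoduleE(3) unfolding Rel_eq by blast
  show "a \<oplus>\<^bsub>F\<^esub> b \<in> Rel" if "a \<in> Rel" "b \<in> Rel" for a b
    using that F.submoduleE(5) unfolding Rel_eq by blast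
  show "b \<odot>\<^bsub>F\<^esub> a \<in> Rel" if "b \<in> carrier B" "a \<in> Rel" for a b
    using that F.submoduleE(4) unfolding Rel_eq by blast
qed

lemma relators_Rel: "relators \<subseteq> Rel"
  unfolding Rel_eq by blast

sublocale Q: module_quotient B F Rel
  by (intro module_quotient.intro module_quotient_axioms.intro F.module_axioms Rel_submodule)

lemma BM_eq: "BM = quotient_module F Rel"
  by (simp add: base_change_def)

lemma elt_eq: "elt u = Rel +>\<^bsub>F\<^esub> \<delta> u"
  by (simp add: base_change_elem_def)

sublocale BM: module B BM
  unfolding BM_eq by (rule Q.quotient_module)

lemma BM_module: "module B BM"
  by (rule BM.module_axioms)

lemma elt_closed: "u \<in> carrier M \<Longrightarrow> elt u \<in> carrier BM"
  unfolding BM_eq elt_eq by (intro Q.quotient_closed delta_closed)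

lemma elt_add:
  assumes "x \<in> carrier M" "y \<in> carrier M"
  shows "elt (x \<oplus>\<^bsub>M\<^esub> y) = elt x \<oplus>\<^bsub>BM\<^esub> elt y"
proof -
  have "\<delta> (x \<oplus>\<^bsub>M\<^esub> y) \<ominus>\<^bsub>F\<^esub> (\<delta> x \<oplus>\<^bsub>F\<^esub> \<delta> y) \<in> Rel"
    using relators_Rel assms unfolding relators_def by blast
  then have "Rel +>\<^bsub>F\<^esub> \<delta> (x \<oplus>\<^bsub>M\<^esub> y) = Rel +>\<^bsub>F\<^esub> (\<delta> x \<oplus>\<^bsub>F\<^esub> \<delta> y)"
    using assms by (subst Q.quotient_eq_iff) (simp_all add: delta_closed F.M.a_closed del: free_module_simps)
  then show ?thesis
    unfolding BM_eq elt_eq using assms by (subst Q.quotient_add) (auto intro: delta_closed simp del: free_module_simps)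
qed

lemma elt_smult:
  assumes "a \<in> carrier A" "x \<in> carrier M"
  shows "elt (a \<odot>\<^bsub>M\<^esub> x) = \<phi> a \<odot>\<^bsub>BM\<^esub> elt x"
proof -
  have "\<delta> (a \<odot>\<^bsub>M\<^esub> x) \<ominus>\<^bsub>F\<^esub> (\<phi> a \<odot>\<^bsub>F\<^esub> \<delta> x) \<in> Rel"
    using relators_Rel assms unfolding relators_def by blast
  then have "Rel +>\<^bsub>F\<^esub> \<delta> (a \<odot>\<^bsub>M\<^esub> x) = Rel +>\<^bsub>F\<^esub> (\<phi> a \<odot>\<^bsub>F\<^esub> \<delta> x)"
    using assms by (subst Q.quotient_eq_iff)
      (simp_all add: delta_closed \<phi>_closed F.smult_closed del: free_module_simps)
  then show ?thesis
    unfolding BM_eq elt_eq using assms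
    by (subst Q.quotient_smult) (auto intro: delta_closed \<phi>_closed simp del: free_module_simps)
qed

text \<open>A balanced biadditive \<beta> extends additively to the free module and kills all
  multiples of the relators. The target is a mere abelian group because the maps to which this is
  applied, such as \<open>p^-1\<close>-linear ones, are not \<open>B\<close>-linear.\<close>

lemma universal:
  assumes Y: "abelian_group Y"
    and cl: "\<And>b x. b \<in> carrier B \<Longrightarrow> x \<in> carrier M \<Longrightarrow> \<beta> b x \<in> carrier Y"
    and addl: "\<And>b c x. b \<in> carrier B \<Longrightarrow> c \<in> carrier B \<Longrightarrow> x \<in> carrier M \<Longrightarrow>
      \<beta> (b \<oplus>\<^bsub>B\<^esub> c) x = \<beta> b x \<oplus>\<^bsub>Y\<^esub> \<beta> c x"
    and addr: "\<And>b x y. b \<in> carrier B \<Longrightarrow> x \<in> carrier M \<Longrightarrow> y \<in> carrier M \<Longrightarrow>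
      \<beta> b (x \<oplus>\<^bsub>M\<^esub> y) = \<beta> b x \<oplus>\<^bsub>Y\<^esub> \<beta> b y"
    and bal: "\<And>b a x. b \<in> carrier B \<Longrightarrow> a \<in> carrier A \<Longrightarrow> x \<in> carrier M \<Longrightarrow>
      \<beta> (b \<otimes>\<^bsub>B\<^esub> \<phi> a) x = \<beta> b (a \<odot>\<^bsub>M\<^esub> x)"
    and b: "b \<in> carrier B" "u \<in> carrier M" "b \<odot>\<^bsub>BM\<^esub> elt u = \<zero>\<^bsub>BM\<^esub>"
  shows "\<beta> b u = \<zero>\<^bsub>Y\<^esub>"
proof -
  interpret Y: abelian_group Y by fact
  have z: "\<beta> \<zero>\<^bsub>B\<^esub> x = \<zero>\<^bsub>Y\<^esub>" if "x \<in> carrier M" for x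
    using addl[of "\<zero>\<^bsub>B\<^esub>" "\<zero>\<^bsub>B\<^esub>" x] cl[of "\<zero>\<^bsub>B\<^esub>" x] that by simp
  define g where "g f = (\<Oplus>\<^bsub>Y\<^esub>x\<in>{x \<in> carrier M. f x \<noteq> \<zero>\<^bsub>B\<^esub>}. \<beta> (f x) x)" for f
  have Fc: "f x \<in> carrier B" if "f \<in> carrier F" "x \<in> carrier M" for f x
    using that by auto
  have gT: "g f = (\<Oplus>\<^bsub>Y\<^esub>x\<in>T. \<beta> (f x) x)"
    if "f \<in> carrier F" "finite T" "T \<subseteq> carrier M" "{x \<in> carrier M. f x \<noteq> \<zero>\<^bsub>B\<^esub>} \<subseteq> T" for f T
    unfolding g_def
    using that Fc[OF that(1)] by (intro Y.add.finprod_mono_neutral_cong_left) (auto intro!: cl z)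
  have fin: "finite {x \<in> carrier M. f x \<noteq> \<zero>\<^bsub>B\<^esub>}" if "f \<in> carrier F" for f using that by simp
  have gc: "g f \<in> carrier Y" if "f \<in> carrier F" for f
    unfolding g_def using Fc[OF that] by (intro Y.finsum_closed) (auto intro!: cl)
  have gadd: "g (f \<oplus>\<^bsub>F\<^esub> h) = g f \<oplus>\<^bsub>Y\<^esub> g h" if f: "f \<in> carrier F" and h: "h \<in> carrier F" for f h
  proof -
    define T where "T = {x \<in> carrier M. f x \<noteq> \<zero>\<^bsub>B\<^esub>} \<union> {x \<in> carrier M. h x \<noteq> \<zero>\<^bsub>B\<^esub>}"
    have T: "finite T" "T \<subseteq> carrier M" using fin[OF f] fin[OF h] by (auto simp: T_def)
    have "g (f \<oplus>\<^bsub>F\<^esub> h) = (\<Oplus>\<^bsub>Y\<^esub>x\<in>T. \<beta> ((f \<oplus>\<^bsub>F\<^esub> h) x) x)"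
    proof (rule gT[OF F.M.a_closed[OF f h] T])
      show "{x \<in> carrier M. (f \<oplus>\<^bsub>F\<^esub> h) x \<noteq> \<zero>\<^bsub>B\<^esub>} \<subseteq> T" by (auto simp: T_def)
    qed
    also have "\<dots> = (\<Oplus>\<^bsub>Y\<^esub>x\<in>T. \<beta> (f x) x \<oplus>\<^bsub>Y\<^esub> \<beta> (h x) x)"
      using T(2) Fc[OF f] Fc[OF h] by (intro Y.finsum_cong') (auto simp: addl intro!: cl)
    also have "\<dots> = (\<Oplus>\<^bsub>Y\<^esub>x\<in>T. \<beta> (f x) x) \<oplus>\<^bsub>Y\<^esub> (\<Oplus>\<^bsub>Y\<^esub>x\<in>T. \<beta> (h x) x)"
      using T(2) Fc[OF f] Fc[OF h] by (intro Y.finsum_addf) (auto intro!: cl)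
    also have "\<dots> = g f \<oplus>\<^bsub>Y\<^esub> g h" using gT[OF f T] gT[OF h T] by (simp add: T_def)
    finally show ?thesis .
  qed
  have gdelta: "g (c \<odot>\<^bsub>F\<^esub> \<delta> x) = \<beta> c x" if c: "c \<in> carrier B" and x: "x \<in> carrier M" for c x
  proof -
    have "g (c \<odot>\<^bsub>F\<^esub> \<delta> x) = (\<Oplus>\<^bsub>Y\<^esub>y\<in>{x}. \<beta> ((c \<odot>\<^bsub>F\<^esub> \<delta> x) y) y)"
      using c x by (intro gT F.smult_closed delta_closed) (auto simp: free_generator_def split: if_splits)
    also have "\<dots> = \<beta> ((c \<odot>\<^bsub>F\<^esub> \<delta> x) x) x \<oplus>\<^bsub>Y\<^esub> \<zero>\<^bsub>Y\<^esub>"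
      using c x by (subst Y.finsum_insert) (auto simp: free_generator_def intro!: cl)
    also have "\<dots> = \<beta> c x" using c x cl by (simp add: free_generator_def)
    finally show ?thesis .
  qed
  have gdiff: "g (c \<odot>\<^bsub>F\<^esub> (f \<ominus>\<^bsub>F\<^esub> h)) = \<zero>\<^bsub>Y\<^esub>"
    if "c \<in> carrier B" "f \<in> carrier F" "h \<in> carrier F" "g (c \<odot>\<^bsub>F\<^esub> f) = g (c \<odot>\<^bsub>F\<^esub> h)" for c f h
  proof -
    note cl' = F.smult_closed[OF that(1,2)] F.smult_closed[OF that(1,3)]
      F.smult_closed[OF that(1) F.M.minus_closed[OF that(2,3)]]
    have "f = (f \<ominus>\<^bsub>F\<^esub> h) \<oplus>\<^bsub>F\<^esub> h"
      using that(2,3) by (simp add: F.M.minus_eq F.M.a_assoc F.M.l_neg del: free_module_simps)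
    then have "c \<odot>\<^bsub>F\<^esub> f = c \<odot>\<^bsub>F\<^esub> (f \<ominus>\<^bsub>F\<^esub> h) \<oplus>\<^bsub>F\<^esub> c \<odot>\<^bsub>F\<^esub> h"
      using that F.smult_r_distr[of c "f \<ominus>\<^bsub>F\<^esub> h" h] by (simp del: free_module_simps)
    then have "g (c \<odot>\<^bsub>F\<^esub> f) = g (c \<odot>\<^bsub>F\<^esub> (f \<ominus>\<^bsub>F\<^esub> h)) \<oplus>\<^bsub>Y\<^esub> g (c \<odot>\<^bsub>F\<^esub> h)"
      using gadd[OF cl'(3,2)] by simp
    then show ?thesis
      using gc[OF cl'(3)] gc[OF cl'(2)] that(4) by (metis Y.add.r_cancel_one')
  qed
  \<comment> \<open>\<open>g\<close> is only additive, so its kernel need not be a submodule;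
    \<open>N\<close> is the largest submodule inside it.\<close>
  define N where "N = {f \<in> carrier F. \<forall>c\<in>carrier B. g (c \<odot>\<^bsub>F\<^esub> f) = \<zero>\<^bsub>Y\<^esub>}"
  have NI: "f \<in> N" if "f \<in> carrier F" "\<And>c. c \<in> carrier B \<Longrightarrow> g (c \<odot>\<^bsub>F\<^esub> f) = \<zero>\<^bsub>Y\<^esub>" for f
    using that by (simp add: N_def del: free_module_simps)
  have ND: "f \<in> carrier F" "\<And>c. c \<in> carrier B \<Longrightarrow> g (c \<odot>\<^bsub>F\<^esub> f) = \<zero>\<^bsub>Y\<^esub>" if "f \<in> N" for f
    using that by (simp_all add: N_def del: free_module_simps)
  have g0: "g \<zero>\<^bsub>F\<^esub> = \<zero>\<^bsub>Y\<^esub>"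
  proof -
    have "g \<zero>\<^bsub>F\<^esub> = (\<Oplus>\<^bsub>Y\<^esub>x\<in>{}. \<beta> (\<zero>\<^bsub>F\<^esub> x) x)"
      by (rule gT) (auto simp: restrict_def)
    then show ?thesis by simp
  qed
  have Ns: "submodule N B F"
  proof (rule F.submoduleI)
    show "N \<subseteq> carrier F" using ND by blast
    show "\<zero>\<^bsub>F\<^esub> \<in> N"
    proof (rule NI)
      fix c assume "c \<in> carrier B"
      then have "c \<odot>\<^bsub>F\<^esub> \<zero>\<^bsub>F\<^esub> = \<zero>\<^bsub>F\<^esub>" by (rule F.smult_r_null)
      then show "g (c \<odot>\<^bsub>F\<^esub> \<zero>\<^bsub>F\<^esub>) = \<zero>\<^bsub>Y\<^esub>" using g0 by (simp del: free_module_simps)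
    qed (rule F.M.zero_closed)
    show sm: "a \<odot>\<^bsub>F\<^esub> f \<in> N" if "a \<in> carrier B" "f \<in> N" for a f
    proof (rule NI)
      fix c assume c: "c \<in> carrier B"
      have "c \<odot>\<^bsub>F\<^esub> (a \<odot>\<^bsub>F\<^esub> f) = (c \<otimes>\<^bsub>B\<^esub> a) \<odot>\<^bsub>F\<^esub> f"
        by (rule F.smult_assoc1[OF c that(1) ND(1)[OF that(2)], symmetric])
      then show "g (c \<odot>\<^bsub>F\<^esub> (a \<odot>\<^bsub>F\<^esub> f)) = \<zero>\<^bsub>Y\<^esub>"
        using ND(2)[OF that(2), of "c \<otimes>\<^bsub>B\<^esub> a"] c that by (simp del: free_module_simps)
    qed (rule F.smult_closed[OF that(1) ND(1)[OF that(2)]])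
    show "f \<oplus>\<^bsub>F\<^esub> h \<in> N" if "f \<in> N" "h \<in> N" for f h
    proof (rule NI)
      note fh = ND(1)[OF that(1)] ND(1)[OF that(2)]
      show "f \<oplus>\<^bsub>F\<^esub> h \<in> carrier F" by (rule F.M.a_closed[OF fh])
      fix c assume c: "c \<in> carrier B"
      show "g (c \<odot>\<^bsub>F\<^esub> (f \<oplus>\<^bsub>F\<^esub> h)) = \<zero>\<^bsub>Y\<^esub>"
        unfolding F.smult_r_distr[OF c fh] gadd[OF F.smult_closed[OF c fh(1)] F.smult_closed[OF c fh(2)]]
        using ND(2)[OF that(1) c] ND(2)[OF that(2) c] by simp
    qed
    show "\<ominus>\<^bsub>F\<^esub> f \<in> N" if "f \<in> N" for f
    proof -
      have "\<ominus>\<^bsub>F\<^esub> f = (\<ominus>\<^bsub>B\<^esub> \<one>\<^bsub>B\<^esub>) \<odot>\<^bsub>F\<^esub> f"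
        using F.smult_l_minus[OF B.one_closed ND(1)[OF that]] F.smult_one[OF ND(1)[OF that]] by simp
      then show ?thesis using sm[of "\<ominus>\<^bsub>B\<^esub> \<one>\<^bsub>B\<^esub>" f] that by simp
    qed
  qed
  have "relators \<subseteq> N"
  proof
    fix f assume f: "f \<in> relators"
    then have fc: "f \<in> carrier F" using relators_carrier by blast
    show "f \<in> N"
    proof (rule NI[OF fc])
      fix c assume c: "c \<in> carrier B"
      from f consider x y where "x \<in> carrier M" "y \<in> carrier M" "f = \<delta> (x \<oplus>\<^bsub>M\<^esub> y) \<ominus>\<^bsub>F\<^esub> (\<delta> x \<oplus>\<^bsub>F\<^esub> \<delta> y)"
        | a x where "a \<in> carrier A" "x \<in> carrier M" "f = \<delta> (a \<odot>\<^bsub>M\<^esub> x) \<ominus>\<^bsub>F\<^esub> (\<phi> a \<odot>\<^bsub>F\<^esub> \<delta> x)"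
        unfolding relators_def by blast
      then show "g (c \<odot>\<^bsub>F\<^esub> f) = \<zero>\<^bsub>Y\<^esub>"
      proof cases
        case 1
        note d = delta_closed[OF 1(1)] delta_closed[OF 1(2)]
        show ?thesis unfolding 1(3)
        proof (rule gdiff[OF c delta_closed F.M.a_closed[OF d]])
          show "g (c \<odot>\<^bsub>F\<^esub> \<delta> (x \<oplus>\<^bsub>M\<^esub> y)) = g (c \<odot>\<^bsub>F\<^esub> (\<delta> x \<oplus>\<^bsub>F\<^esub> \<delta> y))"
            unfolding F.smult_r_distr[OF c d] gadd[OF F.smult_closed[OF c d(1)] F.smult_closed[OF c d(2)]]
            using 1 c by (simp add: gdelta addr del: free_module_simps)
        qed (use 1 in auto)
      next
        case 2
        note d = delta_closed[OF 2(2)]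
        show ?thesis unfolding 2(3)
        proof (rule gdiff[OF c delta_closed F.smult_closed[OF \<phi>_closed[OF 2(1)] d]])
          show "g (c \<odot>\<^bsub>F\<^esub> \<delta> (a \<odot>\<^bsub>M\<^esub> x)) = g (c \<odot>\<^bsub>F\<^esub> (\<phi> a \<odot>\<^bsub>F\<^esub> \<delta> x))"
            unfolding F.smult_assoc1[OF c \<phi>_closed[OF 2(1)] d, symmetric]
            using 2 c \<phi>_closed[OF 2(1)] bal[OF c 2(1,2)] by (simp add: gdelta del: free_module_simps)
        qed (use 2 in auto)
      qed
    qed
  qed
  then have "Rel \<subseteq> N" using Ns unfolding Rel_eq by blast
  moreover have "b \<odot>\<^bsub>F\<^esub> \<delta> u \<in> Rel"
  proof -
    have d: "\<delta> u \<in> carrier F" by (rule delta_closed[OF b(2)])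
    have "Rel +>\<^bsub>F\<^esub> (b \<odot>\<^bsub>F\<^esub> \<delta> u) = Rel"
      using b(3) unfolding BM_eq elt_eq Q.quotient_smult[OF b(1) d] Q.quotient_zero .
    then show ?thesis using Q.quotient_eq_zero_iff[OF F.smult_closed[OF b(1) d]] by simp
  qed
  ultimately have "b \<odot>\<^bsub>F\<^esub> \<delta> u \<in> N" by blast
  then have "g (\<one>\<^bsub>B\<^esub> \<odot>\<^bsub>F\<^esub> (b \<odot>\<^bsub>F\<^esub> \<delta> u)) = \<zero>\<^bsub>Y\<^esub>" using ND(2) by blast
  also have "\<one>\<^bsub>B\<^esub> \<odot>\<^bsub>F\<^esub> (b \<odot>\<^bsub>F\<^esub> \<delta> u) = b \<odot>\<^bsub>F\<^esub> \<delta> u"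
    by (rule F.smult_one[OF F.smult_closed[OF b(1) delta_closed[OF b(2)]]])
  finally show ?thesis unfolding gdelta[OF b(1,2)] .
qed

end

section \<open>Tight closure of zero\<close>

text \<open>The elements of \<open>Hom\<^sub>A(F\<^sup>e\<^sub>*A, N)\<close>, where \<open>q = p\<^sup>e\<close>.\<close>

definition root_linear :: "('a, 'r) ring_scheme \<Rightarrow> nat \<Rightarrow> ('a, 'b, 'm) module_scheme \<Rightarrow> ('a \<Rightarrow> 'b) \<Rightarrow> bool" where
  "root_linear A q N \<phi> \<longleftrightarrow> \<phi> \<in> carrier A \<rightarrow> carrier N \<and>
     (\<forall>x\<in>carrier A. \<forall>y\<in>carrier A. \<phi> (x \<oplus>\<^bsub>A\<^esub> y) = \<phi> x \<oplus>\<^bsub>N\<^esub> \<phi> y) \<and>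
     (\<forall>a\<in>carrier A. \<forall>x\<in>carrier A. \<phi> (a [^]\<^bsub>A\<^esub> q \<otimes>\<^bsub>A\<^esub> x) = a \<odot>\<^bsub>N\<^esub> \<phi> x)"

lemma
  assumes "root_linear A q N \<phi>"
  shows root_linear_closed: "x \<in> carrier A \<Longrightarrow> \<phi> x \<in> carrier N"
    and root_linear_add: "x \<in> carrier A \<Longrightarrow> y \<in> carrier A \<Longrightarrow> \<phi> (x \<oplus>\<^bsub>A\<^esub> y) = \<phi> x \<oplus>\<^bsub>N\<^esub> \<phi> y"
    and root_linear_smult: "a \<in> carrier A \<Longrightarrow> x \<in> carrier A \<Longrightarrow> \<phi> (a [^]\<^bsub>A\<^esub> q \<otimes>\<^bsub>A\<^esub> x) = a \<odot>\<^bsub>N\<^esub> \<phi> x"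
  using assms by (auto simp: root_linear_def)

text \<open>The endomorphisms of \<open>F\<^sub>*A\<close> which factor through a finite free module.\<close>

inductive frobenius_combination :: "('a, 'r) ring_scheme \<Rightarrow> nat \<Rightarrow> ('a \<Rightarrow> 'a) \<Rightarrow> bool" for A p where
  zero: "frobenius_combination A p (\<lambda>_. \<zero>\<^bsub>A\<^esub>)"
| add: "frobenius_combination A p f \<Longrightarrow> root_linear A p (self_module A) \<phi> \<Longrightarrow> b \<in> carrier A \<Longrightarrow>
    frobenius_combination A p (\<lambda>x. f x \<oplus>\<^bsub>A\<^esub> \<phi> x [^]\<^bsub>A\<^esub> p \<otimes>\<^bsub>A\<^esub> b)"

text \<open>Hence \<open>F\<^sub>*A\<close> is projective after inverting \<open>c\<close>.\<close>

definition frobenius_dual_basis :: "('a, 'r) ring_scheme \<Rightarrow> nat \<Rightarrow> 'a \<Rightarrow> bool" where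
  "frobenius_dual_basis A p c \<longleftrightarrow>
     (\<exists>f. frobenius_combination A p f \<and> (\<forall>x\<in>carrier A. c \<otimes>\<^bsub>A\<^esub> x = f x))"

lemma (in cring) frobenius_combination_closed:
  assumes "frobenius_combination R p f" "x \<in> carrier R"
  shows "f x \<in> carrier R"
  using assms
proof (induct rule: frobenius_combination.induct)
  case (add f \<phi> b)
  then show ?case using root_linear_closed[OF add(3), of x] by simp
qed simp

locale frobenius_module = A: cring A + W: module A W for A (structure) and W +
  fixes p :: nat
begin

lemma ext: "scalar_extension A A W (frobenius A p e)"
  by unfold_locales (simp add: frobenius_def)

lemmas elt_closed = scalar_extension.elt_closed[OF ext]
lemmas elt_add = scalar_extension.elt_add[OF ext]
lemmas elt_smult = scalar_extension.elt_smult[OF ext]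
lemmas universal = scalar_extension.universal[OF ext]
lemmas Fr_module = scalar_extension.BM_module[OF ext]
lemmas Fr_smult_closed = module.smult_closed[OF Fr_module]
lemmas Fr_smult_l_distr = module.smult_l_distr[OF Fr_module]
lemmas Fr_smult_r_distr = module.smult_r_distr[OF Fr_module]
lemmas Fr_smult_assoc1 = module.smult_assoc1[OF Fr_module]
lemmas Fr_group = module.axioms(2)[OF Fr_module]

abbreviation "Fr e \<equiv> base_change A A (frobenius A p e) W"
abbreviation "el e \<equiv> base_change_elem A A (frobenius A p e) W"

text \<open>The condition \<open>x u^q = 0\<close> in \<open>F^e(W)\<close> for
  \<open>q = p^e\<close>.\<close>

definition annihilated where
  "annihilated e u x \<longleftrightarrow> x \<odot>\<^bsub>Fr e\<^esub> el e u = \<zero>\<^bsub>Fr e\<^esub>"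

lemma tight_closure_zero_iff:
  "u \<in> tight_closure_zero A p W \<longleftrightarrow>
     u \<in> carrier W \<and> (\<exists>c\<in>avoiding_minimal_primes A. \<exists>e0. \<forall>e\<ge>e0. annihilated e u c)"
  by (simp add: tight_closure_zero_def annihilated_def)

lemma annihilated_zero: "u \<in> carrier W \<Longrightarrow> annihilated e u \<zero>"
  by (simp add: annihilated_def elt_closed module.smult_l_null[OF Fr_module])

lemma annihilated_add:
  "u \<in> carrier W \<Longrightarrow> x \<in> carrier A \<Longrightarrow> y \<in> carrier A \<Longrightarrow> annihilated e u x \<Longrightarrow> annihilated e u y \<Longrightarrow>
    annihilated e u (x \<oplus> y)"
  by (simp add: annihilated_def elt_closed Fr_smult_l_distr
      abelian_monoid.l_zero[OF abelian_group.axioms(1)[OF Fr_group]]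
      abelian_monoid.zero_closed[OF abelian_group.axioms(1)[OF Fr_group]])

lemma annihilated_mult:
  "u \<in> carrier W \<Longrightarrow> a \<in> carrier A \<Longrightarrow> x \<in> carrier A \<Longrightarrow> annihilated e u x \<Longrightarrow> annihilated e u (a \<otimes> x)"
  by (simp add: annihilated_def elt_closed Fr_smult_assoc1 module.smult_r_null[OF Fr_module])

text \<open>A \<open>p^-1\<close>-linear \<phi> turns \<open>d u^(p q) = 0\<close> into
  \<open>\<phi>(d) u^q = 0\<close>. The pairing of \<open>b\<close> and \<open>x\<close> to
  \<open>\<phi>(b) x^q\<close> is balanced over the next Frobenius power because
  \<open>\<phi>(b a^(p q)) = a^q \<phi>(b)\<close>.\<close>

lemma annihilated_root_linear:
  assumes \<phi>: "root_linear A p (self_module A) \<phi>" and u: "u \<in> carrier W" and d: "d \<in> carrier A"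
    and "annihilated (Suc e) u d"
  shows "annihilated e u (\<phi> d)"
  unfolding annihilated_def
proof (rule universal[where e = "Suc e" and \<beta> = "\<lambda>b x. \<phi> b \<odot>\<^bsub>Fr e\<^esub> el e x"])
  note \<phi>c = root_linear_closed[OF \<phi>, simplified]
  show "abelian_group (Fr e)" by (rule Fr_group)
  show "d \<odot>\<^bsub>Fr (Suc e)\<^esub> el (Suc e) u = \<zero>\<^bsub>Fr (Suc e)\<^esub>" using assms(4) by (simp add: annihilated_def)
  show "\<phi> b \<odot>\<^bsub>Fr e\<^esub> el e x \<in> carrier (Fr e)" if "b \<in> carrier A" "x \<in> carrier W" for b x
    using that \<phi>c by (simp add: elt_closed Fr_smult_closed)
  show "\<phi> (b \<oplus> c) \<odot>\<^bsub>Fr e\<^esub> el e x = \<phi> b \<odot>\<^bsub>Fr e\<^esub> el e x \<oplus>\<^bsub>Fr e\<^esub> \<phi> c \<odot>\<^bsub>Fr e\<^esub> el e x"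
    if "b \<in> carrier A" "c \<in> carrier A" "x \<in> carrier W" for b c x
    using that \<phi>c by (simp add: elt_closed root_linear_add[OF \<phi>] Fr_smult_l_distr)
  show "\<phi> b \<odot>\<^bsub>Fr e\<^esub> el e (x \<oplus>\<^bsub>W\<^esub> y) = \<phi> b \<odot>\<^bsub>Fr e\<^esub> el e x \<oplus>\<^bsub>Fr e\<^esub> \<phi> b \<odot>\<^bsub>Fr e\<^esub> el e y"
    if "b \<in> carrier A" "x \<in> carrier W" "y \<in> carrier W" for b x y
    using that \<phi>c by (simp add: elt_closed elt_add Fr_smult_r_distr)
  show "\<phi> (b \<otimes> frobenius A p (Suc e) a) \<odot>\<^bsub>Fr e\<^esub> el e x = \<phi> b \<odot>\<^bsub>Fr e\<^esub> el e (a \<odot>\<^bsub>W\<^esub> x)"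
    if b: "b \<in> carrier A" and a: "a \<in> carrier A" and x: "x \<in> carrier W" for b a x
  proof -
    have "b \<otimes> frobenius A p (Suc e) a = (a [^] (p ^ e)) [^] p \<otimes> b"
      using a b by (simp add: frobenius_def A.nat_pow_pow A.m_comm mult.commute)
    then have "\<phi> (b \<otimes> frobenius A p (Suc e) a) = frobenius A p e a \<otimes> \<phi> b"
      using root_linear_smult[OF \<phi>, of "a [^] (p ^ e)" b] a b by (simp add: frobenius_def)
    also have "\<dots> = \<phi> b \<otimes> frobenius A p e a"
      using a b \<phi>c by (simp add: frobenius_def A.m_comm)
    finally show ?thesis
      using a b x \<phi>c by (simp add: elt_smult elt_closed frobenius_def Fr_smult_assoc1)
  qed
qed (use u d in auto)

text \<open>The ideal \<open>I\<close> of elements killing all \<open>u\<^sup>q\<close>, \<open>q \<ge> q\<^sub>0\<close>, is stable under \<open>p\<^sup>-\<^sup>1\<close>-linear maps, so the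
  dual basis gives \<open>c I \<subseteq> I\<^sup>2\<close>.\<close>

lemma power_annihilates:
  assumes noeth: "noetherian_ring A" and p: "p \<ge> 2" and c: "c \<in> carrier A"
    and basis: "frobenius_dual_basis A p c" and u: "u \<in> carrier W"
    and d: "d \<in> avoiding_minimal_primes A" and ann: "\<And>e. e \<ge> e0 \<Longrightarrow> annihilated e u d"
  shows "\<exists>N. \<forall>e\<ge>e0. annihilated e u (c [^] (N::nat))"
proof -
  define I where "I = {x \<in> carrier A. \<forall>e\<ge>e0. annihilated e u x}"
  have I: "ideal I A"
    by (rule A.idealI')
      (auto simp: I_def u annihilated_zero annihilated_add annihilated_mult)
  have mem_I: "x \<in> I \<longleftrightarrow> x \<in> carrier A \<and> (\<forall>e\<ge>e0. annihilated e u x)" for x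
    by (auto simp: I_def)
  interpret I: ideal I A by fact
  obtain f where f: "frobenius_combination A p f" "\<And>x. x \<in> carrier A \<Longrightarrow> c \<otimes> x = f x"
    using basis unfolding frobenius_dual_basis_def by blast
  \<comment> \<open>At least two factors \<open>y\<close> are needed to write \<open>y^p b\<close>
    as a product of two elements of \<open>I\<close>.\<close>
  obtain k where k: "p = Suc (Suc k)" using p by (metis add_2_eq_Suc le_Suc_ex)
  interpret II: ideal "ideal_prod A I I" A by (intro A.ideal_prod_is_ideal I)
  have "f x \<in> ideal_prod A I I" if x: "x \<in> I" for x
    using f(1)
  proof (induct rule: frobenius_combination.induct)
    case (add f \<phi> b)
    have x': "x \<in> carrier A" "\<And>e. e \<ge> e0 \<Longrightarrow> annihilated e u x" using x unfolding mem_I by blast+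
    define y where "y = \<phi> x"
    have y: "y \<in> I"
      unfolding mem_I y_def using root_linear_closed[OF add(3) x'(1)]
      by (auto intro!: annihilated_root_linear[OF add(3) u x'(1) x'(2)])
    have "y [^] p \<otimes> b = y \<otimes> (y [^] k \<otimes> b \<otimes> y)"
      unfolding k using I.Icarr[OF y] add(4) by (simp add: A.m_ac)
    moreover have "y [^] k \<otimes> b \<otimes> y \<in> I" using I.Icarr[OF y] y add(4) by (intro I.I_l_closed) auto
    ultimately have "y [^] p \<otimes> b \<in> ideal_prod A I I"
      using y ideal_prod.prod[of y I "y [^] k \<otimes> b \<otimes> y" I A] by simp
    then show ?case using add(2) unfolding y_def by (rule II.a_closed[rotated])
  qed (rule II.zero_closed)
  then have "c \<otimes> x \<in> ideal_prod A I I" if "x \<in> I" for x using that f(2)[OF I.Icarr[OF that]] by simp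
  moreover have "d \<in> I" using d ann unfolding mem_I by (simp add: avoiding_minimal_primes_def)
  ultimately obtain N :: nat where "c [^] N \<in> I"
    using power_in_ideal_of_square_absorbing[OF noeth A.is_cring I c _ _ d] by blast
  then show ?thesis unfolding mem_I by blast
qed

text \<open>The dual basis at 1 writes \<open>c\<close> as a sum of terms
  \<open>\<phi>(1)^p b\<close>. Replacing one factor \<open>\<phi>(1)\<close> in each term by the
  map \<phi> gives the sum of the maps \<open>\<phi>(1)^(p-1) b \<phi>\<close>, which is again
  \<open>p^-1\<close>-linear and takes the value \<open>c\<close> at 1.\<close>

lemma root_linear_one:
  assumes p: "p \<ge> 2" and c: "c \<in> carrier A" and basis: "frobenius_dual_basis A p c"
  shows "\<exists>\<psi>. root_linear A p (self_module A) \<psi> \<and> \<psi> \<one> = c"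
proof -
  obtain f where f: "frobenius_combination A p f" "\<And>x. x \<in> carrier A \<Longrightarrow> c \<otimes> x = f x"
    using basis unfolding frobenius_dual_basis_def by blast
  obtain k where k: "p = Suc k" using p by (cases p) auto
  have "\<exists>\<psi>. root_linear A p (self_module A) \<psi> \<and> \<psi> \<one> = f \<one>"
    using f(1)
  proof (induct rule: frobenius_combination.induct)
    case zero
    show ?case by (rule exI[of _ "\<lambda>_. \<zero>"]) (simp add: root_linear_def)
  next
    case (add f \<phi> b)
    then obtain \<psi> where \<psi>: "root_linear A p (self_module A) \<psi>" "\<psi> \<one> = f \<one>" by blast
    note cl = root_linear_closed[OF \<psi>(1), simplified] root_linear_closed[OF add(3), simplified]
    define m where "m = \<phi> \<one> [^] k \<otimes> b"
    have m: "m \<in> carrier A" using cl(2)[of \<one>] add(4) by (simp add: m_def)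
    have "root_linear A p (self_module A) (\<lambda>x. \<psi> x \<oplus> m \<otimes> \<phi> x)"
      unfolding root_linear_def using cl m
      by (auto simp: root_linear_add[OF \<psi>(1)] root_linear_add[OF add(3)] root_linear_smult[OF \<psi>(1)]
          root_linear_smult[OF add(3)] A.r_distr A.a_ac A.m_lcomm)
    moreover have "\<psi> \<one> \<oplus> m \<otimes> \<phi> \<one> = f \<one> \<oplus> \<phi> \<one> [^] p \<otimes> b"
      unfolding m_def k using \<psi>(2) cl(2)[of \<one>] add(4) by (simp add: A.m_ac)
    ultimately show ?case by (intro exI[of _ "\<lambda>x. \<psi> x \<oplus> m \<otimes> \<phi> x"]) simp
  qed
  then show ?thesis using f(2)[of \<one>] c by simp
qed

text \<open>A map \<open>\<psi>\<close> with \<open>\<psi>(1) = c\<close> sends \<open>c\<^sup>p\<^sup>j\<close> to \<open>c\<^sup>j\<^sup>+\<^sup>1\<close>, which lowers any exponent to at most 3.\<close>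

theorem tight_closure_zero_test:
  assumes noeth: "noetherian_ring A" and p: "p \<ge> 2" and c: "c \<in> avoiding_minimal_primes A"
    and basis: "frobenius_dual_basis A p c"
  shows "tight_closure_zero A p W = {u \<in> carrier W. \<forall>e. annihilated e u (c [^] (3::nat))}"
proof
  have cc: "c \<in> carrier A" using c by (simp add: avoiding_minimal_primes_def)
  show "{u \<in> carrier W. \<forall>e. annihilated e u (c [^] (3::nat))} \<subseteq> tight_closure_zero A p W"
  proof -
    have "c [^] (3::nat) \<in> avoiding_minimal_primes A"
      using c primeideal.pow_memD[of _ A c 3] by (auto simp: avoiding_minimal_primes_def minimal_prime_def)
    then show ?thesis unfolding tight_closure_zero_iff subset_eq by blast
  qed
  show "tight_closure_zero A p W \<subseteq> {u \<in> carrier W. \<forall>e. annihilated e u (c [^] (3::nat))}"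
  proof
    fix u assume "u \<in> tight_closure_zero A p W"
    then obtain d e0 where u: "u \<in> carrier W" and d: "d \<in> avoiding_minimal_primes A"
      "\<And>e. e \<ge> e0 \<Longrightarrow> annihilated e u d"
      unfolding tight_closure_zero_iff by blast
    obtain \<psi> where \<psi>: "root_linear A p (self_module A) \<psi>" "\<psi> \<one> = c"
      using root_linear_one[OF p cc basis] by blast
    have up: "annihilated e u (c [^] n)" if "annihilated e u (c [^] m)" "m \<le> n" for e and m n :: nat
    proof -
      have "c [^] n = c [^] (n - m) \<otimes> c [^] m" using that(2) cc by (simp add: A.nat_pow_mult)
      then show ?thesis using annihilated_mult[OF u _ _ that(1)] cc by simp
    qed
    \<comment> \<open>Since \<open>p \<ge> 2\<close>, \<open>c^(p j)\<close> is a multiple of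
      \<open>c^N\<close>, and \<psi> takes it to \<open>c^(j+1)\<close> while lowering the Frobenius
      exponent by one.\<close>
    have down: "annihilated e u (c [^] (Suc j))" if "annihilated (Suc e) u (c [^] N)" "N \<le> 2 * j"
      for e N j :: nat
    proof -
      have "2 * j \<le> p * j" using p by simp
      then have "annihilated (Suc e) u (c [^] (p * j))" using that by (intro up[OF that(1)]) linarith
      then have "annihilated e u (\<psi> (c [^] (p * j)))"
        using annihilated_root_linear[OF \<psi>(1) u] cc by simp
      moreover have "\<psi> (c [^] (p * j)) = c [^] (Suc j)"
      proof -
        have "c [^] (p * j) = (c [^] j) [^] p \<otimes> \<one>" using cc by (simp add: A.nat_pow_pow mult.commute)
        then show ?thesis using root_linear_smult[OF \<psi>(1), of "c [^] j" \<one>] \<psi>(2) cc by simp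
      qed
      ultimately show ?thesis by simp
    qed
    obtain N :: nat where N: "\<And>e. e \<ge> e0 \<Longrightarrow> annihilated e u (c [^] N)"
      using power_annihilates[OF noeth p cc basis u d] by blast
    have three: "annihilated e u (c [^] (3::nat))" if "e \<ge> e0" for e
      using N that
    proof (induct N arbitrary: e rule: less_induct)
      case (less N)
      show ?case
      proof (cases "N \<le> 3")
        case True
        then show ?thesis using less up by blast
      next
        case False
        \<comment> \<open>Half of \<open>N\<close>, rounded up. The inequality
          \<open>j + 1 < N\<close> holds exactly for \<open>N > 3\<close>, which is the origin of
          the exponent 3.\<close>
        define j where "j = (N + 1) div 2"
        have j: "N \<le> 2 * j" "Suc j < N" using False by (auto simp: j_def)
        show ?thesis
          by (rule less(1)[OF j(2)]) (use down[OF _ j(1)] less in auto)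
      qed
    qed
    \<comment> \<open>From exponent 3 the descent with \<open>j = 2\<close> returns exponent 3, so
      it can be continued below \<open>e0\<close> and the bound disappears.\<close>
    have "annihilated e u (c [^] (3::nat))" if "e + k \<ge> e0" for e k
      using that
    proof (induct k arbitrary: e)
      case 0
      then show ?case using three by simp
    next
      case (Suc k)
      then have "annihilated (Suc e) u (c [^] (3::nat))" by simp
      from down[OF this, of 2] show ?case by (simp add: numeral_3_eq_3 numeral_2_eq_2)
    qed
    then have "annihilated e u (c [^] (3::nat))" for e by (meson le_add2)
    then show "u \<in> {u \<in> carrier W. \<forall>e. annihilated e u (c [^] (3::nat))}" using u by simp
  qed
qed

end

section \<open>Dual bases of the Frobenius pushforward\<close>

context cring
begin

lemma add_diff_cancel: "u \<in> carrier R \<Longrightarrow> v \<in> carrier R \<Longrightarrow> u \<oplus> v \<ominus> v = u"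
  by algebra

lemma binomial:
  assumes x: "x \<in> carrier R" and y: "y \<in> carrier R"
  shows "(x \<oplus> y) [^] (n::nat) = (\<Oplus>k\<in>{..n}. [(n choose k)] \<cdot> (x [^] k \<otimes> y [^] (n - k)))"
proof (induct n)
  case 0
  have "(\<Oplus>k\<in>{..0::nat}. [(0 choose k)] \<cdot> (x [^] k \<otimes> y [^] (0 - k))) = [(0 choose 0)] \<cdot> (x [^] (0::nat) \<otimes> y [^] (0 - 0 :: nat))"
    using x y by (subst finsum_0) auto
  then show ?case by simp
next
  case (Suc n)
  define t where "t n k = [(n choose k)] \<cdot> (x [^] k \<otimes> y [^] (n - k))" for n k :: nat
  have tc: "t m k \<in> carrier R" for m k using x y by (simp add: t_def)
  have s: "t (Suc n) (Suc j) = x \<otimes> t n j \<oplus> y \<otimes> t n (Suc j)" if "j \<le> n" for j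
  proof -
    have 1: "[(n choose j)] \<cdot> (x [^] Suc j \<otimes> y [^] (n - j)) = x \<otimes> t n j"
      using x y by (simp add: t_def add_pow_rdistr m_ac)
    \<comment> \<open>For \<open>j = n\<close> truncated subtraction makes the exponent of
      \<open>y\<close> on the right too large by one, but the binomial coefficient vanishes.\<close>
    have 2: "[(n choose Suc j)] \<cdot> (x [^] Suc j \<otimes> y [^] (n - j)) = y \<otimes> t n (Suc j)"
    proof (cases "j = n")
      case True
      then show ?thesis using x y by (simp add: t_def binomial_eq_0)
    next
      case False
      then have "n - j = Suc (n - Suc j)" using that by simp
      then show ?thesis using x y by (simp add: t_def add_pow_rdistr m_ac)
    qed
    have "t (Suc n) (Suc j) = [((n choose j) + (n choose Suc j))] \<cdot> (x [^] Suc j \<otimes> y [^] (n - j))"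
      by (simp add: t_def)
    also have "\<dots> = [(n choose j)] \<cdot> (x [^] Suc j \<otimes> y [^] (n - j)) \<oplus> [(n choose Suc j)] \<cdot> (x [^] Suc j \<otimes> y [^] (n - j))"
      using x y by (intro add.nat_pow_mult[symmetric]) simp
    finally show ?thesis unfolding 1 2 .
  qed
  have t0: "t (Suc n) 0 = y \<otimes> t n 0" using x y by (simp add: t_def m_comm)
  have tn: "t n (Suc n) = \<zero>" using x y by (simp add: t_def binomial_eq_0)
  have "(\<Oplus>k\<in>{..Suc n}. t (Suc n) k) = (\<Oplus>j\<in>{..n}. t (Suc n) (Suc j)) \<oplus> t (Suc n) 0"
    using tc by (intro finsum_Suc2) auto
  also have "(\<Oplus>j\<in>{..n}. t (Suc n) (Suc j)) = (\<Oplus>j\<in>{..n}. x \<otimes> t n j \<oplus> y \<otimes> t n (Suc j))"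
    using tc x y by (intro finsum_cong') (auto simp: s)
  also have "\<dots> = (\<Oplus>j\<in>{..n}. x \<otimes> t n j) \<oplus> (\<Oplus>j\<in>{..n}. y \<otimes> t n (Suc j))"
    using tc x y by (intro finsum_addf) auto
  also have "(\<Oplus>j\<in>{..n}. x \<otimes> t n j) = x \<otimes> (\<Oplus>j\<in>{..n}. t n j)"
    using tc x by (intro finsum_rdistr[symmetric]) auto
  also have "(\<Oplus>j\<in>{..n}. y \<otimes> t n (Suc j)) = y \<otimes> (\<Oplus>j\<in>{..n}. t n (Suc j))"
    using tc y by (intro finsum_rdistr[symmetric]) auto
  also have "x \<otimes> (\<Oplus>j\<in>{..n}. t n j) \<oplus> y \<otimes> (\<Oplus>j\<in>{..n}. t n (Suc j)) \<oplus> t (Suc n) 0 =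
     x \<otimes> (\<Oplus>j\<in>{..n}. t n j) \<oplus> y \<otimes> ((\<Oplus>j\<in>{..n}. t n (Suc j)) \<oplus> t n 0)"
    unfolding t0 using tc x y by (simp add: finsum_closed Pi_iff r_distr a_assoc)
  also have "(\<Oplus>j\<in>{..n}. t n (Suc j)) \<oplus> t n 0 = (\<Oplus>k\<in>{..Suc n}. t n k)"
    using tc by (intro finsum_Suc2[symmetric]) auto
  also have "\<dots> = (\<Oplus>k\<in>{..n}. t n k)"
    using tc tn by (subst finsum_Suc) (auto simp: finsum_closed Pi_iff)
  also have "x \<otimes> (\<Oplus>j\<in>{..n}. t n j) \<oplus> y \<otimes> (\<Oplus>k\<in>{..n}. t n k) = (x \<oplus> y) \<otimes> (\<Oplus>k\<in>{..n}. t n k)"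
    using tc x y by (simp add: finsum_closed Pi_iff l_distr)
  also have "(\<Oplus>k\<in>{..n}. t n k) = (x \<oplus> y) [^] n" using Suc by (simp add: t_def)
  finally show ?case using x y by (simp add: t_def m_comm)
qed

lemma frobenius_add:
  assumes p: "Factorial_Ring.prime p" "ring_characteristic R p"
    and x: "x \<in> carrier R" and y: "y \<in> carrier R"
  shows "(x \<oplus> y) [^] p = x [^] p \<oplus> y [^] p"
proof -
  have p2: "p \<ge> 2" using p(1) by (rule prime_ge_2_nat)
  have zero: "[n] \<cdot> z = \<zero>" if "p dvd n" "z \<in> carrier R" for n :: nat and z
  proof -
    have "[n] \<cdot> \<one> = \<zero>" using p(2) that by (simp add: ring_characteristic_def)
    then have "([n] \<cdot> \<one>) \<otimes> z = \<zero>" using that by simp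
    then show ?thesis using that add_pow_ldistr[of \<one> z n] by simp
  qed
  define f where "f k = [(p choose k)] \<cdot> (x [^] k \<otimes> y [^] (p - k))" for k
  have fc: "f k \<in> carrier R" for k using x y by (simp add: f_def)
  have "(x \<oplus> y) [^] p = (\<Oplus>k\<in>{..p}. f k)" unfolding f_def by (rule binomial[OF x y])
  also have "\<dots> = (\<Oplus>k\<in>{0, p}. f k)"
  proof (rule add.finprod_mono_neutral_cong_right)
    show "f k = \<zero>" if "k \<in> {..p} - {0, p}" for k
      unfolding f_def using that p(1) p2 x y by (intro zero dvd_choose_prime) auto
  qed (use fc in auto)
  also have "\<dots> = f 0 \<oplus> f p" using p2 fc by (subst finsum_insert) auto
  also have "\<dots> = x [^] p \<oplus> y [^] p" using x y by (simp add: f_def a_comm)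
  finally show ?thesis .
qed

lemma frobenius_power_add:
  assumes p: "Factorial_Ring.prime p" "ring_characteristic R p"
    and x: "x \<in> carrier R" and y: "y \<in> carrier R"
  shows "(x \<oplus> y) [^] (p ^ e) = x [^] (p ^ e) \<oplus> y [^] (p ^ e)"
proof (induct e)
  case (Suc e)
  have *: "z [^] (p ^ Suc e) = (z [^] (p ^ e)) [^] p" if "z \<in> carrier R" for z
    using that by (simp add: nat_pow_pow mult.commute)
  show ?case using Suc x y by (simp add: * frobenius_add[OF p] del: power_Suc)
qed (use x y in auto)

lemma frobenius_power_finsum:
  assumes p: "Factorial_Ring.prime p" "ring_characteristic R p"
    and "finite A" "f \<in> A \<rightarrow> carrier R"
  shows "(\<Oplus>i\<in>A. f i) [^] (p ^ e) = (\<Oplus>i\<in>A. f i [^] (p ^ e))"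
  using assms(3,4)
proof (induct A rule: finite_induct)
  case empty
  have "p ^ e > 0" using prime_gt_0_nat[OF p(1)] by simp
  then show ?case by (simp add: nat_pow_zero)
next
  case (insert i A)
  then show ?case
    by (subst (1 2) finsum_insert) (auto simp: frobenius_power_add[OF p] Pi_iff)
qed

end

section \<open>Construction of a dual basis up to a nonzerodivisor\<close>

lemma (in cring) frobenius_dual_basisI:
  assumes B: "finite B" "\<And>s. s \<in> B \<Longrightarrow> root_linear R p (self_module R) (\<phi> s)" "\<And>s. s \<in> B \<Longrightarrow> b s \<in> carrier R"
    and sum: "\<And>x. x \<in> carrier R \<Longrightarrow> c \<otimes> x = (\<Oplus>s\<in>B. \<phi> s x [^] p \<otimes> b s)"
  shows "frobenius_dual_basis R p c"
proof -
  have "\<exists>f. frobenius_combination R p f \<and> (\<forall>x\<in>carrier R. (\<Oplus>s\<in>B. \<phi> s x [^] p \<otimes> b s) = f x)"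
    using B
  proof (induct B rule: finite_induct)
    case (insert s B)
    then obtain f where f: "frobenius_combination R p f" "\<And>x. x \<in> carrier R \<Longrightarrow> (\<Oplus>s\<in>B. \<phi> s x [^] p \<otimes> b s) = f x"
      by blast
    have "\<phi> t x \<in> carrier R" if "t \<in> insert s B" "x \<in> carrier R" for t x
      using root_linear_closed[OF insert(4)[OF that(1)] that(2)] by simp
    then have "(\<Oplus>s\<in>insert s B. \<phi> s x [^] p \<otimes> b s) = f x \<oplus> \<phi> s x [^] p \<otimes> b s" if "x \<in> carrier R" for x
      using insert that frobenius_combination_closed[OF f(1) that] by (subst finsum_insert) (auto simp: f(2) a_comm)
    then show ?case using frobenius_combination.add[OF f(1) insert(4,5)] by blast
  qed (auto intro: frobenius_combination.zero)
  then show ?thesis unfolding frobenius_dual_basis_def using sum by auto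
qed

lemma (in cring) frobenius_dual_basis_add:
  assumes c: "c \<in> carrier R" "frobenius_dual_basis R p c" and d: "d \<in> carrier R" "frobenius_dual_basis R p d"
  shows "frobenius_dual_basis R p (c \<oplus> d)"
proof -
  obtain f g where f: "frobenius_combination R p f" "\<And>x. x \<in> carrier R \<Longrightarrow> c \<otimes> x = f x"
    and g: "frobenius_combination R p g" "\<And>x. x \<in> carrier R \<Longrightarrow> d \<otimes> x = g x"
    using c d unfolding frobenius_dual_basis_def by blast
  have "\<exists>h. frobenius_combination R p h \<and> (\<forall>x\<in>carrier R. f x \<oplus> g x = h x)"
    using g(1)
  proof (induct rule: frobenius_combination.induct)
    case zero
    then show ?case using f(1) frobenius_combination_closed[OF f(1)] by auto
  next
    case (add g \<phi> b)
    then obtain h where h: "frobenius_combination R p h" "\<And>x. x \<in> carrier R \<Longrightarrow> f x \<oplus> g x = h x" by blast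
    have "f x \<oplus> (g x \<oplus> \<phi> x [^] p \<otimes> b) = h x \<oplus> \<phi> x [^] p \<otimes> b" if "x \<in> carrier R" for x
      using that h(2) frobenius_combination_closed[OF f(1) that] frobenius_combination_closed[OF add(1) that]
        root_linear_closed[OF add(3) that] add(4) by (simp add: a_assoc[symmetric])
    then show ?case using frobenius_combination.add[OF h(1) add(3,4)] by blast
  qed
  then show ?thesis unfolding frobenius_dual_basis_def using f(2) g(2) c d by (auto simp: l_distr)
qed

text \<open>Take a family of primes with zero intersection of least cardinality. If every element
  common to the other primes lay in \<open>Q\<close>, then \<open>Q\<close> could be
  dropped.\<close>

lemma irredundant_primes:
  fixes R (structure)
  assumes "noetherian_ring R" "reduced_ring R"
  shows "\<exists>F. finite F \<and> (\<forall>Q\<in>F. primeideal Q R) \<and> (\<forall>x\<in>carrier R. (\<forall>Q\<in>F. x \<in> Q) \<longrightarrow> x = \<zero>) \<and>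
     (\<forall>Q\<in>F. \<exists>e\<in>carrier R. e \<notin> Q \<and> (\<forall>Q'\<in>F - {Q}. e \<in> Q'))"
proof -
  interpret cring R using assms by (simp add: reduced_ring_def)
  define good where "good F \<longleftrightarrow> finite F \<and> (\<forall>Q\<in>F. primeideal Q R) \<and>
      (\<forall>x\<in>carrier R. (\<forall>Q\<in>F. x \<in> Q) \<longrightarrow> x = \<zero>)" for F
  obtain G where G: "finite G" "\<forall>Q\<in>G. primeideal Q R"
    "\<forall>x\<in>carrier R. (\<forall>Q\<in>G. x \<in> Q) \<longrightarrow> (\<exists>n::nat. x [^] n \<in> {\<zero>})"
    using finite_primes_radical[OF assms(1) is_cring zeroideal] by (elim exE conjE)
  have "good G" using G assms(2) unfolding good_def reduced_ring_def by blast
  then obtain F where F: "good F" "\<And>H. good H \<Longrightarrow> card F \<le> card H"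
    using arg_min_nat_lemma[of good G card] by blast
  have "\<exists>e\<in>carrier R. e \<notin> Q \<and> (\<forall>Q'\<in>F - {Q}. e \<in> Q')" if Q: "Q \<in> F" for Q
  proof (rule ccontr)
    assume a: "\<not> ?thesis"
    have "good (F - {Q})"
      unfolding good_def
    proof (intro conjI ballI impI)
      fix x assume x: "x \<in> carrier R" "\<forall>Q\<in>F - {Q}. x \<in> Q"
      then have "x \<in> Q" using a by blast
      then have "\<forall>Q\<in>F. x \<in> Q" using x by blast
      then show "x = \<zero>" using F(1) x(1) unfolding good_def by blast
    qed (use F(1) in \<open>auto simp: good_def\<close>)
    then have "card F \<le> card (F - {Q})" by (rule F(2))
    moreover have "card (F - {Q}) < card F"
      using F(1) Q by (intro card_Diff1_less) (auto simp: good_def)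
    ultimately show False by simp
  qed
  then show ?thesis using F(1) unfolding good_def by blast
qed

locale frobenius_finite = cring R for R (structure) +
  fixes p :: nat and T
  assumes prime_p: "Factorial_Ring.prime p" and char_p: "ring_characteristic R p"
    and T: "finite T" "T \<subseteq> carrier R"
    and T_span: "\<And>x. x \<in> carrier R \<Longrightarrow> \<exists>a\<in>T \<rightarrow> carrier R. x = (\<Oplus>t\<in>T. a t [^] p \<otimes> t)"
begin

lemma p_pos: "p > 0"
  using prime_p by (rule prime_gt_0_nat)

definition comb where
  "comb B a = (\<Oplus>t\<in>B. a t [^] p \<otimes> t)"

lemma comb_closed: "B \<subseteq> carrier R \<Longrightarrow> a \<in> B \<rightarrow> carrier R \<Longrightarrow> comb B a \<in> carrier R"
  unfolding comb_def by (intro finsum_closed) (auto simp: Pi_iff subset_eq)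

lemma comb_add:
  assumes "B \<subseteq> carrier R" "a \<in> B \<rightarrow> carrier R" "b \<in> B \<rightarrow> carrier R"
  shows "comb B (\<lambda>t. a t \<oplus> b t) = comb B a \<oplus> comb B b"
proof -
  have c: "t \<in> carrier R" "a t \<in> carrier R" "b t \<in> carrier R" if "t \<in> B" for t using assms that by auto
  have "comb B (\<lambda>t. a t \<oplus> b t) = (\<Oplus>t\<in>B. a t [^] p \<otimes> t \<oplus> b t [^] p \<otimes> t)"
    unfolding comb_def using c
    by (intro finsum_cong') (auto simp: frobenius_add[OF prime_p char_p] l_distr)
  also have "\<dots> = comb B a \<oplus> comb B b"
    unfolding comb_def using c by (intro finsum_addf) auto
  finally show ?thesis .
qed

lemma comb_smult:
  assumes "B \<subseteq> carrier R" "a \<in> B \<rightarrow> carrier R" "r \<in> carrier R" "finite B"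
  shows "comb B (\<lambda>t. r \<otimes> a t) = r [^] p \<otimes> comb B a"
proof -
  have c: "t \<in> carrier R" "a t \<in> carrier R" if "t \<in> B" for t using assms that by auto
  have "comb B (\<lambda>t. r \<otimes> a t) = (\<Oplus>t\<in>B. r [^] p \<otimes> (a t [^] p \<otimes> t))"
    unfolding comb_def using c assms(3)
    by (intro finsum_cong') (auto simp: nat_pow_distrib m_assoc)
  also have "\<dots> = r [^] p \<otimes> comb B a"
    unfolding comb_def using c assms by (intro finsum_rdistr[symmetric]) auto
  finally show ?thesis .
qed

lemma comb_minus:
  assumes "B \<subseteq> carrier R" "a \<in> B \<rightarrow> carrier R" "b \<in> B \<rightarrow> carrier R" "finite B"
  shows "comb B (\<lambda>t. a t \<ominus> b t) = comb B a \<ominus> comb B b"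
proof -
  have c: "t \<in> carrier R" "a t \<in> carrier R" "b t \<in> carrier R" if "t \<in> B" for t using assms that by auto
  have "comb B a = comb B (\<lambda>t. (a t \<ominus> b t) \<oplus> b t)"
    unfolding comb_def
  proof (rule finsum_cong')
    fix t assume t: "t \<in> B"
    have "a t \<ominus> b t \<oplus> b t = a t" using c[OF t] by algebra
    then show "a t [^] p \<otimes> t = (a t \<ominus> b t \<oplus> b t) [^] p \<otimes> t" by simp
  qed (use c in auto)
  also have "\<dots> = comb B (\<lambda>t. a t \<ominus> b t) \<oplus> comb B b"
    using assms by (intro comb_add) auto
  finally have e: "comb B a = comb B (\<lambda>t. a t \<ominus> b t) \<oplus> comb B b" .
  have "comb B (\<lambda>t. a t \<ominus> b t) \<in> carrier R" "comb B b \<in> carrier R"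
    using assms by (auto intro!: comb_closed)
  then show ?thesis unfolding e by (simp add: add_diff_cancel)
qed

text \<open>Modulo a prime \<open>Q\<close>, generators over the \<open>p\<close>-th powers are discarded until the remaining ones are
  independent; each relation costs a factor outside \<open>Q\<close>.\<close>

lemma independent_generators:
  assumes Q: "primeideal Q R" and "finite B" "B \<subseteq> carrier R" "d \<in> carrier R" "d \<notin> Q"
    and "\<forall>x\<in>carrier R. \<exists>a\<in>B \<rightarrow> carrier R. d [^] p \<otimes> x \<ominus> comb B a \<in> Q"
  shows "\<exists>B d. finite B \<and> B \<subseteq> carrier R \<and> d \<in> carrier R \<and> d \<notin> Q \<and>
    (\<forall>x\<in>carrier R. \<exists>a. a \<in> B \<rightarrow> carrier R \<and> d [^] p \<otimes> x \<ominus> comb B a \<in> Q) \<and>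
    (\<forall>a\<in>B \<rightarrow> carrier R. comb B a \<in> Q \<longrightarrow> (\<forall>t\<in>B. a t \<in> Q))"
  using assms(2-)
proof (induct B arbitrary: d rule: finite_psubset_induct)
  case (psubset B)
  interpret Q: primeideal Q R by fact
  show ?case
  proof (cases "\<forall>a\<in>B \<rightarrow> carrier R. comb B a \<in> Q \<longrightarrow> (\<forall>t\<in>B. a t \<in> Q)")
    case True
    show ?thesis
      by (intro exI[of _ B] exI[of _ d] conjI True psubset(1,3,4,5)) (use psubset(6) in blast)
  next
    case False
    then obtain a t where a: "a \<in> B \<rightarrow> carrier R" "comb B a \<in> Q" and t: "t \<in> B" "a t \<notin> Q" by blast
    define B' where "B' = B - {t}"
    have B': "finite B'" "B' \<subseteq> carrier R" "t \<notin> B'" "B = insert t B'" using psubset t by (auto simp: B'_def)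
    have at: "a t \<in> carrier R" "t \<in> carrier R" "a \<in> B' \<rightarrow> carrier R" using a t psubset by (auto simp: B'_def)
    have split: "comb B b = b t [^] p \<otimes> t \<oplus> comb B' b" if "b \<in> B \<rightarrow> carrier R" for b
      unfolding comb_def B'(4) using that B' psubset(3) t by (subst finsum_insert) (auto simp: Pi_iff subset_eq)
    have "\<exists>b\<in>B' \<rightarrow> carrier R. (d \<otimes> a t) [^] p \<otimes> x \<ominus> comb B' b \<in> Q" if x: "x \<in> carrier R" for x
    proof -
      obtain b where b: "b \<in> B \<rightarrow> carrier R" "d [^] p \<otimes> x \<ominus> comb B b \<in> Q" using bspec[OF psubset(6) x] by blast
      have bt: "b t \<in> carrier R" "b \<in> B' \<rightarrow> carrier R" using b t by (auto simp: B'_def)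
      have sc: "(\<lambda>s. a t \<otimes> b s) \<in> B' \<rightarrow> carrier R" "(\<lambda>s. b t \<otimes> a s) \<in> B' \<rightarrow> carrier R" using at bt by auto
      define V where "V = comb B' a"
      define Y where "Y = comb B' b"
      define A where "A = a t [^] p"
      define C where "C = b t [^] p"
      define D where "D = d [^] p \<otimes> x"
      have cl: "V \<in> carrier R" "Y \<in> carrier R" "A \<in> carrier R" "C \<in> carrier R" "D \<in> carrier R"
        using comb_closed[OF B'(2)] at bt psubset(4) x by (auto simp: V_def Y_def A_def C_def D_def)
      \<comment> \<open>Multiplying the expression for \<open>d^p x\<close> by
        \<open>(a t)^p\<close> and subtracting \<open>(b t)^p\<close> times the relation
        \<open>comb B a \<in> Q\<close> eliminates the generator \<open>t\<close>.\<close>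
      have "comb B' (\<lambda>s. a t \<otimes> b s \<ominus> b t \<otimes> a s) = A \<otimes> Y \<ominus> C \<otimes> V"
        using comb_minus[OF B'(2) sc B'(1)] comb_smult[OF B'(2) bt(2) at(1) B'(1)] comb_smult[OF B'(2) at(3) bt(1) B'(1)]
        by (simp add: V_def Y_def A_def C_def)
      moreover have "(d \<otimes> a t) [^] p \<otimes> x = A \<otimes> D"
        using psubset(4) at(1) x by (simp add: A_def D_def nat_pow_distrib m_ac)
      moreover have "A \<otimes> D \<ominus> (A \<otimes> Y \<ominus> C \<otimes> V) = A \<otimes> (D \<ominus> (C \<otimes> t \<oplus> Y)) \<oplus> C \<otimes> (A \<otimes> t \<oplus> V)"
        using cl at(2) by algebra
      moreover have "A \<otimes> (D \<ominus> (C \<otimes> t \<oplus> Y)) \<oplus> C \<otimes> (A \<otimes> t \<oplus> V) \<in> Q"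
        using Q.I_l_closed[OF b(2) cl(3)] Q.I_l_closed[OF a(2) cl(4)] split[OF b(1)] split[OF a(1)]
        by (simp add: V_def Y_def A_def C_def D_def)
      ultimately have "(d \<otimes> a t) [^] p \<otimes> x \<ominus> comb B' (\<lambda>s. a t \<otimes> b s \<ominus> b t \<otimes> a s) \<in> Q" by simp
      moreover have "(\<lambda>s. a t \<otimes> b s \<ominus> b t \<otimes> a s) \<in> B' \<rightarrow> carrier R" using at bt by auto
      ultimately show ?thesis by blast
    qed
    moreover have "d \<otimes> a t \<notin> Q" using Q.I_prime[OF psubset(4) at(1)] psubset(5) t(2) by blast
    moreover have "B' \<subset> B" using B' by blast
    ultimately show ?thesis using psubset(2)[OF _ B'(2), of "d \<otimes> a t"] psubset(4) at(1) by simp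
  qed
qed

text \<open>Since \<open>e Q = 0\<close>, coefficients modulo \<open>Q\<close> become elements of \<open>R\<close> after multiplication with \<open>e\<close>.\<close>

lemma dual_basis_at_prime:
  assumes Q: "primeideal Q R" and e: "e \<in> carrier R" "e \<notin> Q" "\<And>x. x \<in> Q \<Longrightarrow> e \<otimes> x = \<zero>"
  shows "\<exists>d\<in>carrier R. d \<notin> Q \<and> frobenius_dual_basis R p ((e \<otimes> d) [^] p)"
proof -
  interpret Q: primeideal Q R by fact
  have start: "\<forall>x\<in>carrier R. \<exists>a\<in>T \<rightarrow> carrier R. \<one> [^] p \<otimes> x \<ominus> comb T a \<in> Q"
  proof
    fix x assume x: "x \<in> carrier R"
    obtain a where a: "a \<in> T \<rightarrow> carrier R" "x = (\<Oplus>t\<in>T. a t [^] p \<otimes> t)" using T_span[OF x] by blast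
    show "\<exists>a\<in>T \<rightarrow> carrier R. \<one> [^] p \<otimes> x \<ominus> comb T a \<in> Q" using a(1) x by (intro bexI[of _ a]) (simp_all add: comb_def a(2)[symmetric])
  qed
  have "\<one> \<notin> Q" using Q.one_imp_carrier Q.I_notcarr by blast
  from independent_generators[OF Q T one_closed this start]
  obtain B d where BT: "finite B" "B \<subseteq> carrier R" and d: "d \<in> carrier R" "d \<notin> Q"
    and span: "\<forall>x\<in>carrier R. \<exists>a. a \<in> B \<rightarrow> carrier R \<and> d [^] p \<otimes> x \<ominus> comb B a \<in> Q"
    and Bi: "\<forall>a\<in>B \<rightarrow> carrier R. comb B a \<in> Q \<longrightarrow> (\<forall>t\<in>B. a t \<in> Q)"
    by (elim exE conjE)
  from span obtain \<alpha> where \<alpha>: "\<And>x. x \<in> carrier R \<Longrightarrow> \<alpha> x \<in> B \<rightarrow> carrier R"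
    "\<And>x. x \<in> carrier R \<Longrightarrow> d [^] p \<otimes> x \<ominus> comb B (\<alpha> x) \<in> Q" by metis
  have \<alpha>c: "\<alpha> x t \<in> carrier R" if "x \<in> carrier R" "t \<in> B" for x t using \<alpha>(1)[OF that(1)] that by auto
  \<comment> \<open>Independence determines the coefficients modulo \<open>Q\<close>, and
    \<open>e\<close> kills \<open>Q\<close>. Hence the arbitrary choice \<alpha> becomes additive
    and \<open>p^-1\<close>-linear after multiplication by \<open>e\<close>.\<close>
  have uniq: "e \<otimes> a t = e \<otimes> b t"
    if a: "a \<in> B \<rightarrow> carrier R" and b: "b \<in> B \<rightarrow> carrier R" and y: "y \<in> carrier R"
      and ya: "y \<ominus> comb B a \<in> Q" and yb: "y \<ominus> comb B b \<in> Q" and t: "t \<in> B" for a b y t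
  proof -
    note c = comb_closed[OF BT(2) a] comb_closed[OF BT(2) b]
    have "comb B a \<ominus> comb B b = (y \<ominus> comb B b) \<ominus> (y \<ominus> comb B a)" using c y by algebra
    then have "comb B (\<lambda>t. a t \<ominus> b t) \<in> Q"
      unfolding comb_minus[OF BT(2) a b BT(1)] using Q.minus_in[OF yb ya] by simp
    then have "a t \<ominus> b t \<in> Q" using a b t using bspec[OF Bi, of "\<lambda>t. a t \<ominus> b t"] by auto
    then have "e \<otimes> (a t \<ominus> b t) = \<zero>" by (rule e(3))
    moreover have tc: "a t \<in> carrier R" "b t \<in> carrier R" using a b t by auto
    moreover have "e \<otimes> (a t \<ominus> b t) = e \<otimes> a t \<ominus> e \<otimes> b t" using tc e(1) by algebra
    ultimately show ?thesis using e(1) by simp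
  qed
  have "frobenius_dual_basis R p ((e \<otimes> d) [^] p)"
  proof (rule frobenius_dual_basisI[of B p "\<lambda>t x. e \<otimes> \<alpha> x t" "\<lambda>t. t"])
    show "finite B" by (rule BT(1))
    show "t \<in> carrier R" if "t \<in> B" for t using that BT(2) by auto
    have dp: "d [^] p \<in> carrier R" using d by simp
    show "root_linear R p (self_module R) (\<lambda>x. e \<otimes> \<alpha> x t)" if t: "t \<in> B" for t
      unfolding root_linear_def
    proof (intro conjI ballI funcsetI)
      show "e \<otimes> \<alpha> x t \<in> carrier (self_module R)" if "x \<in> carrier R" for x
        using \<alpha>c[OF that t] e by simp
      show "e \<otimes> \<alpha> (x \<oplus> y) t = (e \<otimes> \<alpha> x t) \<oplus>\<^bsub>self_module R\<^esub> (e \<otimes> \<alpha> y t)"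
        if x: "x \<in> carrier R" and y: "y \<in> carrier R" for x y
      proof -
        have "e \<otimes> \<alpha> (x \<oplus> y) t = e \<otimes> (\<lambda>t. \<alpha> x t \<oplus> \<alpha> y t) t"
        proof (rule uniq[OF \<alpha>(1) _ _ \<alpha>(2) _ t])
          show "(\<lambda>t. \<alpha> x t \<oplus> \<alpha> y t) \<in> B \<rightarrow> carrier R" using \<alpha>c x y by auto
          note c = comb_closed[OF BT(2) \<alpha>(1)[OF x]] comb_closed[OF BT(2) \<alpha>(1)[OF y]]
          have "d [^] p \<otimes> (x \<oplus> y) \<ominus> (comb B (\<alpha> x) \<oplus> comb B (\<alpha> y)) =
             (d [^] p \<otimes> x \<ominus> comb B (\<alpha> x)) \<oplus> (d [^] p \<otimes> y \<ominus> comb B (\<alpha> y))"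
            using c x y dp by algebra
          then show "d [^] p \<otimes> (x \<oplus> y) \<ominus> comb B (\<lambda>t. \<alpha> x t \<oplus> \<alpha> y t) \<in> Q"
            unfolding comb_add[OF BT(2) \<alpha>(1)[OF x] \<alpha>(1)[OF y]]
            using Q.a_closed[OF \<alpha>(2)[OF x] \<alpha>(2)[OF y]] by simp
        qed (use x y dp in auto)
        then show ?thesis using \<alpha>c[OF x t] \<alpha>c[OF y t] e by (simp add: r_distr)
      qed
      show "e \<otimes> \<alpha> (a [^] p \<otimes> x) t = a \<odot>\<^bsub>self_module R\<^esub> (e \<otimes> \<alpha> x t)"
        if a: "a \<in> carrier R" and x: "x \<in> carrier R" for a x
      proof -
        have ap: "a [^] p \<in> carrier R" using a by simp
        have "e \<otimes> \<alpha> (a [^] p \<otimes> x) t = e \<otimes> (\<lambda>t. a \<otimes> \<alpha> x t) t"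
        proof (rule uniq[OF \<alpha>(1) _ _ \<alpha>(2) _ t])
          show "(\<lambda>t. a \<otimes> \<alpha> x t) \<in> B \<rightarrow> carrier R" using \<alpha>c x a by auto
          note c = comb_closed[OF BT(2) \<alpha>(1)[OF x]]
          have "d [^] p \<otimes> (a [^] p \<otimes> x) \<ominus> a [^] p \<otimes> comb B (\<alpha> x) = a [^] p \<otimes> (d [^] p \<otimes> x \<ominus> comb B (\<alpha> x))"
            using c x ap dp by algebra
          then show "d [^] p \<otimes> (a [^] p \<otimes> x) \<ominus> comb B (\<lambda>t. a \<otimes> \<alpha> x t) \<in> Q"
            unfolding comb_smult[OF BT(2) \<alpha>(1)[OF x] a BT(1)]
            using Q.I_l_closed[OF \<alpha>(2)[OF x] ap] by simp
        qed (use x a dp in auto)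
        then show ?thesis using \<alpha>c[OF x t] e a by (simp add: m_lcomm)
      qed
    qed
    show "(e \<otimes> d) [^] p \<otimes> x = (\<Oplus>t\<in>B. (e \<otimes> \<alpha> x t) [^] p \<otimes> t)" if x: "x \<in> carrier R" for x
    proof -
      note c = comb_closed[OF BT(2) \<alpha>(1)[OF x]]
      obtain k where k: "p = Suc k" using p_pos by (cases p) auto
      have ek: "e [^] k \<in> carrier R" using e by simp
      have "e [^] p \<otimes> (d [^] p \<otimes> x \<ominus> comb B (\<alpha> x)) = e [^] k \<otimes> (e \<otimes> (d [^] p \<otimes> x \<ominus> comb B (\<alpha> x)))"
      proof -
        have "d [^] p \<otimes> x \<ominus> comb B (\<alpha> x) \<in> carrier R" using dp x c by simp
        moreover have "e [^] p = e [^] k \<otimes> e" by (simp add: k)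
        ultimately show ?thesis using ek e(1) by (simp add: m_assoc)
      qed
      also have "\<dots> = \<zero>" using e(3)[OF \<alpha>(2)[OF x]] ek by simp
      finally have "e [^] p \<otimes> (d [^] p \<otimes> x \<ominus> comb B (\<alpha> x)) = \<zero>" .
      moreover have ep: "e [^] p \<in> carrier R" using e by simp
      moreover have "e [^] p \<otimes> (d [^] p \<otimes> x \<ominus> comb B (\<alpha> x)) = e [^] p \<otimes> (d [^] p \<otimes> x) \<ominus> e [^] p \<otimes> comb B (\<alpha> x)"
        using ep dp x c by algebra
      ultimately have "e [^] p \<otimes> (d [^] p \<otimes> x) = e [^] p \<otimes> comb B (\<alpha> x)" using dp x c by simp
      moreover have "(e \<otimes> d) [^] p \<otimes> x = e [^] p \<otimes> (d [^] p \<otimes> x)"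
        using e d x by (simp add: nat_pow_distrib m_assoc)
      moreover have "(\<Oplus>t\<in>B. (e \<otimes> \<alpha> x t) [^] p \<otimes> t) = e [^] p \<otimes> comb B (\<alpha> x)"
        using comb_smult[OF BT(2) \<alpha>(1)[OF x] e(1) BT(1)] by (simp add: comb_def)
      ultimately show ?thesis by simp
    qed
  qed
  then show ?thesis using d by blast
qed

end

text \<open>The elements that admit a dual basis are closed under addition. Each prime of an
  irredundant family with zero intersection yields one that lies outside this prime and inside all
  the others. Their sum avoids every prime of the family and is therefore a nonzerodivisor.\<close>

theorem exists_frobenius_dual_basis:
  fixes R (structure)
  assumes noeth: "noetherian_ring R" and red: "reduced_ring R"
    and p: "Factorial_Ring.prime p" "ring_characteristic R p" and fin: "F_finite R p"
  shows "\<exists>c. nonzerodivisor R c \<and> frobenius_dual_basis R p c"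
proof -
  interpret cring R using red by (simp add: reduced_ring_def)
  obtain T where T: "T \<subseteq> carrier R" "finite T"
    "\<And>x. x \<in> carrier R \<Longrightarrow> \<exists>a\<in>T \<rightarrow> carrier R. x = (\<Oplus>t\<in>T. a t [^] p \<otimes> t)"
    using fin unfolding F_finite_def module_finite_map_def frobenius_def by auto
  interpret frobenius_finite R p T
    by (intro frobenius_finite.intro frobenius_finite_axioms.intro is_cring p T)
  obtain F where F: "finite F" "\<And>Q. Q \<in> F \<Longrightarrow> primeideal Q R"
    "\<And>x. x \<in> carrier R \<Longrightarrow> (\<forall>Q\<in>F. x \<in> Q) \<Longrightarrow> x = \<zero>"
    "\<And>Q. Q \<in> F \<Longrightarrow> \<exists>e\<in>carrier R. e \<notin> Q \<and> (\<forall>Q'\<in>F - {Q}. e \<in> Q')"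
    using irredundant_primes[OF noeth red] by metis
  \<comment> \<open>The invariant also records that \<open>c\<close> lies in the primes not yet
    treated, so that the next summand cannot be cancelled by \<open>c\<close> modulo its own
    prime.\<close>
  have *: "\<exists>c\<in>carrier R. frobenius_dual_basis R p c \<and> (\<forall>Q\<in>G. c \<notin> Q) \<and> (\<forall>Q\<in>F - G. c \<in> Q)"
    if "G \<subseteq> F" for G
    using finite_subset[OF that F(1)] that
  proof (induct G rule: finite_induct)
    case empty
    have "\<forall>Q\<in>F. \<zero> \<in> Q"
      using F(2) by (meson additive_subgroup.zero_closed ideal.axioms(1) primeideal.axioms(1))
    then show ?case 
      using frobenius_dual_basisI[of "{}" p _ _ \<zero>] by auto
  next
    case (insert Q G)
    then obtain c where c: "c \<in> carrier R" "frobenius_dual_basis R p c"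
      "\<forall>Q\<in>G. c \<notin> Q" "\<forall>Q\<in>F - G. c \<in> Q" by blast
    have QF: "Q \<in> F" using insert by simp
    interpret Q: primeideal Q R by (rule F(2)[OF QF])
    obtain e where e: "e \<in> carrier R" "e \<notin> Q" "\<forall>Q'\<in>F - {Q}. e \<in> Q'" using F(4)[OF QF] by blast
    \<comment> \<open>\<open>e x\<close> lies in \<open>Q\<close> because of \<open>x\<close> and in
      every other prime of \<open>F\<close> because of \<open>e\<close>.\<close>
    have "e \<otimes> x = \<zero>" if x: "x \<in> Q" for x
    proof (rule F(3))
      have xc: "x \<in> carrier R" by (rule Q.Icarr[OF x])
      show "e \<otimes> x \<in> carrier R" using e xc by simp
      show "\<forall>Q'\<in>F. e \<otimes> x \<in> Q'"
      proof
        fix Q' assume Q': "Q' \<in> F"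
        interpret Q': primeideal Q' R by (rule F(2)[OF Q'])
        show "e \<otimes> x \<in> Q'"
          using Q'.I_l_closed[of x e] Q'.I_r_closed[of e x] e xc x Q' by blast
      qed
    qed
    then obtain d where d: "d \<in> carrier R" "d \<notin> Q" "frobenius_dual_basis R p ((e \<otimes> d) [^] p)"
      using dual_basis_at_prime[OF F(2)[OF QF] e(1,2)] by blast
    define g where "g = (e \<otimes> d) [^] p"
    have g: "g \<in> carrier R" using e d by (simp add: g_def)
    have gQ: "g \<notin> Q"
      using Q.pow_memD[of "e \<otimes> d" p] Q.I_prime[OF e(1) d(1)] e d by (auto simp: g_def)
    have gQ': "g \<in> Q'" if Q': "Q' \<in> F" "Q' \<noteq> Q" for Q'
    proof -
      interpret Q': primeideal Q' R by (rule F(2)[OF Q'(1)])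
      obtain k where "p = Suc k" using p_pos by (cases p) auto
      moreover have "e \<otimes> d \<in> Q'" using Q'.I_r_closed[of e d] e d Q' by blast
      ultimately show ?thesis using e d Q'.I_l_closed[of "e \<otimes> d" "(e \<otimes> d) [^] k"] by (simp add: g_def)
    qed
    have diff: "u \<in> Q'" if "Q' \<in> F" "u \<oplus> v \<in> Q'" "v \<in> Q'" "u \<in> carrier R" for u v Q'
    proof -
      interpret Q': primeideal Q' R by (rule F(2)[OF that(1)])
      show ?thesis using Q'.minus_in[OF that(2,3)] add_diff_cancel[of u v] that Q'.Icarr by simp
    qed
    show ?case
    proof (intro bexI[of _ "c \<oplus> g"] conjI ballI)
      show "frobenius_dual_basis R p (c \<oplus> g)"
        by (rule frobenius_dual_basis_add[OF c(1,2) g]) (use d in \<open>simp add: g_def\<close>)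
      show "c \<oplus> g \<in> carrier R" using c g by simp
      fix Q' assume Q': "Q' \<in> insert Q G"
      show "c \<oplus> g \<notin> Q'"
      proof (cases "Q' = Q")
        case True
        then have "c \<in> Q" using c(4) QF insert by blast
        then show ?thesis using diff[OF QF, of g c] gQ g c a_comm[of g c] True by auto
      next
        case False
        then have "Q' \<in> G" "Q' \<in> F" using Q' insert by auto
        then show ?thesis using diff[of Q' c g] gQ'[OF _ False] c by blast
      qed
    next
      fix Q' assume Q': "Q' \<in> F - insert Q G"
      interpret Q': primeideal Q' R using F(2) Q' by blast
      show "c \<oplus> g \<in> Q'" using c(4) Q' gQ'[of Q'] by blast
    qed
  qed
  then obtain c where c: "c \<in> carrier R" "frobenius_dual_basis R p c" "\<forall>Q\<in>F. c \<notin> Q" by blast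
  have "nonzerodivisor R c"
    unfolding nonzerodivisor_def
  proof (intro conjI ballI impI)
    fix x assume x: "x \<in> carrier R" "c \<otimes> x = \<zero>"
    show "x = \<zero>"
    proof (rule F(3)[OF x(1)], rule)
      fix Q assume Q: "Q \<in> F"
      interpret Q: primeideal Q R by (rule F(2)[OF Q])
      show "x \<in> Q" using Q.I_prime[OF c(1) x(1)] x(2) c(3) Q Q.zero_closed by auto
    qed
  qed (rule c(1))
  then show ?thesis using c by blast
qed

section \<open>Completion and localization\<close>

locale adic = cring A for A (structure) + fixes I
  assumes I: "ideal I A"
begin

abbreviation "C \<equiv> adic_completion A I"
abbreviation "Ip n \<equiv> ideal_power A I n"

lemma Ip_ideal: "ideal (Ip n) A"
  by (rule ideal_power_ideal[OF I])

lemma Ip_mono: "Ip (Suc n) \<subseteq> Ip n"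
  by (rule ideal_power_antimono[OF I]) simp

lemma Q_cring: "cring (A Quot Ip n)"
  by (rule ideal.quotient_is_cring[OF Ip_ideal is_cring])

lemma Q_hom: "(+>) (Ip n) \<in> ring_hom A (A Quot Ip n)"
  by (rule ideal.rcos_ring_hom[OF Ip_ideal])

lemma Q_carrier: "carrier (A Quot Ip n) = (+>) (Ip n) ` carrier A"
  by (auto simp: FactRing_def A_RCOSETS_def')

lemma Q_zero: "\<zero>\<^bsub>A Quot Ip n\<^esub> = Ip n"
  by (simp add: FactRing_def)

lemma coset_self: "x \<in> carrier A \<Longrightarrow> x \<in> Ip n +> x"
  by (rule abelian_subgroup.a_rcos_self) (use Ip_ideal[of n] in \<open>auto intro: ideal.is_ideal abelian_subgroupI3 ideal.axioms(1) is_abelian_group\<close>)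

lemma Ip_abelian: "abelian_subgroup (Ip n) A"
  by (intro abelian_subgroupI3 ideal.axioms(1)[OF Ip_ideal] is_abelian_group)

lemma coset_eqI: "x \<in> carrier A \<Longrightarrow> y \<in> Ip n +> x \<Longrightarrow> Ip n +> x = Ip n +> y"
  by (rule abelian_subgroup.a_repr_independence'[OF Ip_abelian])

lemma coset_carrier: "x \<in> carrier A \<Longrightarrow> y \<in> Ip n +> x \<Longrightarrow> y \<in> carrier A"
  by (rule abelian_subgroup.a_elemrcos_carrier[OF Ip_abelian])

lemma coset_eq_iff:
  assumes "x \<in> carrier A" "y \<in> carrier A"
  shows "Ip n +> x = Ip n +> y \<longleftrightarrow> x \<ominus> y \<in> Ip n"
  using quotient_eq_iff_same_a_r_cos[OF Ip_ideal assms] by simp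

lemma coset_zero_iff:
  assumes "x \<in> carrier A"
  shows "Ip n +> x = Ip n \<longleftrightarrow> x \<in> Ip n"
proof -
  have "Ip n = Ip n +> \<zero>" using Q_hom ring_hom_zero[OF Q_hom ring_axioms cring.axioms(1)[OF Q_cring]] Q_zero by simp
  then show ?thesis using coset_eq_iff[OF assms zero_closed, of n] assms by simp
qed

lemma coset_mono: "Ip (Suc n) +> x \<subseteq> Ip n +> x"
  using Ip_mono[of n] by (auto simp: a_r_coset_def')

text \<open>Inclusion of consecutive cosets means that any representative of the smaller one also
  represents the larger one. A common representative for two neighbouring components is all that
  closure proofs in the completion need.\<close>

lemma C_carrier:
  "a \<in> carrier C \<longleftrightarrow> (\<forall>n. \<exists>x\<in>carrier A. a n = Ip n +> x \<and> a (Suc n) = Ip (Suc n) +> x)"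
proof
  assume a: "a \<in> carrier C"
  show "\<forall>n. \<exists>x\<in>carrier A. a n = Ip n +> x \<and> a (Suc n) = Ip (Suc n) +> x"
  proof
    fix n
    have all: "\<forall>n. a n \<in> carrier (A Quot Ip n) \<and> a (Suc n) \<subseteq> a n"
      using a by (simp add: adic_completion_def)
    have "a (Suc n) \<in> carrier (A Quot Ip (Suc n))" "a n \<in> carrier (A Quot Ip n)" "a (Suc n) \<subseteq> a n"
      using spec[OF all, of "Suc n"] spec[OF all, of n] by blast+
    then obtain x y where x: "x \<in> carrier A" "a (Suc n) = Ip (Suc n) +> x"
      and y: "y \<in> carrier A" "a n = Ip n +> y" "a (Suc n) \<subseteq> a n"
      unfolding Q_carrier by blast
    have "x \<in> Ip n +> y" using coset_self[OF x(1), of "Suc n"] x y by auto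
    then have "a n = Ip n +> x" using coset_eqI[OF y(1)] y by simp
    then show "\<exists>x\<in>carrier A. a n = Ip n +> x \<and> a (Suc n) = Ip (Suc n) +> x" using x by blast
  qed
next
  assume a: "\<forall>n. \<exists>x\<in>carrier A. a n = Ip n +> x \<and> a (Suc n) = Ip (Suc n) +> x"
  have "a n \<in> carrier (A Quot Ip n) \<and> a (Suc n) \<subseteq> a n" for n
    using a[rule_format, of n] coset_mono[of n] unfolding Q_carrier by auto
  then show "a \<in> carrier C" by (simp add: adic_completion_def)
qed

lemma C_rep:
  assumes "a \<in> carrier C"
  obtains x where "x \<in> carrier A" "a n = Ip n +> x" "a (Suc n) = Ip (Suc n) +> x"
  using assms unfolding C_carrier by blast

lemma C_simps:
  "(a \<otimes>\<^bsub>C\<^esub> b) n = a n \<otimes>\<^bsub>A Quot Ip n\<^esub> b n" "(a \<oplus>\<^bsub>C\<^esub> b) n = a n \<oplus>\<^bsub>A Quot Ip n\<^esub> b n"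
  "\<one>\<^bsub>C\<^esub> n = \<one>\<^bsub>A Quot Ip n\<^esub>" "\<zero>\<^bsub>C\<^esub> n = \<zero>\<^bsub>A Quot Ip n\<^esub>"
  by (auto simp: adic_completion_def)

lemma C_component: "a \<in> carrier C \<Longrightarrow> a n \<in> carrier (A Quot Ip n)"
  by (simp add: adic_completion_def)

lemma Q_mult: "x \<in> carrier A \<Longrightarrow> y \<in> carrier A \<Longrightarrow> (Ip n +> x) \<otimes>\<^bsub>A Quot Ip n\<^esub> (Ip n +> y) = Ip n +> (x \<otimes> y)"
  using ring_hom_mult[OF Q_hom] by simp

lemma Q_add: "x \<in> carrier A \<Longrightarrow> y \<in> carrier A \<Longrightarrow> (Ip n +> x) \<oplus>\<^bsub>A Quot Ip n\<^esub> (Ip n +> y) = Ip n +> (x \<oplus> y)"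
  using ring_hom_add[OF Q_hom] by simp

lemma Q_one: "\<one>\<^bsub>A Quot Ip n\<^esub> = Ip n +> \<one>"
  using ring_hom_one[OF Q_hom] by simp

lemma Q_zero': "\<zero>\<^bsub>A Quot Ip n\<^esub> = Ip n +> \<zero>"
  using ring_hom_zero[OF Q_hom ring_axioms cring.axioms(1)[OF Q_cring]] by simp

lemma C_eqI: "(\<And>n. a n = b n) \<Longrightarrow> a = b" for a b :: "nat \<Rightarrow> 'a set"
  by (rule ext)

lemma C_mult_closed: "a \<in> carrier C \<Longrightarrow> b \<in> carrier C \<Longrightarrow> a \<otimes>\<^bsub>C\<^esub> b \<in> carrier C"
  unfolding C_carrier[of "a \<otimes>\<^bsub>C\<^esub> b"]
proof
  fix n assume a: "a \<in> carrier C" and b: "b \<in> carrier C"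
  obtain x where x: "x \<in> carrier A" "a n = Ip n +> x" "a (Suc n) = Ip (Suc n) +> x" by (rule C_rep[OF a])
  obtain y where y: "y \<in> carrier A" "b n = Ip n +> y" "b (Suc n) = Ip (Suc n) +> y" by (rule C_rep[OF b])
  show "\<exists>z\<in>carrier A. (a \<otimes>\<^bsub>C\<^esub> b) n = Ip n +> z \<and> (a \<otimes>\<^bsub>C\<^esub> b) (Suc n) = Ip (Suc n) +> z"
    unfolding C_simps x(2,3) y(2,3) Q_mult[OF x(1) y(1)] using x(1) y(1) by (intro bexI[of _ "x \<otimes> y"]) auto
qed

lemma C_add_closed: "a \<in> carrier C \<Longrightarrow> b \<in> carrier C \<Longrightarrow> a \<oplus>\<^bsub>C\<^esub> b \<in> carrier C"
  unfolding C_carrier[of "a \<oplus>\<^bsub>C\<^esub> b"]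
proof
  fix n assume a: "a \<in> carrier C" and b: "b \<in> carrier C"
  obtain x where x: "x \<in> carrier A" "a n = Ip n +> x" "a (Suc n) = Ip (Suc n) +> x" by (rule C_rep[OF a])
  obtain y where y: "y \<in> carrier A" "b n = Ip n +> y" "b (Suc n) = Ip (Suc n) +> y" by (rule C_rep[OF b])
  show "\<exists>z\<in>carrier A. (a \<oplus>\<^bsub>C\<^esub> b) n = Ip n +> z \<and> (a \<oplus>\<^bsub>C\<^esub> b) (Suc n) = Ip (Suc n) +> z"
    unfolding C_simps x(2,3) y(2,3) Q_add[OF x(1) y(1)] using x(1) y(1) by (intro bexI[of _ "x \<oplus> y"]) auto
qed

definition "emb x = (\<lambda>n. Ip n +> x)"

lemma emb_closed: "x \<in> carrier A \<Longrightarrow> emb x \<in> carrier C"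
  unfolding C_carrier emb_def by blast

lemma C_minus:
  assumes "a \<in> carrier C"
  shows "\<exists>b\<in>carrier C. b \<oplus>\<^bsub>C\<^esub> a = \<zero>\<^bsub>C\<^esub>"
proof (rule bexI)
  let ?b = "\<lambda>n. \<ominus>\<^bsub>A Quot Ip n\<^esub> a n"
  have neg: "\<ominus>\<^bsub>A Quot Ip n\<^esub> (Ip n +> x) = Ip n +> (\<ominus> x)" if "x \<in> carrier A" for n x
  proof -
    interpret Q: cring "A Quot Ip n" by (rule Q_cring)
    have "(Ip n +> (\<ominus> x)) \<oplus>\<^bsub>A Quot Ip n\<^esub> (Ip n +> x) = \<zero>\<^bsub>A Quot Ip n\<^esub>"
      using that by (simp add: Q_add Q_zero' l_neg)
    moreover have "Ip n +> (\<ominus> x) \<in> carrier (A Quot Ip n)" "Ip n +> x \<in> carrier (A Quot Ip n)"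
      unfolding Q_carrier using that by blast+
    ultimately show ?thesis by (intro Q.minus_equality)
  qed
  show "?b \<in> carrier C"
    unfolding C_carrier
  proof
    fix n
    obtain x where x: "x \<in> carrier A" "a n = Ip n +> x" "a (Suc n) = Ip (Suc n) +> x" by (rule C_rep[OF assms])
    show "\<exists>x\<in>carrier A. ?b n = Ip n +> x \<and> ?b (Suc n) = Ip (Suc n) +> x"
      unfolding x(2,3) neg[OF x(1)] using x(1) by (intro bexI[of _ "\<ominus> x"]) auto
  qed
  show "?b \<oplus>\<^bsub>C\<^esub> a = \<zero>\<^bsub>C\<^esub>"
  proof (rule C_eqI)
    fix n
    interpret Q: cring "A Quot Ip n" by (rule Q_cring)
    show "(?b \<oplus>\<^bsub>C\<^esub> a) n = \<zero>\<^bsub>C\<^esub> n"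
      unfolding C_simps using C_component[OF assms] by (rule Q.l_neg)
  qed
qed

lemma C_one_zero: "\<one>\<^bsub>C\<^esub> \<in> carrier C" "\<zero>\<^bsub>C\<^esub> \<in> carrier C"
  unfolding C_carrier C_simps Q_one Q_zero' by blast+

lemma C_cring: "cring C"
proof (intro cringI abelian_groupI comm_monoidI)
  fix a b c assume a: "a \<in> carrier C" and b: "b \<in> carrier C" and c: "c \<in> carrier C"
  show "a \<oplus>\<^bsub>C\<^esub> b \<oplus>\<^bsub>C\<^esub> c = a \<oplus>\<^bsub>C\<^esub> (b \<oplus>\<^bsub>C\<^esub> c)"
    and "a \<otimes>\<^bsub>C\<^esub> b \<otimes>\<^bsub>C\<^esub> c = a \<otimes>\<^bsub>C\<^esub> (b \<otimes>\<^bsub>C\<^esub> c)"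
    and "(a \<oplus>\<^bsub>C\<^esub> b) \<otimes>\<^bsub>C\<^esub> c = a \<otimes>\<^bsub>C\<^esub> c \<oplus>\<^bsub>C\<^esub> b \<otimes>\<^bsub>C\<^esub> c"
  proof -
    have "(a \<oplus>\<^bsub>C\<^esub> b \<oplus>\<^bsub>C\<^esub> c) n = (a \<oplus>\<^bsub>C\<^esub> (b \<oplus>\<^bsub>C\<^esub> c)) n \<and>
      (a \<otimes>\<^bsub>C\<^esub> b \<otimes>\<^bsub>C\<^esub> c) n = (a \<otimes>\<^bsub>C\<^esub> (b \<otimes>\<^bsub>C\<^esub> c)) n \<and>
      ((a \<oplus>\<^bsub>C\<^esub> b) \<otimes>\<^bsub>C\<^esub> c) n = (a \<otimes>\<^bsub>C\<^esub> c \<oplus>\<^bsub>C\<^esub> b \<otimes>\<^bsub>C\<^esub> c) n" for n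
    proof -
      interpret Q: cring "A Quot Ip n" by (rule Q_cring)
      show ?thesis
        using C_component[OF a, of n] C_component[OF b, of n] C_component[OF c, of n]
        by (simp add: C_simps Q.a_assoc Q.m_assoc Q.l_distr)
    qed
    then show "a \<oplus>\<^bsub>C\<^esub> b \<oplus>\<^bsub>C\<^esub> c = a \<oplus>\<^bsub>C\<^esub> (b \<oplus>\<^bsub>C\<^esub> c)"
      and "a \<otimes>\<^bsub>C\<^esub> b \<otimes>\<^bsub>C\<^esub> c = a \<otimes>\<^bsub>C\<^esub> (b \<otimes>\<^bsub>C\<^esub> c)"
      and "(a \<oplus>\<^bsub>C\<^esub> b) \<otimes>\<^bsub>C\<^esub> c = a \<otimes>\<^bsub>C\<^esub> c \<oplus>\<^bsub>C\<^esub> b \<otimes>\<^bsub>C\<^esub> c"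
      by (blast intro: C_eqI)+
  qed
next
  fix a b assume a: "a \<in> carrier C" and b: "b \<in> carrier C"
  have *: "(a \<oplus>\<^bsub>C\<^esub> b) n = (b \<oplus>\<^bsub>C\<^esub> a) n \<and> (a \<otimes>\<^bsub>C\<^esub> b) n = (b \<otimes>\<^bsub>C\<^esub> a) n" for n
  proof -
    interpret Q: cring "A Quot Ip n" by (rule Q_cring)
    show ?thesis
      using C_component[OF a, of n] C_component[OF b, of n]
      by (simp add: C_simps Q.a_comm Q.m_comm)
  qed
  show "a \<oplus>\<^bsub>C\<^esub> b = b \<oplus>\<^bsub>C\<^esub> a" and "a \<otimes>\<^bsub>C\<^esub> b = b \<otimes>\<^bsub>C\<^esub> a" using * by (blast intro: C_eqI)+
next
  fix a assume a: "a \<in> carrier C"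
  have *: "(\<zero>\<^bsub>C\<^esub> \<oplus>\<^bsub>C\<^esub> a) n = a n \<and> (\<one>\<^bsub>C\<^esub> \<otimes>\<^bsub>C\<^esub> a) n = a n" for n
  proof -
    interpret Q: cring "A Quot Ip n" by (rule Q_cring)
    show ?thesis using C_component[OF a, of n] by (simp add: C_simps)
  qed
  show "\<zero>\<^bsub>C\<^esub> \<oplus>\<^bsub>C\<^esub> a = a" and "\<one>\<^bsub>C\<^esub> \<otimes>\<^bsub>C\<^esub> a = a" using * by (blast intro: C_eqI)+
qed (auto intro: C_mult_closed C_add_closed C_minus C_one_zero)

sublocale C: cring C
  by (rule C_cring)

lemma emb_hom: "emb \<in> ring_hom A C"
proof (rule ring_hom_memI)
  show "emb x \<in> carrier C" if "x \<in> carrier A" for x using emb_closed[OF that] .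
  show "emb (x \<otimes> y) = emb x \<otimes>\<^bsub>C\<^esub> emb y" if "x \<in> carrier A" "y \<in> carrier A" for x y
    by (rule C_eqI) (simp add: C_simps emb_def Q_mult[OF that])
  show "emb (x \<oplus> y) = emb x \<oplus>\<^bsub>C\<^esub> emb y" if "x \<in> carrier A" "y \<in> carrier A" for x y
    by (rule C_eqI) (simp add: C_simps emb_def Q_add[OF that])
  show "emb \<one> = \<one>\<^bsub>C\<^esub>" by (rule C_eqI) (simp add: C_simps emb_def Q_one)
qed

text \<open>The kernel of the projection to \<open>A / I^n\<close>. With kernels in place of powers
  of the extended ideal, separatedness and completeness are immediate.\<close>

definition "K n = {a \<in> carrier C. a n = Ip n}"

lemma diff_K_iff:
  assumes a: "a \<in> carrier C" and b: "b \<in> carrier C"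
  shows "a \<ominus>\<^bsub>C\<^esub> b \<in> K n \<longleftrightarrow> a n = b n"
proof -
  interpret Q: cring "A Quot Ip n" by (rule Q_cring)
  define c where "c = a \<ominus>\<^bsub>C\<^esub> b"
  have c: "c \<in> carrier C" using a b by (simp add: c_def)
  have "c \<oplus>\<^bsub>C\<^esub> b = a" unfolding c_def using a b by (simp add: C.minus_eq C.a_assoc C.l_neg)
  then have e: "c n \<oplus>\<^bsub>A Quot Ip n\<^esub> b n = a n" using C_simps(2)[of c b n] by simp
  have "c \<in> K n \<longleftrightarrow> c n = \<zero>\<^bsub>A Quot Ip n\<^esub>" using c by (simp add: K_def Q_zero)
  also have "\<dots> \<longleftrightarrow> c n \<oplus>\<^bsub>A Quot Ip n\<^esub> b n = b n"
    using C_component[OF c] C_component[OF b] by (simp add: Q.add.r_cancel_one)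
  finally show ?thesis unfolding e c_def[symmetric] by simp
qed

lemma emb_K_iff: "x \<in> carrier A \<Longrightarrow> emb x \<in> K n \<longleftrightarrow> x \<in> Ip n"
  by (simp add: K_def emb_closed) (simp add: emb_def coset_zero_iff)

lemma C_antimono:
  assumes "a \<in> carrier C" "m \<le> n"
  shows "a n \<subseteq> a m"
  by (rule lift_Suc_antimono_le[of a]) (use assms in \<open>auto simp: adic_completion_def\<close>)

lemma K_rep:
  assumes a: "a \<in> K m" and mn: "m \<le> n"
  obtains x where "x \<in> Ip m" "a n = Ip n +> x"
proof -
  have ac: "a \<in> carrier C" using a by (simp add: K_def)
  obtain x where x: "x \<in> carrier A" "a n = Ip n +> x" by (rule C_rep[OF ac])
  have "x \<in> a m" using C_antimono[OF ac mn] coset_self[OF x(1), of n] x(2) by auto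
  then have "x \<in> Ip m" using a by (simp add: K_def)
  then show ?thesis using that x by blast
qed

lemma K_filtration: "complete_filtration C K"
proof (intro complete_filtration.intro complete_filtration_axioms.intro C_cring)
  show "ideal (K n) C" for n
  proof (rule C.idealI')
    interpret Q: cring "A Quot Ip n" by (rule Q_cring)
    have z: "a \<in> K n \<longleftrightarrow> a \<in> carrier C \<and> a n = \<zero>\<^bsub>A Quot Ip n\<^esub>" for a by (simp add: K_def Q_zero)
    show "K n \<subseteq> carrier C" "\<zero>\<^bsub>C\<^esub> \<in> K n" by (auto simp: z C_simps)
    show "a \<oplus>\<^bsub>C\<^esub> b \<in> K n" if "a \<in> K n" "b \<in> K n" for a b
      using that by (simp add: z C_simps)
    show "a \<otimes>\<^bsub>C\<^esub> b \<in> K n" if "a \<in> carrier C" "b \<in> K n" for a b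
      using that C_component[of a n] by (simp add: z C_simps)
  qed
  show "K (Suc n) \<subseteq> K n" for n
  proof
    fix a assume a: "a \<in> K (Suc n)"
    then have ac: "a \<in> carrier C" by (simp add: K_def)
    obtain x where x: "x \<in> carrier A" "a n = Ip n +> x" "a (Suc n) = Ip (Suc n) +> x" by (rule C_rep[OF ac])
    have "x \<in> Ip (Suc n)" using a x coset_zero_iff[OF x(1), of "Suc n"] by (simp add: K_def)
    then have "x \<in> Ip n" using Ip_mono by blast
    then show "a \<in> K n" using ac x coset_zero_iff[OF x(1), of n] by (simp add: K_def)
  qed
  show "K 0 = carrier C"
  proof -
    have "a 0 = Ip 0" if a: "a \<in> carrier C" for a
    proof -
      obtain x where x: "x \<in> carrier A" "a 0 = Ip 0 +> x" by (rule C_rep[OF a])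
      have "x \<in> Ip 0" using x(1) unfolding ideal_power_0 .
      then show ?thesis using coset_zero_iff[OF x(1), of 0] x(2) by simp
    qed
    then show ?thesis unfolding K_def by blast
  qed
  show "a \<otimes>\<^bsub>C\<^esub> b \<in> K (m + n)" if a: "a \<in> K m" and b: "b \<in> K n" for a b m n
  proof -
    obtain x where x: "x \<in> Ip m" "a (m + n) = Ip (m + n) +> x" by (rule K_rep[OF a, of "m + n"]) auto
    obtain y where y: "y \<in> Ip n" "b (m + n) = Ip (m + n) +> y" by (rule K_rep[OF b, of "m + n"]) auto
    have c: "x \<in> carrier A" "y \<in> carrier A"
      using x(1) y(1) ideal.Icarr[OF Ip_ideal] by auto
    have "x \<otimes> y \<in> Ip (m + n)" by (rule ideal_power_mult_closed[OF I x(1) y(1)])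
    then have "(a \<otimes>\<^bsub>C\<^esub> b) (m + n) = Ip (m + n)"
      unfolding C_simps x(2) y(2) Q_mult[OF c] using coset_zero_iff c by simp
    moreover have "a \<otimes>\<^bsub>C\<^esub> b \<in> carrier C" using a b by (intro C_mult_closed) (auto simp: K_def)
    ultimately show ?thesis by (simp add: K_def)
  qed
  show "a = \<zero>\<^bsub>C\<^esub>" if "a \<in> carrier C" "\<And>n. a \<in> K n" for a
    using that by (intro C_eqI) (auto simp: K_def C_simps Q_zero)
  show "\<exists>l\<in>carrier C. \<forall>n. l \<ominus>\<^bsub>C\<^esub> y n \<in> K n"
    if y: "\<And>n. y n \<in> carrier C" and cauchy: "\<And>n. y (Suc n) \<ominus>\<^bsub>C\<^esub> y n \<in> K n" for y
  proof -
    have e: "y (Suc n) n = y n n" for n using cauchy[of n] diff_K_iff[OF y y] by simp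
    \<comment> \<open>The diagonal: from index \<open>n\<close> on, the \<open>n\<close>-th
      component of the sequence no longer changes.\<close>
    define l where "l n = y n n" for n
    have l: "l \<in> carrier C"
      unfolding C_carrier
    proof
      fix n
      obtain x where x: "x \<in> carrier A" "y (Suc n) n = Ip n +> x" "y (Suc n) (Suc n) = Ip (Suc n) +> x"
        by (rule C_rep[OF y])
      then show "\<exists>x\<in>carrier A. l n = Ip n +> x \<and> l (Suc n) = Ip (Suc n) +> x"
        using e[of n] by (auto simp: l_def)
    qed
    have "l \<ominus>\<^bsub>C\<^esub> y n \<in> K n" for n using diff_K_iff[OF l y] by (simp add: l_def)
    then show ?thesis using l by blast
  qed
qed

end

section \<open>Localization at a prime\<close>

locale prime_localization = primeideal P R for R (structure) and P
begin

abbreviation "L \<equiv> localization R P"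
abbreviation "fr \<equiv> fraction R P"
abbreviation "U \<equiv> carrier R - P"

lemma U_one: "\<one> \<in> U"
  using one_imp_carrier I_notcarr by blast

lemma U_mult: "s \<in> U \<Longrightarrow> t \<in> U \<Longrightarrow> s \<otimes> t \<in> U"
  using I_prime[of s t] by blast

lemma U_carrier: "s \<in> U \<Longrightarrow> s \<in> carrier R"
  by blast

lemma frac_iff:
  assumes "r \<in> carrier R" "s \<in> U"
  shows "(r', s') \<in> fr r s \<longleftrightarrow> r' \<in> carrier R \<and> s' \<in> U \<and>
     (\<exists>t\<in>U. t \<otimes> (s' \<otimes> r) = t \<otimes> (s \<otimes> r'))"
proof -
  have "t \<otimes> (s' \<otimes> r \<ominus> s \<otimes> r') = \<zero> \<longleftrightarrow> t \<otimes> (s' \<otimes> r) = t \<otimes> (s \<otimes> r')"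
    if "t \<in> carrier R" "r' \<in> carrier R" "s' \<in> carrier R" for t
  proof -
    have "t \<otimes> (s' \<otimes> r \<ominus> s \<otimes> r') = t \<otimes> (s' \<otimes> r) \<ominus> t \<otimes> (s \<otimes> r')"
      using that assms U_carrier by algebra
    then show ?thesis using that assms by simp
  qed
  then show ?thesis by (auto simp: fraction_def)
qed

lemma frac_self: "r \<in> carrier R \<Longrightarrow> s \<in> U \<Longrightarrow> (r, s) \<in> fr r s"
  using U_one by (auto simp: frac_iff)

lemma frac_eq_iff:
  assumes r: "r \<in> carrier R" "s \<in> U" and r': "r' \<in> carrier R" "s' \<in> U"
  shows "fr r s = fr r' s' \<longleftrightarrow> (\<exists>t\<in>U. t \<otimes> (s' \<otimes> r) = t \<otimes> (s \<otimes> r'))"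
proof
  assume "fr r s = fr r' s'"
  then have "(r', s') \<in> fr r s" using frac_self[OF r'] by simp
  then show "\<exists>t\<in>U. t \<otimes> (s' \<otimes> r) = t \<otimes> (s \<otimes> r')" using frac_iff[OF r] by blast
next
  assume "\<exists>t\<in>U. t \<otimes> (s' \<otimes> r) = t \<otimes> (s \<otimes> r')"
  then obtain t where t: "t \<in> U" "t \<otimes> (s' \<otimes> r) = t \<otimes> (s \<otimes> r')" by blast
  \<comment> \<open>Transitivity of the fraction relation. The middle denominator \<open>a2\<close>
    cannot be cancelled and joins the multiplier instead.\<close>
  have step: "\<exists>t\<in>U. t \<otimes> (x2 \<otimes> b) = t \<otimes> (b2 \<otimes> x)"
    if 1: "u \<in> U" "u \<otimes> (x2 \<otimes> a) = u \<otimes> (a2 \<otimes> x)" and 2: "t \<in> U" "t \<otimes> (b2 \<otimes> a) = t \<otimes> (a2 \<otimes> b)"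
      and c: "a \<in> carrier R" "b \<in> carrier R" "x \<in> carrier R" "a2 \<in> U" "b2 \<in> U" "x2 \<in> U"
    for u t a a2 b b2 x x2
  proof (rule bexI)
    note cc = c(1-3) U_carrier[OF c(4)] U_carrier[OF c(5)] U_carrier[OF c(6)] U_carrier[OF 1(1)] U_carrier[OF 2(1)]
    have "(t \<otimes> u \<otimes> a2) \<otimes> (x2 \<otimes> b) = u \<otimes> x2 \<otimes> (t \<otimes> (a2 \<otimes> b))" using cc by (simp add: m_ac)
    also have "\<dots> = t \<otimes> b2 \<otimes> (u \<otimes> (x2 \<otimes> a))" unfolding 2(2)[symmetric] using cc by (simp add: m_ac)
    also have "\<dots> = (t \<otimes> u \<otimes> a2) \<otimes> (b2 \<otimes> x)" unfolding 1(2) using cc by (simp add: m_ac)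
    finally show "(t \<otimes> u \<otimes> a2) \<otimes> (x2 \<otimes> b) = (t \<otimes> u \<otimes> a2) \<otimes> (b2 \<otimes> x)" .
    show "t \<otimes> u \<otimes> a2 \<in> U" by (intro U_mult 1 2 c)
  qed
  have t': "t \<otimes> (s \<otimes> r') = t \<otimes> (s' \<otimes> r)" using t by simp
  show "fr r s = fr r' s'"
  proof (rule equalityI; rule subsetI)
    fix z assume z: "z \<in> fr r s"
    obtain x y where xy: "z = (x, y)" by (cases z)
    then obtain u where "x \<in> carrier R" "y \<in> U" "u \<in> U" "u \<otimes> (y \<otimes> r) = u \<otimes> (s \<otimes> x)"
      using z frac_iff[OF r] by blast
    then show "z \<in> fr r' s'"
      using step[OF _ _ t, of u y x] r r' unfolding xy frac_iff[OF r'] by blast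
  next
    fix z assume z: "z \<in> fr r' s'"
    obtain x y where xy: "z = (x, y)" by (cases z)
    then obtain u where "x \<in> carrier R" "y \<in> U" "u \<in> U" "u \<otimes> (y \<otimes> r') = u \<otimes> (s' \<otimes> x)"
      using z frac_iff[OF r'] by blast
    then show "z \<in> fr r s"
      using step[OF _ _ t(1) t', of u y x] r r' unfolding xy frac_iff[OF r] by blast
  qed
qed

lemma frac_eqI:
  assumes "r \<in> carrier R" "s \<in> U" "r' \<in> carrier R" "s' \<in> U" "s' \<otimes> r = s \<otimes> r'"
  shows "fr r s = fr r' s'"
  unfolding frac_eq_iff[OF assms(1-4)] using U_one assms(5) by auto

lemma frac_eqI':
  assumes "r \<in> carrier R" "s \<in> U" "r' \<in> carrier R" "s' \<in> U"
    and "t \<in> U" "t \<otimes> (s' \<otimes> r) = t \<otimes> (s \<otimes> r')"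
  shows "fr r s = fr r' s'"
  unfolding frac_eq_iff[OF assms(1-4)] using assms(5,6) by blast

lemma frac_mem_eq:
  assumes "r \<in> carrier R" "s \<in> U" "(r', s') \<in> fr r s"
  shows "r' \<in> carrier R" "s' \<in> U" "fr r' s' = fr r s"
proof -
  show c: "r' \<in> carrier R" "s' \<in> U" using assms frac_iff by blast+
  show "fr r' s' = fr r s"
    using frac_eq_iff[OF assms(1,2) c] assms(3) frac_iff[OF assms(1,2)] by metis
qed

lemma L_carrier: "z \<in> carrier L \<longleftrightarrow> (\<exists>r\<in>carrier R. \<exists>s\<in>U. z = fr r s)"
  by (auto simp: localization_def)

lemma frac_closed: "r \<in> carrier R \<Longrightarrow> s \<in> U \<Longrightarrow> fr r s \<in> carrier L"
  unfolding L_carrier by blast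

lemma L_one: "\<one>\<^bsub>L\<^esub> = fr \<one> \<one>" and L_zero: "\<zero>\<^bsub>L\<^esub> = fr \<zero> \<one>"
  by (auto simp: localization_def)

text \<open>The product is defined as a union over all pairs of representatives; since all of them
  give the same fraction, the union collapses to one of its terms.\<close>

lemma L_mult:
  assumes a: "a \<in> carrier R" "b \<in> U" and c: "c \<in> carrier R" "d \<in> U"
  shows "fr a b \<otimes>\<^bsub>L\<^esub> fr c d = fr (a \<otimes> c) (b \<otimes> d)"
proof -
  have e: "fr (r \<otimes> r') (s \<otimes> s') = fr (a \<otimes> c) (b \<otimes> d)"
    if rs: "(r, s) \<in> fr a b" and rs': "(r', s') \<in> fr c d" for r s r' s'
  proof -
    note 1 = frac_mem_eq(1,2)[OF a rs] and 2 = frac_mem_eq(1,2)[OF c rs']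
    obtain t where t: "t \<in> U" "t \<otimes> (s \<otimes> a) = t \<otimes> (b \<otimes> r)" using frac_iff[OF a] rs by blast
    obtain u where u: "u \<in> U" "u \<otimes> (s' \<otimes> c) = u \<otimes> (d \<otimes> r')" using frac_iff[OF c] rs' by blast
    note cc = a(1) c(1) 1(1) 2(1) U_carrier[OF a(2)] U_carrier[OF c(2)] U_carrier[OF 1(2)] U_carrier[OF 2(2)]
      U_carrier[OF t(1)] U_carrier[OF u(1)]
    have "(t \<otimes> u) \<otimes> ((b \<otimes> d) \<otimes> (r \<otimes> r')) = (t \<otimes> (b \<otimes> r)) \<otimes> (u \<otimes> (d \<otimes> r'))"
      using cc by (simp add: m_ac)
    also have "\<dots> = (t \<otimes> u) \<otimes> ((s \<otimes> s') \<otimes> (a \<otimes> c))"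
      unfolding t(2)[symmetric] u(2)[symmetric] using cc by (simp add: m_ac)
    finally have eq: "(t \<otimes> u) \<otimes> ((b \<otimes> d) \<otimes> (r \<otimes> r')) = (t \<otimes> u) \<otimes> ((s \<otimes> s') \<otimes> (a \<otimes> c))" .
    have "t \<otimes> u \<in> U" by (intro U_mult t u)
    then show ?thesis using cc by (intro frac_eqI'[OF _ _ _ _ _ eq] U_mult 1(2) 2(2) a(2) c(2) t(1) u(1)) auto
  qed
  have "fr a b \<otimes>\<^bsub>L\<^esub> fr c d =
     (\<Union>z\<in>fr a b. \<Union>z'\<in>fr c d. fr (fst z \<otimes> fst z') (snd z \<otimes> snd z'))"
    by (simp add: localization_def case_prod_beta)
  also have "\<dots> = fr (a \<otimes> c) (b \<otimes> d)"
  proof (rule UN_constant_eq[OF frac_self[OF a]], rule ballI)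
    fix z assume z: "z \<in> fr a b"
    show "(\<Union>z'\<in>fr c d. fr (fst z \<otimes> fst z') (snd z \<otimes> snd z')) = fr (a \<otimes> c) (b \<otimes> d)"
      by (rule UN_constant_eq[OF frac_self[OF c]], rule ballI, rule e) (use z in auto)
  qed
  finally show ?thesis .
qed

lemma L_add:
  assumes a: "a \<in> carrier R" "b \<in> U" and c: "c \<in> carrier R" "d \<in> U"
  shows "fr a b \<oplus>\<^bsub>L\<^esub> fr c d = fr (d \<otimes> a \<oplus> b \<otimes> c) (b \<otimes> d)"
proof -
  have e: "fr (s' \<otimes> r \<oplus> s \<otimes> r') (s \<otimes> s') = fr (d \<otimes> a \<oplus> b \<otimes> c) (b \<otimes> d)"
    if rs: "(r, s) \<in> fr a b" and rs': "(r', s') \<in> fr c d" for r s r' s'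
  proof -
    note 1 = frac_mem_eq(1,2)[OF a rs] and 2 = frac_mem_eq(1,2)[OF c rs']
    obtain t where t: "t \<in> U" "t \<otimes> (s \<otimes> a) = t \<otimes> (b \<otimes> r)" using frac_iff[OF a] rs by blast
    obtain u where u: "u \<in> U" "u \<otimes> (s' \<otimes> c) = u \<otimes> (d \<otimes> r')" using frac_iff[OF c] rs' by blast
    note cc = a(1) c(1) 1(1) 2(1) U_carrier[OF a(2)] U_carrier[OF c(2)] U_carrier[OF 1(2)] U_carrier[OF 2(2)]
      U_carrier[OF t(1)] U_carrier[OF u(1)]
    have "(t \<otimes> u) \<otimes> ((b \<otimes> d) \<otimes> (s' \<otimes> r \<oplus> s \<otimes> r')) =
      (u \<otimes> d \<otimes> s') \<otimes> (t \<otimes> (b \<otimes> r)) \<oplus> (t \<otimes> b \<otimes> s) \<otimes> (u \<otimes> (d \<otimes> r'))"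
      using cc by (simp add: m_ac r_distr)
    also have "\<dots> = (t \<otimes> u) \<otimes> ((s \<otimes> s') \<otimes> (d \<otimes> a \<oplus> b \<otimes> c))"
      unfolding t(2)[symmetric] u(2)[symmetric] using cc by (simp add: m_ac r_distr)
    finally have eq: "(t \<otimes> u) \<otimes> ((b \<otimes> d) \<otimes> (s' \<otimes> r \<oplus> s \<otimes> r')) = (t \<otimes> u) \<otimes> ((s \<otimes> s') \<otimes> (d \<otimes> a \<oplus> b \<otimes> c))" .
    have "t \<otimes> u \<in> U" by (intro U_mult t u)
    then show ?thesis using cc by (intro frac_eqI'[OF _ _ _ _ _ eq] U_mult 1(2) 2(2) a(2) c(2) t(1) u(1)) auto
  qed
  have "fr a b \<oplus>\<^bsub>L\<^esub> fr c d =
     (\<Union>z\<in>fr a b. \<Union>z'\<in>fr c d. fr (snd z' \<otimes> fst z \<oplus> snd z \<otimes> fst z') (snd z \<otimes> snd z'))"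
    by (simp add: localization_def case_prod_beta)
  also have "\<dots> = fr (d \<otimes> a \<oplus> b \<otimes> c) (b \<otimes> d)"
  proof (rule UN_constant_eq[OF frac_self[OF a]], rule ballI)
    fix z assume z: "z \<in> fr a b"
    show "(\<Union>z'\<in>fr c d. fr (snd z' \<otimes> fst z \<oplus> snd z \<otimes> fst z') (snd z \<otimes> snd z')) = fr (d \<otimes> a \<oplus> b \<otimes> c) (b \<otimes> d)"
      by (rule UN_constant_eq[OF frac_self[OF c]], rule ballI, rule e) (use z in auto)
  qed
  finally show ?thesis .
qed

lemma L_cring: "cring L"
proof (intro cringI abelian_groupI comm_monoidI)
  note cl = U_mult U_carrier
  fix x y z assume "x \<in> carrier L" "y \<in> carrier L" "z \<in> carrier L"
  then obtain a b c d e f where x: "a \<in> carrier R" "b \<in> U" "x = fr a b"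
    and y: "c \<in> carrier R" "d \<in> U" "y = fr c d" and z: "e \<in> carrier R" "f \<in> U" "z = fr e f"
    unfolding L_carrier by blast
  note cc = x(1,2) y(1,2) z(1,2) U_carrier[OF x(2)] U_carrier[OF y(2)] U_carrier[OF z(2)]
  have m: "b \<otimes> d \<in> U" "d \<otimes> f \<in> U" "b \<otimes> d \<otimes> f \<in> U" "b \<otimes> (d \<otimes> f) \<in> U" "b \<otimes> f \<in> U"
    "b \<otimes> f \<otimes> (d \<otimes> f) \<in> U"
    by (intro U_mult cc)+
  show "x \<oplus>\<^bsub>L\<^esub> y \<in> carrier L" "x \<otimes>\<^bsub>L\<^esub> y \<in> carrier L"
    unfolding x y using cc m by (simp_all add: L_add L_mult frac_closed del: Diff_iff)
  show "x \<oplus>\<^bsub>L\<^esub> y \<oplus>\<^bsub>L\<^esub> z = x \<oplus>\<^bsub>L\<^esub> (y \<oplus>\<^bsub>L\<^esub> z)"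
    unfolding x y z using cc m
    by (simp add: L_add del: Diff_iff) (simp add: m_ac r_distr a_ac del: Diff_iff)
  show "x \<otimes>\<^bsub>L\<^esub> y \<otimes>\<^bsub>L\<^esub> z = x \<otimes>\<^bsub>L\<^esub> (y \<otimes>\<^bsub>L\<^esub> z)"
    unfolding x y z using cc m
    by (simp add: L_mult del: Diff_iff) (simp add: m_ac del: Diff_iff)
  show "x \<oplus>\<^bsub>L\<^esub> y = y \<oplus>\<^bsub>L\<^esub> x" "x \<otimes>\<^bsub>L\<^esub> y = y \<otimes>\<^bsub>L\<^esub> x"
    unfolding x y using cc m
    by (simp_all add: L_add L_mult m_comm[of d b] m_comm[of c a] a_comm[of "b \<otimes> c"] del: Diff_iff)
  show "(x \<oplus>\<^bsub>L\<^esub> y) \<otimes>\<^bsub>L\<^esub> z = x \<otimes>\<^bsub>L\<^esub> z \<oplus>\<^bsub>L\<^esub> y \<otimes>\<^bsub>L\<^esub> z"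
    unfolding x y z using cc m
    by (simp add: L_add L_mult del: Diff_iff, intro frac_eqI)
      (auto intro!: U_mult simp del: Diff_iff simp: m_ac r_distr l_distr)
  show "\<zero>\<^bsub>L\<^esub> \<oplus>\<^bsub>L\<^esub> x = x" "\<one>\<^bsub>L\<^esub> \<otimes>\<^bsub>L\<^esub> x = x"
    unfolding x L_zero L_one using cc U_one by (simp_all add: L_add L_mult del: Diff_iff)
  show "\<exists>y\<in>carrier L. y \<oplus>\<^bsub>L\<^esub> x = \<zero>\<^bsub>L\<^esub>"
  proof (rule bexI)
    show "fr (\<ominus> a) b \<in> carrier L" using cc by (intro frac_closed) auto
    have "fr (\<ominus> a) b \<oplus>\<^bsub>L\<^esub> x = fr (b \<otimes> \<ominus> a \<oplus> b \<otimes> a) (b \<otimes> b)"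
      unfolding x(3) using cc by (intro L_add) auto
    also have "b \<otimes> \<ominus> a \<oplus> b \<otimes> a = \<zero>" using cc by (simp add: r_minus l_neg)
    also have "fr \<zero> (b \<otimes> b) = \<zero>\<^bsub>L\<^esub>"
      unfolding L_zero using cc U_one by (intro frac_eqI U_mult) auto
    finally show "fr (\<ominus> a) b \<oplus>\<^bsub>L\<^esub> x = \<zero>\<^bsub>L\<^esub>" .
  qed
next
  show "\<zero>\<^bsub>L\<^esub> \<in> carrier L" "\<one>\<^bsub>L\<^esub> \<in> carrier L"
    unfolding L_zero L_one using U_one by (auto intro!: frac_closed simp del: Diff_iff)
qed

sublocale L: cring L
  by (rule L_cring)

definition "ext_ideal J = {fr r s |r s. r \<in> J \<and> s \<in> U}"

lemma localization_ideal_eq: "localization_ideal R P = ext_ideal P"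
  by (simp add: localization_ideal_def ext_ideal_def)

context
  fixes J assumes J: "ideal J R"
begin

interpretation J: ideal J R by (rule J)

text \<open>A fraction determines its numerator only up to factors outside \<open>P\<close>, so
  membership of the numerator is tested after such a multiplication.\<close>

lemma ext_ideal_iff:
  assumes "r \<in> carrier R" "s \<in> U"
  shows "fr r s \<in> ext_ideal J \<longleftrightarrow> (\<exists>t\<in>U. t \<otimes> r \<in> J)"
proof
  assume "fr r s \<in> ext_ideal J"
  then obtain r' s' where r': "r' \<in> J" "s' \<in> U" "fr r s = fr r' s'" by (auto simp: ext_ideal_def)
  have r'c: "r' \<in> carrier R" using r'(1) by (rule J.Icarr)
  obtain t where t: "t \<in> U" "t \<otimes> (s' \<otimes> r) = t \<otimes> (s \<otimes> r')"
    using frac_eq_iff[OF assms r'c r'(2)] r'(3) by blast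
  have "t \<otimes> (s \<otimes> r') \<in> J" using t(1) assms r' by (intro J.I_l_closed) auto
  then have "(t \<otimes> s') \<otimes> r \<in> J" using t(2) t(1) r'(2) assms by (simp add: m_assoc)
  then show "\<exists>t\<in>U. t \<otimes> r \<in> J" using U_mult[OF t(1) r'(2)] by blast
next
  assume "\<exists>t\<in>U. t \<otimes> r \<in> J"
  then obtain t where t: "t \<in> U" "t \<otimes> r \<in> J" by blast
  have "fr r s = fr (t \<otimes> r) (t \<otimes> s)"
    using t(1) assms by (intro frac_eqI U_mult) (auto simp: m_ac)
  then show "fr r s \<in> ext_ideal J"
    using t U_mult[OF t(1) assms(2)] unfolding ext_ideal_def by blast
qed

lemma ext_ideal_ideal: "ideal (ext_ideal J) L"
proof (rule L.idealI')
  show "ext_ideal J \<subseteq> carrier L" using frac_closed J.Icarr by (auto simp: ext_ideal_def)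
  show "\<zero>\<^bsub>L\<^esub> \<in> ext_ideal J"
    unfolding L_zero using U_one J.zero_closed unfolding ext_ideal_def by blast
  fix x assume "x \<in> ext_ideal J"
  then obtain a b where x: "a \<in> J" "b \<in> U" "x = fr a b" unfolding ext_ideal_def by blast
  have xc: "a \<in> carrier R" "b \<in> carrier R" using x J.Icarr by auto
  show "x \<oplus>\<^bsub>L\<^esub> y \<in> ext_ideal J" if yJ: "y \<in> ext_ideal J" for y
  proof -
    obtain c d where y: "c \<in> J" "d \<in> U" "y = fr c d" using yJ unfolding ext_ideal_def by blast
    have yc: "c \<in> carrier R" "d \<in> carrier R" using y J.Icarr by auto
    have "d \<otimes> a \<oplus> b \<otimes> c \<in> J" using x y xc yc by (intro J.a_closed J.I_l_closed) auto
    then show ?thesis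
      unfolding x(3) y(3) L_add[OF xc(1) x(2) yc(1) y(2)] using U_mult[OF x(2) y(2)]
      unfolding ext_ideal_def by blast
  qed
  show "y \<otimes>\<^bsub>L\<^esub> x \<in> ext_ideal J" if yL: "y \<in> carrier L" for y
  proof -
    obtain c d where y: "c \<in> carrier R" "d \<in> U" "y = fr c d" using yL unfolding L_carrier by blast
    have "c \<otimes> a \<in> J" using x y xc by (intro J.I_l_closed) auto
    then show ?thesis
      unfolding x(3) y(3) L_mult[OF y(1,2) xc(1) x(2)] using U_mult[OF y(2) x(2)]
      unfolding ext_ideal_def by blast
  qed
qed

end

text \<open>Extending ideals commutes with products. For the harder inclusion, numerators are
  treated over the denominator 1, and \<open>1 / s\<close> is multiplied in at the end.\<close>

lemma ext_ideal_power: "ideal_power L (ext_ideal P) n = ext_ideal (ideal_power R P n)"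
proof (induct n)
  case 0
  have "ext_ideal (carrier R) = carrier L"
    by (simp add: ext_ideal_def localization_def)
  then show ?case unfolding ideal_power_0 by simp
next
  case (Suc n)
  define J where "J = ideal_power R P n"
  have J: "ideal J R" unfolding J_def by (rule ideal_power_ideal[OF is_ideal])
  have JP: "ideal (ideal_prod R J P) R" by (rule ideal_prod_is_ideal[OF J is_ideal])
  interpret J: ideal J R by (rule J)
  interpret JP: ideal "ideal_prod R J P" R by (rule JP)
  have "ideal_prod L (ext_ideal J) (ext_ideal P) = ext_ideal (ideal_prod R J P)"
  proof
    show "ideal_prod L (ext_ideal J) (ext_ideal P) \<subseteq> ext_ideal (ideal_prod R J P)"
    proof (rule L.ideal_prod_least[OF ext_ideal_ideal[OF JP]])
      fix x y assume "x \<in> ext_ideal J" "y \<in> ext_ideal P"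
      then obtain a b c d where x: "a \<in> J" "b \<in> U" "x = fr a b" and y: "c \<in> P" "d \<in> U" "y = fr c d"
        unfolding ext_ideal_def by blast
      have "x \<otimes>\<^bsub>L\<^esub> y = fr (a \<otimes> c) (b \<otimes> d)"
        unfolding x(3) y(3) using x y J.Icarr by (intro L_mult) auto
      moreover have "a \<otimes> c \<in> ideal_prod R J P" by (rule ideal_prod.prod[OF x(1) y(1)])
      ultimately show "x \<otimes>\<^bsub>L\<^esub> y \<in> ext_ideal (ideal_prod R J P)"
        using U_mult[OF x(2) y(2)] unfolding ext_ideal_def by blast
    qed
    interpret LJP: ideal "ideal_prod L (ext_ideal J) (ext_ideal P)" L
      by (rule L.ideal_prod_is_ideal[OF ext_ideal_ideal[OF J] ext_ideal_ideal[OF is_ideal]])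
    have gen: "fr r \<one> \<in> ideal_prod L (ext_ideal J) (ext_ideal P)" if "r \<in> ideal_prod R J P" for r
      using that
    proof induct
      case (prod i j)
      have "fr i \<one> \<otimes>\<^bsub>L\<^esub> fr j \<one> = fr (i \<otimes> j) (\<one> \<otimes> \<one>)"
        using prod U_one J.Icarr by (intro L_mult) auto
      moreover have "fr i \<one> \<otimes>\<^bsub>L\<^esub> fr j \<one> \<in> ideal_prod L (ext_ideal J) (ext_ideal P)"
        using prod U_one by (intro ideal_prod.prod) (auto simp: ext_ideal_def simp del: Diff_iff)
      ultimately show ?case by simp
    next
      case (sum r s)
      have c: "r \<in> carrier R" "s \<in> carrier R" using sum JP.Icarr by auto
      have "fr r \<one> \<oplus>\<^bsub>L\<^esub> fr s \<one> = fr (\<one> \<otimes> r \<oplus> \<one> \<otimes> s) (\<one> \<otimes> \<one>)"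
        using c U_one by (intro L_add) auto
      then show ?case using LJP.a_closed[OF sum(2,4)] c by simp
    qed
    show "ext_ideal (ideal_prod R J P) \<subseteq> ideal_prod L (ext_ideal J) (ext_ideal P)"
    proof
      fix x assume "x \<in> ext_ideal (ideal_prod R J P)"
      then obtain r s where x: "r \<in> ideal_prod R J P" "s \<in> U" "x = fr r s" unfolding ext_ideal_def by blast
      have rc: "r \<in> carrier R" using x JP.Icarr by auto
      have "fr \<one> s \<otimes>\<^bsub>L\<^esub> fr r \<one> = fr (\<one> \<otimes> r) (s \<otimes> \<one>)"
        using x rc U_one by (intro L_mult) auto
      then have "fr \<one> s \<otimes>\<^bsub>L\<^esub> fr r \<one> = x" using x rc by simp
      moreover have "fr \<one> s \<in> carrier L" using x by (intro frac_closed) auto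
      ultimately show "x \<in> ideal_prod L (ext_ideal J) (ext_ideal P)"
        using LJP.I_l_closed[OF gen[OF x(1)]] by metis
    qed
  qed
  then show ?case using Suc unfolding ideal_power_Suc J_def by simp
qed

end

section \<open>Extension of root-linear maps to the completion\<close>

lemma (in abelian_group) diff_add_cancel:
  "a \<in> carrier G \<Longrightarrow> b \<in> carrier G \<Longrightarrow> (a \<ominus> b) \<oplus> b = a"
  by (simp add: minus_eq a_assoc l_neg)

lemma (in abelian_group) add_diff:
  "x \<in> carrier G \<Longrightarrow> y \<in> carrier G \<Longrightarrow> x \<oplus> (y \<ominus> x) = y"
  using diff_add_cancel[of y x] a_comm[of x "y \<ominus> x"] by simp

lemma (in abelian_group) diff_add_diff:
  "x \<in> carrier G \<Longrightarrow> y \<in> carrier G \<Longrightarrow> z \<in> carrier G \<Longrightarrow> (x \<ominus> y) \<oplus> (y \<ominus> z) = x \<ominus> z"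
  by (simp add: minus_eq a_assoc r_neg1)

lemma (in abelian_group) add_diff_add:
  "\<lbrakk>a \<in> carrier G; b \<in> carrier G; c \<in> carrier G; d \<in> carrier G\<rbrakk> \<Longrightarrow> (a \<oplus> b) \<ominus> (c \<oplus> d) = (a \<ominus> c) \<oplus> (b \<ominus> d)"
  by (simp add: minus_eq minus_add a_ac)

lemma (in abelian_group) diff_diff_right:
  "x \<in> carrier G \<Longrightarrow> y \<in> carrier G \<Longrightarrow> z \<in> carrier G \<Longrightarrow> (x \<ominus> z) \<ominus> (y \<ominus> z) = x \<ominus> y"
  using add_diff_add[of x "\<ominus> z" y "\<ominus> z"] by (simp add: minus_eq r_neg l_neg)

lemma (in module) smult_diff_distr:
  "a \<in> carrier R \<Longrightarrow> x \<in> carrier M \<Longrightarrow> y \<in> carrier M \<Longrightarrow> a \<odot>\<^bsub>M\<^esub> (x \<ominus>\<^bsub>M\<^esub> y) = a \<odot>\<^bsub>M\<^esub> x \<ominus>\<^bsub>M\<^esub> a \<odot>\<^bsub>M\<^esub> y"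
  by (simp add: M.minus_eq smult_r_distr smult_r_minus)

lemma (in abelian_group) diff_diff_cancel:
  "a \<in> carrier G \<Longrightarrow> b \<in> carrier G \<Longrightarrow> a \<ominus> (a \<ominus> b) = b"
  by (simp add: minus_eq minus_add r_neg1 r_neg2)

section \<open>Abstract completions of a localization and their noetherianity\<close>

lemma (in cring) combinations_finsum:
  assumes "ideal I R" "finite Z" "Z \<subseteq> carrier R" "w \<in> combinations R I Z"
  shows "\<exists>a\<in>Z \<rightarrow> I. w = (\<Oplus>x\<in>Z. a x \<otimes> x)"
  using assms(2-4)
proof (induct Z arbitrary: w rule: finite_induct)
  case empty
  have "w = \<zero>" using empty(2) by (cases rule: combinations.cases) auto
  then show ?case by simp
next
  case (insert x Z)
  interpret I: ideal I R by fact
  obtain m v where m: "m \<in> I" "v \<in> combinations R I Z" "w = m \<otimes> x \<oplus> v"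
    using combinations_insert[OF assms(1) _ _ insert(5)] insert(4) by auto
  obtain a where a: "a \<in> Z \<rightarrow> I" "v = (\<Oplus>x\<in>Z. a x \<otimes> x)" using insert(3)[OF _ m(2)] insert(4) by auto
  have c: "m \<in> carrier R" "x \<in> carrier R" using m(1) insert(4) by auto
  have ac: "a z \<in> carrier R" "z \<in> carrier R" if "z \<in> Z" for z
    using I.Icarr[OF funcset_mem[OF a(1) that]] insert(4) that by auto
  have "(\<Oplus>z\<in>insert x Z. (a(x := m)) z \<otimes> z) = m \<otimes> x \<oplus> (\<Oplus>z\<in>Z. (a(x := m)) z \<otimes> z)"
    using insert c ac by (subst finsum_insert) auto
  also have "(\<Oplus>z\<in>Z. (a(x := m)) z \<otimes> z) = v"
    unfolding a(2) using insert ac by (intro finsum_cong') auto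
  finally have "w = (\<Oplus>z\<in>insert x Z. (a(x := m)) z \<otimes> z)" using m by simp
  moreover have "a(x := m) \<in> insert x Z \<rightarrow> I" using a m by auto
  ultimately show ?case by blast
qed

text \<open>The completion of \<open>R_P\<close> as seen from \<open>R\<close>: elements outside
  \<open>P\<close> become units, fractions are dense, and \<open>K n\<close> pulls back to the
  elements that lie in \<open>P^n\<close> up to a factor outside \<open>P\<close>. Denominators are
  multiplied out in these axioms, so that \<open>R_P\<close> itself does not occur.\<close>

locale local_completion = R: cring R + P: primeideal P R + S: complete_filtration S K
  for R (structure) and P and S and K +
  fixes \<iota>
  assumes noeth: "noetherian_ring R"
    and \<iota>_hom: "\<iota> \<in> ring_hom R S"
    and \<iota>_unit: "\<And>t. t \<in> carrier R - P \<Longrightarrow> \<exists>v\<in>carrier S. v \<otimes>\<^bsub>S\<^esub> \<iota> t = \<one>\<^bsub>S\<^esub>"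
    and \<iota>_dense: "\<And>s n. s \<in> carrier S \<Longrightarrow> \<exists>r\<in>carrier R. \<exists>t\<in>carrier R - P. \<iota> t \<otimes>\<^bsub>S\<^esub> s \<ominus>\<^bsub>S\<^esub> \<iota> r \<in> K n"
    and \<iota>_K: "\<And>r n. r \<in> carrier R \<Longrightarrow> \<iota> r \<in> K n \<longleftrightarrow> (\<exists>t\<in>carrier R - P. t \<otimes> r \<in> ideal_power R P n)"
begin

abbreviation "U \<equiv> carrier R - P"

lemma U_one: "\<one> \<in> U"
  using P.one_imp_carrier P.I_notcarr by blast

lemma U_carrier: "s \<in> U \<Longrightarrow> s \<in> carrier R"
  by blast

lemma U_mult: "s \<in> U \<Longrightarrow> t \<in> U \<Longrightarrow> s \<otimes> t \<in> U"
  using P.I_prime[of s t] by blast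

lemma U_pow: "s \<in> U \<Longrightarrow> s [^] (n::nat) \<in> U"
proof (induct n)
  case 0
  then show ?case using U_one unfolding R.nat_pow_0 by blast
next
  case (Suc n)
  then show ?case unfolding R.nat_pow_Suc by (intro U_mult)
qed

sublocale \<iota>: ring_hom_cring R S \<iota>
  by (intro ring_hom_cring.intro ring_hom_cring_axioms.intro R.is_cring S.is_cring \<iota>_hom)

lemma \<iota>_closed: "r \<in> carrier R \<Longrightarrow> \<iota> r \<in> carrier S"
  by simp

lemma \<iota>_K_I: "r \<in> ideal_power R P n \<Longrightarrow> \<iota> r \<in> K n"
proof -
  assume r: "r \<in> ideal_power R P n"
  have rc: "r \<in> carrier R" using ideal.Icarr[OF R.ideal_power_ideal[OF P.is_ideal] r] .
  have "\<one> \<otimes> r \<in> ideal_power R P n" using r rc by simp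
  then show ?thesis using \<iota>_K[OF rc] U_one by blast
qed

lemma K_cancel_unit:
  assumes "t \<in> U" "s \<in> carrier S" "\<iota> t \<otimes>\<^bsub>S\<^esub> s \<in> K n"
  shows "s \<in> K n"
proof -
  interpret Kn: ideal "K n" S by (rule S.K_ideal)
  obtain v where v: "v \<in> carrier S" "v \<otimes>\<^bsub>S\<^esub> \<iota> t = \<one>\<^bsub>S\<^esub>" using \<iota>_unit[OF assms(1)] by blast
  have "v \<otimes>\<^bsub>S\<^esub> (\<iota> t \<otimes>\<^bsub>S\<^esub> s) \<in> K n" by (rule Kn.I_l_closed[OF assms(3) v(1)])
  moreover have "v \<otimes>\<^bsub>S\<^esub> (\<iota> t \<otimes>\<^bsub>S\<^esub> s) = s"
    using v assms U_carrier[OF assms(1)] by (simp add: S.m_assoc[symmetric])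
  ultimately show ?thesis by simp
qed

lemma K_diff_mem:
  assumes "a \<ominus>\<^bsub>S\<^esub> b \<in> K n" "a \<in> carrier S" "b \<in> carrier S"
  shows "a \<in> K n \<longleftrightarrow> b \<in> K n"
proof -
  interpret Kn: ideal "K n" S by (rule S.K_ideal)
  have "a = (a \<ominus>\<^bsub>S\<^esub> b) \<oplus>\<^bsub>S\<^esub> b" "b = a \<ominus>\<^bsub>S\<^esub> (a \<ominus>\<^bsub>S\<^esub> b)"
    using assms(2,3) by (simp_all add: S.diff_add_cancel S.diff_diff_cancel)
  then show ?thesis using assms(1) Kn.a_closed Kn.minus_in by metis
qed

text \<open>Approximate \<open>z\<close> by a fraction \<open>r / t\<close>. Up to a unit
  \<open>u\<close>, the numerator lies in \<open>P^(n+1)\<close>, which is \<open>P^n\<close> times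
  \<open>P\<close>, so it is a combination of the generators with coefficients in
  \<open>P^n\<close>. Dividing by the unit \<open>t u\<close> gives the coefficients for
  \<open>z\<close>.\<close>

lemma K_Suc_combination:
  assumes G: "finite G" "G \<subseteq> carrier R" "P = genideal R G" and z: "z \<in> K (Suc n)"
  shows "\<exists>a\<in>\<iota> ` G \<rightarrow> K n. z \<ominus>\<^bsub>S\<^esub> (\<Oplus>\<^bsub>S\<^esub>y\<in>\<iota> ` G. a y \<otimes>\<^bsub>S\<^esub> y) \<in> K (Suc (Suc n))"
proof -
  have zc: "z \<in> carrier S" using z by (rule S.K_carrier)
  have Gi: "\<iota> ` G \<subseteq> carrier S" using G by auto
  obtain r t where r: "r \<in> carrier R" "t \<in> U" "\<iota> t \<otimes>\<^bsub>S\<^esub> z \<ominus>\<^bsub>S\<^esub> \<iota> r \<in> K (Suc (Suc n))"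
    using \<iota>_dense[OF zc] by blast
  interpret K2: ideal "K (Suc (Suc n))" S by (rule S.K_ideal)
  interpret K1: ideal "K (Suc n)" S by (rule S.K_ideal)
  have tc: "t \<in> carrier R" using r by simp
  have "\<iota> t \<otimes>\<^bsub>S\<^esub> z \<in> K (Suc n)" using z tc by (intro K1.I_l_closed) auto
  moreover have "\<iota> t \<otimes>\<^bsub>S\<^esub> z \<ominus>\<^bsub>S\<^esub> \<iota> r \<in> K (Suc n)" using r(3) S.K_Suc by blast
  ultimately have "\<iota> r \<in> K (Suc n)" using K_diff_mem r(1) tc zc by (metis \<iota>_closed S.m_closed)
  then obtain u where u: "u \<in> U" "u \<otimes> r \<in> ideal_power R P (Suc n)" using \<iota>_K[OF r(1)] by blast
  have uc: "u \<in> carrier R" using u by simp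
  have Pn: "ideal (ideal_power R P n) R" by (rule R.ideal_power_ideal[OF P.is_ideal])
  have "ideal_prod R (ideal_power R P n) P \<subseteq> combinations R (ideal_power R P n) G"
    using R.mult_genideal_combinations[OF Pn G(2)] G(3)
    by (intro R.ideal_prod_least R.combinations_ideal Pn G) auto
  then have w: "u \<otimes> r \<in> combinations R (ideal_power R P n) G" using u(2) unfolding ideal_power_Suc by blast
  have comb: "\<iota> w \<in> combinations S (K n) (\<iota> ` G)" if "w \<in> combinations R (ideal_power R P n) G" for w
    using that
  proof induct
    case zero
    then show ?case using combinations.zero[of S] by simp
  next
    case (step m x w)
    have c: "m \<in> carrier R" "x \<in> carrier R" "w \<in> carrier R"
      using step G(2) ideal.Icarr[OF Pn] R.combinations_carrier[OF Pn G(2)] by auto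
    have "\<iota> (m \<otimes> x \<oplus> w) = \<iota> m \<otimes>\<^bsub>S\<^esub> \<iota> x \<oplus>\<^bsub>S\<^esub> \<iota> w" using c by simp
    then show ?case using step \<iota>_K_I[OF step(1)] combinations.step[of "\<iota> m" "K n" "\<iota> x" "\<iota> ` G" "\<iota> w" S] by simp
  qed
  obtain v where v: "v \<in> carrier S" "v \<otimes>\<^bsub>S\<^esub> \<iota> (t \<otimes> u) = \<one>\<^bsub>S\<^esub>" using \<iota>_unit[OF U_mult[OF r(2) u(1)]] by blast
  have "v \<otimes>\<^bsub>S\<^esub> \<iota> (u \<otimes> r) \<in> combinations S (K n) (\<iota> ` G)"
    by (intro S.combinations_mult[OF S.K_ideal Gi] comb w v(1))
  then obtain a where a: "a \<in> \<iota> ` G \<rightarrow> K n" "v \<otimes>\<^bsub>S\<^esub> \<iota> (u \<otimes> r) = (\<Oplus>\<^bsub>S\<^esub>y\<in>\<iota> ` G. a y \<otimes>\<^bsub>S\<^esub> y)"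
    using S.combinations_finsum[OF S.K_ideal _ Gi] G(1) by blast
  have c: "\<iota> t \<in> carrier S" "\<iota> u \<in> carrier S" "\<iota> r \<in> carrier S" using tc uc r(1) by auto
  have "(v \<otimes>\<^bsub>S\<^esub> \<iota> u) \<otimes>\<^bsub>S\<^esub> (\<iota> t \<otimes>\<^bsub>S\<^esub> z \<ominus>\<^bsub>S\<^esub> \<iota> r) = (v \<otimes>\<^bsub>S\<^esub> (\<iota> t \<otimes>\<^bsub>S\<^esub> \<iota> u)) \<otimes>\<^bsub>S\<^esub> z \<ominus>\<^bsub>S\<^esub> v \<otimes>\<^bsub>S\<^esub> (\<iota> u \<otimes>\<^bsub>S\<^esub> \<iota> r)"
    using c v(1) zc by algebra
  also have "\<dots> = z \<ominus>\<^bsub>S\<^esub> v \<otimes>\<^bsub>S\<^esub> \<iota> (u \<otimes> r)" using v tc uc r(1) zc by simp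
  finally have "z \<ominus>\<^bsub>S\<^esub> v \<otimes>\<^bsub>S\<^esub> \<iota> (u \<otimes> r) \<in> K (Suc (Suc n))"
    using K2.I_l_closed[OF r(3), of "v \<otimes>\<^bsub>S\<^esub> \<iota> u"] v(1) c by simp
  then show ?thesis using a by auto
qed

text \<open>The criterion for complete filtrations applies: generators of \<open>P\<close> generate
  \<open>K 1\<close> by successive approximation, and an element outside \<open>K 1\<close> differs
  by an element of \<open>K 1\<close>, up to a unit factor, from the image of some \<open>r\<close>
  outside \<open>P\<close>, which is a unit. Hence nothing lies strictly between \<open>K 1\<close>
  and the whole ring.\<close>

lemma noetherian_S: "noetherian_ring S"
proof -
  obtain G where G: "finite G" "G \<subseteq> carrier R" "P = genideal R G"
    using noetherian_ring.finetely_gen[OF noeth P.is_ideal] by blast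
  have P1: "ideal_power R P 1 = P" by (rule R.ideal_power_1[OF P.is_ideal])
  have Gi: "\<iota> ` G \<subseteq> carrier S" using G by auto
  interpret K1: ideal "K 1" S by (rule S.K_ideal)
  have "G \<subseteq> P" using R.genideal_self[OF G(2)] G(3) by simp
  then have GK: "\<iota> ` G \<subseteq> K 1" using \<iota>_K_I[of _ 1] unfolding P1 by blast
  show ?thesis
  proof (rule S.noetherian)
    show "finite (\<iota> ` G)" using G by simp
    show "\<iota> ` G \<subseteq> carrier S" by (rule Gi)
    show "K 1 = genideal S (\<iota> ` G)"
    proof
      show "genideal S (\<iota> ` G) \<subseteq> K 1" by (rule S.genideal_minimal[OF S.K_ideal GK])
      interpret I: ideal "genideal S (\<iota> ` G)" S by (rule S.genideal_ideal[OF Gi])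
      show "K 1 \<subseteq> genideal S (\<iota> ` G)"
      proof
        fix z assume z: "z \<in> K 1"
        have "\<exists>b\<in>\<iota> ` G \<rightarrow> carrier S. z = (\<Oplus>\<^bsub>S\<^esub>y\<in>\<iota> ` G. b y \<otimes>\<^bsub>S\<^esub> y)"
        \<comment> \<open>The remainders lie one level deeper than the coefficients, because the
          generators themselves already lie in \<open>K 1\<close>.\<close>
        proof (rule S.successive_approximation[OF _ Gi, of "\<lambda>n. K (Suc n)"])
          show "\<exists>a\<in>\<iota> ` G \<rightarrow> K n. z \<ominus>\<^bsub>S\<^esub> (\<Oplus>\<^bsub>S\<^esub>y\<in>\<iota> ` G. a y \<otimes>\<^bsub>S\<^esub> y) \<in> K (Suc (Suc n))"
            if "z \<in> K (Suc n)" for n z by (rule K_Suc_combination[OF G that])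
        qed (use G z S.K_Suc in auto)
        then obtain b where b: "b \<in> \<iota> ` G \<rightarrow> carrier S" "z = (\<Oplus>\<^bsub>S\<^esub>y\<in>\<iota> ` G. b y \<otimes>\<^bsub>S\<^esub> y)" by blast
        show "z \<in> genideal S (\<iota> ` G)"
          unfolding b(2) using b(1) S.genideal_self[OF Gi]
          by (intro S.finsum_ideal I.is_ideal I.I_l_closed) auto
      qed
    qed
    fix I assume I: "ideal I S" "K 1 \<subseteq> I"
    interpret I: ideal I S by fact
    have "I = carrier S" if ne: "I \<noteq> K 1"
    proof -
      obtain z where z: "z \<in> I" "z \<notin> K 1" using ne I(2) by blast
      have zc: "z \<in> carrier S" using z(1) by (rule I.Icarr)
      obtain r t where r: "r \<in> carrier R" "t \<in> U" "\<iota> t \<otimes>\<^bsub>S\<^esub> z \<ominus>\<^bsub>S\<^esub> \<iota> r \<in> K 1"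
        using \<iota>_dense[OF zc] by blast
      have tc: "\<iota> t \<in> carrier S" "\<iota> r \<in> carrier S" using r by auto
      have "\<iota> t \<otimes>\<^bsub>S\<^esub> z \<notin> K 1" using K_cancel_unit[OF r(2) zc] z(2) by blast
      then have "\<iota> r \<notin> K 1" using K_diff_mem[OF r(3)] tc zc by simp
      then have "r \<notin> P" using \<iota>_K_I[of r 1] unfolding P1 by blast
      then obtain v where v: "v \<in> carrier S" "v \<otimes>\<^bsub>S\<^esub> \<iota> r = \<one>\<^bsub>S\<^esub>" using \<iota>_unit[of r] r(1) by blast
      have "\<iota> r = \<iota> t \<otimes>\<^bsub>S\<^esub> z \<ominus>\<^bsub>S\<^esub> (\<iota> t \<otimes>\<^bsub>S\<^esub> z \<ominus>\<^bsub>S\<^esub> \<iota> r)"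
        using tc zc by (simp add: S.diff_diff_cancel)
      moreover have "\<iota> t \<otimes>\<^bsub>S\<^esub> z \<in> I" using z(1) tc by (intro I.I_l_closed)
      ultimately have "\<iota> r \<in> I" using I.minus_in I(2) r(3) by (metis subsetD)
      then have "\<one>\<^bsub>S\<^esub> \<in> I" using I.I_l_closed[OF _ v(1)] v(2) by metis
      then show ?thesis by (rule I.one_imp_carrier)
    qed
    then show "I = K 1 \<or> I = carrier S" by blast
  qed
qed

end

text \<open>Covers the two targets to which maps are extended: \<open>S\<close> over itself with
  \<open>Y = K\<close>, and the hull of \<open>R/P\<close> with the discrete filtration.
  \<open>Y_K\<close> says that multiplication is continuous in the scalar at each fixed
  \<open>x\<close>.\<close>

locale complete_module = local_completion R P S K \<iota> + N: module S N
  for R (structure) and P and S and K and \<iota> and N +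
  fixes Y
  assumes Y_submodule: "\<And>m. submodule (Y m) S N"
    and Y_Suc: "\<And>m. Y (Suc m) \<subseteq> Y m"
    and Y_Inter: "\<And>x. x \<in> carrier N \<Longrightarrow> (\<And>m. x \<in> Y m) \<Longrightarrow> x = \<zero>\<^bsub>N\<^esub>"
    and Y_complete: "\<And>y. (\<And>m. y m \<in> carrier N) \<Longrightarrow> (\<And>m. y (Suc m) \<ominus>\<^bsub>N\<^esub> y m \<in> Y m) \<Longrightarrow>
       \<exists>l\<in>carrier N. \<forall>m. l \<ominus>\<^bsub>N\<^esub> y m \<in> Y m"
    and Y_K: "\<And>x m. x \<in> carrier N \<Longrightarrow> \<exists>n. \<forall>k\<in>K n. k \<odot>\<^bsub>N\<^esub> x \<in> Y m"
begin

lemma Y_add: "x \<in> Y m \<Longrightarrow> y \<in> Y m \<Longrightarrow> x \<oplus>\<^bsub>N\<^esub> y \<in> Y m"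
  by (rule N.submoduleE(5)[OF Y_submodule])

lemma Y_smult: "a \<in> carrier S \<Longrightarrow> x \<in> Y m \<Longrightarrow> a \<odot>\<^bsub>N\<^esub> x \<in> Y m"
  by (rule N.submoduleE(4)[OF Y_submodule])

lemma Y_minus: "x \<in> Y m \<Longrightarrow> \<ominus>\<^bsub>N\<^esub> x \<in> Y m"
  by (rule N.submoduleE(3)[OF Y_submodule])

lemma Y_diff: "x \<in> Y m \<Longrightarrow> y \<in> Y m \<Longrightarrow> x \<ominus>\<^bsub>N\<^esub> y \<in> Y m"
  unfolding N.M.minus_eq by (intro Y_add Y_minus)

lemma Y_trans:
  assumes "a \<ominus>\<^bsub>N\<^esub> b \<in> Y m" "b \<ominus>\<^bsub>N\<^esub> c \<in> Y m" "a \<in> carrier N" "b \<in> carrier N" "c \<in> carrier N"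
  shows "a \<ominus>\<^bsub>N\<^esub> c \<in> Y m"
  using Y_add[OF assms(1,2)] N.M.diff_add_diff[OF assms(3-5)] by simp

lemma Y_cancel_unit:
  assumes "t \<in> U" "x \<in> carrier N" "\<iota> t \<odot>\<^bsub>N\<^esub> x \<in> Y m"
  shows "x \<in> Y m"
proof -
  obtain v where v: "v \<in> carrier S" "v \<otimes>\<^bsub>S\<^esub> \<iota> t = \<one>\<^bsub>S\<^esub>" using \<iota>_unit[OF assms(1)] by blast
  have "v \<odot>\<^bsub>N\<^esub> (\<iota> t \<odot>\<^bsub>N\<^esub> x) \<in> Y m" by (rule Y_smult[OF v(1) assms(3)])
  moreover have "v \<odot>\<^bsub>N\<^esub> (\<iota> t \<odot>\<^bsub>N\<^esub> x) = x"
    using v assms U_carrier[OF assms(1)] by (simp add: N.smult_assoc1[symmetric])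
  ultimately show ?thesis by simp
qed

end

lemma (in local_completion) \<iota>_pow:
  "x \<in> carrier R \<Longrightarrow> \<iota> (x [^] (n::nat)) = \<iota> x [^]\<^bsub>S\<^esub> n"
  by (induct n) auto

text \<open>A root-linear map can pull out only \<open>q\<close>-th powers, so the approximating
  fraction \<open>r / t\<close> is expanded by \<open>t^(q-1)\<close>.\<close>

lemma (in local_completion) approximation:
  assumes q: "q \<noteq> (0::nat)" and "s \<in> carrier S"
  shows "\<exists>r\<in>carrier R. \<exists>t\<in>U. \<iota> t [^]\<^bsub>S\<^esub> q \<otimes>\<^bsub>S\<^esub> s \<ominus>\<^bsub>S\<^esub> \<iota> r \<in> K n"
proof -
  obtain r t where r: "r \<in> carrier R" "t \<in> U" "\<iota> t \<otimes>\<^bsub>S\<^esub> s \<ominus>\<^bsub>S\<^esub> \<iota> r \<in> K n" using \<iota>_dense[OF assms(2)] by blast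
  obtain k where k: "q = Suc k" using q by (cases q) auto
  define T where "T = \<iota> t [^]\<^bsub>S\<^esub> k"
  have c: "\<iota> t \<in> carrier S" "\<iota> r \<in> carrier S" "T \<in> carrier S" using r by (auto simp: T_def)
  have "\<iota> t [^]\<^bsub>S\<^esub> q \<otimes>\<^bsub>S\<^esub> s \<ominus>\<^bsub>S\<^esub> \<iota> (t [^] k \<otimes> r) = (T \<otimes>\<^bsub>S\<^esub> \<iota> t) \<otimes>\<^bsub>S\<^esub> s \<ominus>\<^bsub>S\<^esub> T \<otimes>\<^bsub>S\<^esub> \<iota> r"
    using r by (simp add: k T_def \<iota>_pow)
  also have "\<dots> = T \<otimes>\<^bsub>S\<^esub> (\<iota> t \<otimes>\<^bsub>S\<^esub> s \<ominus>\<^bsub>S\<^esub> \<iota> r)" using c assms by algebra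
  also have "\<dots> \<in> K n" by (rule ideal.I_l_closed[OF S.K_ideal r(3) c(3)])
  finally show ?thesis using r by blast
qed

context complete_module
begin

context
  fixes \<theta> q
  assumes q: "q \<noteq> (0::nat)"
    and \<theta>_closed: "\<And>r. r \<in> carrier R \<Longrightarrow> \<theta> r \<in> carrier N"
    and \<theta>_add: "\<And>r s. r \<in> carrier R \<Longrightarrow> s \<in> carrier R \<Longrightarrow> \<theta> (r \<oplus> s) = \<theta> r \<oplus>\<^bsub>N\<^esub> \<theta> s"
    and \<theta>_smult: "\<And>a r. a \<in> carrier R \<Longrightarrow> r \<in> carrier R \<Longrightarrow> \<theta> (a [^] q \<otimes> r) = \<iota> a \<odot>\<^bsub>N\<^esub> \<theta> r"
    and \<theta>_nilpotent: "\<And>m x. x \<in> P \<Longrightarrow> \<exists>k::nat. \<forall>r\<in>carrier R. \<iota> x [^]\<^bsub>S\<^esub> k \<odot>\<^bsub>N\<^esub> \<theta> r \<in> Y m"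
begin

text \<open>The \<open>r\<close> all of whose multiples are mapped into \<open>Y m\<close> form an
  ideal. It contains a power of every \<open>x\<close> in \<open>P\<close>, since
  \<open>x^(k q)\<close> is pulled out as \<open>x^k\<close>, and hence, \<open>R\<close> being
  noetherian, a power of \<open>P\<close>.\<close>

lemma continuity: "\<exists>n. \<forall>r\<in>carrier R. \<iota> r \<in> K n \<longrightarrow> \<theta> r \<in> Y m"
proof -
  define J where "J = {r \<in> carrier R. \<forall>r'\<in>carrier R. \<theta> (r \<otimes> r') \<in> Y m}"
  have "\<theta> \<zero> \<in> Y m"
  proof -
    have "\<theta> \<zero> = \<theta> \<zero> \<oplus>\<^bsub>N\<^esub> \<theta> \<zero>" using \<theta>_add[of \<zero> \<zero>] by simp
    then have "\<theta> \<zero> = \<zero>\<^bsub>N\<^esub>" using \<theta>_closed[of \<zero>] by (metis N.M.add.l_cancel_one' R.zero_closed)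
    then show ?thesis using submodule_zero[OF Y_submodule] by simp
  qed
  then have J: "ideal J R"
  proof (intro R.idealI')
    show "a \<otimes> r \<in> J" if "a \<in> carrier R" "r \<in> J" for a r
    proof -
      have rc: "r \<in> carrier R" using that by (simp add: J_def)
      have "\<theta> (a \<otimes> r \<otimes> r') \<in> Y m" if "r' \<in> carrier R" for r'
      proof -
        have "a \<otimes> r \<otimes> r' = r \<otimes> (a \<otimes> r')" using \<open>a \<in> carrier R\<close> rc that by (simp add: R.m_ac)
        then show ?thesis using \<open>a \<in> carrier R\<close> \<open>r \<in> J\<close> that by (simp add: J_def)
      qed
      then show ?thesis using that rc by (simp add: J_def)
    qed
  qed (auto simp: J_def R.l_distr \<theta>_add Y_add)
  have memJ: "r \<in> J \<longleftrightarrow> r \<in> carrier R \<and> (\<forall>r'\<in>carrier R. \<theta> (r \<otimes> r') \<in> Y m)" for r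
    by (simp add: J_def)
  have "\<exists>n::nat. x [^] n \<in> J" if x: "x \<in> P" for x
  proof -
    have xc: "x \<in> carrier R" using x by (rule P.Icarr)
    obtain k :: nat where k: "\<forall>r\<in>carrier R. \<iota> x [^]\<^bsub>S\<^esub> k \<odot>\<^bsub>N\<^esub> \<theta> r \<in> Y m"
      using \<theta>_nilpotent[OF x] by blast
    have "\<theta> (x [^] (k * q) \<otimes> r) \<in> Y m" if r: "r \<in> carrier R" for r
      using \<theta>_smult[of "x [^] k" r] bspec[OF k r] xc r by (simp add: R.nat_pow_pow \<iota>_pow)
    then have "x [^] (k * q) \<in> J" unfolding memJ using xc by simp
    then show ?thesis ..
  qed
  then obtain n where n: "ideal_power R P n \<subseteq> J"
    using ideal_power_subset_of_radical[OF noeth R.is_cring P.is_ideal J] by blast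
  have "\<theta> r \<in> Y m" if r: "r \<in> carrier R" "\<iota> r \<in> K n" for r
  proof -
    obtain t where t: "t \<in> U" "t \<otimes> r \<in> ideal_power R P n" using \<iota>_K[OF r(1)] r(2) by blast
    have tc: "t \<in> carrier R" using t by simp
    obtain k where k: "q = Suc k" using q by (cases q) auto
    have "t \<otimes> r \<in> J" using n t(2) by blast
    then have "\<theta> (t \<otimes> r \<otimes> t [^] k) \<in> Y m" unfolding memJ using tc by simp
    \<comment> \<open>The factor \<open>t\<close> from the definition of the filtration is completed
      to \<open>t^q\<close>, which can be pulled out and cancelled.\<close>
    moreover have "t \<otimes> r \<otimes> t [^] k = t [^] q \<otimes> r" using tc r by (simp add: k R.m_ac)
    ultimately have "\<iota> t \<odot>\<^bsub>N\<^esub> \<theta> r \<in> Y m" using \<theta>_smult[OF tc r(1)] by simp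
    then show ?thesis by (rule Y_cancel_unit[OF t(1) \<theta>_closed[OF r(1)]])
  qed
  then show ?thesis by blast
qed

text \<open>Partial sums dominate the individual moduli and are monotone. Monotonicity makes an
  approximation of level \<open>m + 1\<close> also one of level \<open>m\<close>.\<close>

lemma moduli: "\<exists>\<nu>. (\<forall>m. \<forall>r\<in>carrier R. \<iota> r \<in> K (\<nu> m) \<longrightarrow> \<theta> r \<in> Y m) \<and> mono \<nu>"
proof -
  obtain n where n: "\<And>m r. r \<in> carrier R \<Longrightarrow> \<iota> r \<in> K (n m) \<Longrightarrow> \<theta> r \<in> Y m"
    using continuity by metis
  have "\<theta> r \<in> Y m" if "r \<in> carrier R" "\<iota> r \<in> K (\<Sum>i\<le>m. n i)" for m r
  proof (rule n[OF that(1)])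
    have "n m \<le> (\<Sum>i\<le>m. n i)" by (rule member_le_sum) auto
    then show "\<iota> r \<in> K (n m)" using S.K_antimono that(2) by blast
  qed
  moreover have "mono (\<lambda>m. \<Sum>i\<le>m. n i)" by (intro monoI sum_mono2) auto
  ultimately show ?thesis by (intro exI[of _ "\<lambda>m. \<Sum>i\<le>m. n i"]) simp
qed

lemma \<theta>_diff:
  assumes "r \<in> carrier R" "s \<in> carrier R"
  shows "\<theta> (r \<ominus> s) = \<theta> r \<ominus>\<^bsub>N\<^esub> \<theta> s"
proof -
  have "\<theta> r = \<theta> (r \<ominus> s) \<oplus>\<^bsub>N\<^esub> \<theta> s" using \<theta>_add[of "r \<ominus> s" s] assms by (simp add: R.diff_add_cancel)
  then show ?thesis using assms \<theta>_closed by (simp add: N.M.minus_eq N.M.a_assoc N.M.r_neg)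
qed

text \<open>The value of the extension at \<open>s \<approx> r / t\<^sup>q\<close> is approximately \<open>\<theta> r / t\<close>.\<close>

lemma extension:
  "\<exists>\<Theta>. root_linear S q N \<Theta> \<and> (\<forall>r\<in>carrier R. \<Theta> (\<iota> r) = \<theta> r) \<and> (\<forall>m. \<exists>n. \<forall>s\<in>K n. \<Theta> s \<in> Y m)"
proof -
  obtain \<nu> where \<nu>: "\<And>m r. r \<in> carrier R \<Longrightarrow> \<iota> r \<in> K (\<nu> m) \<Longrightarrow> \<theta> r \<in> Y m" and mono: "mono \<nu>"
    using moduli by blast
  \<comment> \<open>\<open>A m s r t\<close> says that \<open>r / t^q\<close> approximates
    \<open>s\<close> with the precision required at level \<open>m\<close>.\<close>
  define A where "A m s r t \<longleftrightarrow> r \<in> carrier R \<and> t \<in> U \<and> \<iota> t [^]\<^bsub>S\<^esub> q \<otimes>\<^bsub>S\<^esub> s \<ominus>\<^bsub>S\<^esub> \<iota> r \<in> K (\<nu> m)" for m s r t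
  have AD: "r \<in> carrier R" "t \<in> U" "t \<in> carrier R" "\<iota> t \<in> carrier S" "\<iota> r \<in> carrier S" "\<theta> r \<in> carrier N"
    "\<iota> t [^]\<^bsub>S\<^esub> q \<otimes>\<^bsub>S\<^esub> s \<ominus>\<^bsub>S\<^esub> \<iota> r \<in> K (\<nu> m)" if "A m s r t" for m s r t
    using that \<theta>_closed by (auto simp: A_def)
  have A_ex: "\<exists>r t. A m s r t" if "s \<in> carrier S" for m s using approximation[OF q that] unfolding A_def by blast
  \<comment> \<open>\<open>G m s y\<close> says that \<open>y\<close> is an admissible value at
    \<open>s\<close> up to \<open>Y m\<close>, as witnessed by some approximation. By
    \<open>GD\<close> every approximation of level \<open>m\<close> is then a witness.\<close>
  define G where "G m s y \<longleftrightarrow> (\<exists>r t. A m s r t \<and> \<iota> t \<odot>\<^bsub>N\<^esub> y \<ominus>\<^bsub>N\<^esub> \<theta> r \<in> Y m)" for m s y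
  have GI: "G m s y" if "A m s r t" "\<iota> t \<odot>\<^bsub>N\<^esub> y \<ominus>\<^bsub>N\<^esub> \<theta> r \<in> Y m" for m s y r t
    using that unfolding G_def by blast
  have GD: "\<iota> t \<odot>\<^bsub>N\<^esub> y \<ominus>\<^bsub>N\<^esub> \<theta> r \<in> Y m"
    if G: "G m s y" and a: "A m s r t" and c: "s \<in> carrier S" "y \<in> carrier N" for m s y r t
  proof -
    interpret Kn: ideal "K (\<nu> m)" S by (rule S.K_ideal)
    obtain r' t' where a': "A m s r' t'" and y: "\<iota> t' \<odot>\<^bsub>N\<^esub> y \<ominus>\<^bsub>N\<^esub> \<theta> r' \<in> Y m" using G unfolding G_def by blast
    note d = AD[OF a] and d' = AD[OF a']
    define T where "T = \<iota> t [^]\<^bsub>S\<^esub> q"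
    define T' where "T' = \<iota> t' [^]\<^bsub>S\<^esub> q"
    have T: "T \<in> carrier S" "T' \<in> carrier S" using d d' by (auto simp: T_def T'_def)
    have "\<iota> (t [^] q \<otimes> r' \<ominus> t' [^] q \<otimes> r) = T \<otimes>\<^bsub>S\<^esub> \<iota> r' \<ominus>\<^bsub>S\<^esub> T' \<otimes>\<^bsub>S\<^esub> \<iota> r"
      using d d' by (simp add: \<iota>_pow T_def T'_def R.minus_eq S.minus_eq)
    also have "\<dots> = T' \<otimes>\<^bsub>S\<^esub> (T \<otimes>\<^bsub>S\<^esub> s \<ominus>\<^bsub>S\<^esub> \<iota> r) \<ominus>\<^bsub>S\<^esub> T \<otimes>\<^bsub>S\<^esub> (T' \<otimes>\<^bsub>S\<^esub> s \<ominus>\<^bsub>S\<^esub> \<iota> r')" using T d d' c by algebra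
    also have "\<dots> \<in> K (\<nu> m)"
      using Kn.I_l_closed[OF d(7) T(2)] Kn.I_l_closed[OF d'(7) T(1)] unfolding T_def T'_def by (rule Kn.minus_in)
    finally have "\<theta> (t [^] q \<otimes> r' \<ominus> t' [^] q \<otimes> r) \<in> Y m" using d d' by (intro \<nu>) auto
    then have e1: "\<iota> t \<odot>\<^bsub>N\<^esub> \<theta> r' \<ominus>\<^bsub>N\<^esub> \<iota> t' \<odot>\<^bsub>N\<^esub> \<theta> r \<in> Y m" using d d' by (simp add: \<theta>_diff \<theta>_smult)
    have "\<iota> t \<odot>\<^bsub>N\<^esub> (\<iota> t' \<odot>\<^bsub>N\<^esub> y) \<ominus>\<^bsub>N\<^esub> \<iota> t \<odot>\<^bsub>N\<^esub> \<theta> r' \<in> Y m"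
      using Y_smult[OF d(4) y] d d' c by (simp add: N.smult_diff_distr)
    then have "\<iota> t \<odot>\<^bsub>N\<^esub> (\<iota> t' \<odot>\<^bsub>N\<^esub> y) \<ominus>\<^bsub>N\<^esub> \<iota> t' \<odot>\<^bsub>N\<^esub> \<theta> r \<in> Y m"
      by (rule Y_trans[OF _ e1]) (use d d' c in auto)
    moreover have "\<iota> t \<odot>\<^bsub>N\<^esub> (\<iota> t' \<odot>\<^bsub>N\<^esub> y) = \<iota> t' \<odot>\<^bsub>N\<^esub> (\<iota> t \<odot>\<^bsub>N\<^esub> y)"
      using d d' c by (simp add: S.m_comm flip: N.smult_assoc1)
    ultimately have "\<iota> t' \<odot>\<^bsub>N\<^esub> (\<iota> t \<odot>\<^bsub>N\<^esub> y \<ominus>\<^bsub>N\<^esub> \<theta> r) \<in> Y m" using d d' c by (simp add: N.smult_diff_distr)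
    then show ?thesis using Y_cancel_unit[OF d'(2)] d c by simp
  qed
  have G_unique: "y \<ominus>\<^bsub>N\<^esub> y' \<in> Y m"
    if "G m s y" "G m s y'" "s \<in> carrier S" "y \<in> carrier N" "y' \<in> carrier N" for m s y y'
  proof -
    obtain r t where a: "A m s r t" using A_ex \<open>s \<in> carrier S\<close> by blast
    note d = AD[OF a]
    have "\<iota> t \<odot>\<^bsub>N\<^esub> (y \<ominus>\<^bsub>N\<^esub> y') \<in> Y m"
      using Y_diff[OF GD[OF that(1) a] GD[OF that(2) a]] that d
      by (simp add: N.smult_diff_distr N.M.diff_diff_right)
    then show ?thesis using Y_cancel_unit[OF d(2)] that by simp
  qed
  have ex: "\<exists>y\<in>carrier N. \<forall>m. G m s y" if s: "s \<in> carrier S" for s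
  proof -
    have "\<exists>y. y \<in> carrier N \<and> G m s y" for m
    proof -
      obtain r t where a: "A m s r t" using A_ex s by blast
      note d = AD[OF a]
      obtain v where v: "v \<in> carrier S" "v \<otimes>\<^bsub>S\<^esub> \<iota> t = \<one>\<^bsub>S\<^esub>" using \<iota>_unit[OF d(2)] by blast
      have "\<iota> t \<odot>\<^bsub>N\<^esub> (v \<odot>\<^bsub>N\<^esub> \<theta> r) = \<theta> r" using v d S.m_comm[of v "\<iota> t"] by (simp flip: N.smult_assoc1)
      then show ?thesis using GI[OF a, of "v \<odot>\<^bsub>N\<^esub> \<theta> r"] v d submodule_zero[OF Y_submodule] by auto
    qed
    then obtain y where y: "\<And>m. y m \<in> carrier N" "\<And>m. G m s (y m)" by metis
    have Suc: "G m s y'" if "G (Suc m) s y'" for m y'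
    proof -
      have "\<nu> m \<le> \<nu> (Suc m)" using mono by (rule monoD) simp
      then show ?thesis using that S.K_antimono Y_Suc unfolding G_def A_def by blast
    qed
    \<comment> \<open>A value admissible at level \<open>m + 1\<close> is admissible at level
      \<open>m\<close>, where admissible values agree up to \<open>Y m\<close>.\<close>
    have "y (Suc m) \<ominus>\<^bsub>N\<^esub> y m \<in> Y m" for m by (rule G_unique[OF Suc[OF y(2)] y(2) s y(1) y(1)])
    from Y_complete[OF y(1) this] obtain l where l: "l \<in> carrier N" "\<forall>m. l \<ominus>\<^bsub>N\<^esub> y m \<in> Y m"
      by (elim bexE)
    have "G m s l" for m
    proof -
      obtain r t where a: "A m s r t" using A_ex s by blast
      note d = AD[OF a]
      have "\<iota> t \<odot>\<^bsub>N\<^esub> l \<ominus>\<^bsub>N\<^esub> \<iota> t \<odot>\<^bsub>N\<^esub> y m \<in> Y m"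
        using Y_smult[OF d(4) spec[OF l(2)]] d l(1) y(1) by (simp add: N.smult_diff_distr)
      then show ?thesis by (rule GI[OF a Y_trans[OF _ GD[OF y(2) a s y(1)]]]) (use d l y in auto)
    qed
    then show ?thesis using l(1) by blast
  qed
  have uniq: "y = y'" if "\<And>m. G m s y" "\<And>m. G m s y'" "s \<in> carrier S" "y \<in> carrier N" "y' \<in> carrier N" for s y y'
    using Y_Inter[OF N.M.minus_closed[OF that(4,5)] G_unique[OF that]] that by simp
  obtain \<Theta> where \<Theta>: "\<And>s. s \<in> carrier S \<Longrightarrow> \<Theta> s \<in> carrier N" "\<And>s m. s \<in> carrier S \<Longrightarrow> G m s (\<Theta> s)"
    using ex by metis
  have "\<Theta> (s \<oplus>\<^bsub>S\<^esub> s') = \<Theta> s \<oplus>\<^bsub>N\<^esub> \<Theta> s'" if s: "s \<in> carrier S" "s' \<in> carrier S" for s s'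
  proof (rule uniq[OF \<Theta>(2)])
    fix m
    interpret Kn: ideal "K (\<nu> m)" S by (rule S.K_ideal)
    obtain r t where a: "A m s r t" using A_ex s by blast
    obtain r' t' where a': "A m s' r' t'" using A_ex s by blast
    note d = AD[OF a] and d' = AD[OF a']
    define T where "T = \<iota> t [^]\<^bsub>S\<^esub> q"
    define T' where "T' = \<iota> t' [^]\<^bsub>S\<^esub> q"
    have T: "T \<in> carrier S" "T' \<in> carrier S" using d d' by (auto simp: T_def T'_def)
    show "G m (s \<oplus>\<^bsub>S\<^esub> s') (\<Theta> s \<oplus>\<^bsub>N\<^esub> \<Theta> s')"
    proof (rule GI)
      have "\<iota> (t' \<otimes> t) [^]\<^bsub>S\<^esub> q \<otimes>\<^bsub>S\<^esub> (s \<oplus>\<^bsub>S\<^esub> s') \<ominus>\<^bsub>S\<^esub> \<iota> (t' [^] q \<otimes> r \<oplus> t [^] q \<otimes> r') =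
          (T' \<otimes>\<^bsub>S\<^esub> T) \<otimes>\<^bsub>S\<^esub> (s \<oplus>\<^bsub>S\<^esub> s') \<ominus>\<^bsub>S\<^esub> (T' \<otimes>\<^bsub>S\<^esub> \<iota> r \<oplus>\<^bsub>S\<^esub> T \<otimes>\<^bsub>S\<^esub> \<iota> r')"
        using d d' by (simp add: \<iota>_pow T_def T'_def S.nat_pow_distrib)
      also have "\<dots> = T' \<otimes>\<^bsub>S\<^esub> (T \<otimes>\<^bsub>S\<^esub> s \<ominus>\<^bsub>S\<^esub> \<iota> r) \<oplus>\<^bsub>S\<^esub> T \<otimes>\<^bsub>S\<^esub> (T' \<otimes>\<^bsub>S\<^esub> s' \<ominus>\<^bsub>S\<^esub> \<iota> r')" using T d d' s by algebra
      also have "\<dots> \<in> K (\<nu> m)"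
        using Kn.I_l_closed[OF d(7) T(2)] Kn.I_l_closed[OF d'(7) T(1)] unfolding T_def T'_def by (rule Kn.a_closed)
      finally show "A m (s \<oplus>\<^bsub>S\<^esub> s') (t' [^] q \<otimes> r \<oplus> t [^] q \<otimes> r') (t' \<otimes> t)"
        unfolding A_def using U_mult[OF d'(2) d(2)] d d' by simp
      have "\<iota> (t' \<otimes> t) \<odot>\<^bsub>N\<^esub> (\<Theta> s \<oplus>\<^bsub>N\<^esub> \<Theta> s') = \<iota> t' \<odot>\<^bsub>N\<^esub> (\<iota> t \<odot>\<^bsub>N\<^esub> \<Theta> s) \<oplus>\<^bsub>N\<^esub> \<iota> t \<odot>\<^bsub>N\<^esub> (\<iota> t' \<odot>\<^bsub>N\<^esub> \<Theta> s')"
        using d d' \<Theta>(1) s by (simp add: N.smult_r_distr S.m_comm flip: N.smult_assoc1)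
      moreover have "\<theta> (t' [^] q \<otimes> r \<oplus> t [^] q \<otimes> r') = \<iota> t' \<odot>\<^bsub>N\<^esub> \<theta> r \<oplus>\<^bsub>N\<^esub> \<iota> t \<odot>\<^bsub>N\<^esub> \<theta> r'"
        using d d' by (simp add: \<theta>_add \<theta>_smult)
      ultimately show "\<iota> (t' \<otimes> t) \<odot>\<^bsub>N\<^esub> (\<Theta> s \<oplus>\<^bsub>N\<^esub> \<Theta> s') \<ominus>\<^bsub>N\<^esub> \<theta> (t' [^] q \<otimes> r \<oplus> t [^] q \<otimes> r') \<in> Y m"
        using Y_add[OF Y_smult[OF d'(4) GD[OF \<Theta>(2) a]] Y_smult[OF d(4) GD[OF \<Theta>(2) a']]] s d d' \<Theta>(1)
        by (simp add: N.smult_diff_distr N.M.add_diff_add)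
    qed
  qed (use s \<Theta>(1) in auto)
  moreover have "\<Theta> (a [^]\<^bsub>S\<^esub> q \<otimes>\<^bsub>S\<^esub> s) = a \<odot>\<^bsub>N\<^esub> \<Theta> s" if a: "a \<in> carrier S" and s: "s \<in> carrier S" for a s
  proof (rule uniq[OF \<Theta>(2)])
    fix m
    interpret Kn: ideal "K (\<nu> m)" S by (rule S.K_ideal)
    obtain r t where A: "A m s r t" using A_ex s by blast
    note d = AD[OF A]
    obtain n where n: "\<forall>k\<in>K n. k \<odot>\<^bsub>N\<^esub> \<theta> r \<in> Y m" using Y_K[OF d(6)] by blast
    \<comment> \<open>Two precisions are needed: \<open>n\<close>, so that the error acts on
      \<open>\<theta> r\<close> as zero modulo \<open>Y m\<close>, and \<open>\<nu> m\<close>, so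
      that the \<open>q\<close>-th powers still agree modulo \<open>K (\<nu> m)\<close>.\<close>
    obtain u w where u: "u \<in> carrier R" "w \<in> U" "\<iota> w \<otimes>\<^bsub>S\<^esub> a \<ominus>\<^bsub>S\<^esub> \<iota> u \<in> K (max n (\<nu> m))"
      using \<iota>_dense[OF a] by blast
    define b where "b = \<iota> w \<otimes>\<^bsub>S\<^esub> a"
    have c: "\<iota> w \<in> carrier S" "\<iota> u \<in> carrier S" "w \<in> carrier R" "b \<in> carrier S" using u a by (auto simp: b_def)
    have un: "b \<ominus>\<^bsub>S\<^esub> \<iota> u \<in> K n" "b \<ominus>\<^bsub>S\<^esub> \<iota> u \<in> K (\<nu> m)"
      using u(3) S.K_antimono[of n "max n (\<nu> m)"] S.K_antimono[of "\<nu> m" "max n (\<nu> m)"] by (auto simp: b_def)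
    have "b = \<iota> u \<oplus>\<^bsub>S\<^esub> (b \<ominus>\<^bsub>S\<^esub> \<iota> u)" using c by (simp add: S.add_diff)
    then obtain j where j: "j \<in> K (\<nu> m)" "b [^]\<^bsub>S\<^esub> q = \<iota> u [^]\<^bsub>S\<^esub> q \<oplus>\<^bsub>S\<^esub> j"
      using S.pow_add_cong[OF S.K_ideal c(2) un(2), of q] by metis
    define B where "B = \<iota> u [^]\<^bsub>S\<^esub> q"
    define T where "T = \<iota> t [^]\<^bsub>S\<^esub> q \<otimes>\<^bsub>S\<^esub> s"
    have BT: "B \<in> carrier S" "T \<in> carrier S" "j \<in> carrier S" using c d s Kn.Icarr[OF j(1)] by (auto simp: B_def T_def)
    show "G m (a [^]\<^bsub>S\<^esub> q \<otimes>\<^bsub>S\<^esub> s) (a \<odot>\<^bsub>N\<^esub> \<Theta> s)"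
    proof (rule GI)
      have "\<iota> (w \<otimes> t) [^]\<^bsub>S\<^esub> q \<otimes>\<^bsub>S\<^esub> (a [^]\<^bsub>S\<^esub> q \<otimes>\<^bsub>S\<^esub> s) = b [^]\<^bsub>S\<^esub> q \<otimes>\<^bsub>S\<^esub> T"
        using c d a s by (simp add: b_def T_def S.nat_pow_distrib S.m_ac)
      then have "\<iota> (w \<otimes> t) [^]\<^bsub>S\<^esub> q \<otimes>\<^bsub>S\<^esub> (a [^]\<^bsub>S\<^esub> q \<otimes>\<^bsub>S\<^esub> s) \<ominus>\<^bsub>S\<^esub> \<iota> (u [^] q \<otimes> r) = (B \<oplus>\<^bsub>S\<^esub> j) \<otimes>\<^bsub>S\<^esub> T \<ominus>\<^bsub>S\<^esub> B \<otimes>\<^bsub>S\<^esub> \<iota> r"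
        unfolding j(2) B_def using u(1) d by (simp add: \<iota>_pow)
      also have "\<dots> = B \<otimes>\<^bsub>S\<^esub> (T \<ominus>\<^bsub>S\<^esub> \<iota> r) \<oplus>\<^bsub>S\<^esub> T \<otimes>\<^bsub>S\<^esub> j" using BT d by algebra
      also have "\<dots> \<in> K (\<nu> m)" using d(7) j(1) BT by (intro Kn.a_closed Kn.I_l_closed) (auto simp: T_def)
      finally show "A m (a [^]\<^bsub>S\<^esub> q \<otimes>\<^bsub>S\<^esub> s) (u [^] q \<otimes> r) (w \<otimes> t)"
        unfolding A_def using U_mult[OF u(2) d(2)] u(1) d by simp
      have "b \<odot>\<^bsub>N\<^esub> (\<iota> t \<odot>\<^bsub>N\<^esub> \<Theta> s) \<ominus>\<^bsub>N\<^esub> b \<odot>\<^bsub>N\<^esub> \<theta> r \<in> Y m"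
        using Y_smult[OF c(4) GD[OF \<Theta>(2) A]] s d c \<Theta>(1) by (simp add: N.smult_diff_distr)
      moreover have "b \<odot>\<^bsub>N\<^esub> \<theta> r \<ominus>\<^bsub>N\<^esub> \<iota> u \<odot>\<^bsub>N\<^esub> \<theta> r \<in> Y m"
        using bspec[OF n un(1)] c d by (simp add: N.M.minus_eq S.minus_eq N.smult_l_distr N.smult_l_minus)
      ultimately have "b \<odot>\<^bsub>N\<^esub> (\<iota> t \<odot>\<^bsub>N\<^esub> \<Theta> s) \<ominus>\<^bsub>N\<^esub> \<iota> u \<odot>\<^bsub>N\<^esub> \<theta> r \<in> Y m"
        by (rule Y_trans) (use c d \<Theta>(1) s in auto)
      moreover have "\<iota> (w \<otimes> t) \<odot>\<^bsub>N\<^esub> (a \<odot>\<^bsub>N\<^esub> \<Theta> s) = b \<odot>\<^bsub>N\<^esub> (\<iota> t \<odot>\<^bsub>N\<^esub> \<Theta> s)"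
        using c d a \<Theta>(1) s by (simp add: b_def S.m_ac flip: N.smult_assoc1)
      ultimately show "\<iota> (w \<otimes> t) \<odot>\<^bsub>N\<^esub> (a \<odot>\<^bsub>N\<^esub> \<Theta> s) \<ominus>\<^bsub>N\<^esub> \<theta> (u [^] q \<otimes> r) \<in> Y m" using u(1) d by (simp add: \<theta>_smult)
    qed
  qed (use a s \<Theta>(1) in auto)
  ultimately have "root_linear S q N \<Theta>" using \<Theta>(1) by (auto simp: root_linear_def)
  moreover have z: "\<theta> \<zero> = \<zero>\<^bsub>N\<^esub>" using \<theta>_diff[of \<zero> \<zero>] \<theta>_closed[of \<zero>] by simp
  have A1: "A m s r \<one>" if "s \<ominus>\<^bsub>S\<^esub> \<iota> r \<in> K (\<nu> m)" "r \<in> carrier R" "s \<in> carrier S" for m s r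
    using that U_one by (simp add: A_def)
  have "\<Theta> (\<iota> r) = \<theta> r" if r: "r \<in> carrier R" for r
  proof (rule uniq[OF \<Theta>(2)])
    show "G m (\<iota> r) (\<theta> r)" for m
      using r \<theta>_closed[OF r] submodule_zero[OF Y_submodule] additive_subgroup.zero_closed[OF ideal.axioms(1)[OF S.K_ideal]]
      by (intro GI[OF A1[of "\<iota> r" r m]]) simp_all
  qed (use r \<theta>_closed \<Theta>(1) in auto)
  moreover have "\<Theta> s \<in> Y m" if s: "s \<in> K (\<nu> m)" for m s
    using GD[OF \<Theta>(2) A1[of s \<zero> m]] s S.K_carrier[OF s] \<Theta>(1) z by simp
  ultimately show ?thesis by blast
qed

end

text \<open>After multiplication by a suitable \<open>t^q\<close>, \<open>s\<close> is the image of
  an element of \<open>R\<close> plus an error on which both maps are small. The factor is pulled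
  out as \<open>t\<close> and cancelled.\<close>

lemma extension_unique:
  assumes q: "q \<noteq> (0::nat)" and \<Theta>: "root_linear S q N \<Theta>" and \<Theta>': "root_linear S q N \<Theta>'"
    and cont: "\<And>m. \<exists>n. \<forall>s\<in>K n. \<Theta> s \<in> Y m" and cont': "\<And>m. \<exists>n. \<forall>s\<in>K n. \<Theta>' s \<in> Y m"
    and eq: "\<And>r. r \<in> carrier R \<Longrightarrow> \<Theta> (\<iota> r) = \<Theta>' (\<iota> r)" and s: "s \<in> carrier S"
  shows "\<Theta> s = \<Theta>' s"
proof -
  note c = root_linear_closed[OF \<Theta>] root_linear_closed[OF \<Theta>']
  have "\<Theta> s \<ominus>\<^bsub>N\<^esub> \<Theta>' s \<in> Y m" for m
  proof -
    obtain n n' where n: "\<And>s. s \<in> K n \<Longrightarrow> \<Theta> s \<in> Y m" "\<And>s. s \<in> K n' \<Longrightarrow> \<Theta>' s \<in> Y m"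
      using cont[of m] cont'[of m] by blast
    obtain r t where r: "r \<in> carrier R" "t \<in> U" "\<iota> t [^]\<^bsub>S\<^esub> q \<otimes>\<^bsub>S\<^esub> s \<ominus>\<^bsub>S\<^esub> \<iota> r \<in> K (max n n')"
      using approximation[OF q s] by blast
    define z where "z = \<iota> t [^]\<^bsub>S\<^esub> q \<otimes>\<^bsub>S\<^esub> s \<ominus>\<^bsub>S\<^esub> \<iota> r"
    have z: "z \<in> carrier S" "\<iota> t \<in> carrier S" "\<iota> r \<in> carrier S" using r s by (auto simp: z_def)
    have e: "\<iota> t [^]\<^bsub>S\<^esub> q \<otimes>\<^bsub>S\<^esub> s = \<iota> r \<oplus>\<^bsub>S\<^esub> z" using z s by (simp add: z_def S.add_diff)
    have h: "\<iota> t \<odot>\<^bsub>N\<^esub> \<Psi> s = \<Psi> (\<iota> r) \<oplus>\<^bsub>N\<^esub> \<Psi> z" if "root_linear S q N \<Psi>" for \<Psi>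
      using root_linear_smult[OF that z(2) s] root_linear_add[OF that z(3,1)] by (simp add: e)
    have "\<iota> t \<odot>\<^bsub>N\<^esub> (\<Theta> s \<ominus>\<^bsub>N\<^esub> \<Theta>' s) = \<Theta> z \<ominus>\<^bsub>N\<^esub> \<Theta>' z"
      using c s z by (simp add: N.smult_diff_distr h[OF \<Theta>] h[OF \<Theta>'] eq[OF r(1)] N.M.add_diff_add)
    also have "\<dots> \<in> Y m" using r(3) S.K_antimono[of n "max n n'"] S.K_antimono[of n' "max n n'"] n
      by (intro Y_diff) (auto simp: z_def)
    finally show ?thesis using Y_cancel_unit[OF r(2)] c s by simp
  qed
  then show ?thesis using Y_Inter[of "\<Theta> s \<ominus>\<^bsub>N\<^esub> \<Theta>' s"] c s by simp
qed

end

section \<open>The injective hull of a residue domain\<close>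

lemma (in cring) self_module_minus:
  assumes "x \<in> carrier R" "y \<in> carrier R"
  shows "x \<ominus>\<^bsub>self_module R\<^esub> y = x \<ominus> y"
proof -
  interpret N: module R "self_module R" by (rule self_module)
  have "\<ominus>\<^bsub>self_module R\<^esub> y = \<ominus> y"
    by (rule N.M.minus_equality) (use assms in \<open>auto simp: l_neg\<close>)
  then show ?thesis unfolding N.M.minus_eq minus_eq by simp
qed

lemma (in local_completion) self_complete_module:
  "complete_module R P S K \<iota> (self_module S) K"
proof (intro complete_module.intro complete_module_axioms.intro local_completion_axioms S.self_module)
  show "submodule (K m) S (self_module S)" for m by (rule S.ideal_submodule[OF S.K_ideal])
  show "K (Suc m) \<subseteq> K m" for m by (rule S.K_Suc)
  show "x = \<zero>\<^bsub>self_module S\<^esub>" if "x \<in> carrier (self_module S)" "\<And>m. x \<in> K m" for x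
    using S.K_Inter[of x] that by simp
  show "\<exists>l\<in>carrier (self_module S). \<forall>m. l \<ominus>\<^bsub>self_module S\<^esub> y m \<in> K m"
    if "\<And>m. y m \<in> carrier (self_module S)" "\<And>m. y (Suc m) \<ominus>\<^bsub>self_module S\<^esub> y m \<in> K m" for y
  proof -
    have y: "y m \<in> carrier S" for m using that(1) by simp
    then have "y (Suc m) \<ominus>\<^bsub>S\<^esub> y m \<in> K m" for m using that(2)[of m] S.self_module_minus by simp
    then obtain l where "l \<in> carrier S" "\<forall>m. l \<ominus>\<^bsub>S\<^esub> y m \<in> K m" using S.K_complete[of y] y by blast
    then show ?thesis using S.self_module_minus y by (intro bexI[of _ l]) simp_all
  qed
  show "\<exists>n. \<forall>k\<in>K n. k \<odot>\<^bsub>self_module S\<^esub> x \<in> K m" if "x \<in> carrier (self_module S)" for x m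
    using that ideal.I_r_closed[OF S.K_ideal] by (intro exI[of _ m]) simp
qed

text \<open>Each \<phi> extends continuously to \<open>S\<close>, which gives a combination
  \<open>g\<close> over \<open>S\<close>. Multiplication by the image of \<open>c\<close> and
  \<open>g\<close> are both continuous, agree on \<open>R\<close> and pull out \<open>p\<close>-th
  powers, so they agree by density.\<close>

lemma (in local_completion) frobenius_dual_basis_completion:
  assumes p: "p \<noteq> 0" and c: "c \<in> carrier R" and basis: "frobenius_dual_basis R p c"
  shows "frobenius_dual_basis S p (\<iota> c)"
proof -
  interpret CM: complete_module R P S K \<iota> "self_module S" K by (rule self_complete_module)
  obtain f where f: "frobenius_combination R p f" "\<And>x. x \<in> carrier R \<Longrightarrow> c \<otimes> x = f x"
    using basis unfolding frobenius_dual_basis_def by blast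
  \<comment> \<open>The induction carries just what the density argument uses. Continuity is stated
    through differences because \<open>g\<close> is not known to be additive: it contains
    \<open>p\<close>-th powers, and only \<open>p\<close> nonzero is assumed here.\<close>
  have "\<exists>g. frobenius_combination S p g \<and> (\<forall>r\<in>carrier R. g (\<iota> r) = \<iota> (f r)) \<and>
      (\<forall>a\<in>carrier S. \<forall>s\<in>carrier S. g (a [^]\<^bsub>S\<^esub> p \<otimes>\<^bsub>S\<^esub> s) = a [^]\<^bsub>S\<^esub> p \<otimes>\<^bsub>S\<^esub> g s) \<and>
      (\<forall>m. \<exists>n. \<forall>s\<in>carrier S. \<forall>k\<in>K n. g (s \<oplus>\<^bsub>S\<^esub> k) \<ominus>\<^bsub>S\<^esub> g s \<in> K m)"
    using f(1)
  proof (induct rule: frobenius_combination.induct)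
    case zero
    show ?case
      using additive_subgroup.zero_closed[OF ideal.axioms(1)[OF S.K_ideal]]
      by (intro exI[of _ "\<lambda>_. \<zero>\<^bsub>S\<^esub>"] conjI frobenius_combination.zero) auto
  next
    case (add f \<phi> b)
    then obtain g where g: "frobenius_combination S p g" "\<And>r. r \<in> carrier R \<Longrightarrow> g (\<iota> r) = \<iota> (f r)"
      "\<And>a s. a \<in> carrier S \<Longrightarrow> s \<in> carrier S \<Longrightarrow> g (a [^]\<^bsub>S\<^esub> p \<otimes>\<^bsub>S\<^esub> s) = a [^]\<^bsub>S\<^esub> p \<otimes>\<^bsub>S\<^esub> g s"
      "\<And>m. \<exists>n. \<forall>s\<in>carrier S. \<forall>k\<in>K n. g (s \<oplus>\<^bsub>S\<^esub> k) \<ominus>\<^bsub>S\<^esub> g s \<in> K m" by blast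
    note \<phi> = add(3)
    note \<phi>c = root_linear_closed[OF \<phi>, simplified]
    have "\<exists>\<Phi>. root_linear S p (self_module S) \<Phi> \<and> (\<forall>r\<in>carrier R. \<Phi> (\<iota> r) = \<iota> (\<phi> r)) \<and>
        (\<forall>m. \<exists>n. \<forall>s\<in>K n. \<Phi> s \<in> K m)"
    proof (rule CM.extension[OF p])
      show "\<iota> (\<phi> r) \<in> carrier (self_module S)" if "r \<in> carrier R" for r using \<phi>c[OF that] by simp
      show "\<iota> (\<phi> (r \<oplus> s)) = \<iota> (\<phi> r) \<oplus>\<^bsub>self_module S\<^esub> \<iota> (\<phi> s)" if "r \<in> carrier R" "s \<in> carrier R" for r s
        using root_linear_add[OF \<phi> that] \<phi>c that by simp
      show "\<iota> (\<phi> (a [^] p \<otimes> r)) = \<iota> a \<odot>\<^bsub>self_module S\<^esub> \<iota> (\<phi> r)" if "a \<in> carrier R" "r \<in> carrier R" for a r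
        using root_linear_smult[OF \<phi> that] \<phi>c that by simp
      show "\<exists>k. \<forall>r\<in>carrier R. \<iota> x [^]\<^bsub>S\<^esub> (k::nat) \<odot>\<^bsub>self_module S\<^esub> \<iota> (\<phi> r) \<in> K m" if x: "x \<in> P" for m x
      proof (intro exI[of _ m] ballI)
        fix r assume r: "r \<in> carrier R"
        have "\<iota> x \<in> K 1" using \<iota>_K_I[of x 1] x R.ideal_power_1[OF P.is_ideal] by simp
        then have "\<iota> x [^]\<^bsub>S\<^esub> m \<in> K m" by (rule S.K_pow)
        then show "\<iota> x [^]\<^bsub>S\<^esub> m \<odot>\<^bsub>self_module S\<^esub> \<iota> (\<phi> r) \<in> K m"
          using ideal.I_r_closed[OF S.K_ideal] \<phi>c[OF r] by simp
      qed
    qed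
    then obtain \<Phi> where \<Phi>: "root_linear S p (self_module S) \<Phi>" "\<And>r. r \<in> carrier R \<Longrightarrow> \<Phi> (\<iota> r) = \<iota> (\<phi> r)"
      "\<And>m. \<exists>n. \<forall>s\<in>K n. \<Phi> s \<in> K m" by blast
    note \<Phi>c = root_linear_closed[OF \<Phi>(1), simplified]
    note gc = S.frobenius_combination_closed[OF g(1)]
    have ib: "\<iota> b \<in> carrier S" using add(4) by simp
    show ?case
    proof (intro exI[of _ "\<lambda>s. g s \<oplus>\<^bsub>S\<^esub> \<Phi> s [^]\<^bsub>S\<^esub> p \<otimes>\<^bsub>S\<^esub> \<iota> b"] conjI ballI allI)
      show "frobenius_combination S p (\<lambda>s. g s \<oplus>\<^bsub>S\<^esub> \<Phi> s [^]\<^bsub>S\<^esub> p \<otimes>\<^bsub>S\<^esub> \<iota> b)"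
        by (intro frobenius_combination.add g(1) \<Phi>(1) ib)
      show "g (\<iota> r) \<oplus>\<^bsub>S\<^esub> \<Phi> (\<iota> r) [^]\<^bsub>S\<^esub> p \<otimes>\<^bsub>S\<^esub> \<iota> b = \<iota> (f r \<oplus> \<phi> r [^] p \<otimes> b)" if "r \<in> carrier R" for r
        using that add(4) \<phi>c[OF that] R.frobenius_combination_closed[OF add(1) that] by (simp add: g(2) \<Phi>(2) \<iota>_pow)
      show "g (a [^]\<^bsub>S\<^esub> p \<otimes>\<^bsub>S\<^esub> s) \<oplus>\<^bsub>S\<^esub> \<Phi> (a [^]\<^bsub>S\<^esub> p \<otimes>\<^bsub>S\<^esub> s) [^]\<^bsub>S\<^esub> p \<otimes>\<^bsub>S\<^esub> \<iota> b =
          a [^]\<^bsub>S\<^esub> p \<otimes>\<^bsub>S\<^esub> (g s \<oplus>\<^bsub>S\<^esub> \<Phi> s [^]\<^bsub>S\<^esub> p \<otimes>\<^bsub>S\<^esub> \<iota> b)" if "a \<in> carrier S" "s \<in> carrier S" for a s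
        using that \<Phi>c gc ib
        by (simp add: g(3) root_linear_smult[OF \<Phi>(1)] S.nat_pow_distrib S.m_assoc S.r_distr)
      fix m
      interpret Km: ideal "K m" S by (rule S.K_ideal)
      obtain n where n: "\<And>s k. s \<in> carrier S \<Longrightarrow> k \<in> K n \<Longrightarrow> g (s \<oplus>\<^bsub>S\<^esub> k) \<ominus>\<^bsub>S\<^esub> g s \<in> K m" using g(4) by blast
      obtain n' where n': "\<And>s. s \<in> K n' \<Longrightarrow> \<Phi> s \<in> K m" using \<Phi>(3) by blast
      have "(g (s \<oplus>\<^bsub>S\<^esub> k) \<oplus>\<^bsub>S\<^esub> \<Phi> (s \<oplus>\<^bsub>S\<^esub> k) [^]\<^bsub>S\<^esub> p \<otimes>\<^bsub>S\<^esub> \<iota> b) \<ominus>\<^bsub>S\<^esub> (g s \<oplus>\<^bsub>S\<^esub> \<Phi> s [^]\<^bsub>S\<^esub> p \<otimes>\<^bsub>S\<^esub> \<iota> b) \<in> K m"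
        if s: "s \<in> carrier S" and k: "k \<in> K (max n n')" for s k
      proof -
        have k': "k \<in> K n" "k \<in> K n'" "k \<in> carrier S"
          using k S.K_antimono[of n "max n n'"] S.K_antimono[of n' "max n n'"] S.K_carrier by auto
        obtain j where j: "j \<in> K m" "\<Phi> (s \<oplus>\<^bsub>S\<^esub> k) [^]\<^bsub>S\<^esub> p = \<Phi> s [^]\<^bsub>S\<^esub> p \<oplus>\<^bsub>S\<^esub> j"
          using S.pow_add_cong[OF S.K_ideal \<Phi>c[OF s] n'[OF k'(2)], of p] root_linear_add[OF \<Phi>(1) s k'(3)] by auto
        have "\<Phi> (s \<oplus>\<^bsub>S\<^esub> k) [^]\<^bsub>S\<^esub> p \<otimes>\<^bsub>S\<^esub> \<iota> b \<ominus>\<^bsub>S\<^esub> \<Phi> s [^]\<^bsub>S\<^esub> p \<otimes>\<^bsub>S\<^esub> \<iota> b = j \<otimes>\<^bsub>S\<^esub> \<iota> b"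
        proof -
          define Q where "Q = \<Phi> s [^]\<^bsub>S\<^esub> p"
          have "Q \<in> carrier S" "j \<in> carrier S" using \<Phi>c[OF s] Km.Icarr[OF j(1)] by (auto simp: Q_def)
          then show ?thesis unfolding j(2) Q_def[symmetric] using ib by algebra
        qed
        then show ?thesis
          using Km.a_closed[OF n[OF s k'(1)] Km.I_r_closed[OF j(1) ib]] gc[of s] gc[of "s \<oplus>\<^bsub>S\<^esub> k"] \<Phi>c s k'(3) ib
          by (simp add: S.add_diff_add)
      qed
      then show "\<exists>n. \<forall>s\<in>carrier S. \<forall>k\<in>K n. (g (s \<oplus>\<^bsub>S\<^esub> k) \<oplus>\<^bsub>S\<^esub> \<Phi> (s \<oplus>\<^bsub>S\<^esub> k) [^]\<^bsub>S\<^esub> p \<otimes>\<^bsub>S\<^esub> \<iota> b)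
          \<ominus>\<^bsub>S\<^esub> (g s \<oplus>\<^bsub>S\<^esub> \<Phi> s [^]\<^bsub>S\<^esub> p \<otimes>\<^bsub>S\<^esub> \<iota> b) \<in> K m" by blast
    qed
  qed
  then obtain g where g: "frobenius_combination S p g" "\<And>r. r \<in> carrier R \<Longrightarrow> g (\<iota> r) = \<iota> (f r)"
    "\<And>a s. a \<in> carrier S \<Longrightarrow> s \<in> carrier S \<Longrightarrow> g (a [^]\<^bsub>S\<^esub> p \<otimes>\<^bsub>S\<^esub> s) = a [^]\<^bsub>S\<^esub> p \<otimes>\<^bsub>S\<^esub> g s"
    "\<And>m. \<exists>n. \<forall>s\<in>carrier S. \<forall>k\<in>K n. g (s \<oplus>\<^bsub>S\<^esub> k) \<ominus>\<^bsub>S\<^esub> g s \<in> K m" by blast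
  note gc = S.frobenius_combination_closed[OF g(1)]
  have "\<iota> c \<otimes>\<^bsub>S\<^esub> s = g s" if s: "s \<in> carrier S" for s
  proof -
    have "\<iota> c \<otimes>\<^bsub>S\<^esub> s \<ominus>\<^bsub>S\<^esub> g s \<in> K m" for m
    proof -
      interpret Km: ideal "K m" S by (rule S.K_ideal)
      obtain n where n: "\<And>s k. s \<in> carrier S \<Longrightarrow> k \<in> K n \<Longrightarrow> g (s \<oplus>\<^bsub>S\<^esub> k) \<ominus>\<^bsub>S\<^esub> g s \<in> K m" using g(4) by blast
      obtain r t where r: "r \<in> carrier R" "t \<in> U" "\<iota> t [^]\<^bsub>S\<^esub> p \<otimes>\<^bsub>S\<^esub> s \<ominus>\<^bsub>S\<^esub> \<iota> r \<in> K (max m n)"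
        using approximation[OF p s] by blast
      define T where "T = \<iota> t [^]\<^bsub>S\<^esub> p"
      define k where "k = T \<otimes>\<^bsub>S\<^esub> s \<ominus>\<^bsub>S\<^esub> \<iota> r"
      have k: "k \<in> K n" "k \<in> K m"
        using r(3) S.K_antimono[of n "max m n"] S.K_antimono[of m "max m n"] by (auto simp: k_def T_def)
      have cl: "T \<in> carrier S" "\<iota> r \<in> carrier S" "\<iota> c \<in> carrier S" "k \<in> carrier S" "\<iota> t \<in> carrier S"
        using r c s by (auto simp: T_def k_def)
      have Ts: "T \<otimes>\<^bsub>S\<^esub> s = \<iota> r \<oplus>\<^bsub>S\<^esub> k" using cl s by (simp add: k_def S.add_diff)
      define G where "G = g (\<iota> r \<oplus>\<^bsub>S\<^esub> k)"
      have G: "G \<in> carrier S" "T \<otimes>\<^bsub>S\<^esub> g s = G"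
        using gc[of "\<iota> r \<oplus>\<^bsub>S\<^esub> k"] cl g(3)[OF cl(5) s] unfolding G_def T_def[symmetric] Ts by auto
      have "T \<otimes>\<^bsub>S\<^esub> (\<iota> c \<otimes>\<^bsub>S\<^esub> s \<ominus>\<^bsub>S\<^esub> g s) = \<iota> c \<otimes>\<^bsub>S\<^esub> (T \<otimes>\<^bsub>S\<^esub> s) \<ominus>\<^bsub>S\<^esub> T \<otimes>\<^bsub>S\<^esub> g s"
        using cl s gc[OF s] by algebra
      also have "\<dots> = \<iota> c \<otimes>\<^bsub>S\<^esub> k \<ominus>\<^bsub>S\<^esub> (G \<ominus>\<^bsub>S\<^esub> \<iota> c \<otimes>\<^bsub>S\<^esub> \<iota> r)" unfolding Ts G(2) using cl G(1) by algebra
      also have "\<iota> c \<otimes>\<^bsub>S\<^esub> \<iota> r = g (\<iota> r)" using g(2)[OF r(1)] f(2)[OF r(1)] c r(1) by (metis \<iota>.hom_mult)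
      also have "\<iota> c \<otimes>\<^bsub>S\<^esub> k \<ominus>\<^bsub>S\<^esub> (G \<ominus>\<^bsub>S\<^esub> g (\<iota> r)) \<in> K m"
        unfolding G_def by (intro Km.minus_in Km.I_l_closed k cl n)
      finally have "\<iota> (t [^] p) \<otimes>\<^bsub>S\<^esub> (\<iota> c \<otimes>\<^bsub>S\<^esub> s \<ominus>\<^bsub>S\<^esub> g s) \<in> K m" using r(2) by (simp add: \<iota>_pow T_def)
      then show ?thesis using K_cancel_unit[OF U_pow[OF r(2), of p]] s gc[OF s] cl(3) by simp
    qed
    then show ?thesis using S.K_Inter[of "\<iota> c \<otimes>\<^bsub>S\<^esub> s \<ominus>\<^bsub>S\<^esub> g s"] s gc[OF s] c by simp
  qed
  then show ?thesis unfolding frobenius_dual_basis_def using g(1) by blast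
qed

text \<open>The embedding of \<open>R/P\<close> is recorded by the image \<open>e0\<close> of the
  class of 1, and essentiality becomes a statement about elements: every nonzero \<open>e\<close>
  has a multiple \<open>r e0\<close> with \<open>r\<close> outside \<open>P\<close>.\<close>

locale prime_hull = R: cring R + P: primeideal P R + E: module R E for R (structure) and P and E +
  fixes e0
  assumes noeth: "noetherian_ring R" and inj: "injective_module R E"
    and e0: "e0 \<in> carrier E"
    and e0_ann: "\<And>r. r \<in> carrier R \<Longrightarrow> r \<odot>\<^bsub>E\<^esub> e0 = \<zero>\<^bsub>E\<^esub> \<longleftrightarrow> r \<in> P"
    and essential: "\<And>e. e \<in> carrier E \<Longrightarrow> e \<noteq> \<zero>\<^bsub>E\<^esub> \<Longrightarrow> \<exists>a\<in>carrier R. \<exists>r\<in>carrier R - P. a \<odot>\<^bsub>E\<^esub> e = r \<odot>\<^bsub>E\<^esub> e0"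

lemma prime_hull_exists:
  fixes R (structure)
  assumes "noetherian_ring R" and P: "primeideal P R" and hull: "injective_hull R (cyclic_module R P) E \<epsilon>"
  shows "\<exists>e0. prime_hull R P E e0"
proof -
  interpret P: primeideal P R by fact
  interpret N: module R "self_module R" by (rule P.self_module)
  interpret Q: module_quotient R "self_module R" P
    by (intro module_quotient.intro module_quotient_axioms.intro N.module_axioms P.ideal_submodule P.is_ideal)
  let ?c = "\<lambda>x. P +>\<^bsub>self_module R\<^esub> x"
  have inj: "injective_module R E" and \<epsilon>: "lin R (cyclic_module R P) E \<epsilon>" and i: "inj_on \<epsilon> (carrier (cyclic_module R P))"
    and ess: "\<And>K. submodule K R E \<Longrightarrow> K \<noteq> {\<zero>\<^bsub>E\<^esub>} \<Longrightarrow> K \<inter> \<epsilon> ` carrier (cyclic_module R P) \<noteq> {\<zero>\<^bsub>E\<^esub>}"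
    using hull by (auto simp: injective_hull_def linear_maps_iff)
  have E: "module R E" using inj by (simp add: injective_module_def)
  have Cm: "module R (cyclic_module R P)" unfolding cyclic_module_def by (rule Q.quotient_module)
  interpret CE: two_modules R "cyclic_module R P" E by (intro two_modules.intro Cm E)
  define e0 where "e0 = \<epsilon> (?c \<one>)"
  have cc: "?c x \<in> carrier (cyclic_module R P)" if "x \<in> carrier R" for x
    unfolding cyclic_module_def using that by (intro Q.quotient_closed) simp
  have sm: "r \<odot>\<^bsub>E\<^esub> e0 = \<epsilon> (?c r)" if "r \<in> carrier R" for r
  proof -
    have "r \<odot>\<^bsub>cyclic_module R P\<^esub> ?c \<one> = ?c r"
      unfolding cyclic_module_def using Q.quotient_smult[of r \<one>] that by simp
    then show ?thesis using lin_smult[OF \<epsilon> that cc[OF P.one_closed]] by (simp add: e0_def)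
  qed
  have z: "\<epsilon> (?c r) = \<zero>\<^bsub>E\<^esub> \<longleftrightarrow> r \<in> P" if r: "r \<in> carrier R" for r
  proof -
    have z0: "\<zero>\<^bsub>cyclic_module R P\<^esub> = P" by (simp add: cyclic_module_def Q.quotient_zero)
    have "\<epsilon> (?c r) = \<zero>\<^bsub>E\<^esub> \<longleftrightarrow> \<epsilon> (?c r) = \<epsilon> \<zero>\<^bsub>cyclic_module R P\<^esub>"
      using CE.lin_zero[OF \<epsilon>] by simp
    also have "\<dots> \<longleftrightarrow> ?c r = \<zero>\<^bsub>cyclic_module R P\<^esub>"
      using inj_on_eq_iff[OF i cc[OF r] CE.M.M.zero_closed] .
    also have "\<dots> \<longleftrightarrow> r \<in> P" unfolding z0 using Q.quotient_eq_zero_iff[of r] r by simp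
    finally show ?thesis .
  qed
  have "prime_hull R P E e0"
  proof (intro prime_hull.intro prime_hull_axioms.intro P.is_cring P E assms(1) inj)
    show "e0 \<in> carrier E" unfolding e0_def by (rule lin_closed[OF \<epsilon> cc[OF P.one_closed]])
    show "r \<odot>\<^bsub>E\<^esub> e0 = \<zero>\<^bsub>E\<^esub> \<longleftrightarrow> r \<in> P" if "r \<in> carrier R" for r
      using sm[OF that] z[OF that] by simp
    fix e assume e: "e \<in> carrier E" "e \<noteq> \<zero>\<^bsub>E\<^esub>"
    define D where "D = {r \<odot>\<^bsub>E\<^esub> e |r. r \<in> carrier R}"
    have D: "submodule D R E" unfolding D_def by (rule CE.N.cyclic_submodule[OF e(1)])
    have "e \<in> D" using e(1) by (auto simp: D_def intro!: exI[of _ \<one>])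
    then have "D \<noteq> {\<zero>\<^bsub>E\<^esub>}" using e(2) by blast
    from ess[OF D this] have "D \<inter> \<epsilon> ` carrier (cyclic_module R P) \<noteq> {\<zero>\<^bsub>E\<^esub>}" .
    moreover have "\<zero>\<^bsub>E\<^esub> \<in> D \<inter> \<epsilon> ` carrier (cyclic_module R P)"
      using submodule_zero[OF D] CE.lin_zero[OF \<epsilon>] CE.M.M.zero_closed by (metis IntI imageI)
    ultimately obtain d where d: "d \<in> D" "d \<in> \<epsilon> ` carrier (cyclic_module R P)" "d \<noteq> \<zero>\<^bsub>E\<^esub>" by blast
    obtain a where a: "a \<in> carrier R" "d = a \<odot>\<^bsub>E\<^esub> e" using d(1) by (auto simp: D_def)
    obtain r where r: "r \<in> carrier R" "d = \<epsilon> (?c r)"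
      using d(2) unfolding cyclic_module_def Q.quotient_carrier by auto
    have "r \<notin> P" using z[OF r(1)] d(3) r(2) by blast
    then show "\<exists>a\<in>carrier R. \<exists>r\<in>carrier R - P. a \<odot>\<^bsub>E\<^esub> e = r \<odot>\<^bsub>E\<^esub> e0"
      using a(1) r(1) sm[OF r(1)] a(2) r(2) by (intro bexI[of _ a] bexI[of _ r]; simp)
  qed
  then show ?thesis ..
qed

context prime_hull
begin

text \<open>A nonzero \<open>e\<close> has a multiple \<open>r e0\<close> with \<open>r\<close>
  outside \<open>P\<close>. If \<open>s e = 0\<close>, then \<open>s r\<close> kills
  \<open>e0\<close> and lies in \<open>P\<close>, although neither factor does.\<close>

lemma unit_cancel:
  assumes s: "s \<in> carrier R - P" and e: "e \<in> carrier E" and "s \<odot>\<^bsub>E\<^esub> e = \<zero>\<^bsub>E\<^esub>"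
  shows "e = \<zero>\<^bsub>E\<^esub>"
proof (rule ccontr)
  assume "e \<noteq> \<zero>\<^bsub>E\<^esub>"
  then obtain a r where a: "a \<in> carrier R" and r: "r \<in> carrier R - P" "a \<odot>\<^bsub>E\<^esub> e = r \<odot>\<^bsub>E\<^esub> e0"
    using essential[OF e] by blast
  have "(s \<otimes> r) \<odot>\<^bsub>E\<^esub> e0 = s \<odot>\<^bsub>E\<^esub> (a \<odot>\<^bsub>E\<^esub> e)" using s r e0 by (simp add: E.smult_assoc1)
  also have "\<dots> = a \<odot>\<^bsub>E\<^esub> (s \<odot>\<^bsub>E\<^esub> e)" using s a e by (simp add: R.m_comm flip: E.smult_assoc1)
  finally have "(s \<otimes> r) \<odot>\<^bsub>E\<^esub> e0 = \<zero>\<^bsub>E\<^esub>" using assms(3) a by simp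
  then have "s \<otimes> r \<in> P" using e0_ann[of "s \<otimes> r"] s r by simp
  then show False using P.I_prime[of s r] s r by blast
qed

lemma unit_inj:
  assumes s: "s \<in> carrier R - P" and e: "e \<in> carrier E" "e' \<in> carrier E" and eq: "s \<odot>\<^bsub>E\<^esub> e = s \<odot>\<^bsub>E\<^esub> e'"
  shows "e = e'"
proof -
  have "s \<odot>\<^bsub>E\<^esub> (e \<ominus>\<^bsub>E\<^esub> e') = s \<odot>\<^bsub>E\<^esub> e \<ominus>\<^bsub>E\<^esub> s \<odot>\<^bsub>E\<^esub> e'"
    using s e by (simp add: E.M.minus_eq E.smult_r_distr E.smult_r_minus)
  then have "e \<ominus>\<^bsub>E\<^esub> e' = \<zero>\<^bsub>E\<^esub>" using s e eq by (subst unit_cancel[OF s]) simp_all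
  then show ?thesis using e by simp
qed

text \<open>Under the hypothesis, sending \<open>s\<close> to \<open>e\<close> defines a map on the
  principal ideal of \<open>s\<close>. Injectivity extends it to \<open>R\<close>, and its value at
  1 is the required preimage. It serves both for \<open>s\<close> outside \<open>P\<close> and for
  nonzerodivisors.\<close>

lemma regular_surj:
  assumes s: "s \<in> carrier R" and e: "e \<in> carrier E"
    and reg: "\<And>r. r \<in> carrier R \<Longrightarrow> r \<otimes> s = \<zero> \<Longrightarrow> r \<odot>\<^bsub>E\<^esub> e = \<zero>\<^bsub>E\<^esub>"
  shows "\<exists>e'\<in>carrier E. s \<odot>\<^bsub>E\<^esub> e' = e"
proof -
  obtain g where g: "lin R (self_module R) E g" "g s = e"
    using extension_from_cyclic[OF inj R.self_module _ e, of s] s reg by auto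
  have "s \<odot>\<^bsub>E\<^esub> g \<one> = e" using lin_smult[OF g(1) s, of \<one>] s g(2) by simp
  then show ?thesis using lin_closed[OF g(1), of \<one>] by auto
qed

lemma unit_surj:
  assumes s: "s \<in> carrier R - P" and e: "e \<in> carrier E"
  shows "\<exists>e'\<in>carrier E. s \<odot>\<^bsub>E\<^esub> e' = e"
proof (rule regular_surj[OF _ e])
  show "r \<odot>\<^bsub>E\<^esub> e = \<zero>\<^bsub>E\<^esub>" if "r \<in> carrier R" "r \<otimes> s = \<zero>" for r
  proof (rule unit_cancel[OF s])
    show "s \<odot>\<^bsub>E\<^esub> (r \<odot>\<^bsub>E\<^esub> e) = \<zero>\<^bsub>E\<^esub>" using that s e by (simp add: R.m_comm flip: E.smult_assoc1)
  qed (use that e in simp)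
qed (use s in simp)

lemma ann_ideal:
  assumes "e \<in> carrier E"
  shows "ideal {r \<in> carrier R. r \<odot>\<^bsub>E\<^esub> e = \<zero>\<^bsub>E\<^esub>} R"
  by (rule R.idealI') (use assms in \<open>auto simp: E.smult_l_distr E.smult_assoc1\<close>)

text \<open>The annihilators of \<open>x^n e\<close> increase and hence become stationary. If
  \<open>x^n e\<close> is nonzero, some \<open>a\<close> takes it to \<open>r e0\<close> with
  \<open>r\<close> outside \<open>P\<close>. As \<open>x\<close> kills \<open>e0\<close>, this
  \<open>a\<close> kills \<open>x^(n+1) e\<close>, hence already \<open>x^n e\<close> by
  stationarity, which contradicts that \<open>r e0\<close> is nonzero.\<close>

lemma element_nilpotent:
  assumes x: "x \<in> P" and e: "e \<in> carrier E"
  shows "\<exists>n::nat. x [^] n \<odot>\<^bsub>E\<^esub> e = \<zero>\<^bsub>E\<^esub>"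
proof -
  have xc: "x \<in> carrier R" by (rule P.Icarr[OF x])
  define A where "A n = {r \<in> carrier R. r \<odot>\<^bsub>E\<^esub> (x [^] n \<odot>\<^bsub>E\<^esub> e) = \<zero>\<^bsub>E\<^esub>}" for n :: nat
  have A: "ideal (A n) R" for n unfolding A_def by (rule ann_ideal) (use xc e in simp)
  have mem: "r \<in> A n \<longleftrightarrow> r \<in> carrier R \<and> (r \<otimes> x [^] n) \<odot>\<^bsub>E\<^esub> e = \<zero>\<^bsub>E\<^esub>" for r n
    using xc e by (auto simp: A_def E.smult_assoc1)
  have step: "A n \<subseteq> A (Suc n)" for n
  proof
    fix r assume r: "r \<in> A n"
    have "(r \<otimes> x [^] Suc n) \<odot>\<^bsub>E\<^esub> e = x \<odot>\<^bsub>E\<^esub> ((r \<otimes> x [^] n) \<odot>\<^bsub>E\<^esub> e)"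
      using r xc e unfolding mem by (subst E.smult_assoc1[symmetric]) (auto simp: R.m_ac)
    then show "r \<in> A (Suc n)" using r xc unfolding mem by simp
  qed
  have mono: "A m \<subseteq> A n" if "m \<le> n" for m n using lift_Suc_mono_le[of A, OF step that] .
  have "A m \<subseteq> A n \<or> A n \<subseteq> A m" for m n using mono nat_le_linear by metis
  then have "subset.chain {I. ideal I R} (range A)" using A unfolding pred_on.chain_def by blast
  then have "\<Union>(range A) \<in> range A" by (intro noetherian_ring.ideal_chain_is_trivial[OF noeth]) auto
  then obtain n where "\<Union>(range A) = A n" by auto
  then have n: "A (Suc n) \<subseteq> A n" by blast
  have "x [^] n \<odot>\<^bsub>E\<^esub> e = \<zero>\<^bsub>E\<^esub>"
  proof (rule ccontr)
    assume "x [^] n \<odot>\<^bsub>E\<^esub> e \<noteq> \<zero>\<^bsub>E\<^esub>"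
    then obtain a r where a: "a \<in> carrier R" and r: "r \<in> carrier R - P" "a \<odot>\<^bsub>E\<^esub> (x [^] n \<odot>\<^bsub>E\<^esub> e) = r \<odot>\<^bsub>E\<^esub> e0"
      using essential[of "x [^] n \<odot>\<^bsub>E\<^esub> e"] xc e by auto
    have "(a \<otimes> x [^] Suc n) \<odot>\<^bsub>E\<^esub> e = x \<odot>\<^bsub>E\<^esub> (a \<odot>\<^bsub>E\<^esub> (x [^] n \<odot>\<^bsub>E\<^esub> e))"
      using a xc e by (simp add: R.m_ac flip: E.smult_assoc1)
    also have "\<dots> = r \<odot>\<^bsub>E\<^esub> (x \<odot>\<^bsub>E\<^esub> e0)"
      unfolding r(2) using r(1) xc e0 by (simp add: R.m_ac flip: E.smult_assoc1)
    also have "\<dots> = \<zero>\<^bsub>E\<^esub>" using e0_ann[OF xc] x r(1) by simp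
    finally have "a \<in> A (Suc n)" using a unfolding mem by blast
    then have "a \<in> A n" using n by blast
    then have "r \<odot>\<^bsub>E\<^esub> e0 = \<zero>\<^bsub>E\<^esub>" using r(2) by (simp add: A_def)
    then show False using e0_ann r(1) by blast
  qed
  then show ?thesis ..
qed

lemma power_kills:
  assumes e: "e \<in> carrier E"
  shows "\<exists>n. \<forall>y\<in>ideal_power R P n. y \<odot>\<^bsub>E\<^esub> e = \<zero>\<^bsub>E\<^esub>"
proof -
  have "\<exists>n::nat. ideal_power R P n \<subseteq> {r \<in> carrier R. r \<odot>\<^bsub>E\<^esub> e = \<zero>\<^bsub>E\<^esub>}"
    using element_nilpotent[OF _ e] P.Icarr
    by (intro ideal_power_subset_of_radical noeth R.is_cring P.is_ideal ann_ideal[OF e]) simp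
  then show ?thesis by blast
qed

end

section \<open>The action of a completion on a torsion module\<close>

locale torsion_module = adic A I + E: module A E for A (structure) and I and E +
  assumes torsion: "\<And>e. e \<in> carrier E \<Longrightarrow> \<exists>n. \<forall>y\<in>Ip n. y \<odot>\<^bsub>E\<^esub> e = \<zero>\<^bsub>E\<^esub>"
begin

abbreviation "act \<equiv> completed_smult A I E"

lemma C_mem:
  assumes "a \<in> carrier C"
  obtains x where "x \<in> a n" "x \<in> carrier A" "a n = Ip n +> x"
  using assms coset_self unfolding C_carrier by metis

lemma C_mem_carrier:
  assumes "a \<in> carrier C" "x \<in> a n"
  shows "x \<in> carrier A" "a n = Ip n +> x"
  using assms coset_carrier coset_eqI unfolding C_carrier by metis+

lemma smult_eq:
  assumes a: "a \<in> carrier C" and x: "x \<in> a n" "y \<in> a n" and e: "e \<in> carrier E"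
    and kill: "\<And>y. y \<in> Ip n \<Longrightarrow> y \<odot>\<^bsub>E\<^esub> e = \<zero>\<^bsub>E\<^esub>"
  shows "x \<odot>\<^bsub>E\<^esub> e = y \<odot>\<^bsub>E\<^esub> e"
proof -
  have c: "x \<in> carrier A" "y \<in> carrier A" "x \<ominus> y \<in> Ip n"
    using C_mem_carrier[OF a x(1)] C_mem_carrier[OF a x(2)] coset_eq_iff[of x y n] by simp_all
  have "x \<odot>\<^bsub>E\<^esub> e \<ominus>\<^bsub>E\<^esub> y \<odot>\<^bsub>E\<^esub> e = (x \<ominus> y) \<odot>\<^bsub>E\<^esub> e"
    using c e by (simp add: E.M.minus_eq minus_eq E.smult_l_distr E.smult_l_minus)
  then show ?thesis using kill[OF c(3)] c e by simp
qed

text \<open>The description in \<open>completed_smult\<close> ranges over all admissible indices.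
  They give the same value because the components of \<open>a\<close> are nested, so that any two
  can be compared at the smaller index.\<close>

lemma act_eq:
  assumes a: "a \<in> carrier C" and x: "x \<in> a n" and e: "e \<in> carrier E"
    and kill: "\<And>y. y \<in> Ip n \<Longrightarrow> y \<odot>\<^bsub>E\<^esub> e = \<zero>\<^bsub>E\<^esub>"
  shows "act a e = x \<odot>\<^bsub>E\<^esub> e"
  unfolding completed_smult_def
proof (rule the_equality)
  show "\<exists>n. (\<forall>y\<in>Ip n. y \<odot>\<^bsub>E\<^esub> e = \<zero>\<^bsub>E\<^esub>) \<and> (\<exists>xa\<in>a n. x \<odot>\<^bsub>E\<^esub> e = xa \<odot>\<^bsub>E\<^esub> e)"
    using x kill by blast
  fix e' assume "\<exists>n. (\<forall>y\<in>Ip n. y \<odot>\<^bsub>E\<^esub> e = \<zero>\<^bsub>E\<^esub>) \<and> (\<exists>x\<in>a n. e' = x \<odot>\<^bsub>E\<^esub> e)"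
  then obtain m y where m: "\<forall>y\<in>Ip m. y \<odot>\<^bsub>E\<^esub> e = \<zero>\<^bsub>E\<^esub>" and y: "y \<in> a m" "e' = y \<odot>\<^bsub>E\<^esub> e" by blast
  show "e' = x \<odot>\<^bsub>E\<^esub> e"
  proof (cases "m \<le> n")
    case True
    then have "x \<in> a m" using C_antimono[OF a] x by blast
    then show ?thesis using smult_eq[OF a y(1) _ e] m y(2) by blast
  next
    case False
    then have "y \<in> a n" using C_antimono[OF a, of n m] y by auto
    then show ?thesis using smult_eq[OF a _ x e] kill y(2) by blast
  qed
qed

lemma torsion2:
  assumes "e \<in> carrier E" "e' \<in> carrier E"
  shows "\<exists>n. \<forall>y\<in>Ip n. y \<odot>\<^bsub>E\<^esub> e = \<zero>\<^bsub>E\<^esub> \<and> y \<odot>\<^bsub>E\<^esub> e' = \<zero>\<^bsub>E\<^esub>"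
proof -
  obtain m where m: "\<forall>y\<in>Ip m. y \<odot>\<^bsub>E\<^esub> e = \<zero>\<^bsub>E\<^esub>" using torsion[OF assms(1)] by blast
  obtain n where n: "\<forall>y\<in>Ip n. y \<odot>\<^bsub>E\<^esub> e' = \<zero>\<^bsub>E\<^esub>" using torsion[OF assms(2)] by blast
  show ?thesis
    using m n ideal_power_antimono[OF I, of m "max m n"] ideal_power_antimono[OF I, of n "max m n"]
    by (intro exI[of _ "max m n"]) auto
qed

lemma act_closed:
  assumes "a \<in> carrier C" "e \<in> carrier E"
  shows "act a e \<in> carrier E"
proof -
  obtain n where n: "\<And>y. y \<in> Ip n \<Longrightarrow> y \<odot>\<^bsub>E\<^esub> e = \<zero>\<^bsub>E\<^esub>" using torsion assms by blast
  obtain x where "x \<in> a n" "x \<in> carrier A" by (rule C_mem[OF assms(1)])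
  then show ?thesis using act_eq[OF assms(1) _ assms(2) n] assms by simp
qed

lemma act_emb:
  assumes "x \<in> carrier A" "e \<in> carrier E"
  shows "act (emb x) e = x \<odot>\<^bsub>E\<^esub> e"
proof -
  obtain n where n: "\<And>y. y \<in> Ip n \<Longrightarrow> y \<odot>\<^bsub>E\<^esub> e = \<zero>\<^bsub>E\<^esub>" using torsion assms by blast
  show ?thesis by (rule act_eq[OF emb_closed _ assms(2) n]) (use assms coset_self in \<open>auto simp: emb_def\<close>)
qed

lemma act_K:
  assumes "a \<in> K n" "e \<in> carrier E" "\<And>y. y \<in> Ip n \<Longrightarrow> y \<odot>\<^bsub>E\<^esub> e = \<zero>\<^bsub>E\<^esub>"
  shows "act a e = \<zero>\<^bsub>E\<^esub>"
proof -
  have "act a e = \<zero> \<odot>\<^bsub>E\<^esub> e"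
    using assms additive_subgroup.zero_closed[OF ideal.axioms(1)[OF Ip_ideal[of n]]]
    by (intro act_eq[of _ _ n]) (auto simp: K_def)
  then show ?thesis using assms by simp
qed

theorem module_act: "module C (with_scalars E act)"
proof (intro moduleI abelian_groupI)
  show "\<exists>y\<in>carrier (with_scalars E act). y \<oplus>\<^bsub>with_scalars E act\<^esub> x = \<zero>\<^bsub>with_scalars E act\<^esub>"
    if "x \<in> carrier (with_scalars E act)" for x
    using that by (intro bexI[of _ "\<ominus>\<^bsub>E\<^esub> x"]) (auto simp: E.M.l_neg)
  fix a e assume a: "a \<in> carrier C" and e: "e \<in> carrier (with_scalars E act)"
  then have e: "e \<in> carrier E" by simp
  obtain n where n: "\<And>y. y \<in> Ip n \<Longrightarrow> y \<odot>\<^bsub>E\<^esub> e = \<zero>\<^bsub>E\<^esub>" using torsion e by blast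
  obtain x where x: "x \<in> a n" "x \<in> carrier A" "a n = Ip n +> x" by (rule C_mem[OF a])
  have ae: "act a e = x \<odot>\<^bsub>E\<^esub> e" by (rule act_eq[OF a x(1) e n])
  show "a \<odot>\<^bsub>with_scalars E act\<^esub> e \<in> carrier (with_scalars E act)" using act_closed[OF a e] by simp
  show "a \<odot>\<^bsub>with_scalars E act\<^esub> (e \<oplus>\<^bsub>with_scalars E act\<^esub> e') =
      a \<odot>\<^bsub>with_scalars E act\<^esub> e \<oplus>\<^bsub>with_scalars E act\<^esub> a \<odot>\<^bsub>with_scalars E act\<^esub> e'"
    if "e' \<in> carrier (with_scalars E act)" for e'
  proof -
    have e': "e' \<in> carrier E" using that by simp
    obtain m where m: "\<And>y. y \<in> Ip m \<Longrightarrow> y \<odot>\<^bsub>E\<^esub> e = \<zero>\<^bsub>E\<^esub>" "\<And>y. y \<in> Ip m \<Longrightarrow> y \<odot>\<^bsub>E\<^esub> e' = \<zero>\<^bsub>E\<^esub>"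
      using torsion2[OF e e'] by blast
    have k: "y \<odot>\<^bsub>E\<^esub> (e \<oplus>\<^bsub>E\<^esub> e') = \<zero>\<^bsub>E\<^esub>" if "y \<in> Ip m" for y
      using m[OF that] ideal.Icarr[OF Ip_ideal that] e e' by (simp add: E.smult_r_distr)
    obtain z where z: "z \<in> a m" "z \<in> carrier A" by (rule C_mem[OF a])
    show ?thesis
      using act_eq[OF a z(1) _ k] act_eq[OF a z(1) e m(1)] act_eq[OF a z(1) e' m(2)] e e' z
      by (simp add: E.smult_r_distr)
  qed
  fix b assume b: "b \<in> carrier C"
  obtain y where y: "y \<in> b n" "y \<in> carrier A" "b n = Ip n +> y" by (rule C_mem[OF b])
  have be: "act b e = y \<odot>\<^bsub>E\<^esub> e" by (rule act_eq[OF b y(1) e n])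
  have "(a \<oplus>\<^bsub>C\<^esub> b) n = Ip n +> (x \<oplus> y)" using x y by (simp add: C_simps Q_add)
  then have "x \<oplus> y \<in> (a \<oplus>\<^bsub>C\<^esub> b) n" using coset_self x y by simp
  then show "(a \<oplus>\<^bsub>C\<^esub> b) \<odot>\<^bsub>with_scalars E act\<^esub> e =
      a \<odot>\<^bsub>with_scalars E act\<^esub> e \<oplus>\<^bsub>with_scalars E act\<^esub> b \<odot>\<^bsub>with_scalars E act\<^esub> e"
    using act_eq[OF C_add_closed[OF a b] _ e n, of "x \<oplus> y"] ae be x y e by (simp add: E.smult_l_distr)
  have "(a \<otimes>\<^bsub>C\<^esub> b) n = Ip n +> (x \<otimes> y)" using x y by (simp add: C_simps Q_mult)
  then have "x \<otimes> y \<in> (a \<otimes>\<^bsub>C\<^esub> b) n" using coset_self x y by simp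
  then have "act (a \<otimes>\<^bsub>C\<^esub> b) e = x \<odot>\<^bsub>E\<^esub> (y \<odot>\<^bsub>E\<^esub> e)"
    using act_eq[OF C_mult_closed[OF a b] _ e n, of "x \<otimes> y"] x y e by (simp add: E.smult_assoc1)
  also have "\<dots> = act a (y \<odot>\<^bsub>E\<^esub> e)"
  proof (rule act_eq[OF a x(1), symmetric])
    fix z assume z: "z \<in> Ip n"
    then have "z \<in> carrier A" by (rule ideal.Icarr[OF Ip_ideal])
    then have "z \<odot>\<^bsub>E\<^esub> (y \<odot>\<^bsub>E\<^esub> e) = y \<odot>\<^bsub>E\<^esub> (z \<odot>\<^bsub>E\<^esub> e)"
      using y e by (simp add: m_comm flip: E.smult_assoc1)
    then show "z \<odot>\<^bsub>E\<^esub> (y \<odot>\<^bsub>E\<^esub> e) = \<zero>\<^bsub>E\<^esub>" using n[OF z] y by simp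
  qed (use y e in simp)
  finally show "(a \<otimes>\<^bsub>C\<^esub> b) \<odot>\<^bsub>with_scalars E act\<^esub> e =
      a \<odot>\<^bsub>with_scalars E act\<^esub> (b \<odot>\<^bsub>with_scalars E act\<^esub> e)" using be by simp
next
  fix e assume e: "e \<in> carrier (with_scalars E act)"
  have "\<one>\<^bsub>C\<^esub> = emb \<one>" by (rule C_eqI) (simp add: C_simps Q_one emb_def)
  then show "\<one>\<^bsub>C\<^esub> \<odot>\<^bsub>with_scalars E act\<^esub> e = e" using act_emb[of \<one> e] e by simp
qed (auto simp: C_cring E.M.a_assoc intro: E.M.a_comm)

end

context prime_localization
begin

lemma localization_ideal_ideal: "ideal (localization_ideal R P) L"
  unfolding localization_ideal_eq by (rule ext_ideal_ideal[OF is_ideal])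

lemma localization_power_iff:
  assumes "r \<in> carrier R" "s \<in> U"
  shows "fr r s \<in> ideal_power L (localization_ideal R P) n \<longleftrightarrow> (\<exists>t\<in>U. t \<otimes> r \<in> ideal_power R P n)"
  unfolding localization_ideal_eq ext_ideal_power
  by (rule ext_ideal_iff[OF ideal_power_ideal[OF is_ideal] assms])

sublocale A: adic L "localization_ideal R P"
  by (intro adic.intro adic_axioms.intro L_cring localization_ideal_ideal)

definition "to_completion r = A.emb (fr r \<one>)"

lemma fr_one_hom: "(\<lambda>r. fr r \<one>) \<in> ring_hom R L"
  using U_one by (intro ring_hom_memI) (auto simp: L_mult L_add L_one frac_closed)

text \<open>Density holds exactly rather than approximately at each level: the \<open>n\<close>-th
  component of \<open>s\<close> is the coset of a single fraction.\<close>

theorem local_completion: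
  assumes "noetherian_ring R"
  shows "local_completion R P (completed_localization R P) A.K to_completion"
  unfolding completed_localization_def
proof (intro local_completion.intro local_completion_axioms.intro is_cring primeideal_axioms A.K_filtration assms)
  have em: "to_completion = A.emb \<circ> (\<lambda>r. fr r \<one>)" by (auto simp: to_completion_def)
  show "to_completion \<in> ring_hom R A.C" unfolding em
    by (rule ring_hom_trans[OF fr_one_hom A.emb_hom])
  show "\<exists>v\<in>carrier A.C. v \<otimes>\<^bsub>A.C\<^esub> to_completion t = \<one>\<^bsub>A.C\<^esub>" if t: "t \<in> U" for t
  proof (intro bexI)
    have "fr \<one> t \<otimes>\<^bsub>L\<^esub> fr t \<one> = fr \<one> \<one>"
      using t U_one by (simp add: L_mult) (rule frac_eqI; simp)
    then show "A.emb (fr \<one> t) \<otimes>\<^bsub>A.C\<^esub> to_completion t = \<one>\<^bsub>A.C\<^esub>"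
      using ring_hom_mult[OF A.emb_hom, of "fr \<one> t" "fr t \<one>"] ring_hom_one[OF A.emb_hom] t U_one
      by (simp add: to_completion_def frac_closed L_one)
  qed (use t in \<open>simp add: A.emb_closed frac_closed\<close>)
  show "\<exists>r\<in>carrier R. \<exists>t\<in>U. to_completion t \<otimes>\<^bsub>A.C\<^esub> s \<ominus>\<^bsub>A.C\<^esub> to_completion r \<in> A.K n"
    if s: "s \<in> carrier A.C" for s n
  proof -
    obtain x where x: "x \<in> carrier L" "s n = A.Ip n +>\<^bsub>L\<^esub> x" using s unfolding A.C_carrier by blast
    obtain r t where rt: "r \<in> carrier R" "t \<in> U" "x = fr r t" using x(1) L_carrier by blast
    have "fr t \<one> \<otimes>\<^bsub>L\<^esub> x = fr r \<one>"
      unfolding rt(3) using rt(1,2) U_one by (simp add: L_mult) (rule frac_eqI; simp)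
    moreover have "(A.emb (fr t \<one>) \<otimes>\<^bsub>A.C\<^esub> s) n = A.Ip n +>\<^bsub>L\<^esub> (fr t \<one> \<otimes>\<^bsub>L\<^esub> x)"
      using x rt(2) U_one by (simp add: A.C_simps A.emb_def A.Q_mult frac_closed)
    ultimately have "A.emb (fr t \<one>) \<otimes>\<^bsub>A.C\<^esub> s \<ominus>\<^bsub>A.C\<^esub> A.emb (fr r \<one>) \<in> A.K n"
      using A.diff_K_iff[OF A.C_mult_closed[OF A.emb_closed s] A.emb_closed, of "fr t \<one>" "fr r \<one>" n]
        rt U_one frac_closed by (simp add: A.emb_def[of "fr r \<one>"])
    then show ?thesis using rt unfolding to_completion_def by blast
  qed
  show "to_completion r \<in> A.K n \<longleftrightarrow> (\<exists>t\<in>U. t \<otimes> r \<in> ideal_power R P n)" if "r \<in> carrier R" for r n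
    unfolding to_completion_def
    using A.emb_K_iff[of "fr r \<one>" n] localization_power_iff[OF that U_one, of n] frac_closed[OF that U_one] by simp
qed

end

section \<open>The completion of the localization acting on the hull\<close>

sublocale prime_hull \<subseteq> loc: prime_localization R P
  by (rule prime_localization.intro) (rule P.primeideal_axioms)

context prime_hull
begin

abbreviation "S \<equiv> completed_localization R P"
abbreviation "act \<equiv> completed_localization_smult R P E"
abbreviation "lsm \<equiv> localized_smult R P E"

text \<open>All representatives of the fraction lead to the same element, because scalars outside
  \<open>P\<close> act injectively on the hull.\<close>

lemma lsm_eqI:
  assumes r: "r \<in> carrier R" "s \<in> carrier R - P" and e: "e \<in> carrier E" "e' \<in> carrier E"
    and eq: "s \<odot>\<^bsub>E\<^esub> e' = r \<odot>\<^bsub>E\<^esub> e"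
  shows "lsm (loc.fr r s) e = e'"
  unfolding localized_smult_def
proof (rule the_equality)
  show "e' \<in> carrier E \<and> (\<exists>(r, s)\<in>loc.fr r s. s \<odot>\<^bsub>E\<^esub> e' = r \<odot>\<^bsub>E\<^esub> e)"
    using loc.frac_self[OF r] eq e by blast
  fix e'' assume "e'' \<in> carrier E \<and> (\<exists>(r, s)\<in>loc.fr r s. s \<odot>\<^bsub>E\<^esub> e'' = r \<odot>\<^bsub>E\<^esub> e)"
  then obtain r' s' where e'': "e'' \<in> carrier E" and rs: "(r', s') \<in> loc.fr r s" "s' \<odot>\<^bsub>E\<^esub> e'' = r' \<odot>\<^bsub>E\<^esub> e"
    by blast
  obtain t where t: "r' \<in> carrier R" "s' \<in> carrier R - P" "t \<in> carrier R - P" "t \<otimes> (s' \<otimes> r) = t \<otimes> (s \<otimes> r')"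
    using rs(1) unfolding loc.frac_iff[OF r] by blast
  have "(t \<otimes> (s \<otimes> s')) \<odot>\<^bsub>E\<^esub> e'' = (t \<otimes> (s \<otimes> r')) \<odot>\<^bsub>E\<^esub> e"
    using t r e e'' rs(2) by (simp add: E.smult_assoc1)
  also have "\<dots> = (t \<otimes> (s' \<otimes> s)) \<odot>\<^bsub>E\<^esub> e'"
    unfolding t(4)[symmetric] using t(1-3) r e eq by (simp add: E.smult_assoc1)
  also have "t \<otimes> (s' \<otimes> s) = t \<otimes> (s \<otimes> s')" using t r by (simp add: R.m_comm)
  finally show "e'' = e'"
    by (rule unit_inj[rotated 3]) (use t r e e'' loc.U_mult in auto)
qed

lemma lsm_props:
  assumes r: "r \<in> carrier R" "s \<in> carrier R - P" and e: "e \<in> carrier E"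
  shows "lsm (loc.fr r s) e \<in> carrier E" "s \<odot>\<^bsub>E\<^esub> lsm (loc.fr r s) e = r \<odot>\<^bsub>E\<^esub> e"
proof -
  obtain e' where "e' \<in> carrier E" "s \<odot>\<^bsub>E\<^esub> e' = r \<odot>\<^bsub>E\<^esub> e"
    using unit_surj[OF r(2), of "r \<odot>\<^bsub>E\<^esub> e"] r e by auto
  then show "lsm (loc.fr r s) e \<in> carrier E" "s \<odot>\<^bsub>E\<^esub> lsm (loc.fr r s) e = r \<odot>\<^bsub>E\<^esub> e"
    using lsm_eqI[OF r e] by auto
qed

lemma module_lsm: "module loc.L (with_scalars E lsm)"
proof (intro moduleI abelian_groupI)
  show "\<exists>y\<in>carrier (with_scalars E lsm). y \<oplus>\<^bsub>with_scalars E lsm\<^esub> x = \<zero>\<^bsub>with_scalars E lsm\<^esub>"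
    if "x \<in> carrier (with_scalars E lsm)" for x
    using that by (intro bexI[of _ "\<ominus>\<^bsub>E\<^esub> x"]) (auto simp: E.M.l_neg)
  fix a e assume "a \<in> carrier loc.L" and "e \<in> carrier (with_scalars E lsm)"
  then have e: "e \<in> carrier E" and "a \<in> carrier loc.L" by simp_all
  then obtain r s where r: "r \<in> carrier R" "s \<in> carrier R - P" and a: "a = loc.fr r s"
    using loc.L_carrier by blast
  note ae = lsm_props[OF r e]
  show "a \<odot>\<^bsub>with_scalars E lsm\<^esub> e \<in> carrier (with_scalars E lsm)" using ae by (simp add: a)
  show "a \<odot>\<^bsub>with_scalars E lsm\<^esub> (e \<oplus>\<^bsub>with_scalars E lsm\<^esub> e') =
      a \<odot>\<^bsub>with_scalars E lsm\<^esub> e \<oplus>\<^bsub>with_scalars E lsm\<^esub> a \<odot>\<^bsub>with_scalars E lsm\<^esub> e'"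
    if "e' \<in> carrier (with_scalars E lsm)" for e'
    using that e r lsm_props[OF r, of e'] ae by (simp add: a) (rule lsm_eqI; simp add: E.smult_r_distr)
  fix b assume "b \<in> carrier loc.L"
  then obtain r' s' where r': "r' \<in> carrier R" "s' \<in> carrier R - P" and b: "b = loc.fr r' s'"
    using loc.L_carrier by blast
  note be = lsm_props[OF r' e]
  have ss: "s \<otimes> s' \<in> carrier R - P" by (rule loc.U_mult[OF r(2) r'(2)])
  show "(a \<oplus>\<^bsub>loc.L\<^esub> b) \<odot>\<^bsub>with_scalars E lsm\<^esub> e =
      a \<odot>\<^bsub>with_scalars E lsm\<^esub> e \<oplus>\<^bsub>with_scalars E lsm\<^esub> b \<odot>\<^bsub>with_scalars E lsm\<^esub> e"
  proof -
    have "(s \<otimes> s') \<odot>\<^bsub>E\<^esub> (lsm a e \<oplus>\<^bsub>E\<^esub> lsm b e) = (s' \<otimes> s) \<odot>\<^bsub>E\<^esub> lsm a e \<oplus>\<^bsub>E\<^esub> (s \<otimes> s') \<odot>\<^bsub>E\<^esub> lsm b e"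
      using r r' ae be by (simp add: E.smult_r_distr a b R.m_comm)
    also have "\<dots> = (s' \<otimes> r) \<odot>\<^bsub>E\<^esub> e \<oplus>\<^bsub>E\<^esub> (s \<otimes> r') \<odot>\<^bsub>E\<^esub> e"
      using r r' ae be e by (simp add: E.smult_assoc1 a b)
    also have "\<dots> = (s' \<otimes> r \<oplus> s \<otimes> r') \<odot>\<^bsub>E\<^esub> e"
      using r r' e by (simp add: E.smult_l_distr)
    finally have "lsm (loc.fr (s' \<otimes> r \<oplus> s \<otimes> r') (s \<otimes> s')) e = lsm a e \<oplus>\<^bsub>E\<^esub> lsm b e"
      using r r' e ae be ss by (intro lsm_eqI) (simp_all add: a b)
    then show ?thesis using loc.L_add[OF r r'] by (simp add: a b)
  qed
  have "(s \<otimes> s') \<odot>\<^bsub>E\<^esub> lsm a (lsm b e) = (s' \<otimes> s) \<odot>\<^bsub>E\<^esub> lsm a (lsm b e)"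
    using r r' by (simp add: R.m_comm)
  also have "\<dots> = (s' \<otimes> r) \<odot>\<^bsub>E\<^esub> lsm b e"
    using r r' be lsm_props[OF r, of "lsm b e"] by (simp add: E.smult_assoc1 a b)
  also have "\<dots> = (r \<otimes> r') \<odot>\<^bsub>E\<^esub> e"
    using r r' be e by (subst R.m_comm) (simp_all add: E.smult_assoc1 b)
  finally have "lsm (loc.fr (r \<otimes> r') (s \<otimes> s')) e = lsm a (lsm b e)"
    using r r' e lsm_props[OF r, of "lsm b e"] be ss by (intro lsm_eqI) (simp_all add: a b)
  then show "(a \<otimes>\<^bsub>loc.L\<^esub> b) \<odot>\<^bsub>with_scalars E lsm\<^esub> e =
      a \<odot>\<^bsub>with_scalars E lsm\<^esub> (b \<odot>\<^bsub>with_scalars E lsm\<^esub> e)"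
    using loc.L_mult[OF r r'] by (simp add: a b)
next
  fix e assume "e \<in> carrier (with_scalars E lsm)"
  then show "\<one>\<^bsub>loc.L\<^esub> \<odot>\<^bsub>with_scalars E lsm\<^esub> e = e"
    using loc.U_one by (simp add: loc.L_one) (rule lsm_eqI; simp)
qed (auto simp: loc.L_cring E.M.a_assoc intro: E.M.a_comm)

lemma lsm_power_zero:
  assumes kill: "\<And>y. y \<in> ideal_power R P n \<Longrightarrow> y \<odot>\<^bsub>E\<^esub> e = \<zero>\<^bsub>E\<^esub>" and e: "e \<in> carrier E" and u: "u \<in> loc.A.Ip n"
  shows "lsm u e = \<zero>\<^bsub>E\<^esub>"
proof -
  obtain r s where rs: "r \<in> ideal_power R P n" "s \<in> carrier R - P" "u = loc.fr r s"
    using u unfolding loc.localization_ideal_eq loc.ext_ideal_power unfolding loc.ext_ideal_def by blast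
  have "r \<in> carrier R" by (rule ideal.Icarr[OF R.ideal_power_ideal[OF P.is_ideal] rs(1)])
  then show ?thesis unfolding rs(3) using rs(2) e kill[OF rs(1)] by (intro lsm_eqI) simp_all
qed

sublocale T: torsion_module loc.L "localization_ideal R P" "with_scalars E lsm"
proof (intro torsion_module.intro torsion_module_axioms.intro loc.A.adic_axioms module_lsm)
  fix e assume "e \<in> carrier (with_scalars E lsm)"
  then have e: "e \<in> carrier E" by simp
  obtain n where "\<And>y. y \<in> ideal_power R P n \<Longrightarrow> y \<odot>\<^bsub>E\<^esub> e = \<zero>\<^bsub>E\<^esub>" using power_kills[OF e] by blast
  then show "\<exists>n. \<forall>y\<in>loc.A.Ip n. y \<odot>\<^bsub>with_scalars E lsm\<^esub> e = \<zero>\<^bsub>with_scalars E lsm\<^esub>"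
    using lsm_power_zero[OF _ e, of n] by (intro exI[of _ n] ballI) simp
qed

lemma act_def: "act = completed_smult loc.L (localization_ideal R P) (with_scalars E lsm)"
  by (simp add: completed_localization_smult_def)

lemma module_act: "module S (with_scalars E act)"
  using T.module_act unfolding act_def completed_localization_def with_scalars_def by simp

lemma act_closed: "a \<in> carrier S \<Longrightarrow> e \<in> carrier E \<Longrightarrow> act a e \<in> carrier E"
  using T.act_closed[of a e] unfolding act_def completed_localization_def by simp

lemma act_to_completion:
  assumes "r \<in> carrier R" "e \<in> carrier E"
  shows "act (loc.to_completion r) e = r \<odot>\<^bsub>E\<^esub> e"
proof -
  have "act (loc.to_completion r) e = lsm (loc.fr r \<one>) e"
    using T.act_emb[of "loc.fr r \<one>" e] assms loc.U_one
    by (simp add: act_def loc.to_completion_def loc.frac_closed)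
  then show ?thesis using lsm_eqI[OF assms(1) loc.U_one assms(2), of "r \<odot>\<^bsub>E\<^esub> e"] assms by simp
qed

lemma act_K:
  assumes "a \<in> loc.A.K n" "e \<in> carrier E" "\<And>y. y \<in> ideal_power R P n \<Longrightarrow> y \<odot>\<^bsub>E\<^esub> e = \<zero>\<^bsub>E\<^esub>"
  shows "act a e = \<zero>\<^bsub>E\<^esub>"
  using T.act_K[OF assms(1), of e] lsm_power_zero[OF assms(3) assms(2)] assms(2) by (simp add: act_def)

sublocale comp: local_completion R P S loc.A.K loc.to_completion
  by (rule loc.local_completion[OF noeth])

text \<open>\<open>R\<close> acts through its image in the commutative ring \<open>S\<close>. This
  is the compatibility that makes maps into the hull an \<open>S\<close>-module.\<close>

lemma act_comm:
  assumes a: "a \<in> carrier S" and r: "r \<in> carrier R" and e: "e \<in> carrier E"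
  shows "act a (r \<odot>\<^bsub>E\<^esub> e) = r \<odot>\<^bsub>E\<^esub> act a e"
proof -
  interpret N: module S "with_scalars E act" by (rule module_act)
  have "act a (act (loc.to_completion r) e) = act (loc.to_completion r) (act a e)"
    using N.smult_assoc1[of a "loc.to_completion r" e] N.smult_assoc1[of "loc.to_completion r" a e]
      a comp.\<iota>_closed[OF r] e by (simp add: comp.S.m_comm)
  then show ?thesis using act_to_completion r e act_closed[OF a e] by simp
qed

end

context prime_hull
begin

text \<open>Let \<open>I\<close> consist of the elements that lie in \<open>P^n\<close> up to a
  factor outside \<open>P\<close>. If \<open>a r\<close> is in \<open>I\<close>, then
  \<open>a\<close> is in \<open>P\<close> and kills \<open>e0\<close>, so sending the class of
  \<open>r\<close> to \<open>e0\<close> extends to a map from \<open>R/I\<close> to the hull. The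
  image of the class of 1 is the required element.\<close>

lemma detects:
  assumes r: "r \<in> carrier R" and "\<And>t. t \<in> carrier R - P \<Longrightarrow> t \<otimes> r \<notin> ideal_power R P n"
  shows "\<exists>e\<in>carrier E. (\<forall>y\<in>ideal_power R P n. y \<odot>\<^bsub>E\<^esub> e = \<zero>\<^bsub>E\<^esub>) \<and> r \<odot>\<^bsub>E\<^esub> e \<noteq> \<zero>\<^bsub>E\<^esub>"
proof -
  interpret Pn: ideal "ideal_power R P n" R by (rule R.ideal_power_ideal[OF P.is_ideal])
  define I where "I = {x \<in> carrier R. \<exists>t\<in>carrier R - P. t \<otimes> x \<in> ideal_power R P n}"
  have mem: "x \<in> I \<longleftrightarrow> x \<in> carrier R \<and> (\<exists>t\<in>carrier R - P. t \<otimes> x \<in> ideal_power R P n)" for x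
    by (simp add: I_def)
  have I: "ideal I R"
  proof (rule R.idealI')
    show "I \<subseteq> carrier R" using mem by blast
    show "\<zero> \<in> I" unfolding mem using loc.U_one by (auto intro!: bexI[of _ \<one>])
    show "x \<oplus> y \<in> I" if xI: "x \<in> I" and yI: "y \<in> I" for x y
    proof -
      obtain t where x: "x \<in> carrier R" "t \<in> carrier R - P" "t \<otimes> x \<in> ideal_power R P n" using xI unfolding mem by blast
      obtain u where y: "y \<in> carrier R" "u \<in> carrier R - P" "u \<otimes> y \<in> ideal_power R P n" using yI unfolding mem by blast
      have "(t \<otimes> u) \<otimes> (x \<oplus> y) = u \<otimes> (t \<otimes> x) \<oplus> t \<otimes> (u \<otimes> y)"
        using x(1,2) y(1,2) by (simp add: R.r_distr R.m_ac)
      also have "\<dots> \<in> ideal_power R P n" 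
        using Pn.a_closed[OF Pn.I_l_closed[OF x(3), of u] Pn.I_l_closed[OF y(3), of t]] x(2) y(2) by simp
      finally show ?thesis unfolding mem using x y loc.U_mult by blast
    qed
    show "a \<otimes> x \<in> I" if a: "a \<in> carrier R" and xI: "x \<in> I" for a x
    proof -
      obtain t where x: "x \<in> carrier R" "t \<in> carrier R - P" "t \<otimes> x \<in> ideal_power R P n" using xI unfolding mem by blast
      have "t \<otimes> (a \<otimes> x) = a \<otimes> (t \<otimes> x)" using a x(1,2) by (simp add: R.m_lcomm)
      also have "\<dots> \<in> ideal_power R P n" by (intro Pn.I_l_closed x a)
      finally show ?thesis unfolding mem using a x by blast
    qed
  qed
  interpret N: module R "self_module R" by (rule R.self_module)
  interpret Q: module_quotient R "self_module R" I
    by (intro module_quotient.intro module_quotient_axioms.intro N.module_axioms R.ideal_submodule I)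
  let ?Q = "quotient_module (self_module R) I"
  let ?c = "\<lambda>x. I +>\<^bsub>self_module R\<^esub> x"
  have cc: "?c x \<in> carrier ?Q" if "x \<in> carrier R" for x using that by (intro Q.quotient_closed) simp
  have sm: "a \<odot>\<^bsub>?Q\<^esub> ?c x = ?c (a \<otimes> x)" if "a \<in> carrier R" "x \<in> carrier R" for a x
    using that Q.quotient_smult[of a x] by simp
  have z: "?c x = \<zero>\<^bsub>?Q\<^esub> \<longleftrightarrow> x \<in> I" if "x \<in> carrier R" for x
    using that Q.quotient_eq_zero_iff[of x] by (simp add: Q.quotient_zero)
  have "\<exists>g. lin R ?Q E g \<and> g (?c r) = e0"
  proof (rule extension_from_cyclic[OF inj Q.quotient_module cc[OF r] e0])
    fix a assume a: "a \<in> carrier R" "a \<odot>\<^bsub>?Q\<^esub> ?c r = \<zero>\<^bsub>?Q\<^esub>"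
    then have "a \<otimes> r \<in> I" using sm[OF a(1) r] z[of "a \<otimes> r"] r by simp
    then obtain t where t: "t \<in> carrier R - P" "t \<otimes> (a \<otimes> r) \<in> ideal_power R P n" unfolding mem by blast
    have "(t \<otimes> a) \<otimes> r \<in> ideal_power R P n" using t a r by (simp add: R.m_assoc)
    then have "t \<otimes> a \<in> P" using assms(2)[of "t \<otimes> a"] t a(1) by blast
    then have "a \<in> P" using P.I_prime t a by blast
    then show "a \<odot>\<^bsub>E\<^esub> e0 = \<zero>\<^bsub>E\<^esub>" using e0_ann a by simp
  qed
  then obtain g where g: "lin R ?Q E g" "g (?c r) = e0" by blast
  interpret QE: two_modules R ?Q E by (intro two_modules.intro Q.quotient_module E.module_axioms)
  have gr: "a \<odot>\<^bsub>E\<^esub> g (?c \<one>) = g (?c a)" if "a \<in> carrier R" for a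
    using lin_smult[OF g(1) that cc[OF R.one_closed]] sm[OF that R.one_closed] that by simp
  show ?thesis
  proof (intro bexI conjI ballI)
    show "g (?c \<one>) \<in> carrier E" by (rule lin_closed[OF g(1) cc[OF R.one_closed]])
    show "r \<odot>\<^bsub>E\<^esub> g (?c \<one>) \<noteq> \<zero>\<^bsub>E\<^esub>"
      using gr[OF r] g(2) e0_ann[of \<one>] e0 P.one_imp_carrier P.I_notcarr by auto
    fix y assume y: "y \<in> ideal_power R P n"
    then have "y \<in> I" unfolding mem using loc.U_one Pn.Icarr[OF y] by (auto intro!: bexI[of _ \<one>])
    then show "y \<odot>\<^bsub>E\<^esub> g (?c \<one>) = \<zero>\<^bsub>E\<^esub>" using gr[OF Pn.Icarr[OF y]] z[OF Pn.Icarr[OF y]] QE.lin_zero[OF g(1)] by simp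
  qed
qed

text \<open>Modulo \<open>K n\<close>, \<open>a\<close> is a fraction \<open>r / t\<close>. If
  \<open>a\<close> acts as zero, so does \<open>r\<close> on all elements killed by
  \<open>P^n\<close>, and \<open>detects\<close> puts the image of \<open>r\<close>, hence
  \<open>a\<close>, into \<open>K n\<close>.\<close>

lemma act_faithful:
  assumes a: "a \<in> carrier S" and zero: "\<And>e. e \<in> carrier E \<Longrightarrow> act a e = \<zero>\<^bsub>E\<^esub>"
  shows "a = \<zero>\<^bsub>S\<^esub>"
proof (rule comp.S.K_Inter[OF a])
  fix n
  interpret N: module S "with_scalars E act" by (rule module_act)
  obtain r t where r: "r \<in> carrier R" "t \<in> carrier R - P"
    "loc.to_completion t \<otimes>\<^bsub>S\<^esub> a \<ominus>\<^bsub>S\<^esub> loc.to_completion r \<in> loc.A.K n"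
    using comp.\<iota>_dense[OF a] by blast
  have c: "loc.to_completion t \<in> carrier S" "loc.to_completion r \<in> carrier S" using r by auto
  have "loc.to_completion r \<in> loc.A.K n"
  proof (rule ccontr)
    assume "loc.to_completion r \<notin> loc.A.K n"
    then obtain e where e: "e \<in> carrier E" "\<And>y. y \<in> ideal_power R P n \<Longrightarrow> y \<odot>\<^bsub>E\<^esub> e = \<zero>\<^bsub>E\<^esub>" "r \<odot>\<^bsub>E\<^esub> e \<noteq> \<zero>\<^bsub>E\<^esub>"
      using detects[OF r(1), of n] comp.\<iota>_K[OF r(1), of n] by blast
    have "act (loc.to_completion t \<otimes>\<^bsub>S\<^esub> a \<ominus>\<^bsub>S\<^esub> loc.to_completion r) e = \<zero>\<^bsub>E\<^esub>"
      by (rule act_K[OF r(3) e(1,2)])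
    moreover have "act (loc.to_completion t \<otimes>\<^bsub>S\<^esub> a) e = \<zero>\<^bsub>E\<^esub>"
      using N.smult_assoc1[OF c(1) a, of e] e(1) zero[OF e(1)] N.smult_r_null[OF c(1)] by simp
    moreover have "loc.to_completion t \<otimes>\<^bsub>S\<^esub> a =
        (loc.to_completion t \<otimes>\<^bsub>S\<^esub> a \<ominus>\<^bsub>S\<^esub> loc.to_completion r) \<oplus>\<^bsub>S\<^esub> loc.to_completion r"
      using c a by (simp add: comp.S.diff_add_cancel)
    ultimately have "act (loc.to_completion r) e = \<zero>\<^bsub>E\<^esub>"
      using N.smult_l_distr[of "loc.to_completion t \<otimes>\<^bsub>S\<^esub> a \<ominus>\<^bsub>S\<^esub> loc.to_completion r" "loc.to_completion r" e]
        c a e(1) act_closed[OF c(2) e(1)] by simp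
    then show False using act_to_completion[OF r(1) e(1)] e(3) by simp
  qed
  then have "loc.to_completion t \<otimes>\<^bsub>S\<^esub> a \<in> loc.A.K n" using comp.K_diff_mem[OF r(3)] c a by simp
  then show "a \<in> loc.A.K n" using comp.K_cancel_unit[OF r(2) a] by blast
qed

text \<open>Every \<open>e\<close> in the hull has the form \<open>c e'\<close>, so
  \<open>c x = 0\<close> gives \<open>x e = x c e' = 0\<close>, and \<open>x\<close> vanishes
  because \<open>S\<close> acts faithfully. This takes the place of an argument by flatness of the
  completion.\<close>

lemma nonzerodivisor_completion:
  assumes "nonzerodivisor R c"
  shows "nonzerodivisor S (loc.to_completion c)"
  unfolding nonzerodivisor_def
proof (intro conjI ballI impI)
  have c: "c \<in> carrier R" and reg: "\<And>x. x \<in> carrier R \<Longrightarrow> c \<otimes> x = \<zero> \<Longrightarrow> x = \<zero>"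
    using assms by (auto simp: nonzerodivisor_def)
  interpret N: module S "with_scalars E act" by (rule module_act)
  show ic: "loc.to_completion c \<in> carrier S" using c by simp
  fix x assume x: "x \<in> carrier S" "loc.to_completion c \<otimes>\<^bsub>S\<^esub> x = \<zero>\<^bsub>S\<^esub>"
  show "x = \<zero>\<^bsub>S\<^esub>"
  proof (rule act_faithful[OF x(1)])
    fix e assume e: "e \<in> carrier E"
    obtain e' where e': "e' \<in> carrier E" "c \<odot>\<^bsub>E\<^esub> e' = e"
      using regular_surj[OF c e] reg c e R.m_comm by (metis E.smult_l_null)
    have "act x e = act (x \<otimes>\<^bsub>S\<^esub> loc.to_completion c) e'"
      using N.smult_assoc1[OF x(1) ic, of e'] act_to_completion[OF c e'(1)] e' by simp
    also have "x \<otimes>\<^bsub>S\<^esub> loc.to_completion c = \<zero>\<^bsub>S\<^esub>" using x ic by (simp add: comp.S.m_comm)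
    finally show "act x e = \<zero>\<^bsub>E\<^esub>" using N.smult_l_null[of e'] e' by simp
  qed
qed

text \<open>For the discrete filtration the sequences to be completed are constant, and continuity
  of the action says that each element is killed by some \<open>K n\<close>.\<close>

lemma hull_complete_module:
  "complete_module R P S loc.A.K loc.to_completion (with_scalars E act) (\<lambda>_. {\<zero>\<^bsub>E\<^esub>})"
proof (intro complete_module.intro complete_module_axioms.intro comp.local_completion_axioms module_act)
  interpret N: module S "with_scalars E act" by (rule module_act)
  show "submodule {\<zero>\<^bsub>E\<^esub>} S (with_scalars E act)"
    using N.M.minus_equality[of "\<zero>\<^bsub>E\<^esub>" "\<zero>\<^bsub>E\<^esub>"] N.smult_r_null by (intro N.submoduleI) auto
  show "\<exists>l\<in>carrier (with_scalars E act). \<forall>m. l \<ominus>\<^bsub>with_scalars E act\<^esub> y m \<in> {\<zero>\<^bsub>E\<^esub>}"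
    if y: "\<And>m. y m \<in> carrier (with_scalars E act)"
      "\<And>m. y (Suc m) \<ominus>\<^bsub>with_scalars E act\<^esub> y m \<in> {\<zero>\<^bsub>E\<^esub>}" for y :: "nat \<Rightarrow> _"
  proof -
    have "y (Suc m) = y m" for m using N.M.diff_eq_zero_iff[OF y(1) y(1)] y(2)[of m] by simp
    then have "y m = y 0" for m by (induct m) auto
    then have "y 0 \<ominus>\<^bsub>with_scalars E act\<^esub> y m = \<zero>\<^bsub>E\<^esub>" for m
      using N.M.diff_eq_zero_iff[OF y(1) y(1), of 0 m] by (metis with_scalars_simps(3))
    then show ?thesis by (intro bexI[of _ "y 0"] allI) (use y(1) in simp_all)
  qed
  show "\<exists>n. \<forall>k\<in>loc.A.K n. k \<odot>\<^bsub>with_scalars E act\<^esub> x \<in> {\<zero>\<^bsub>E\<^esub>}" if "x \<in> carrier (with_scalars E act)" for x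
  proof -
    have x: "x \<in> carrier E" using that by simp
    obtain n where "\<And>y. y \<in> ideal_power R P n \<Longrightarrow> y \<odot>\<^bsub>E\<^esub> x = \<zero>\<^bsub>E\<^esub>" using power_kills[OF x] by blast
    then show ?thesis using act_K[OF _ x] by auto
  qed
qed auto

end

section \<open>Finite presentation of the Frobenius pushforward\<close>

text \<open>Expand \<open>x\<close> with \<open>p\<close>-th powers as coefficients, then expand
  each of these coefficients \<open>a t\<close> with \<open>p^e\<close>-th powers. Since Frobenius
  is additive, the products \<open>s^p t\<close> generate over the \<open>p^(e+1)\<close>-th
  powers.\<close>

lemma (in cring) frobenius_generators:
  assumes p: "Factorial_Ring.prime p" "ring_characteristic R p" and fin: "F_finite R p"
  shows "\<exists>T. finite T \<and> T \<subseteq> carrier R \<and>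
    (\<forall>x\<in>carrier R. \<exists>a\<in>T \<rightarrow> carrier R. x = (\<Oplus>t\<in>T. a t [^] (p ^ e) \<otimes> t))"
proof (induct e)
  case 0
  show ?case by (rule exI[of _ "{\<one>}"]) (auto intro!: bexI[of _ "\<lambda>_. _"] simp: finsum_insert)
next
  case (Suc e)
  then obtain T where T: "finite T" "T \<subseteq> carrier R"
    "\<And>x. x \<in> carrier R \<Longrightarrow> \<exists>a\<in>T \<rightarrow> carrier R. x = (\<Oplus>t\<in>T. a t [^] (p ^ e) \<otimes> t)" by blast
  obtain T1 where T1: "T1 \<subseteq> carrier R" "finite T1"
    "\<And>x. x \<in> carrier R \<Longrightarrow> \<exists>a\<in>T1 \<rightarrow> carrier R. x = (\<Oplus>t\<in>T1. a t [^] p \<otimes> t)"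
    using fin unfolding F_finite_def module_finite_map_def frobenius_def by auto
  define q where "q = p ^ Suc e"
  have q: "q > 0" using prime_gt_0_nat[OF p(1)] by (simp add: q_def)
  define U where "U = (\<lambda>(s, t). s [^] p \<otimes> t) ` (T \<times> T1)"
  have U: "finite U" "U \<subseteq> carrier R" using T(1,2) T1(1,2) by (auto simp: U_def)
  \<comment> \<open>Different pairs may give the same product \<open>s^p t\<close>, so expressions
    are added up inside \<open>V\<close> rather than reindexed over pairs.\<close>
  define V where "V = {\<Oplus>u\<in>U. a u [^] q \<otimes> u |a. a \<in> U \<rightarrow> carrier R}"
  have V0: "\<zero> \<in> V"
  proof -
    have "(\<Oplus>u\<in>U. \<zero> [^] q \<otimes> u) = (\<Oplus>u\<in>U. \<zero>)"
      using q U by (intro finsum_cong') (auto simp: nat_pow_zero)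
    then show ?thesis unfolding V_def by (auto intro!: exI[of _ "\<lambda>_. \<zero>"])
  qed
  have Vadd: "x \<oplus> y \<in> V" if x: "x \<in> V" and y: "y \<in> V" for x y
  proof -
    obtain a b where a: "a \<in> U \<rightarrow> carrier R" "x = (\<Oplus>u\<in>U. a u [^] q \<otimes> u)"
      and b: "b \<in> U \<rightarrow> carrier R" "y = (\<Oplus>u\<in>U. b u [^] q \<otimes> u)" using x y unfolding V_def by blast
    have c: "u \<in> carrier R" "a u \<in> carrier R" "b u \<in> carrier R" if "u \<in> U" for u using that U(2) a(1) b(1) by auto
    have "(\<Oplus>u\<in>U. (a u \<oplus> b u) [^] q \<otimes> u) = (\<Oplus>u\<in>U. a u [^] q \<otimes> u \<oplus> b u [^] q \<otimes> u)"
      using c unfolding q_def by (intro finsum_cong') (auto simp: frobenius_power_add[OF p] l_distr simp del: power_Suc)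
    also have "\<dots> = x \<oplus> y" unfolding a b using c by (intro finsum_addf) auto
    finally show ?thesis unfolding V_def using c by (auto intro!: exI[of _ "\<lambda>u. a u \<oplus> b u"])
  qed
  have Vgen: "a [^] q \<otimes> u \<in> V" if a: "a \<in> carrier R" and u: "u \<in> U" for a u
  proof -
    have "(\<Oplus>v\<in>U. (if u = v then a else \<zero>) [^] q \<otimes> v) = (\<Oplus>v\<in>U. if u = v then a [^] q \<otimes> v else \<zero>)"
      using q U a by (intro finsum_cong') (auto simp: nat_pow_zero)
    also have "\<dots> = a [^] q \<otimes> u" using U a u by (intro add.finprod_singleton) auto
    finally show ?thesis unfolding V_def using a by (auto intro!: exI[of _ "\<lambda>v. if u = v then a else \<zero>"])
  qed
  have Vc: "V \<subseteq> carrier R" unfolding V_def using U by (auto intro!: finsum_closed)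
  have Vsum: "(\<Oplus>i\<in>A. f i) \<in> V" if "finite A" "\<And>i. i \<in> A \<Longrightarrow> f i \<in> V" for A :: "'a set" and f
    using that
  proof (induct A rule: finite_induct)
    case (insert i A)
    then have "f \<in> A \<rightarrow> carrier R" "f i \<in> carrier R" using Vc by auto
    then show ?case using insert Vadd by (simp add: finsum_insert)
  qed (simp add: V0)
  have "x \<in> V" if x: "x \<in> carrier R" for x
  proof -
    obtain a where a: "a \<in> T1 \<rightarrow> carrier R" "x = (\<Oplus>t\<in>T1. a t [^] p \<otimes> t)" using T1(3)[OF x] by blast
    have "a t [^] p \<otimes> t \<in> V" if t: "t \<in> T1" for t
    proof -
      have tc: "t \<in> carrier R" using t T1 by blast
      obtain b where b: "b \<in> T \<rightarrow> carrier R" "a t = (\<Oplus>s\<in>T. b s [^] (p ^ e) \<otimes> s)"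
        using T(3)[of "a t"] a(1) t by blast
      have c: "s \<in> carrier R" "b s \<in> carrier R" if "s \<in> T" for s using that T(2) b(1) by auto
      have "a t [^] p = (\<Oplus>s\<in>T. (b s [^] (p ^ e) \<otimes> s) [^] p)"
        unfolding b(2) using frobenius_power_finsum[OF p T(1), of "\<lambda>s. b s [^] (p ^ e) \<otimes> s" 1] c by simp
      also have "\<dots> \<otimes> t = (\<Oplus>s\<in>T. (b s [^] (p ^ e) \<otimes> s) [^] p \<otimes> t)"
        using c tc by (intro finsum_ldistr T) auto
      also have "\<dots> = (\<Oplus>s\<in>T. b s [^] q \<otimes> (s [^] p \<otimes> t))"
        using c tc by (intro finsum_cong') (auto simp: q_def nat_pow_distrib nat_pow_pow m_assoc mult.commute)
      also have "\<dots> \<in> V" using c t by (intro Vsum T(1) Vgen) (auto simp: U_def)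
      finally show ?thesis .
    qed
    then show ?thesis unfolding a(2) by (intro Vsum T1(2))
  qed
  then show ?case using U unfolding V_def q_def by (intro exI[of _ U]) blast
qed

text \<open>Induction on the set of coordinates that may be nonzero. The values at one coordinate
  \<open>t\<close> form a finitely generated ideal, whose generators lift to \<open>G1\<close>, and
  the elements vanishing at \<open>t\<close> are covered by the induction hypothesis. Generation is
  expressed by containment in every submodule that contains \<open>G\<close>.\<close>

lemma (in noetherian_ring) finite_free_submodule:
  assumes "cring R" "finite T" "submodule D R (free_module R T)"
  shows "\<exists>G\<subseteq>D. finite G \<and> (\<forall>D'. submodule D' R (free_module R T) \<longrightarrow> G \<subseteq> D' \<longrightarrow> D \<subseteq> D')"
proof -
  interpret cring R by fact
  let ?F = "free_module R T"
  interpret F: module R ?F by (rule module_free_module)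
  have val: "\<rho> t \<in> carrier R" if "\<rho> \<in> carrier ?F" "t \<in> T" for \<rho> t using that by auto
  have main: "\<exists>G\<subseteq>D. finite G \<and> (\<forall>D'. submodule D' R ?F \<longrightarrow> G \<subseteq> D' \<longrightarrow> D \<subseteq> D')"
    if "finite T'" "T' \<subseteq> T" "submodule D R ?F" "\<And>\<rho> t. \<rho> \<in> D \<Longrightarrow> t \<in> T - T' \<Longrightarrow> \<rho> t = \<zero>" for T' D
    using that
  proof (induct T' arbitrary: D rule: finite_induct)
    case empty
    have Dc: "D \<subseteq> carrier ?F" by (rule F.submoduleE(1)[OF empty(2)])
    have "\<rho> = \<zero>\<^bsub>?F\<^esub>" if "\<rho> \<in> D" for \<rho>
    proof
      show "\<rho> t = \<zero>\<^bsub>?F\<^esub> t" for t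
        using empty(3)[OF that, of t] Dc that by (cases "t \<in> T") (auto simp: PiE_def extensional_def)
    qed
    then have "D \<subseteq> D'" if "submodule D' R ?F" for D' using submodule_zero[OF that] by auto
    then show ?case by (intro exI[of _ "{}"]) simp
  next
    case (insert t T')
    have t: "t \<in> T" using insert by simp
    note D = insert(5)
    note DE = F.submoduleE[OF D]
    have Dc: "\<rho> \<in> carrier ?F" if "\<rho> \<in> D" for \<rho> using DE(1) that by blast
    have I: "ideal ((\<lambda>\<rho>. \<rho> t) ` H) R" if H: "submodule H R ?F" for H
    proof (rule idealI')
      note HE = F.submoduleE[OF H]
      have Hc: "\<rho> \<in> carrier ?F" if "\<rho> \<in> H" for \<rho> using HE(1) that by blast
      show "(\<lambda>\<rho>. \<rho> t) ` H \<subseteq> carrier R" using Hc val[OF _ t] by blast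
      show "\<zero> \<in> (\<lambda>\<rho>. \<rho> t) ` H"
        using submodule_zero[OF H] t by (auto intro!: rev_image_eqI[of "\<lambda>x\<in>T. \<zero>"] simp: restrict_def)
      show "x \<oplus> y \<in> (\<lambda>\<rho>. \<rho> t) ` H" if xy: "x \<in> (\<lambda>\<rho>. \<rho> t) ` H" "y \<in> (\<lambda>\<rho>. \<rho> t) ` H" for x y
      proof -
        obtain \<rho> \<sigma> where "\<rho> \<in> H" "\<sigma> \<in> H" "x = \<rho> t" "y = \<sigma> t" using xy by blast
        then show ?thesis using HE(5)[of \<rho> \<sigma>] t by (intro rev_image_eqI[of "\<rho> \<oplus>\<^bsub>?F\<^esub> \<sigma>"]) auto
      qed
      show "a \<otimes> x \<in> (\<lambda>\<rho>. \<rho> t) ` H" if a: "a \<in> carrier R" and x: "x \<in> (\<lambda>\<rho>. \<rho> t) ` H" for a x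
      proof -
        obtain \<rho> where "\<rho> \<in> H" "x = \<rho> t" using x by blast
        then show ?thesis using HE(4)[OF a, of \<rho>] t by (intro rev_image_eqI[of "a \<odot>\<^bsub>?F\<^esub> \<rho>"]) auto
      qed
    qed
    obtain Z where Z: "Z \<subseteq> carrier R" "finite Z" "(\<lambda>\<rho>. \<rho> t) ` D = genideal R Z"
      using finetely_gen[OF I[OF D]] by blast
    have "Z \<subseteq> (\<lambda>\<rho>. \<rho> t) ` D" unfolding Z(3) by (rule genideal_self[OF Z(1)])
    then obtain G1 where G1: "G1 \<subseteq> D" "finite G1" "Z = (\<lambda>\<rho>. \<rho> t) ` G1"
      using finite_subset_image[OF Z(2)] by metis
    define D0 where "D0 = {\<rho> \<in> D. \<rho> t = \<zero>}"
    have D0: "submodule D0 R ?F"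
    proof (rule F.submoduleI)
      fix a assume a: "a \<in> D0"
      then have aD: "a \<in> D" "a t = \<zero>" "a \<in> carrier ?F" using Dc by (auto simp: D0_def)
      have "\<ominus>\<^bsub>?F\<^esub> a = (\<ominus> \<one>) \<odot>\<^bsub>?F\<^esub> a" using F.smult_l_minus[OF one_closed aD(3)] F.smult_one[OF aD(3)] by simp
      then have "(\<ominus>\<^bsub>?F\<^esub> a) t = \<zero>" using aD t by simp
      then show "\<ominus>\<^bsub>?F\<^esub> a \<in> D0" using DE(3)[OF aD(1)] by (simp add: D0_def)
      show "r \<odot>\<^bsub>?F\<^esub> a \<in> D0" if "r \<in> carrier R" for r using DE(4)[OF that aD(1)] aD(2) t that by (simp add: D0_def)
      show "a \<oplus>\<^bsub>?F\<^esub> b \<in> D0" if "b \<in> D0" for b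
        using DE(5)[OF aD(1), of b] aD(2) t that by (simp add: D0_def)
    qed (use Dc submodule_zero[OF D] t in \<open>auto simp: D0_def\<close>)
    obtain G2 where G2: "G2 \<subseteq> D0" "finite G2" "\<And>D'. submodule D' R ?F \<Longrightarrow> G2 \<subseteq> D' \<Longrightarrow> D0 \<subseteq> D'"
      using insert(3)[OF _ D0] insert(4,6) by (auto simp: D0_def)
    show ?case
    proof (intro exI conjI allI impI)
      show "G1 \<union> G2 \<subseteq> D" using G1 G2 by (auto simp: D0_def)
      show "finite (G1 \<union> G2)" using G1 G2 by simp
      fix D' assume D': "submodule D' R ?F" and G: "G1 \<union> G2 \<subseteq> D'"
      note DE' = F.submoduleE[OF D']
      have DD: "submodule (D \<inter> D') R ?F"
        by (rule F.submoduleI) (use DE DE' submodule_zero[OF D] submodule_zero[OF D'] in auto)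
      have "genideal R Z \<subseteq> (\<lambda>\<rho>. \<rho> t) ` (D \<inter> D')"
        by (rule genideal_minimal[OF I[OF DD]]) (use G G1 in auto)
      then have im: "\<exists>\<sigma>\<in>D \<inter> D'. \<sigma> t = \<rho> t" if "\<rho> \<in> D" for \<rho> using that unfolding Z(3)[symmetric] by force
      show "D \<subseteq> D'"
      proof
        fix \<rho> assume r: "\<rho> \<in> D"
        then obtain \<sigma> where s: "\<sigma> \<in> D" "\<sigma> \<in> D'" "\<sigma> t = \<rho> t" using im by blast
        note c = Dc[OF r] Dc[OF s(1)]
        have "\<ominus>\<^bsub>?F\<^esub> \<sigma> = (\<ominus> \<one>) \<odot>\<^bsub>?F\<^esub> \<sigma>" using F.smult_l_minus[OF one_closed c(2)] F.smult_one[OF c(2)] by simp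
        then have "(\<rho> \<oplus>\<^bsub>?F\<^esub> \<ominus>\<^bsub>?F\<^esub> \<sigma>) t = \<zero>" using s(3) t val[OF c(1) t] by (simp add: l_minus r_neg)
        then have "\<rho> \<oplus>\<^bsub>?F\<^esub> \<ominus>\<^bsub>?F\<^esub> \<sigma> \<in> D0" using DE(5)[OF r DE(3)[OF s(1)]] by (simp add: D0_def)
        then have "\<rho> \<oplus>\<^bsub>?F\<^esub> \<ominus>\<^bsub>?F\<^esub> \<sigma> \<in> D'" using G2(3)[OF D'] G by blast
        then have "(\<rho> \<oplus>\<^bsub>?F\<^esub> \<ominus>\<^bsub>?F\<^esub> \<sigma>) \<oplus>\<^bsub>?F\<^esub> \<sigma> \<in> D'" using DE'(5) s(2) by blast
        moreover have "(\<rho> \<oplus>\<^bsub>?F\<^esub> \<ominus>\<^bsub>?F\<^esub> \<sigma>) \<oplus>\<^bsub>?F\<^esub> \<sigma> = \<rho>"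
          unfolding F.M.a_assoc[OF c(1) F.M.a_inv_closed[OF c(2)] c(2)] F.M.l_neg[OF c(2)] by (rule F.M.r_zero[OF c(1)])
        ultimately show "\<rho> \<in> D'" by simp
      qed
    qed
  qed
  show ?thesis by (rule main[OF assms(2) subset_refl assms(3)]) simp
qed

lemma root_linear_generated:
  fixes R (structure)
  assumes "cring R" "module R N" "finite T" "T \<subseteq> carrier R"
    and T: "\<And>x. x \<in> carrier R \<Longrightarrow> \<exists>a\<in>T \<rightarrow> carrier R. x = (\<Oplus>t\<in>T. a t [^] q \<otimes> t)"
    and \<phi>: "root_linear R q N \<phi>" and D: "submodule D R N" and mem: "\<And>t. t \<in> T \<Longrightarrow> \<phi> t \<in> D"
    and r: "r \<in> carrier R"
  shows "\<phi> r \<in> D"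
proof -
  interpret cring R by fact
  interpret N: module R N by fact
  obtain a where a: "a \<in> T \<rightarrow> carrier R" "r = (\<Oplus>t\<in>T. a t [^] q \<otimes> t)" using T[OF r] by blast
  have z: "\<phi> \<zero> \<in> D"
  proof -
    have "\<phi> \<zero> = \<phi> \<zero> \<oplus>\<^bsub>N\<^esub> \<phi> \<zero>" using root_linear_add[OF \<phi>, of \<zero> \<zero>] by simp
    then have "\<phi> \<zero> = \<zero>\<^bsub>N\<^esub>" using root_linear_closed[OF \<phi>, of \<zero>] by (metis N.M.add.l_cancel_one' zero_closed)
    then show ?thesis using submodule_zero[OF D] by simp
  qed
  have "\<phi> (\<Oplus>t\<in>B. a t [^] q \<otimes> t) \<in> D" if "B \<subseteq> T" for B
    using finite_subset[OF that assms(3)] that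
  proof (induct B rule: finite_induct)
    case (insert t B)
    have c: "a t [^] q \<otimes> t \<in> carrier R" if "t \<in> T" for t using that a(1) assms(4) by auto
    then have s: "(\<Oplus>t\<in>B. a t [^] q \<otimes> t) \<in> carrier R" using insert by (intro finsum_closed) auto
    have f: "(\<lambda>t. a t [^] q \<otimes> t) \<in> B \<rightarrow> carrier R" "t \<in> T" using c insert by auto
    have "\<phi> (a t [^] q \<otimes> t) = a t \<odot>\<^bsub>N\<^esub> \<phi> t" using a(1) f(2) assms(4) by (intro root_linear_smult[OF \<phi>]) auto
    moreover have "a t \<in> carrier R" using a(1) f(2) by blast
    ultimately have "\<phi> (a t [^] q \<otimes> t) \<in> D" using N.submoduleE(4)[OF D _ mem[OF f(2)]] by simp
    then have "\<phi> (a t [^] q \<otimes> t) \<oplus>\<^bsub>N\<^esub> \<phi> (\<Oplus>t\<in>B. a t [^] q \<otimes> t) \<in> D"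
      using N.submoduleE(5)[OF D] insert by blast
    then show ?case using insert f c s by (simp add: finsum_insert root_linear_add[OF \<phi>])
  qed (simp add: z)
  then show ?thesis using a(2) by blast
qed

section \<open>Annihilation of Frobenius powers in the colocalization\<close>

locale hull_dual = prime_hull R P E e0 + N: module R N for R (structure) and P and E and e0 and N +
  fixes p :: nat
  assumes prime_p: "Factorial_Ring.prime p" and char_p: "ring_characteristic R p" and fin: "F_finite R p"
begin

text \<open>In the application \<open>N\<close> is the Matlis dual of \<open>M\<close>, and
  \<open>W\<close> is then the colocalization of \<open>M\<close> at \<open>P\<close>.\<close>

abbreviation "W \<equiv> hom_module R N E act"

lemma W_module: "module S W"
  by (rule module_hom_module[OF N.module_axioms E.module_axioms module_act act_comm])

sublocale fm: frobenius_module S W p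
  by (intro frobenius_module.intro comp.S.is_cring W_module)

sublocale hc: complete_module R P S loc.A.K loc.to_completion "with_scalars E act" "\<lambda>_. {\<zero>\<^bsub>E\<^esub>}"
  by (rule hull_complete_module)

sublocale NE: two_modules R N E
  by (intro two_modules.intro N.module_axioms E.module_axioms)

lemma q_pos: "p ^ e \<noteq> 0"
  using prime_gt_0_nat[OF prime_p] by simp

lemma W_lin: "w \<in> carrier W \<Longrightarrow> lin R N E w"
  by (simp add: linear_maps_iff)

text \<open>The issue is the nilpotence demanded by \<open>extension\<close>. Each value
  \<open>w (\<phi> t)\<close> is killed by some power of \<open>x\<close>; as finitely many
  \<open>t\<close> generate the pushforward, one power works for all arguments.\<close>

lemma extend:
  assumes w: "w \<in> carrier W" and \<phi>: "root_linear R (p ^ e) N \<phi>"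
  shows "\<exists>\<Theta>. root_linear S (p ^ e) (with_scalars E act) \<Theta> \<and>
    (\<forall>r\<in>carrier R. \<Theta> (loc.to_completion r) = w (\<phi> r)) \<and> (\<forall>m::nat. \<exists>n. \<forall>s\<in>loc.A.K n. \<Theta> s \<in> {\<zero>\<^bsub>E\<^esub>})"
proof (rule hc.extension[OF q_pos])
  note w = W_lin[OF w]
  note \<phi>c = root_linear_closed[OF \<phi>]
  show "w (\<phi> r) \<in> carrier (with_scalars E act)" if "r \<in> carrier R" for r
    using lin_closed[OF w \<phi>c[OF that]] by simp
  show "w (\<phi> (r \<oplus> s)) = w (\<phi> r) \<oplus>\<^bsub>with_scalars E act\<^esub> w (\<phi> s)" if "r \<in> carrier R" "s \<in> carrier R" for r s
    using that \<phi>c by (simp add: root_linear_add[OF \<phi>] lin_add[OF w])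
  show "w (\<phi> (a [^] (p ^ e) \<otimes> r)) = loc.to_completion a \<odot>\<^bsub>with_scalars E act\<^esub> w (\<phi> r)"
    if "a \<in> carrier R" "r \<in> carrier R" for a r
    using that \<phi>c by (simp add: root_linear_smult[OF \<phi>] lin_smult[OF w] act_to_completion lin_closed[OF w])
  fix x assume x: "x \<in> P"
  have xc: "x \<in> carrier R" by (rule P.Icarr[OF x])
  obtain T where T: "finite T" "T \<subseteq> carrier R"
    "\<And>x. x \<in> carrier R \<Longrightarrow> \<exists>a\<in>T \<rightarrow> carrier R. x = (\<Oplus>t\<in>T. a t [^] (p ^ e) \<otimes> t)"
    using R.frobenius_generators[OF prime_p char_p fin, of e] by blast
  have "\<forall>t. \<exists>k::nat. t \<in> T \<longrightarrow> x [^] k \<odot>\<^bsub>E\<^esub> w (\<phi> t) = \<zero>\<^bsub>E\<^esub>"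
    using element_nilpotent[OF x] lin_closed[OF w \<phi>c] T(2) by (metis subsetD)
  then obtain k :: "'a \<Rightarrow> nat" where k: "\<And>t. t \<in> T \<Longrightarrow> x [^] k t \<odot>\<^bsub>E\<^esub> w (\<phi> t) = \<zero>\<^bsub>E\<^esub>"
    by (rule choice[elim_format]) blast
  define n where "n = (\<Sum>t\<in>T. k t)"
  define D where "D = {y \<in> carrier N. x [^] n \<odot>\<^bsub>E\<^esub> w y = \<zero>\<^bsub>E\<^esub>}"
  have D: "submodule D R N"
    unfolding D_def using xc by (intro NE.kernel_submodule NE.lin_scale w) auto
  have "\<phi> t \<in> D" if t: "t \<in> T" for t
  proof -
    have tc: "t \<in> carrier R" using t T by blast
    have "k t \<le> n" unfolding n_def using member_le_sum[of t T k] T(1) t by simp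
    then have "x [^] n = x [^] (n - k t) \<otimes> x [^] k t" using xc by (simp add: R.nat_pow_mult)
    then have "x [^] n \<odot>\<^bsub>E\<^esub> w (\<phi> t) = \<zero>\<^bsub>E\<^esub>"
      using k[OF t] xc lin_closed[OF w \<phi>c[OF tc]] by (simp add: E.smult_assoc1)
    then show ?thesis using \<phi>c[OF tc] by (simp add: D_def)
  qed
  then have D_mem: "\<phi> r \<in> D" if "r \<in> carrier R" for r
    using root_linear_generated[OF R.is_cring N.module_axioms T(1,2,3) \<phi> D _ that] by blast
  have "loc.to_completion x [^]\<^bsub>S\<^esub> n \<odot>\<^bsub>with_scalars E act\<^esub> w (\<phi> r) \<in> {\<zero>\<^bsub>E\<^esub>}" if r: "r \<in> carrier R" for r
    using D_mem[OF r] act_to_completion[of "x [^] n" "w (\<phi> r)"] xc lin_closed[OF w \<phi>c[OF r]]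
    by (simp add: D_def comp.\<iota>_pow)
  then show "\<exists>k::nat. \<forall>r\<in>carrier R. loc.to_completion x [^]\<^bsub>S\<^esub> k \<odot>\<^bsub>with_scalars E act\<^esub> w (\<phi> r) \<in> {\<zero>\<^bsub>E\<^esub>}" by blast
qed

text \<open>Let \<Theta> extend \<open>w \<circ> \<phi>\<close> to \<open>S\<close>. The pairing of
  \<open>s\<close> and \<open>w\<close> to \<open>\<Theta> w s\<close> is balanced and biadditive,
  so it respects \<open>c w^q = 0\<close>. Additivity in \<open>w\<close> and compatibility with
  scalars of \<open>S\<close> follow from uniqueness of the continuous extension, since both sides
  agree on \<open>R\<close>.\<close>

lemma annihilated_imp:
  assumes w: "w \<in> carrier W" and c: "c \<in> carrier R" and \<phi>: "root_linear R (p ^ e) N \<phi>"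
    and ann: "fm.annihilated e w (loc.to_completion c)"
  shows "w (\<phi> c) = \<zero>\<^bsub>E\<^esub>"
proof -
  let ?ext = "\<lambda>w \<Theta>. root_linear S (p ^ e) (with_scalars E act) \<Theta> \<and>
    (\<forall>r\<in>carrier R. \<Theta> (loc.to_completion r) = w (\<phi> r)) \<and> (\<forall>m::nat. \<exists>n. \<forall>s\<in>loc.A.K n. \<Theta> s \<in> {\<zero>\<^bsub>E\<^esub>})"
  have "\<forall>w\<in>carrier W. \<exists>\<Theta>. ?ext w \<Theta>" using extend[OF _ \<phi>] by blast
  then obtain \<Theta> where "\<forall>w\<in>carrier W. ?ext w (\<Theta> w)" by (rule bchoice[elim_format]) blast
  then have \<Theta>: "root_linear S (p ^ e) (with_scalars E act) (\<Theta> w)"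
    "\<And>r. r \<in> carrier R \<Longrightarrow> \<Theta> w (loc.to_completion r) = w (\<phi> r)"
    "\<exists>n. \<forall>s\<in>loc.A.K n. \<Theta> w s = \<zero>\<^bsub>E\<^esub>" if "w \<in> carrier W" for w
    using that by (blast, blast, force)
  have \<Theta>c: "\<Theta> w s \<in> carrier E" if "w \<in> carrier W" "s \<in> carrier S" for w s
    using root_linear_closed[OF \<Theta>(1)[OF that(1)] that(2)] by simp
  have unique: "\<Theta> w s = \<Psi> s"
    if "w \<in> carrier W" "root_linear S (p ^ e) (with_scalars E act) \<Psi>"
      "\<And>r. r \<in> carrier R \<Longrightarrow> \<Psi> (loc.to_completion r) = w (\<phi> r)"
      "\<exists>n. \<forall>s\<in>loc.A.K n. \<Psi> s = \<zero>\<^bsub>E\<^esub>" "s \<in> carrier S" for w s \<Psi>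
    by (rule hc.extension_unique[OF q_pos \<Theta>(1)[OF that(1)] that(2)])
      (use \<Theta>(2,3)[OF that(1)] that in auto)
  have "\<Theta> w (loc.to_completion c) = \<zero>\<^bsub>E\<^esub>"
  proof (rule fm.universal[where e = e and \<beta> = "\<lambda>s w. \<Theta> w s"])
    show "abelian_group E" by (rule E.abelian_group_axioms)
    show "\<Theta> w s \<in> carrier E" if "s \<in> carrier S" "w \<in> carrier W" for s w by (rule \<Theta>c[OF that(2,1)])
    show "\<Theta> w (s \<oplus>\<^bsub>S\<^esub> s') = \<Theta> w s \<oplus>\<^bsub>E\<^esub> \<Theta> w s'"
      if "s \<in> carrier S" "s' \<in> carrier S" "w \<in> carrier W" for s s' w
      using root_linear_add[OF \<Theta>(1)[OF that(3)] that(1,2)] by simp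
    show "\<Theta> (v \<oplus>\<^bsub>W\<^esub> w) s = \<Theta> v s \<oplus>\<^bsub>E\<^esub> \<Theta> w s"
      if s: "s \<in> carrier S" and v: "v \<in> carrier W" and w: "w \<in> carrier W" for s v w
    proof (rule unique[OF fm.W.M.a_closed[OF v w] _ _ _ s])
      show "root_linear S (p ^ e) (with_scalars E act) (\<lambda>s. \<Theta> v s \<oplus>\<^bsub>E\<^esub> \<Theta> w s)"
        unfolding root_linear_def using \<Theta>c v w hc.N.smult_r_distr
        by (auto simp: root_linear_add[OF \<Theta>(1)] root_linear_smult[OF \<Theta>(1)] E.M.a_ac)
      show "\<Theta> v (loc.to_completion r) \<oplus>\<^bsub>E\<^esub> \<Theta> w (loc.to_completion r) = (v \<oplus>\<^bsub>W\<^esub> w) (\<phi> r)"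
        if "r \<in> carrier R" for r
        using \<Theta>(2)[OF v that] \<Theta>(2)[OF w that] root_linear_closed[OF \<phi> that] by simp
      obtain m n where "\<forall>s\<in>loc.A.K m. \<Theta> v s = \<zero>\<^bsub>E\<^esub>" "\<forall>s\<in>loc.A.K n. \<Theta> w s = \<zero>\<^bsub>E\<^esub>"
        using \<Theta>(3)[OF v] \<Theta>(3)[OF w] by blast
      then show "\<exists>n. \<forall>s\<in>loc.A.K n. \<Theta> v s \<oplus>\<^bsub>E\<^esub> \<Theta> w s = \<zero>\<^bsub>E\<^esub>"
        using comp.S.K_antimono[of m "max m n"] comp.S.K_antimono[of n "max m n"]
        by (intro exI[of _ "max m n"] ballI) (simp add: subset_eq)
    qed
    show "\<Theta> w (s \<otimes>\<^bsub>S\<^esub> frobenius S p e a) = \<Theta> (a \<odot>\<^bsub>W\<^esub> w) s"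
      if s: "s \<in> carrier S" and a: "a \<in> carrier S" and w: "w \<in> carrier W" for s a w
    proof -
      have "\<Theta> (a \<odot>\<^bsub>W\<^esub> w) s = act a (\<Theta> w s)"
      proof (rule unique[OF fm.W.smult_closed[OF a w] _ _ _ s])
        show "root_linear S (p ^ e) (with_scalars E act) (\<lambda>s. act a (\<Theta> w s))"
          unfolding root_linear_def
        proof (intro conjI ballI funcsetI)
          show "act a (\<Theta> w x) \<in> carrier (with_scalars E act)" if "x \<in> carrier S" for x
            using act_closed[OF a \<Theta>c[OF w that]] by simp
          show "act a (\<Theta> w (x \<oplus>\<^bsub>S\<^esub> y)) = act a (\<Theta> w x) \<oplus>\<^bsub>with_scalars E act\<^esub> act a (\<Theta> w y)"
            if "x \<in> carrier S" "y \<in> carrier S" for x y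
            using hc.N.smult_r_distr[OF a] \<Theta>c[OF w] that by (simp add: root_linear_add[OF \<Theta>(1)[OF w]])
          show "act a (\<Theta> w (b [^]\<^bsub>S\<^esub> (p ^ e) \<otimes>\<^bsub>S\<^esub> x)) = b \<odot>\<^bsub>with_scalars E act\<^esub> act a (\<Theta> w x)"
            if b: "b \<in> carrier S" and x: "x \<in> carrier S" for b x
            using hc.N.smult_assoc1[OF a b, of "\<Theta> w x"] hc.N.smult_assoc1[OF b a, of "\<Theta> w x"] \<Theta>c[OF w x]
              comp.S.m_comm[OF a b] by (simp add: root_linear_smult[OF \<Theta>(1)[OF w] b x])
        qed
        show "act a (\<Theta> w (loc.to_completion r)) = (a \<odot>\<^bsub>W\<^esub> w) (\<phi> r)" if "r \<in> carrier R" for r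
          using \<Theta>(2)[OF w that] root_linear_closed[OF \<phi> that] by simp
        show "\<exists>n. \<forall>s\<in>loc.A.K n. act a (\<Theta> w s) = \<zero>\<^bsub>E\<^esub>"
          using \<Theta>(3)[OF w] hc.N.smult_r_null[OF a] by (metis with_scalars_simps(3,4))
      qed
      also have "\<dots> = \<Theta> w (s \<otimes>\<^bsub>S\<^esub> frobenius S p e a)"
        using root_linear_smult[OF \<Theta>(1)[OF w] a s] s a by (simp add: frobenius_def comp.S.m_comm)
      finally show ?thesis by simp
    qed
  qed (use w c ann in \<open>auto simp: fm.annihilated_def\<close>)
  then show ?thesis using \<Theta>(2)[OF w c] by simp
qed

end

text \<open>Stated for additive maps, because it is applied to evaluations of maps and to scalar
  multiplications that relate modules over different rings.\<close>

lemma additive_finsum: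
  assumes "abelian_group G" "abelian_group H" and h: "\<And>x. x \<in> carrier G \<Longrightarrow> h x \<in> carrier H"
    and add: "\<And>x y. x \<in> carrier G \<Longrightarrow> y \<in> carrier G \<Longrightarrow> h (x \<oplus>\<^bsub>G\<^esub> y) = h x \<oplus>\<^bsub>H\<^esub> h y"
    and "finite A" "f \<in> A \<rightarrow> carrier G"
  shows "h (\<Oplus>\<^bsub>G\<^esub>i\<in>A. f i) = (\<Oplus>\<^bsub>H\<^esub>i\<in>A. h (f i))"
  using assms(5,6)
proof (induct A rule: finite_induct)
  interpret G: abelian_group G by fact
  interpret H: abelian_group H by fact
  case empty
  have "h \<zero>\<^bsub>G\<^esub> = h \<zero>\<^bsub>G\<^esub> \<oplus>\<^bsub>H\<^esub> h \<zero>\<^bsub>G\<^esub>" using add[of "\<zero>\<^bsub>G\<^esub>" "\<zero>\<^bsub>G\<^esub>"] by simp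
  then show ?case using h[of "\<zero>\<^bsub>G\<^esub>"] by (metis G.finsum_empty G.zero_closed H.add.l_cancel_one' H.finsum_empty)
next
  interpret G: abelian_group G by fact
  interpret H: abelian_group H by fact
  case (insert i A)
  then have f: "f \<in> A \<rightarrow> carrier G" "f i \<in> carrier G" by auto
  then show ?case
    using insert h by (simp add: G.finsum_insert H.finsum_insert add Pi_iff)
qed

lemma (in abelian_group) finsum_swap:
  assumes "finite A" "finite B" "\<And>i j. i \<in> A \<Longrightarrow> j \<in> B \<Longrightarrow> f i j \<in> carrier G"
  shows "(\<Oplus>i\<in>A. \<Oplus>j\<in>B. f i j) = (\<Oplus>j\<in>B. \<Oplus>i\<in>A. f i j)"
  using assms(1,3)
proof (induct A rule: finite_induct)
  case (insert i A)
  have "(\<Oplus>i\<in>insert i A. \<Oplus>j\<in>B. f i j) = (\<Oplus>j\<in>B. f i j) \<oplus> (\<Oplus>j\<in>B. \<Oplus>i\<in>A. f i j)"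
    using insert by (subst finsum_insert) (auto intro!: finsum_closed)
  also have "\<dots> = (\<Oplus>j\<in>B. f i j \<oplus> (\<Oplus>i\<in>A. f i j))"
    using insert by (intro finsum_addf[symmetric]) (auto intro!: finsum_closed)
  also have "\<dots> = (\<Oplus>j\<in>B. \<Oplus>i\<in>insert i A. f i j)"
    using insert by (intro finsum_cong') (auto intro!: finsum_closed simp: finsum_insert Pi_iff)
  finally show ?case .
qed simp

text \<open>The module \<open>F_* R\<close> for the exponent \<open>q\<close>; linear maps out of it
  are the root-linear maps.\<close>

definition frobenius_pushforward :: "('a, 'r) ring_scheme \<Rightarrow> nat \<Rightarrow> ('a, 'a) module" where
  "frobenius_pushforward R q = with_scalars (self_module R) (\<lambda>a x. a [^]\<^bsub>R\<^esub> q \<otimes>\<^bsub>R\<^esub> x)"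

lemma frobenius_pushforward_simps [simp]:
  "carrier (frobenius_pushforward R q) = carrier R" "\<zero>\<^bsub>frobenius_pushforward R q\<^esub> = \<zero>\<^bsub>R\<^esub>"
  "x \<oplus>\<^bsub>frobenius_pushforward R q\<^esub> y = x \<oplus>\<^bsub>R\<^esub> y" "a \<odot>\<^bsub>frobenius_pushforward R q\<^esub> x = a [^]\<^bsub>R\<^esub> q \<otimes>\<^bsub>R\<^esub> x"
  by (simp_all add: frobenius_pushforward_def)

lemma lin_frobenius_pushforward: "lin R (frobenius_pushforward R q) N \<phi> \<longleftrightarrow> root_linear R q N \<phi>"
  by (simp add: lin_def root_linear_def)

text \<open>Restriction of scalars along Frobenius. The distributive law in the scalar is where the
  prime characteristic enters.\<close>

lemma (in module) module_frobenius_scalars: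
  assumes "Factorial_Ring.prime p" "ring_characteristic R p"
  shows "module R (with_scalars M (\<lambda>a x. a [^] (p ^ e) \<odot>\<^bsub>M\<^esub> x))" (is "module R ?M")
proof (intro moduleI abelian_groupI)
  show "\<exists>y\<in>carrier ?M. y \<oplus>\<^bsub>?M\<^esub> x = \<zero>\<^bsub>?M\<^esub>" if "x \<in> carrier ?M" for x
    using that by (intro bexI[of _ "\<ominus>\<^bsub>M\<^esub> x"]) (auto simp: M.l_neg)
  show "x \<oplus>\<^bsub>?M\<^esub> y = y \<oplus>\<^bsub>?M\<^esub> x" if "x \<in> carrier ?M" "y \<in> carrier ?M" for x y
    using that M.a_comm by simp
qed (auto simp: R.is_cring M.a_assoc smult_r_distr R.frobenius_power_add[OF assms] smult_l_distr
    R.nat_pow_distrib smult_assoc1)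

lemma (in cring) module_frobenius_pushforward:
  assumes "Factorial_Ring.prime p" "ring_characteristic R p"
  shows "module R (frobenius_pushforward R (p ^ e))"
  using module.module_frobenius_scalars[OF self_module assms] by (simp add: frobenius_pushforward_def)

section \<open>The converse, by a finite presentation of the pushforward\<close>

context hull_dual
begin

text \<open>Present the pushforward by a free module on \<open>T\<close> with finitely many
  relations \<open>G\<close>, and let \<gamma> be a lift of \<open>c\<close>. A map \<open>h\<close>
  from the free module to \<open>N\<close> that kills \<open>G\<close> factors through the
  pushforward, so \<open>w (h \<gamma>) = 0\<close> by hypothesis. Injectivity of the hull therefore
  writes \<open>w (h \<gamma>)\<close> as a sum of terms \<open>v \<rho> (h \<rho>)\<close> over the
  relations. Read in \<open>W\<close>, this expresses \<open>c w^q\<close> through multiples of the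
  relations, all of which have value zero.\<close>

lemma annihilated_if:
  assumes w: "w \<in> carrier W" and c: "c \<in> carrier R"
    and zero: "\<And>\<phi>. root_linear R (p ^ e) N \<phi> \<Longrightarrow> w (\<phi> c) = \<zero>\<^bsub>E\<^esub>"
  shows "fm.annihilated e w (loc.to_completion c)"
proof -
  define q where "q = p ^ e"
  obtain T where T: "finite T" "T \<subseteq> carrier R"
    "\<And>x. x \<in> carrier R \<Longrightarrow> \<exists>a\<in>T \<rightarrow> carrier R. x = (\<Oplus>t\<in>T. a t [^] q \<otimes> t)"
    using R.frobenius_generators[OF prime_p char_p fin, of e] unfolding q_def by blast
  let ?F = "free_module R T" and ?P = "frobenius_pushforward R q"
  interpret F: module R ?F by (rule R.module_free_module)
  interpret P: module R ?P unfolding q_def by (rule R.module_frobenius_pushforward[OF prime_p char_p])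
  let ?H = "matlis_dual R N ?F"
  have H: "module R ?H" by (rule module_matlis_dual[OF F.module_axioms N.module_axioms])
  interpret FN: two_modules R ?F N by (intro two_modules.intro F.module_axioms N.module_axioms)
  interpret FP: two_modules R ?F ?P by (intro two_modules.intro F.module_axioms P.module_axioms)
  interpret HN: two_modules R ?H N by (intro two_modules.intro H N.module_axioms)
  have Fval: "\<rho> t \<in> carrier R" if "\<rho> \<in> carrier ?F" "t \<in> T" for \<rho> t using that by auto
  define val where "val \<rho> = (\<Oplus>t\<in>T. \<rho> t [^] q \<otimes> t)" for \<rho>
  have val: "lin R ?F ?P val"
  proof (rule linI)
    fix \<rho> assume \<rho>: "\<rho> \<in> carrier ?F"
    note c = Fval[OF \<rho>]
    show "val \<rho> \<in> carrier ?P" unfolding val_def using c T(2) by (auto intro!: R.finsum_closed)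
    show "val (a \<odot>\<^bsub>?F\<^esub> \<rho>) = a \<odot>\<^bsub>?P\<^esub> val \<rho>" if "a \<in> carrier R" for a
    proof -
      have "val (a \<odot>\<^bsub>?F\<^esub> \<rho>) = (\<Oplus>t\<in>T. a [^] q \<otimes> (\<rho> t [^] q \<otimes> t))"
        unfolding val_def using c T(2) that by (intro R.finsum_cong') (auto simp: R.nat_pow_distrib R.m_assoc)
      also have "\<dots> = a [^] q \<otimes> val \<rho>"
        unfolding val_def using c T that by (intro R.finsum_rdistr[symmetric]) auto
      finally show ?thesis by simp
    qed
    show "val (\<rho> \<oplus>\<^bsub>?F\<^esub> \<sigma>) = val \<rho> \<oplus>\<^bsub>?P\<^esub> val \<sigma>" if "\<sigma> \<in> carrier ?F" for \<sigma>
    proof -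
      have "val (\<rho> \<oplus>\<^bsub>?F\<^esub> \<sigma>) = (\<Oplus>t\<in>T. \<rho> t [^] q \<otimes> t \<oplus> \<sigma> t [^] q \<otimes> t)"
        unfolding val_def q_def using c Fval[OF that] T(2)
        by (intro R.finsum_cong') (auto simp: R.frobenius_power_add[OF prime_p char_p] R.l_distr)
      also have "\<dots> = val \<rho> \<oplus> val \<sigma>"
        unfolding val_def using c Fval[OF that] T(2) by (intro R.finsum_addf) auto
      finally show ?thesis by simp
    qed
  qed
  have val_surj: "\<exists>\<rho>. \<rho> \<in> carrier ?F \<and> val \<rho> = x" if x: "x \<in> carrier R" for x
  proof -
    obtain a where a: "a \<in> T \<rightarrow> carrier R" "x = (\<Oplus>t\<in>T. a t [^] q \<otimes> t)" using T(3)[OF x] by blast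
    have "val (restrict a T) = x"
      unfolding val_def a(2) using a(1) T(2) by (intro R.finsum_cong') auto
    moreover have "restrict a T \<in> carrier ?F" using a(1) T(1) by auto
    ultimately show ?thesis by blast
  qed
  define Rel where "Rel = {\<rho> \<in> carrier ?F. val \<rho> = \<zero>}"
  have Rel: "submodule Rel R ?F" using FP.kernel_submodule[OF val] unfolding Rel_def by simp
  obtain G where G: "G \<subseteq> Rel" "finite G" "\<And>D. submodule D R ?F \<Longrightarrow> G \<subseteq> D \<Longrightarrow> Rel \<subseteq> D"
    using noetherian_ring.finite_free_submodule[OF noeth R.is_cring T(1) Rel] by blast
  have Gc: "\<rho> \<in> carrier ?F" "val \<rho> = \<zero>" if "\<rho> \<in> G" for \<rho> using that G(1) unfolding Rel_def by blast+
  obtain \<gamma> where \<gamma>: "\<gamma> \<in> carrier ?F" "val \<gamma> = c" using val_surj[OF c] by blast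
  have wl: "lin R N E w" by (rule W_lin[OF w])
  have Hl: "lin R ?F N h" if "h \<in> carrier ?H" for h using that unfolding matlis_dual_simps linear_maps_iff by blast
  have eval: "lin R ?H N (\<lambda>h. h \<rho>)" if \<rho>: "\<rho> \<in> carrier ?F" for \<rho>
    by (rule linI) (use \<rho> lin_closed[OF Hl] in \<open>simp_all del: free_module_simps\<close>)
  have fl: "lin R (?H\<lparr>carrier := carrier ?H\<rparr>) E (\<lambda>h. w (h \<gamma>))"
    by (intro lin_submodule lin_comp[OF eval[OF \<gamma>(1)] wl]) simp
  \<comment> \<open>An \<open>h\<close> that kills the relations descends to a linear map on the
    pushforward, that is, to a root-linear \<psi> with \<open>\<psi> c = h \<gamma>\<close>.\<close>
  have ker: "w (h \<gamma>) = \<zero>\<^bsub>E\<^esub>" if h: "h \<in> carrier ?H" and hG: "\<And>\<rho>. \<rho> \<in> G \<Longrightarrow> h \<rho> = \<zero>\<^bsub>N\<^esub>" for h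
  proof -
    note hl = Hl[OF h]
    have "G \<subseteq> {\<rho> \<in> carrier ?F. h \<rho> = \<zero>\<^bsub>N\<^esub>}" using Gc hG by blast
    then have "Rel \<subseteq> {\<rho> \<in> carrier ?F. h \<rho> = \<zero>\<^bsub>N\<^esub>}" using G(3) FN.kernel_submodule[OF hl] by blast
    then have "h \<rho> = \<zero>\<^bsub>N\<^esub>" if "\<rho> \<in> carrier ?F" "val \<rho> = \<zero>\<^bsub>?P\<^esub>" for \<rho>
      using that unfolding Rel_def by auto
    moreover have "val ` carrier ?F = carrier ?P" using lin_closed[OF val] val_surj by (auto simp del: free_module_simps)
    ultimately obtain \<psi> where \<psi>: "lin R ?P N \<psi>" "\<And>\<rho>. \<rho> \<in> carrier ?F \<Longrightarrow> \<psi> (val \<rho>) = h \<rho>"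
      using FP.lin_factor[OF N.module_axioms val _ hl] by blast
    show ?thesis using zero[of \<psi>] \<psi>(1) \<psi>(2)[OF \<gamma>(1)] \<gamma>(2) by (simp add: lin_frobenius_pushforward q_def)
  qed
  have Hsub: "submodule (carrier ?H) R ?H" by (rule HN.M.carrier_is_submodule)
  have "\<exists>v. (\<forall>\<rho>\<in>G. lin R N E (v \<rho>)) \<and> (\<forall>h\<in>carrier ?H. w (h \<gamma>) = (\<Oplus>\<^bsub>E\<^esub>\<rho>\<in>G. v \<rho> (h \<rho>)))"
    by (rule injective_factorization[where g = "\<lambda>\<rho> h. h \<rho>", OF inj H N.module_axioms G(2) _ Hsub fl])
      (use eval Gc(1) ker in blast)+
  then obtain v where v: "\<And>\<rho>. \<rho> \<in> G \<Longrightarrow> lin R N E (v \<rho>)"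
    "\<And>h. h \<in> carrier ?H \<Longrightarrow> w (h \<gamma>) = (\<Oplus>\<^bsub>E\<^esub>\<rho>\<in>G. v \<rho> (h \<rho>))" by blast
  define u where "u \<rho> = restrict (v \<rho>) (carrier N)" for \<rho>
  have u: "u \<rho> \<in> carrier W" if "\<rho> \<in> G" for \<rho>
    using restrict_linear_maps[OF N.module_axioms v(1)[OF that]] by (simp add: u_def)
  let ?i = "loc.to_completion"
  \<comment> \<open>The identity is tested at \<open>x\<close> by inserting for \<open>h\<close> the
    map that sends \<rho> to its coordinate at \<open>t\<close> times \<open>x\<close>.\<close>
  have comb: "?i (\<gamma> t) \<odot>\<^bsub>W\<^esub> w = (\<Oplus>\<^bsub>W\<^esub>\<rho>\<in>G. ?i (\<rho> t) \<odot>\<^bsub>W\<^esub> u \<rho>)" if t: "t \<in> T" for t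
  proof (rule linear_maps_eqI)
    have s: "?i (\<rho> t) \<odot>\<^bsub>W\<^esub> u \<rho> \<in> carrier W" if "\<rho> \<in> G" for \<rho>
      using Fval[OF Gc(1)[OF that] t] u[OF that] by (intro fm.W.smult_closed) auto
    then have sc: "(\<Oplus>\<^bsub>W\<^esub>\<rho>\<in>G. ?i (\<rho> t) \<odot>\<^bsub>W\<^esub> u \<rho>) \<in> carrier W" by (intro fm.W.M.finsum_closed) auto
    then show "(\<Oplus>\<^bsub>W\<^esub>\<rho>\<in>G. ?i (\<rho> t) \<odot>\<^bsub>W\<^esub> u \<rho>) \<in> linear_maps R N E" by simp
    have "?i (\<gamma> t) \<odot>\<^bsub>W\<^esub> w \<in> carrier W" using Fval[OF \<gamma>(1) t] w by (intro fm.W.smult_closed) auto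
    then show "?i (\<gamma> t) \<odot>\<^bsub>W\<^esub> w \<in> linear_maps R N E" by simp
    fix x assume x: "x \<in> carrier N"
    define h where "h = restrict (\<lambda>\<rho>. \<rho> t \<odot>\<^bsub>N\<^esub> x) (carrier ?F)"
    have "lin R ?F N (\<lambda>\<rho>. \<rho> t \<odot>\<^bsub>N\<^esub> x)"
      by (rule linI) (use t x in \<open>auto simp: N.smult_l_distr N.smult_assoc1 PiE_def Pi_iff\<close>)
    then have h: "h \<in> carrier ?H" unfolding h_def using restrict_linear_maps[OF F.module_axioms] by simp
    have "(\<Oplus>\<^bsub>W\<^esub>\<rho>\<in>G. ?i (\<rho> t) \<odot>\<^bsub>W\<^esub> u \<rho>) x = (\<Oplus>\<^bsub>E\<^esub>\<rho>\<in>G. (?i (\<rho> t) \<odot>\<^bsub>W\<^esub> u \<rho>) x)"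
    proof (rule additive_finsum[of W E "\<lambda>w. w x"])
      show "f x \<in> carrier E" if "f \<in> carrier W" for f using lin_closed[OF W_lin[OF that] x] .
    qed (use s x G(2) fm.W.abelian_group_axioms E.abelian_group_axioms in auto)
    also have "\<dots> = (\<Oplus>\<^bsub>E\<^esub>\<rho>\<in>G. v \<rho> (h \<rho>))"
    proof (rule E.M.finsum_cong')
      fix \<rho> assume \<rho>: "\<rho> \<in> G"
      note c = Fval[OF Gc(1)[OF \<rho>] t]
      have "(?i (\<rho> t) \<odot>\<^bsub>W\<^esub> u \<rho>) x = \<rho> t \<odot>\<^bsub>E\<^esub> v \<rho> x"
        using x act_to_completion[OF c lin_closed[OF v(1)[OF \<rho>] x]] by (simp add: u_def)
      also have "\<dots> = v \<rho> (h \<rho>)"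
        using lin_smult[OF v(1)[OF \<rho>] c x] Gc(1)[OF \<rho>] by (simp add: h_def del: free_module_simps)
      finally show "(?i (\<rho> t) \<odot>\<^bsub>W\<^esub> u \<rho>) x = v \<rho> (h \<rho>)" .
    qed (use v(1) lin_closed[OF eval[OF Gc(1)] h] in \<open>auto intro: lin_closed\<close>)
    also have "\<dots> = w (h \<gamma>)" by (rule v(2)[OF h, symmetric])
    also have "\<dots> = \<gamma> t \<odot>\<^bsub>E\<^esub> w x"
      using lin_smult[OF wl Fval[OF \<gamma>(1) t] x] \<gamma>(1) by (simp add: h_def del: free_module_simps)
    also have "\<dots> = (?i (\<gamma> t) \<odot>\<^bsub>W\<^esub> w) x"
      using x act_to_completion[OF Fval[OF \<gamma>(1) t] lin_closed[OF wl x]] by simp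
    finally show "(?i (\<gamma> t) \<odot>\<^bsub>W\<^esub> w) x = (\<Oplus>\<^bsub>W\<^esub>\<rho>\<in>G. ?i (\<rho> t) \<odot>\<^bsub>W\<^esub> u \<rho>) x" by simp
  qed
  let ?B = "fm.Fr e" and ?el = "fm.el e"
  interpret B: module S ?B by (rule fm.Fr_module)
  have Tc: "t \<in> carrier R" if "t \<in> T" for t using that T(2) by blast
  \<comment> \<open>In the base change a coefficient moves across the Frobenius:
    \<open>(\<rho>(t)^q t) y^q = t (\<rho>(t) y)^q\<close>.\<close>
  have expand: "?i (val \<rho>) \<odot>\<^bsub>?B\<^esub> ?el y = (\<Oplus>\<^bsub>?B\<^esub>t\<in>T. ?i t \<odot>\<^bsub>?B\<^esub> ?el (?i (\<rho> t) \<odot>\<^bsub>W\<^esub> y))"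
    if \<rho>: "\<rho> \<in> carrier ?F" and y: "y \<in> carrier W" for \<rho> y
  proof -
    have c: "\<rho> t [^] q \<otimes> t \<in> carrier R" if "t \<in> T" for t using Fval[OF \<rho> that] Tc[OF that] by simp
    have ely: "?el y \<in> carrier ?B" by (rule fm.elt_closed[OF y])
    have "?i (val \<rho>) \<odot>\<^bsub>?B\<^esub> ?el y = (\<Oplus>\<^bsub>?B\<^esub>t\<in>T. ?i (\<rho> t [^] q \<otimes> t) \<odot>\<^bsub>?B\<^esub> ?el y)"
      unfolding val_def
      by (rule additive_finsum[of R ?B "\<lambda>x. ?i x \<odot>\<^bsub>?B\<^esub> ?el y"])
        (use c ely T(1) R.abelian_group_axioms B.abelian_group_axioms in \<open>auto simp: B.smult_l_distr\<close>)
    also have "\<dots> = (\<Oplus>\<^bsub>?B\<^esub>t\<in>T. ?i t \<odot>\<^bsub>?B\<^esub> ?el (?i (\<rho> t) \<odot>\<^bsub>W\<^esub> y))"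
    proof (rule B.M.finsum_cong')
      fix t assume t: "t \<in> T"
      note c = Fval[OF \<rho> t] Tc[OF t]
      have "?i (\<rho> t [^] q \<otimes> t) = ?i t \<otimes>\<^bsub>S\<^esub> ?i (\<rho> t) [^]\<^bsub>S\<^esub> q"
        using c by (simp add: comp.\<iota>_pow comp.S.m_comm)
      then show "?i (\<rho> t [^] q \<otimes> t) \<odot>\<^bsub>?B\<^esub> ?el y = ?i t \<odot>\<^bsub>?B\<^esub> ?el (?i (\<rho> t) \<odot>\<^bsub>W\<^esub> y)"
        using c ely fm.elt_smult[of "?i (\<rho> t)" y e] y by (simp add: B.smult_assoc1 frobenius_def q_def del: hom_module_simps)
    qed (use Fval[OF \<rho>] Tc y in \<open>auto intro!: B.smult_closed fm.elt_closed fm.W.smult_closed simp del: hom_module_simps\<close>)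
    finally show ?thesis .
  qed
  have uc: "?i (\<rho> t) \<odot>\<^bsub>W\<^esub> u \<rho> \<in> carrier W" if "t \<in> T" "\<rho> \<in> G" for t \<rho>
    using Fval[OF Gc(1)[OF that(2)] that(1)] u[OF that(2)] by (intro fm.W.smult_closed) auto
  have "?i c \<odot>\<^bsub>?B\<^esub> ?el w = (\<Oplus>\<^bsub>?B\<^esub>t\<in>T. ?i t \<odot>\<^bsub>?B\<^esub> ?el (?i (\<gamma> t) \<odot>\<^bsub>W\<^esub> w))"
    using expand[OF \<gamma>(1) w] \<gamma>(2) by simp
  also have "\<dots> = (\<Oplus>\<^bsub>?B\<^esub>t\<in>T. \<Oplus>\<^bsub>?B\<^esub>\<rho>\<in>G. ?i t \<odot>\<^bsub>?B\<^esub> ?el (?i (\<rho> t) \<odot>\<^bsub>W\<^esub> u \<rho>))"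
  proof (rule B.M.finsum_cong')
    fix t assume t: "t \<in> T"
    show "?i t \<odot>\<^bsub>?B\<^esub> ?el (?i (\<gamma> t) \<odot>\<^bsub>W\<^esub> w) = (\<Oplus>\<^bsub>?B\<^esub>\<rho>\<in>G. ?i t \<odot>\<^bsub>?B\<^esub> ?el (?i (\<rho> t) \<odot>\<^bsub>W\<^esub> u \<rho>))"
      unfolding comb[OF t]
      by (rule additive_finsum[of W ?B "\<lambda>x. ?i t \<odot>\<^bsub>?B\<^esub> ?el x"])
        (use Tc[OF t] uc[OF t] G(2) fm.W.abelian_group_axioms B.abelian_group_axioms
          in \<open>auto simp: fm.elt_add fm.elt_closed B.smult_r_distr simp del: hom_module_simps\<close>)
  qed (use Tc uc in \<open>auto intro!: B.M.finsum_closed B.smult_closed fm.elt_closed simp del: hom_module_simps\<close>)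
  \<comment> \<open>After the exchange of sums, the inner sum for a relation \<rho> is the value of
    \<rho> times the Frobenius power of \<open>u \<rho>\<close>, and the value of a relation is
    zero.\<close>
  also have "\<dots> = (\<Oplus>\<^bsub>?B\<^esub>\<rho>\<in>G. \<Oplus>\<^bsub>?B\<^esub>t\<in>T. ?i t \<odot>\<^bsub>?B\<^esub> ?el (?i (\<rho> t) \<odot>\<^bsub>W\<^esub> u \<rho>))"
    using Tc uc by (intro B.M.finsum_swap T(1) G(2) B.smult_closed fm.elt_closed) auto
  also have "\<dots> = (\<Oplus>\<^bsub>?B\<^esub>\<rho>\<in>G. \<zero>\<^bsub>?B\<^esub>)"
  proof (rule B.M.finsum_cong')
    fix \<rho> assume \<rho>: "\<rho> \<in> G"
    show "(\<Oplus>\<^bsub>?B\<^esub>t\<in>T. ?i t \<odot>\<^bsub>?B\<^esub> ?el (?i (\<rho> t) \<odot>\<^bsub>W\<^esub> u \<rho>)) = \<zero>\<^bsub>?B\<^esub>"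
      unfolding expand[OF Gc(1)[OF \<rho>] u[OF \<rho>], symmetric] Gc(2)[OF \<rho>]
      using B.smult_l_null[OF fm.elt_closed[OF u[OF \<rho>]]] by simp
  qed auto
  finally show ?thesis unfolding fm.annihilated_def by simp
qed

end

section \<open>Duality for Artinian modules\<close>

lemma (in module) submodule_Inter_family:
  assumes D: "\<And>f. f \<in> F \<Longrightarrow> submodule (D f) R M"
  shows "submodule {x \<in> carrier M. \<forall>f\<in>F. x \<in> D f} R M"
proof (rule submoduleI)
  let ?V = "{x \<in> carrier M. \<forall>f\<in>F. x \<in> D f}"
  show "\<zero>\<^bsub>M\<^esub> \<in> ?V" using submodule_zero[OF D] by simp
  show "\<ominus>\<^bsub>M\<^esub> a \<in> ?V" if "a \<in> ?V" for a using submoduleE(3)[OF D] that by simp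
  show "a \<oplus>\<^bsub>M\<^esub> b \<in> ?V" if "a \<in> ?V" "b \<in> ?V" for a b using submoduleE(5)[OF D] that by simp
  show "r \<odot>\<^bsub>M\<^esub> a \<in> ?V" if "r \<in> carrier R" "a \<in> ?V" for r a
    using submoduleE(4)[OF D that(1)] that by simp
qed auto

text \<open>If no finite subfamily sufficed, adjoining one further member at a time would make the
  intersections decrease strictly forever.\<close>

lemma artinian_finite_subfamily:
  assumes M: "artinian_module R M" and D: "\<And>f. f \<in> \<tau> \<Longrightarrow> submodule (D f) R M"
  shows "\<exists>F\<subseteq>\<tau>. finite F \<and> (\<forall>x\<in>carrier M. (\<forall>f\<in>F. x \<in> D f) \<longrightarrow> (\<forall>f\<in>\<tau>. x \<in> D f))"
proof (rule ccontr)
  assume contra: "\<not> ?thesis"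
  interpret module R M using M by (simp add: artinian_module_def)
  define V where "V F = {x \<in> carrier M. \<forall>f\<in>F. x \<in> D f}" for F
  have V: "submodule (V F) R M" if "F \<subseteq> \<tau>" for F
    unfolding V_def using that by (intro submodule_Inter_family D) blast
  have "\<forall>F. \<exists>f. F \<subseteq> \<tau> \<and> finite F \<longrightarrow> f \<in> \<tau> \<and> V (insert f F) \<noteq> V F"
  proof
    fix F
    show "\<exists>f. F \<subseteq> \<tau> \<and> finite F \<longrightarrow> f \<in> \<tau> \<and> V (insert f F) \<noteq> V F"
    proof (cases "F \<subseteq> \<tau> \<and> finite F")
      case True
      then obtain x f where "x \<in> carrier M" "\<forall>f\<in>F. x \<in> D f" "f \<in> \<tau>" "x \<notin> D f" using contra by blast
      then have "x \<in> V F" "x \<notin> V (insert f F)" by (auto simp: V_def)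
      then show ?thesis using \<open>f \<in> \<tau>\<close> by blast
    qed blast
  qed
  then obtain g where g: "\<And>F. F \<subseteq> \<tau> \<Longrightarrow> finite F \<Longrightarrow> g F \<in> \<tau> \<and> V (insert (g F) F) \<noteq> V F"
    by (rule choice[elim_format]) blast
  define F where "F = rec_nat {} (\<lambda>_ F. insert (g F) F)"
  have F0: "F 0 = {}" and FS: "F (Suc n) = insert (g (F n)) (F n)" for n by (simp_all add: F_def)
  have F: "F n \<subseteq> \<tau> \<and> finite (F n)" for n by (induct n) (auto simp: F0 FS g)
  have "\<forall>n. submodule (V (F n)) R M \<and> V (F (Suc n)) \<subseteq> V (F n)"
    using V F by (auto simp: V_def FS)
  then have "\<exists>k. \<forall>n\<ge>k. V (F n) = V (F k)" using M unfolding artinian_module_def by (elim conjE allE[of _ "\<lambda>n. V (F n)"]) blast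
  then obtain k where k: "\<forall>n\<ge>k. V (F n) = V (F k)" by blast
  have "V (F (Suc k)) = V (F k)" by (rule k[rule_format]) simp
  then show False using g[of "F k"] F[of k] unfolding FS by blast
qed

text \<open>By the Artinian property finitely many members of \<tau> have the same common kernel as
  all of \<tau>. Since \<open>f\<close> vanishes there, it factors through these finitely many
  maps.\<close>

lemma dual_double_annihilator:
  assumes M: "artinian_module R M" and E: "injective_module R E" and \<tau>: "\<tau> \<subseteq> linear_maps R M E"
    and f: "lin R M E f" and van: "\<And>x. x \<in> carrier M \<Longrightarrow> (\<And>g. g \<in> \<tau> \<Longrightarrow> g x = \<zero>\<^bsub>E\<^esub>) \<Longrightarrow> f x = \<zero>\<^bsub>E\<^esub>"
  shows "\<exists>F h. F \<subseteq> \<tau> \<and> finite F \<and> (\<forall>g\<in>F. lin R E E (h g)) \<and> (\<forall>x\<in>carrier M. f x = (\<Oplus>\<^bsub>E\<^esub>g\<in>F. h g (g x)))"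
proof -
  have Mm: "module R M" and Em: "module R E" using M E by (auto simp: artinian_module_def injective_module_def)
  interpret ME: two_modules R M E by (intro two_modules.intro Mm Em)
  have l: "lin R M E g" if "g \<in> \<tau>" for g using that \<tau> by (auto simp: linear_maps_iff)
  have "\<exists>F\<subseteq>\<tau>. finite F \<and> (\<forall>x\<in>carrier M. (\<forall>g\<in>F. x \<in> {x \<in> carrier M. g x = \<zero>\<^bsub>E\<^esub>}) \<longrightarrow>
      (\<forall>g\<in>\<tau>. x \<in> {x \<in> carrier M. g x = \<zero>\<^bsub>E\<^esub>}))"
    by (intro artinian_finite_subfamily[OF M] ME.kernel_submodule l)
  then obtain F where F: "F \<subseteq> \<tau>" "finite F"
    "\<forall>x\<in>carrier M. (\<forall>g\<in>F. g x = \<zero>\<^bsub>E\<^esub>) \<longrightarrow> (\<forall>g\<in>\<tau>. g x = \<zero>\<^bsub>E\<^esub>)" by auto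
  have "\<exists>h. (\<forall>g\<in>F. lin R E E (h g)) \<and> (\<forall>x\<in>carrier M. f x = (\<Oplus>\<^bsub>E\<^esub>g\<in>F. h g (g x)))"
  proof (rule injective_factorization[where g = "\<lambda>g. g", OF E Mm Em F(2)])
    show "submodule (carrier M) R M" by (rule ME.M.carrier_is_submodule)
    show "lin R (M\<lparr>carrier := carrier M\<rparr>) E f" by (rule lin_submodule[OF f]) simp
    fix x assume x: "x \<in> carrier M" "\<And>g. g \<in> F \<Longrightarrow> g x = \<zero>\<^bsub>E\<^esub>"
    show "f x = \<zero>\<^bsub>E\<^esub>"
      by (rule van[OF x(1)]) (use F(3) x in blast)
  qed (use F(1) l in blast)
  then show ?thesis using F(1,2) by blast
qed

text \<open>Restriction from the dual of \<open>M\<close> to the dual of \<open>L\<close> is onto by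
  injectivity, so maps on the latter are the maps \<open>w\<close> on the former that vanish on
  every \<open>f\<close> with \<open>f\<close> zero on \<open>L\<close>. Such an \<open>f\<close> is
  a sum of composites \<open>h g (g x)\<close> with \<open>g\<close> in \<tau>. Each composite lies
  in \<tau> by stability, and as \<open>w\<close> is additive, vanishing on \<tau> is
  enough.\<close>

lemma colocalization_submodule_annihilator:
  fixes R :: "('a, 'r) ring_scheme" (structure) and M :: "('a, 'b, 'm) module_scheme" and E :: "('a, 'c, 'n) module_scheme"
  assumes M: "artinian_module R M" and E: "injective_module R E" and E': "module R E'"
    and \<tau>: "\<tau> \<subseteq> linear_maps R M E"
    and stable: "\<And>h f. lin R E E h \<Longrightarrow> f \<in> \<tau> \<Longrightarrow> restrict (\<lambda>x. h (f x)) (carrier M) \<in> \<tau>"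
  shows "colocalization_submodule R P E E' M {x \<in> carrier M. \<forall>f\<in>\<tau>. f x = \<zero>\<^bsub>E\<^esub>} =
    {w \<in> linear_maps R (matlis_dual R E M) E'. \<forall>f\<in>\<tau>. w f = \<zero>\<^bsub>E'\<^esub>}"
proof -
  have Mm: "module R M" and Em: "module R E" using M E by (auto simp: artinian_module_def injective_module_def)
  interpret ME: two_modules R M E by (intro two_modules.intro Mm Em)
  define L where "L = {x \<in> carrier M. \<forall>f\<in>\<tau>. f x = \<zero>\<^bsub>E\<^esub>}"
  let ?L = "M\<lparr>carrier := L\<rparr>"
  let ?N = "matlis_dual R E M" and ?NL = "matlis_dual R E (M\<lparr>carrier := L\<rparr>)"
  have l: "lin R M E f" if "f \<in> linear_maps R M E" for f using that by (auto simp: linear_maps_iff)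
  have LM: "L \<subseteq> carrier M" by (auto simp: L_def)
  have Ls: "submodule L R M"
  proof -
    have "lin R M E f" if "f \<in> \<tau>" for f using that \<tau> l by blast
    then have "submodule {x \<in> carrier M. \<forall>f\<in>\<tau>. x \<in> {x \<in> carrier M. f x = \<zero>\<^bsub>E\<^esub>}} R M"
      by (intro ME.M.submodule_Inter_family ME.kernel_submodule)
    moreover have "{x \<in> carrier M. \<forall>f\<in>\<tau>. x \<in> {x \<in> carrier M. f x = \<zero>\<^bsub>E\<^esub>}} = L"
      by (auto simp: L_def)
    ultimately show ?thesis by simp
  qed
  have Lm: "module R ?L" by (rule submodule.submodule_is_module[OF Ls Mm])
  have N: "module R ?N" by (rule module_matlis_dual[OF Mm Em])
  have NL: "module R ?NL" by (rule module_matlis_dual[OF Lm Em])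
  interpret NE: two_modules R ?N E' by (intro two_modules.intro N E')
  interpret NLE: two_modules R ?NL E' by (intro two_modules.intro NL E')
  define \<rho> where "\<rho> f = (\<lambda>x\<in>L. f x)" for f :: "'b \<Rightarrow> 'c"
  have \<rho>c: "\<rho> f \<in> carrier ?NL" if "f \<in> carrier ?N" for f
    using restrict_linear_maps[OF Lm lin_submodule[OF l LM], of f] that by (simp add: \<rho>_def)
  have \<rho>l: "lin R ?N ?NL \<rho>"
    by (rule linI) (use \<rho>c LM in \<open>auto simp: \<rho>_def restrict_def fun_eq_iff\<close>)
  have map: "colocalization_map R E ?L M (\<lambda>x. x) \<psi> = restrict (\<lambda>f. \<psi> (\<rho> f)) (carrier ?N)" for \<psi>
    by (simp add: colocalization_map_def \<rho>_def)
  have cl: "carrier (colocalization R P E E' ?L) = linear_maps R ?NL E'" by (simp add: colocalization_def)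
  have ext: "\<exists>f. f \<in> carrier ?N \<and> \<rho> f = g" if g: "g \<in> carrier ?NL" for g
  proof -
    have "lin R ?L E g" "g \<in> extensional L" using g by (auto simp: linear_maps_iff)
    moreover obtain f where f: "lin R M E f" "\<And>x. x \<in> L \<Longrightarrow> f x = g x"
      using injective_extension[OF E Mm Ls] calculation by blast
    ultimately have "\<rho> (restrict f (carrier M)) = g"
      using LM by (auto simp: \<rho>_def fun_eq_iff restrict_def extensional_def)
    then show ?thesis using restrict_linear_maps[OF Mm f(1)] by auto
  qed
  have "colocalization_map R E ?L M (\<lambda>x. x) ` linear_maps R ?NL E' =
    {w \<in> linear_maps R ?N E'. \<forall>f\<in>\<tau>. w f = \<zero>\<^bsub>E'\<^esub>}"
  proof (rule equalityI; rule subsetI)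
    fix w assume "w \<in> colocalization_map R E ?L M (\<lambda>x. x) ` linear_maps R ?NL E'"
    then obtain \<psi> where \<psi>: "\<psi> \<in> linear_maps R ?NL E'" and w: "w = restrict (\<lambda>f. \<psi> (\<rho> f)) (carrier ?N)"
      unfolding map by blast
    have \<psi>l: "lin R ?NL E' \<psi>" using \<psi> by (simp add: linear_maps_iff)
    have "w f = \<zero>\<^bsub>E'\<^esub>" if f: "f \<in> \<tau>" for f
    proof -
      have "\<rho> f = \<zero>\<^bsub>?NL\<^esub>" using f by (auto simp: \<rho>_def L_def fun_eq_iff restrict_def)
      moreover have "f \<in> carrier ?N" using f \<tau> by auto
      ultimately show ?thesis using NLE.lin_zero[OF \<psi>l] by (simp only: w restrict_apply if_True)
    qed
    then show "w \<in> {w \<in> linear_maps R ?N E'. \<forall>f\<in>\<tau>. w f = \<zero>\<^bsub>E'\<^esub>}"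
      unfolding w using restrict_linear_maps[OF N lin_comp[OF \<rho>l \<psi>l]] by blast
  next
    fix w assume "w \<in> {w \<in> linear_maps R ?N E'. \<forall>f\<in>\<tau>. w f = \<zero>\<^bsub>E'\<^esub>}"
    then have w: "w \<in> linear_maps R ?N E'" and van: "\<And>f. f \<in> \<tau> \<Longrightarrow> w f = \<zero>\<^bsub>E'\<^esub>" by auto
    have wl: "lin R ?N E' w" using w by (simp add: linear_maps_iff)
    have key: "w f = \<zero>\<^bsub>E'\<^esub>" if f: "f \<in> carrier ?N" and fL: "\<rho> f = \<zero>\<^bsub>?NL\<^esub>" for f
    proof -
      have fl: "lin R M E f" using f l by simp
      have "f x = \<zero>\<^bsub>E\<^esub>" if "x \<in> carrier M" "\<And>g. g \<in> \<tau> \<Longrightarrow> g x = \<zero>\<^bsub>E\<^esub>" for x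
        using fun_cong[OF fL, of x] that by (simp add: \<rho>_def L_def)
      from dual_double_annihilator[OF M E \<tau> fl this] obtain F h where F: "F \<subseteq> \<tau>" "finite F"
        "\<And>g. g \<in> F \<Longrightarrow> lin R E E (h g)" "\<And>x. x \<in> carrier M \<Longrightarrow> f x = (\<Oplus>\<^bsub>E\<^esub>g\<in>F. h g (g x))" by blast
      define k where "k g = restrict (\<lambda>x. h g (g x)) (carrier M)" for g
      have k: "k g \<in> \<tau>" if "g \<in> F" for g unfolding k_def using F(1,3) that by (intro stable) auto
      then have kc: "k g \<in> carrier ?N" if "g \<in> F" for g using that \<tau> by auto
      have "f = (\<Oplus>\<^bsub>?N\<^esub>g\<in>F. k g)"
      proof (rule linear_maps_eqI)
        show "f \<in> linear_maps R M E" using f by simp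
        have s: "(\<Oplus>\<^bsub>?N\<^esub>g\<in>F. k g) \<in> carrier ?N" using kc by (intro NE.M.M.finsum_closed) auto
        then show "(\<Oplus>\<^bsub>?N\<^esub>g\<in>F. k g) \<in> linear_maps R M E" by simp
        fix x assume x: "x \<in> carrier M"
        have "(\<Oplus>\<^bsub>?N\<^esub>g\<in>F. k g) x = (\<Oplus>\<^bsub>E\<^esub>g\<in>F. k g x)"
          by (rule additive_finsum[of ?N E "\<lambda>f. f x"])
            (use x kc F(2) NE.M.abelian_group_axioms ME.N.abelian_group_axioms lin_closed[OF l] in auto)
        also have "\<dots> = f x"
          unfolding F(4)[OF x]
        proof (rule ME.N.M.finsum_cong')
          show kx: "k g x = h g (g x)" for g using x by (simp add: k_def)
          show "(\<lambda>g. h g (g x)) \<in> F \<rightarrow> carrier E"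
            unfolding kx[symmetric] using lin_closed[OF l x] kc by auto
        qed simp
        finally show "f x = (\<Oplus>\<^bsub>?N\<^esub>g\<in>F. k g) x" by simp
      qed
      then have "w f = (\<Oplus>\<^bsub>E'\<^esub>g\<in>F. w (k g))" using NE.lin_finsum[OF wl F(2)] kc by auto
      also have "\<dots> = (\<Oplus>\<^bsub>E'\<^esub>g\<in>F. \<zero>\<^bsub>E'\<^esub>)" using k van by (intro NE.N.M.finsum_cong') auto
      finally show ?thesis by simp
    qed
    interpret NNL: two_modules R ?N ?NL by (intro two_modules.intro N NL)
    have "\<rho> ` carrier ?N = carrier ?NL" using \<rho>c ext by blast
    from NNL.lin_factor[OF E' \<rho>l this wl key] obtain k where
      k: "lin R ?NL E' k" "\<And>f. f \<in> carrier ?N \<Longrightarrow> k (\<rho> f) = w f" by blast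
    define \<psi> where "\<psi> = restrict k (carrier ?NL)"
    have \<psi>: "\<psi> (\<rho> f) = w f" if "f \<in> carrier ?N" for f
      unfolding \<psi>_def using k(2)[OF that] \<rho>c[OF that] by (simp del: matlis_dual_simps)
    have "\<psi> \<in> linear_maps R ?NL E'" unfolding \<psi>_def by (rule restrict_linear_maps[OF NL k(1)])
    moreover have "w = colocalization_map R E ?L M (\<lambda>x. x) \<psi>"
      unfolding map using w \<psi> by (auto simp: linear_maps_iff extensional_def fun_eq_iff restrict_def)
    ultimately show "w \<in> colocalization_map R E ?L M (\<lambda>x. x) ` linear_maps R ?NL E'" by blast
  qed
  then show ?thesis unfolding colocalization_submodule_def L_def[symmetric] cl .
qed

section \<open>Dual description of annihilation over the local ring\<close>

lemma local_ring_ideal: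
  assumes "noetherian_ring R" "local_ring R \<mm>" "ideal I R" "I \<noteq> carrier R"
  shows "I \<subseteq> \<mm>"
  using assms(3,4)
proof (induct I rule: noetherian_ring.noetherian_induct[OF assms(1), consumes 1, case_names ideal])
  case (ideal I)
  show ?case
  proof (cases "maximalideal I R")
    case True
    then show ?thesis using assms(2) unfolding local_ring_def by blast
  next
    case False
    then obtain J where "ideal J R" "I \<subseteq> J" "J \<subseteq> carrier R" "J \<noteq> I" "J \<noteq> carrier R"
      using ideal(1,3) unfolding maximalideal_def maximalideal_axioms_def by blast
    then show ?thesis using ideal(2)[of J] by blast
  qed
qed

locale local_hull = prime_hull R \<mm> E e0 for R (structure) and \<mm> and E and e0 +
  assumes local: "local_ring R \<mm>"
begin

text \<open>The annihilator of a nonzero \<open>x\<close> is a proper ideal, hence contained in the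
  maximal ideal, which kills \<open>e0\<close>. So \<open>x\<close> can be sent to
  \<open>e0\<close>, and the map extends to \<open>M\<close>.\<close>

lemma cogenerator:
  assumes M: "module R M" and x: "x \<in> carrier M" "x \<noteq> \<zero>\<^bsub>M\<^esub>"
  shows "\<exists>g. lin R M E g \<and> g x \<noteq> \<zero>\<^bsub>E\<^esub>"
proof -
  interpret M: module R M by fact
  let ?I = "{r \<in> carrier R. r \<odot>\<^bsub>M\<^esub> x = \<zero>\<^bsub>M\<^esub>}"
  have I: "ideal ?I R" by (rule R.idealI') (use x in \<open>auto simp: M.smult_l_distr M.smult_assoc1\<close>)
  have "\<one> \<notin> ?I" using x by simp
  then have sub: "?I \<subseteq> \<mm>" by (intro local_ring_ideal[OF noeth local I]) auto
  obtain g where g: "lin R M E g" "g x = e0"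
    using extension_from_cyclic[OF inj M x(1) e0] sub e0_ann by blast
  moreover have "e0 \<noteq> \<zero>\<^bsub>E\<^esub>" using e0_ann[of \<one>] e0 P.one_imp_carrier P.I_notcarr by auto
  ultimately show ?thesis by auto
qed

end

locale local_hull_dual = local_hull R \<mm> E e0 + M: module R M for R (structure) and \<mm> and E and e0 and M +
  fixes p :: nat
  assumes prime_p: "Factorial_Ring.prime p" and char_p: "ring_characteristic R p"
begin

sublocale mm: frobenius_module R M p
  by (intro frobenius_module.intro R.is_cring M.module_axioms)

text \<open>One direction applies the universal property to the pairing of \<open>r\<close> and
  \<open>x\<close> to \<open>\<phi> r x\<close>. For the other, let \<open>R\<close> act on
  \<open>F^e(M)\<close> through \<open>q\<close>-th powers. If \<open>c u^q\<close> is nonzero, some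
  linear \<open>g\<close> into the hull does not vanish on it, and \<open>r\<close> mapped to the
  functional \<open>x\<close>, \<open>g (r x^q)\<close> is a root-linear map with nonzero value at
  \<open>c\<close> and \<open>u\<close>.\<close>

lemma annihilated_iff:
  assumes u: "u \<in> carrier M" and c: "c \<in> carrier R"
  shows "mm.annihilated e u c \<longleftrightarrow> (\<forall>\<phi>. root_linear R (p ^ e) (matlis_dual R E M) \<phi> \<longrightarrow> \<phi> c u = \<zero>\<^bsub>E\<^esub>)"
proof (intro iffI allI impI)
  fix \<phi> assume ann: "mm.annihilated e u c" and \<phi>: "root_linear R (p ^ e) (matlis_dual R E M) \<phi>"
  have l: "lin R M E (\<phi> r)" if "r \<in> carrier R" for r
    using root_linear_closed[OF \<phi> that] by (simp add: linear_maps_iff)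
  show "\<phi> c u = \<zero>\<^bsub>E\<^esub>"
  proof (rule mm.universal[where e = e and \<beta> = "\<lambda>r x. \<phi> r x"])
    show "abelian_group E" by (rule E.abelian_group_axioms)
    show "\<phi> r x \<in> carrier E" if "r \<in> carrier R" "x \<in> carrier M" for r x by (rule lin_closed[OF l that(2)]) (rule that)
    show "\<phi> (r \<oplus> s) x = \<phi> r x \<oplus>\<^bsub>E\<^esub> \<phi> s x" if "r \<in> carrier R" "s \<in> carrier R" "x \<in> carrier M" for r s x
      using root_linear_add[OF \<phi> that(1,2)] that(3) by simp
    show "\<phi> r (x \<oplus>\<^bsub>M\<^esub> y) = \<phi> r x \<oplus>\<^bsub>E\<^esub> \<phi> r y" if "r \<in> carrier R" "x \<in> carrier M" "y \<in> carrier M" for r x y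
      by (rule lin_add[OF l[OF that(1)] that(2,3)])
    show "\<phi> (r \<otimes> frobenius R p e a) x = \<phi> r (a \<odot>\<^bsub>M\<^esub> x)"
      if "r \<in> carrier R" "a \<in> carrier R" "x \<in> carrier M" for r a x
      using root_linear_smult[OF \<phi> that(2,1)] lin_smult[OF l[OF that(1)] that(2,3)] that
      by (simp add: frobenius_def R.m_comm)
    show "c \<odot>\<^bsub>mm.Fr e\<^esub> mm.el e u = \<zero>\<^bsub>mm.Fr e\<^esub>" using ann by (simp add: mm.annihilated_def)
  qed (use u c in auto)
next
  assume zero: "\<forall>\<phi>. root_linear R (p ^ e) (matlis_dual R E M) \<phi> \<longrightarrow> \<phi> c u = \<zero>\<^bsub>E\<^esub>"
  let ?B = "mm.Fr e"
  let ?FB = "with_scalars ?B (\<lambda>a x. a [^] (p ^ e) \<odot>\<^bsub>?B\<^esub> x)"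
  interpret B: module R ?B by (rule mm.Fr_module)
  show "mm.annihilated e u c"
  proof (rule ccontr)
    assume "\<not> mm.annihilated e u c"
    then have nz: "c \<odot>\<^bsub>?B\<^esub> mm.el e u \<noteq> \<zero>\<^bsub>?FB\<^esub>" by (simp add: mm.annihilated_def)
    have "c \<odot>\<^bsub>?B\<^esub> mm.el e u \<in> carrier ?FB" using c mm.elt_closed[OF u] by simp
    from cogenerator[OF B.module_frobenius_scalars[OF prime_p char_p] this nz] obtain g where
      g: "lin R ?FB E g" "g (c \<odot>\<^bsub>?B\<^esub> mm.el e u) \<noteq> \<zero>\<^bsub>E\<^esub>" by blast
    have gs: "g (a [^] (p ^ e) \<odot>\<^bsub>?B\<^esub> x) = a \<odot>\<^bsub>E\<^esub> g x" if "a \<in> carrier R" "x \<in> carrier ?B" for a x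
      using lin_smult[OF g(1) that(1), of x] that(2) by simp
    have ga: "g (x \<oplus>\<^bsub>?B\<^esub> y) = g x \<oplus>\<^bsub>E\<^esub> g y" if "x \<in> carrier ?B" "y \<in> carrier ?B" for x y
      using lin_add[OF g(1), of x y] that by simp
    have gc: "g x \<in> carrier E" if "x \<in> carrier ?B" for x using lin_closed[OF g(1), of x] that by simp
    have el: "mm.el e x \<in> carrier ?B" if "x \<in> carrier M" for x by (rule mm.elt_closed[OF that])
    define \<phi> where "\<phi> r = restrict (\<lambda>x. g (r \<odot>\<^bsub>?B\<^esub> mm.el e x)) (carrier M)" for r
    have "root_linear R (p ^ e) (matlis_dual R E M) \<phi>"
      unfolding root_linear_def
    proof (intro conjI ballI funcsetI)
      show "\<phi> r \<in> carrier (matlis_dual R E M)" if r: "r \<in> carrier R" for r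
      proof -
        have "lin R M E (\<lambda>x. g (r \<odot>\<^bsub>?B\<^esub> mm.el e x))"
        proof (rule linI)
          fix x assume x: "x \<in> carrier M"
          show "g (r \<odot>\<^bsub>?B\<^esub> mm.el e x) \<in> carrier E" by (intro gc B.smult_closed r el x)
          show "g (r \<odot>\<^bsub>?B\<^esub> mm.el e (x \<oplus>\<^bsub>M\<^esub> y)) = g (r \<odot>\<^bsub>?B\<^esub> mm.el e x) \<oplus>\<^bsub>E\<^esub> g (r \<odot>\<^bsub>?B\<^esub> mm.el e y)"
            if "y \<in> carrier M" for y
            using that x r el by (simp add: mm.elt_add B.smult_r_distr ga)
          show "g (r \<odot>\<^bsub>?B\<^esub> mm.el e (a \<odot>\<^bsub>M\<^esub> x)) = a \<odot>\<^bsub>E\<^esub> g (r \<odot>\<^bsub>?B\<^esub> mm.el e x)" if a: "a \<in> carrier R" for a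
          proof -
            have "r \<odot>\<^bsub>?B\<^esub> mm.el e (a \<odot>\<^bsub>M\<^esub> x) = (r \<otimes> a [^] (p ^ e)) \<odot>\<^bsub>?B\<^esub> mm.el e x"
              using a r x el by (simp add: mm.elt_smult frobenius_def B.smult_assoc1)
            also have "r \<otimes> a [^] (p ^ e) = a [^] (p ^ e) \<otimes> r" using a r by (simp add: R.m_comm)
            finally show ?thesis using a r x el by (simp add: B.smult_assoc1 gs)
          qed
        qed
        then show ?thesis unfolding \<phi>_def using restrict_linear_maps[OF M.module_axioms] by simp
      qed
      show "\<phi> (r \<oplus> s) = \<phi> r \<oplus>\<^bsub>matlis_dual R E M\<^esub> \<phi> s" if "r \<in> carrier R" "s \<in> carrier R" for r s
        unfolding \<phi>_def using that el by (auto simp: restrict_def fun_eq_iff B.smult_l_distr ga)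
      show "\<phi> (a [^] (p ^ e) \<otimes> r) = a \<odot>\<^bsub>matlis_dual R E M\<^esub> \<phi> r" if "a \<in> carrier R" "r \<in> carrier R" for a r
        unfolding \<phi>_def using that el by (auto simp: restrict_def fun_eq_iff B.smult_assoc1 gs)
    qed
    then have "\<phi> c u = \<zero>\<^bsub>E\<^esub>" using zero by blast
    then show False using g(2) u by (simp add: \<phi>_def)
  qed
qed

end

theorem theorem12p4:
  fixes R :: "('a, 'r) ring_scheme"
    and M :: "('a, 'b, 'm) module_scheme"
    and E\<^sub>\<mm> :: "('a, 'c, 'n) module_scheme"
    and E\<^sub>P :: "('a, 'd, 'k) module_scheme"
    and \<mm> P :: "'a set"
    and p :: nat
  assumes "noetherian_ring R" and "local_ring R \<mm>" and "adically_complete R \<mm>"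
    and "reduced_ring R"
    and "Factorial_Ring.prime p" and "ring_characteristic R p" and "F_finite R p"
    and "artinian_module R M"
    and "primeideal P R"
    and "injective_hull R (cyclic_module R \<mm>) E\<^sub>\<mm> \<iota>\<^sub>\<mm>"
    and "injective_hull R (cyclic_module R P) E\<^sub>P \<iota>\<^sub>P"
  shows "colocalization_submodule R P E\<^sub>\<mm> E\<^sub>P M (tight_closure_zero R p M)
         = tight_closure_zero (completed_localization R P) p (colocalization R P E\<^sub>\<mm> E\<^sub>P M)"
proof -
  interpret R: cring R using assms(2) by (simp add: local_ring_def)
  have "maximalideal \<mm> R" using assms(2) by (simp add: local_ring_def)
  then have \<mm>: "primeideal \<mm> R" by (rule R.maximalideal_prime)
  have M: "module R M" using assms(8) by (simp add: artinian_module_def)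
  obtain e\<^sub>\<mm> where m: "prime_hull R \<mm> E\<^sub>\<mm> e\<^sub>\<mm>" using prime_hull_exists[OF assms(1) \<mm> assms(10)] by blast
  obtain e\<^sub>P where P: "prime_hull R P E\<^sub>P e\<^sub>P" using prime_hull_exists[OF assms(1,9,11)] by blast
  interpret m: prime_hull R \<mm> E\<^sub>\<mm> e\<^sub>\<mm> by (rule m)
  interpret m: local_hull_dual R \<mm> E\<^sub>\<mm> e\<^sub>\<mm> M p
    by (intro local_hull_dual.intro local_hull_dual_axioms.intro local_hull.intro local_hull_axioms.intro
        m M assms(2,5,6))
  let ?N = "matlis_dual R E\<^sub>\<mm> M"
  have N: "module R ?N" by (rule module_matlis_dual[OF M m.E.module_axioms])
  interpret P: hull_dual R P E\<^sub>P e\<^sub>P ?N p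
    by (intro hull_dual.intro hull_dual_axioms.intro P N assms(5,6,7))
  obtain c where c: "nonzerodivisor R c" "frobenius_dual_basis R p c"
    using exists_frobenius_dual_basis[OF assms(1,4,5,6,7)] by blast
  have cR: "c \<in> carrier R" using c(1) by (simp add: nonzerodivisor_def)
  have p: "p \<ge> 2" by (rule prime_ge_2_nat[OF assms(5)])
  define d where "d = c [^]\<^bsub>R\<^esub> (3::nat)"
  have d: "d \<in> carrier R" using cR by (simp add: d_def)
  \<comment> \<open>All exponents \<open>e\<close> are pooled into one set, because both tight
    closures ask for vanishing at every \<open>e\<close> with the same \<open>d\<close>.\<close>
  define \<tau> where "\<tau> = {\<phi> d |\<phi> e. root_linear R (p ^ e) ?N \<phi>}"
  have \<tau>_all: "(\<forall>f\<in>\<tau>. Q f) \<longleftrightarrow> (\<forall>e \<phi>. root_linear R (p ^ e) ?N \<phi> \<longrightarrow> Q (\<phi> d))" for Q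
    unfolding \<tau>_def by blast
  have \<tau>: "\<tau> \<subseteq> linear_maps R M E\<^sub>\<mm>" 
    using root_linear_closed[of R _ ?N, OF _ d, unfolded matlis_dual_simps] unfolding \<tau>_def by blast
  have stable: "restrict (\<lambda>x. h (f x)) (carrier M) \<in> \<tau>" if h: "lin R E\<^sub>\<mm> E\<^sub>\<mm> h" and f: "f \<in> \<tau>" for h f
  proof -
    obtain \<phi> e where \<phi>: "root_linear R (p ^ e) ?N \<phi>" "f = \<phi> d" using f unfolding \<tau>_def by blast
    have l: "lin R M E\<^sub>\<mm> (\<phi> r)" if "r \<in> carrier R" for r
      using root_linear_closed[OF \<phi>(1) that] by (simp add: linear_maps_iff)
    have "root_linear R (p ^ e) ?N (\<lambda>r. restrict (\<lambda>x. h (\<phi> r x)) (carrier M))"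
      unfolding root_linear_def
    proof (intro conjI ballI funcsetI)
      show "restrict (\<lambda>x. h (\<phi> r x)) (carrier M) \<in> carrier ?N" if "r \<in> carrier R" for r
        using restrict_linear_maps[OF M lin_comp[OF l[OF that] h]] by simp
      show "restrict (\<lambda>x. h (\<phi> (r \<oplus>\<^bsub>R\<^esub> s) x)) (carrier M) = restrict (\<lambda>x. h (\<phi> r x)) (carrier M) \<oplus>\<^bsub>?N\<^esub> restrict (\<lambda>x. h (\<phi> s x)) (carrier M)"
        if "r \<in> carrier R" "s \<in> carrier R" for r s
        unfolding matlis_dual_simps root_linear_add[OF \<phi>(1) that]
        by (rule restrict_ext) (simp add: lin_add[OF h lin_closed[OF l] lin_closed[OF l]] that)
      show "restrict (\<lambda>x. h (\<phi> (a [^]\<^bsub>R\<^esub> (p ^ e) \<otimes>\<^bsub>R\<^esub> r) x)) (carrier M) = a \<odot>\<^bsub>?N\<^esub> restrict (\<lambda>x. h (\<phi> r x)) (carrier M)"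
        if "a \<in> carrier R" "r \<in> carrier R" for a r
        unfolding matlis_dual_simps root_linear_smult[OF \<phi>(1) that]
        by (rule restrict_ext) (simp add: lin_smult[OF h _ lin_closed[OF l]] that)
    qed
    then show ?thesis unfolding \<tau>_def \<phi>(2)
      by (intro CollectI exI[of _ "\<lambda>r. restrict (\<lambda>x. h (\<phi> r x)) (carrier M)"] exI[of _ e] conjI refl)
  qed
  have "tight_closure_zero R p M = {u \<in> carrier M. \<forall>e. m.mm.annihilated e u d}"
    unfolding d_def
    by (rule m.mm.tight_closure_zero_test[OF assms(1) p nonzerodivisor_avoids[OF assms(1) R.is_cring c(1)] c(2)])
  also have "\<dots> = {u \<in> carrier M. \<forall>f\<in>\<tau>. f u = \<zero>\<^bsub>E\<^sub>\<mm>\<^esub>}"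
    unfolding \<tau>_all using m.annihilated_iff[OF _ d] by blast
  finally have LHS: "colocalization_submodule R P E\<^sub>\<mm> E\<^sub>P M (tight_closure_zero R p M) =
      {w \<in> linear_maps R ?N E\<^sub>P. \<forall>f\<in>\<tau>. w f = \<zero>\<^bsub>E\<^sub>P\<^esub>}"
    by (simp only:) (rule colocalization_submodule_annihilator[OF assms(8) m.inj P.E.module_axioms \<tau>], rule stable)
  have W: "colocalization R P E\<^sub>\<mm> E\<^sub>P M = P.W" by (simp add: colocalization_def)
  have "tight_closure_zero P.S p P.W = {w \<in> carrier P.W. \<forall>e. P.fm.annihilated e w (P.loc.to_completion d)}"
  proof -
    \<comment> \<open>The multiplier over \<open>S\<close> is the image of the one over
      \<open>R\<close>, so both sides are tested against the same \<open>d\<close>.\<close>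
    have ic: "P.loc.to_completion d = P.loc.to_completion c [^]\<^bsub>P.S\<^esub> (3::nat)"
      unfolding d_def by (rule P.comp.\<iota>_pow[OF cR])
    have "P.loc.to_completion c \<in> avoiding_minimal_primes P.S"
      by (rule nonzerodivisor_avoids[OF P.comp.noetherian_S P.comp.S.is_cring P.nonzerodivisor_completion[OF c(1)]])
    moreover have "frobenius_dual_basis P.S p (P.loc.to_completion c)"
      using p by (intro P.comp.frobenius_dual_basis_completion cR c(2)) simp
    ultimately show ?thesis unfolding ic by (rule P.fm.tight_closure_zero_test[OF P.comp.noetherian_S p])
  qed
  also have "\<dots> = {w \<in> linear_maps R ?N E\<^sub>P. \<forall>f\<in>\<tau>. w f = \<zero>\<^bsub>E\<^sub>P\<^esub>}"
  proof -
    have "(\<forall>e. P.fm.annihilated e w (P.loc.to_completion d)) \<longleftrightarrow> (\<forall>f\<in>\<tau>. w f = \<zero>\<^bsub>E\<^sub>P\<^esub>)" if "w \<in> carrier P.W" for w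
      using P.annihilated_if[OF that d] P.annihilated_imp[OF that d] unfolding \<tau>_all by blast
    then show ?thesis by (auto simp del: matlis_dual_simps)
  qed
  finally show ?thesis unfolding LHS W by simp
qed

end
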